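(* Fix an integer $m\ge1$ and $p\in(1/2,1)$, and consider the graph process described in the context, started from a graph $H\in\mathcal G_m$ on $o(n^{1/2})$ vertices. For $k\ge0$ let $X_k(n)$ be the number of vertices of degree $k$ in $G_n$, and condition on $\overline{\mathcal D}$. Then there exists a sequence $\{x_k:k\ge0\}$ such that (i) if $\alpha<1$ then $x_k=\alpha^{k(1+o_k(1))}$, and if $\alpha>1$ then there exist constants $a,b>0$ such that $x_k=ak^{-\eta-1}+O_k(k^{-\eta-2}\log^b k)$; and (ii) for every fixed $k\ge0$, $X_k(n)=x_kn(1+o_n(1))$ with high probability as $n\to\infty$.
   Context: Graph class: $\mathcal{G}_m$ is the class of undirected multigraphs (parallel edges allowed, no loops) on $[\nu_G]$ such that, orienting edges from larger to smaller endpoint, there is an integer $1_G$ with $m<1_G\le\nu_G$ such that vertices $v\ge1_G$ have out-degree $m$ and vertices $v<1_G$ have out-degree $0$. Process: start with $H\in\mathcal G_m$, labelled $G_{t_0}$ with $t_0=1_H+\nu_H$; write $1_t,\nu_t$ for $1_{G_t},\nu_{G_t}$. Given $G_t$, independently: with probability $1-p$ delete the $m$ edges oriented out of vertex $1_t$ (so $1_{t+1}=1_t+1$); with probability $p$ add vertex $\nu_t+1$ with $m$ edges to vertices chosen independently with probability proportional to their degree in $G_t$ (with or without replacement). $\mathcal D$ is the event that at some time the graph has no edges (i.e. $1_t>\nu_t$ for some $t\ge t_0$). "With high probability" means with probability tending to $1$ as $n\to\infty$. Constants: $\gamma=p/(1-p)$, $\alpha=\frac{p}{4p-2}\ln\gamma$.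 For $\alpha>1$, $\zeta$ is the unique real number $\ne1$ with $\zeta e^{\alpha(1-\zeta)}=1$ and $\eta=-\ln\gamma/\ln\zeta$ (which satisfies $\eta>2$). *)

theory Defs
  imports "HOL-Probability.Probability" "HOL-Library.Landau_Symbols"
begin

text \<open>
  A multigraph on the vertex set \<open>{1..nverts G}\<close>; an undirected edge is the two-element set of its
  endpoints, and is oriented from its larger endpoint \<open>Max e\<close> to its smaller one. The field
  \<open>oldest\<close> is the number $1_G$; a graph in the class below with \<open>m \<ge> 1\<close> determines it (it is the
  least vertex of positive out-degree), but the process also needs it for edgeless graphs.
\<close>

record mgraph =
  oldest :: nat
  nverts :: nat
  edges :: "nat set multiset"


definition degree :: "mgraph \<Rightarrow> nat \<Rightarrow> nat" where
  "degree G v = size (filter_mset (\<lambda>e. v \<in> e) (edges G))"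

definition out_degree :: "mgraph \<Rightarrow> nat \<Rightarrow> nat" where
  "out_degree G v = size (filter_mset (\<lambda>e. Max e = v) (edges G))"

definition graph_class :: "nat \<Rightarrow> mgraph set" where
  "graph_class m = {G.
     (\<forall>e \<in># edges G. card e = 2 \<and> e \<subseteq> {1..nverts G}) \<and>
     m < oldest G \<and> oldest G \<le> nverts G \<and>
     (\<forall>v \<in> {1..nverts G}. out_degree G v = (if oldest G \<le> v then m else 0))}"

definition degree_biased :: "mgraph \<Rightarrow> nat set \<Rightarrow> nat pmf" where
  "degree_biased G A = pmf_of_multiset (\<Sum>v\<in>A. replicate_mset (degree G v) v)"

lemma pmf_degree_biased:
  assumes "finite A" "u \<in> A" "degree G u > 0"
  shows "pmf (degree_biased G A) v =
    (if v \<in> A then real (degree G v) / real (\<Sum>w\<in>A. degree G w) else 0)"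
proof -
  let ?M = "\<Sum>v\<in>A. replicate_mset (degree G v) v"
  have c: "count ?M v = (if v \<in> A then degree G v else 0)" for v
    using assms(1) by (simp add: count_sum sum.delta)
  have s: "size ?M = (\<Sum>w\<in>A. degree G w)"
    using assms(1) by (induction A rule: finite_induct) auto
  have "count ?M u > 0" using assms c by simp
  then have "?M \<noteq> {#}" by (metis count_empty less_numeral_extra(3))
  then show ?thesis
    unfolding degree_biased_def by (simp add: c s)
qed

text \<open>
  Without replacement, each vertex is drawn with probability proportional to its degree among the
  vertices not drawn before. If no undrawn vertex of positive degree is left, the draw falls back
  to all vertices. This can only happen while all edges come from a start graph with parallel
  edges: a vertex with \<open>m\<close> distinct out-neighbours makes \<open>m + 1\<close> vertices of positive degree.
\<close>

definition candidates :: "bool \<Rightarrow> mgraph \<Rightarrow> nat list \<Rightarrow> nat set" where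
  "candidates repl G ws =
     (let A = {v \<in> {1..nverts G}. v \<notin> set ws \<and> degree G v > 0}
      in if repl \<or> A = {} then {1..nverts G} else A)"

primrec draw_targets :: "bool \<Rightarrow> mgraph \<Rightarrow> nat \<Rightarrow> nat list pmf" where
  "draw_targets repl G 0 = return_pmf []"
| "draw_targets repl G (Suc j) =
     bind_pmf (draw_targets repl G j)
       (\<lambda>ws. map_pmf (\<lambda>w. w # ws) (degree_biased G (candidates repl G ws)))"

definition add_vertex :: "mgraph \<Rightarrow> nat list \<Rightarrow> mgraph" where
  "add_vertex G ws = G\<lparr>nverts := nverts G + 1,
     edges := edges G + image_mset (\<lambda>w. {nverts G + 1, w}) (mset ws)\<rparr>"

definition delete_oldest :: "mgraph \<Rightarrow> mgraph" where
  "delete_oldest G = G\<lparr>oldest := oldest G + 1,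
     edges := filter_mset (\<lambda>e. Max e \<noteq> oldest G) (edges G)\<rparr>"

text \<open>
  The process stops at an edgeless graph, from which degree-biased choices are impossible. The
  theorem conditions on this never happening.
\<close>

definition step :: "bool \<Rightarrow> nat \<Rightarrow> real \<Rightarrow> mgraph \<Rightarrow> mgraph pmf" where
  "step repl m p G =
     (if edges G = {#} then return_pmf G
      else bind_pmf (bernoulli_pmf p) (\<lambda>b.
        if b then map_pmf (add_vertex G) (draw_targets repl G m)
        else return_pmf (delete_oldest G)))"

definition transition :: "bool \<Rightarrow> nat \<Rightarrow> real \<Rightarrow> mgraph \<Rightarrow> nat \<Rightarrow> (nat \<Rightarrow> mgraph) \<Rightarrow> mgraph measure"
  where
  "transition repl m p H i \<omega> =
     measure_pmf (if i = 0 then return_pmf H else step repl m p (\<omega> (i - 1)))"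

text \<open>
  The law on trajectories of the Markov chain with kernel \<^const>\<open>step\<close> started at \<open>H\<close>, given by the
  Ionescu-Tulcea theorem. Coordinate \<open>i\<close> is the graph at time \<open>oldest H + nverts H + i\<close>.
\<close>

definition process :: "bool \<Rightarrow> nat \<Rightarrow> real \<Rightarrow> mgraph \<Rightarrow> (nat \<Rightarrow> mgraph) measure" where
  "process repl m p H = projective_family.lim UNIV
     (Ionescu_Tulcea.CI (transition repl m p H) (\<lambda>_. count_space UNIV)) (\<lambda>_. count_space UNIV)"

lemma Ionescu_Tulcea_transition:
  "Ionescu_Tulcea (transition repl m p H) (\<lambda>_. count_space UNIV)"
proof (rule Ionescu_Tulcea.intro)
  fix i :: nat
  show "transition repl m p H i \<in>
    measurable (PiM {0..<i} (\<lambda>_. count_space UNIV)) (subprob_algebra (count_space UNIV))"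
  proof (cases i)
    case 0
    have "transition repl m p H 0 = (\<lambda>_. measure_pmf (return_pmf H))"
      by (simp add: transition_def fun_eq_iff)
    with 0 show ?thesis
      by (simp add: measure_pmf_in_subprob_algebra)
  next
    case (Suc j)
    have "(\<lambda>\<omega>. \<omega> j) \<in> measurable (PiM {0..<i} (\<lambda>_. count_space UNIV)) (count_space UNIV)"
      using Suc by (intro measurable_component_singleton) auto
    moreover have "(\<lambda>G. measure_pmf (step repl m p G)) \<in>
      measurable (count_space UNIV) (subprob_algebra (count_space UNIV))"
      by (simp add: measure_pmf_in_subprob_algebra)
    ultimately have "(\<lambda>\<omega>. measure_pmf (step repl m p (\<omega> j))) \<in>
      measurable (PiM {0..<i} (\<lambda>_. count_space UNIV)) (subprob_algebra (count_space UNIV))"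
      by (rule measurable_compose)
    with Suc show ?thesis by (simp add: transition_def[abs_def])
  qed
next
  show "prob_space (transition repl m p H i x)" for i x
    by (simp add: transition_def measure_pmf.prob_space_axioms)
qed

lemma process_cylinder:
  "emeasure (process repl m p H) {\<omega>. \<forall>i\<le>n. \<omega> i = s i} =
     indicator {H} (s 0) * (\<Prod>i<n. ennreal (pmf (step repl m p (s i)) (s (Suc i))))"
proof -
  let ?M = "\<lambda>_::nat. count_space (UNIV :: mgraph set)"
  interpret IT: Ionescu_Tulcea "transition repl m p H" ?M
    by (rule Ionescu_Tulcea_transition)
  define A where "A n = PiE {0..<n} (\<lambda>i. {s i})" for n :: nat
  have Am[measurable]: "A n \<in> sets (PiM {0..<n} ?M)" for n
    unfolding A_def by (intro sets_PiM_I_finite) auto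
  have sub: "A n \<subseteq> space (PiM {0..<n} ?M)" for n
    using sets.sets_into_space[OF Am] .
  have C: "emeasure (IT.C 0 n (\<lambda>_. undefined)) (A n) =
    (\<Prod>i<n. if i = 0 then indicator {H} (s 0)
            else ennreal (pmf (step repl m p (s (i - 1))) (s i)))" (is "_ = prod ?f _") for n
  proof (induction n)
    case 0
    show ?case by (simp add: A_def space_PiM emeasure_return sets_PiM_empty)
  next
    case (Suc n)
    have sp: "(\<lambda>_. undefined) \<in> space (PiM {0..<0} ?M)" by (simp add: space_PiM)
    have ne: "space (IT.C 0 n (\<lambda>_. undefined)) \<noteq> {}"
      using IT.prob_space_C[OF sp, THEN prob_space.not_empty] by simp
    have eP: "emeasure (IT.eP n \<omega>) (A (Suc n)) = ?f n * indicator (A n) \<omega>"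
      if \<omega>: "\<omega> \<in> space (PiM {0..<n} ?M)" for \<omega>
    proof -
      have "fun_upd \<omega> n x \<in> A (Suc n) \<longleftrightarrow> \<omega> \<in> A n \<and> x = s n" for x
        using \<omega> unfolding A_def
        by (auto simp: PiE_iff space_PiM extensional_def less_Suc_eq split: if_splits)
      then have "fun_upd \<omega> n -` A (Suc n) \<inter> UNIV = (if \<omega> \<in> A n then {s n} else {})"
        by auto
      moreover have "n > 0 \<Longrightarrow> \<omega> \<in> A n \<Longrightarrow> \<omega> (n - 1) = s (n - 1)"
        unfolding A_def by (auto simp: PiE_iff)
      ultimately show ?thesis
        using IT.emeasure_eP[OF \<omega> Am]
        by (auto simp: transition_def emeasure_pmf_single indicator_def)
    qed
    have "emeasure (IT.C 0 (Suc n) (\<lambda>_. undefined)) (A (Suc n)) =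
      (\<integral>\<^sup>+\<omega>. emeasure (IT.eP n \<omega>) (A (Suc n)) \<partial>IT.C 0 n (\<lambda>_. undefined))"
      using IT.sets_C[OF sp, of n] IT.measurable_eP[of n] ne
      by (simp, subst emeasure_bind[where N = "PiM {0..<Suc n} ?M"])
         (auto cong: measurable_cong_sets)
    also have "\<dots> = (\<integral>\<^sup>+\<omega>. ?f n * indicator (A n) \<omega> \<partial>IT.C 0 n (\<lambda>_. undefined))"
      by (intro nn_integral_cong) (use eP IT.space_C[OF sp, of n] in simp)
    also have "\<dots> = ?f n * emeasure (IT.C 0 n (\<lambda>_. undefined)) (A n)"
      by (rule nn_integral_cmult_indicator) (use IT.sets_C[OF sp, of n] Am in simp)
    also have "\<dots> = prod ?f {..<Suc n}"
      by (subst Suc.IH) (simp add: mult.commute)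
    finally show ?case .
  qed
  have "{\<omega>. \<forall>i\<le>n. \<omega> i = s i} = prod_emb UNIV ?M {0..<Suc n} (A (Suc n))"
    unfolding A_def by (auto simp: prod_emb_def space_PiM PiE_iff less_Suc_eq_le)
  then have "emeasure (process repl m p H) {\<omega>. \<forall>i\<le>n. \<omega> i = s i} =
    emeasure (IT.CI {0..<Suc n}) (A (Suc n))"
    unfolding process_def by (simp add: IT.lim[OF _ Am])
  also have "\<dots> = emeasure (IT.C 0 (Suc n) (\<lambda>_. undefined)) (A (Suc n))"
  proof -
    have "prod_emb {0..<Suc n} ?M {0..<Suc n} (A (Suc n)) = A (Suc n)"
      using sub[of "Suc n"] by (intro prod_emb_id) (auto simp: space_PiM)
    then show ?thesis
      using IT.emeasure_CI[OF subset_refl Am, of "Suc n"] by simp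
  qed
  also have "\<dots> = indicator {H} (s 0) * (\<Prod>i<n. ennreal (pmf (step repl m p (s i)) (s (Suc i))))"
    unfolding C by (simp only: prod.lessThan_Suc_shift) simp
  finally show ?thesis .
qed

lemma prob_space_process: "prob_space (process repl m p H)"
proof -
  let ?M = "\<lambda>_::nat. count_space (UNIV :: mgraph set)"
  interpret IT: Ionescu_Tulcea "transition repl m p H" ?M
    by (rule Ionescu_Tulcea_transition)
  have "emeasure (process repl m p H) (prod_emb UNIV ?M {} {\<lambda>_. undefined}) =
    emeasure (IT.CI {}) {\<lambda>_. undefined}"
    unfolding process_def by (rule IT.lim) (auto simp: sets_PiM_empty)
  moreover have "prob_space (IT.CI {})" by (rule IT.PF.prob_space_P) auto
  moreover have "space (IT.CI {}) = {\<lambda>_. undefined}"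
    by (simp add: IT.PF.space_P space_PiM)
  moreover have "prod_emb UNIV ?M {} {\<lambda>_. undefined} = space (process repl m p H)"
    unfolding process_def by (auto simp: prod_emb_def space_PiM)
  ultimately show ?thesis
    by (metis prob_space.emeasure_space_1 prob_spaceI)
qed

definition graph_at :: "mgraph \<Rightarrow> (nat \<Rightarrow> mgraph) \<Rightarrow> nat \<Rightarrow> mgraph" where
  "graph_at H \<omega> n = \<omega> (n - (oldest H + nverts H))"

definition dies :: "(nat \<Rightarrow> mgraph) \<Rightarrow> bool" where
  "dies \<omega> \<longleftrightarrow> (\<exists>i. edges (\<omega> i) = {#})"

definition num_degree :: "nat \<Rightarrow> mgraph \<Rightarrow> nat" where
  "num_degree k G = card {v \<in> {1..nverts G}. degree G v = k}"

definition gamma :: "real \<Rightarrow> real" where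
  "gamma p = p / (1 - p)"

definition alpha :: "real \<Rightarrow> real" where
  "alpha p = p / (4 * p - 2) * ln (gamma p)"

definition zeta :: "real \<Rightarrow> real" where
  "zeta p = (THE z. z \<noteq> 1 \<and> z * exp (alpha p * (1 - z)) = 1)"

definition eta :: "real \<Rightarrow> real" where
  "eta p = - ln (gamma p) / ln (zeta p)"

end

theory Submission
  imports Defs "HOL-Real_Asymp.Real_Asymp"
begin

text \<open>
  Write \<open>\<lambda> = p / (4 p - 2)\<close> and \<open>L = ln \<gamma>\<close>. On the scale of logarithmic time the half-edges at a vertex
  form a branching process: each of them produces offspring at rate \<open>\<lambda>\<close> and lives for time \<open>L\<close>. Let \<open>W\<close> solve
  the delay equation \<open>W' t = \<lambda> (W t - W (t - L))\<close> with \<open>W = 0\<close> on the negative half-line and \<open>W 0 = 1\<close>.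
  The number of descendants alive at time \<open>t\<close> has the generating function
  \<open>FF s t = (s + (1 - s) W (t - L)) / (s + (1 - s) W t)\<close>, so that \<open>x k\<close> is \<open>p\<close> times the coefficient of \<open>s ^ k\<close> in
  the integral over \<open>x\<close> from \<open>0\<close> to \<open>1\<close> of \<open>FF s (- ln x) ^ m\<close>. The two regimes of part (i) come from the
  boundedness of \<open>W\<close> for \<open>\<alpha> < 1\<close> and from \<open>W t = C exp (t / \<eta>) + O(1)\<close> for \<open>\<alpha> > 1\<close>.

  For part (ii), give a vertex the product over its half-edges of \<open>\<beta> b / \<beta> i\<close>, where \<open>b\<close> is the birth time of the
  half-edge, \<open>i\<close> the oldest vertex and \<open>\<beta> j = s + (1 - s) W (- ln (j / N))\<close> with \<open>N\<close> close to \<open>(1 - p) n\<close>, the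
  position of the oldest vertex at time \<open>n\<close>. By the delay equation the sum of these products has almost
  deterministic drift, and an \<open>L\<^sup>2\<close> estimate shows that it is concentrated; at time \<open>n\<close> it is close to the sum
  of \<open>s ^ degree\<close>. The error terms are controlled by the sum of the squared degree proportions, which is
  small once the old vertices have lost most of their edges. Letting \<open>s\<close> tend to \<open>0\<close> extracts the
  degree counts one after the other.
\<close>

section \<open>The delay equation\<close>

text \<open>At time \<open>t = oldest + nverts\<close> a typical graph has \<open>nverts\<close>
  near \<open>p t\<close>, hence \<open>oldest\<close> near \<open>(1 - p) t\<close>,
  \<open>act\<close> near \<open>(2 p - 1) t\<close> and total degree near
  \<open>2 m (2 p - 1) t\<close>. With probability \<open>p\<close> a step draws \<open>m\<close>
  targets, so a half-edge is hit at rate \<open>\<lambda> / t\<close>. Vertex \<open>b\<close>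
  appears near time \<open>b / p\<close> and loses its out-edges near time
  \<open>b / (1 - p)\<close>, a delay of \<open>L\<close> in logarithmic time. Two obstacles shape
  the estimates. The start graph may put its degree on a few vertices; then repeated hits and draws
  without replacement spoil the product form. That error has the order of the sum of squared degree
  proportions, which is shown to be small only in mean and only after time
  \<open>\<epsilon> n\<close>, so the second-moment recursion starts there from a trivial bound. And
  \<open>W\<close> jumps at 0, so the weights are not Lipschitz: a single step may err a lot, but
  the oscillations over all windows telescope. Conditioning is postponed to the end:
  \<open>Ea\<close> restricts expectations to graphs with edges, and survival has probability at
  least \<open>1 - (1 - p) / p > 0\<close>.\<close>

lemma integral_pos_strict:
  fixes f :: "real \<Rightarrow> real"
  assumes f: "(f has_integral I) {a..b}" and ab: "a < b"
    and pos: "\<And>x. a < x \<Longrightarrow> x < b \<Longrightarrow> 0 < f x"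
  shows "0 < I"
proof -
  \<comment> \<open>The sign of \<open>f\<close> is known only in the open interval; changing two
    points leaves the integral alone.\<close>
  define g where "g x = (if x \<in> {a<..<b} then f x else 0)" for x
  have g: "(g has_integral I) {a..b}"
    by (rule has_integral_spike[OF _ _ f, of "{a, b}"]) (auto simp: g_def)
  have g0: "g x \<ge> 0" for x using pos[of x] by (auto simp: g_def)
  have "I \<ge> 0" using has_integral_nonneg[OF g] g0 by auto
  moreover have "I \<noteq> 0"
  proof
    assume "I = 0"
    have "g absolutely_integrable_on {a..b}"
      by (rule nonnegative_absolutely_integrable_1) (use g g0 in auto)
    moreover from this have "(LINT x:{a..b}|lebesgue. g x) = 0"
      using g \<open>I = 0\<close> by (simp add: set_lebesgue_integral_eq_integral integral_unique)
    ultimately have "AE x in lebesgue. indicator {a..b} x *\<^sub>R g x = 0"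
      unfolding set_integrable_def set_lebesgue_integral_def
      by (subst (asm) integral_nonneg_eq_0_iff_AE) (auto simp: g0)
    then have "AE x in lebesgue. x \<notin> {a<..<b}"
      by (rule AE_mp) (intro AE_I2, use pos in \<open>force simp: g_def\<close>)
    then have "emeasure lebesgue {a<..<b} = 0"
      by (subst (asm) AE_iff_measurable[OF _ refl]) (auto simp: greaterThanLessThan_def greaterThan_def lessThan_def Int_def)
    with ab show False by simp
  qed
  ultimately show ?thesis by simp
qed

lemma integrable_on_bounded_borel:
  fixes f :: "real \<Rightarrow> real"
  assumes [measurable]: "f \<in> borel_measurable borel" and B: "\<And>x. x \<in> {a..b} \<Longrightarrow> \<bar>f x\<bar> \<le> B"
  shows "f integrable_on {a..b}"
proof -
  have "set_integrable lborel {a..b} f" unfolding set_integrable_def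
    by (rule integrableI_bounded_set_indicator[where B = B]) (use B in \<open>auto simp: emeasure_lborel_Icc_eq\<close>)
  then show ?thesis by (rule set_borel_integral_eq_integral(1))
qed

text \<open>Continuous induction: the closed set where \<open>f\<close> is not positive would have a
  least point, and the step hypothesis excludes exactly that point. Taking \<open>s = a\<close> in
  the hypothesis provides the start.\<close>

lemma positive_if_no_first_zero:
  fixes f :: "real \<Rightarrow> real"
  assumes cont: "continuous_on {a..} f"
    and step: "\<And>s. a \<le> s \<Longrightarrow> (\<And>r. a \<le> r \<Longrightarrow> r < s \<Longrightarrow> 0 < f r) \<Longrightarrow> 0 < f s"
    and t: "a \<le> t"
  shows "0 < f t"
proof (rule ccontr)
  assume neg: "\<not> 0 < f t"
  define S where "S = {s \<in> {a..}. f s \<in> {..0}}"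
  have "closed S" using continuous_closed_preimage[OF cont, of "{..0}"]
    by (simp add: S_def vimage_def Int_def)
  moreover have "t \<in> S" using neg t by (auto simp: S_def)
  moreover have bb: "bdd_below S" by (auto simp: S_def bdd_below_def intro: exI[of _ a])
  ultimately have i: "Inf S \<in> S" by (intro closed_contains_Inf) auto
  have "0 < f r" if "a \<le> r" "r < Inf S" for r
    using that cInf_lower[OF _ bb, of r] by (fastforce simp: S_def)
  with step[of "Inf S"] i show False by (auto simp: S_def)
qed

locale delay =
  fixes lam L :: real
  assumes lam: "lam > 0" and L: "L > 0"
begin

text \<open>The Laplace transform of the solution of the delay equation is
  \<open>1 / (z - lam + lam * exp (- z L))\<close>. Expanding it in powers of
  \<open>exp (- z L)\<close> gives \<open>(- lam) ^ k * exp (- k z L) / (z - lam) ^ (k + 1)\<close>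
  as term \<open>k\<close>, and \<open>We k\<close> is its inverse transform.\<close>

definition We :: "nat \<Rightarrow> real \<Rightarrow> real" where
  "We k t = (if t < real k * L then 0
     else (- lam) ^ k / fact k * (t - real k * L) ^ k * exp (lam * (t - real k * L)))"

definition W :: "real \<Rightarrow> real" where
  "W t = (\<Sum>k\<le>nat \<lfloor>t / L\<rfloor>. We k t)"

lemma W_eq: assumes "t < real M * L" shows "W t = (\<Sum>k<M. We k t)"
proof -
  have z: "We k t = 0" if "k > nat \<lfloor>t / L\<rfloor>" for k
  proof -
    have "t / L < real k" using that by linarith
    then have "t < real k * L" using L by (simp add: field_simps)
    then show ?thesis by (simp add: We_def)
  qed
  have "We k t = 0" if "k \<ge> M" for k
  proof -
    have "real M * L \<le> real k * L" using that L by simp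
    then show ?thesis using assms by (simp add: We_def)
  qed
  then have "(\<Sum>k<M. We k t) = (\<Sum>k<M + Suc (nat \<lfloor>t / L\<rfloor>). We k t)"
    by (intro sum.mono_neutral_left) auto
  also have "\<dots> = W t" unfolding W_def
    by (rule sum.mono_neutral_right) (use z in auto)
  finally show ?thesis by simp
qed

lemma W_neg: "t < 0 \<Longrightarrow> W t = 0"
  using W_eq[of t 0] by simp

lemma W_init: "0 \<le> t \<Longrightarrow> t < L \<Longrightarrow> W t = exp (lam * t)"
  using W_eq[of t 1] by (simp add: We_def)

lemma W_0: "W 0 = 1" using W_init[of 0] L by simp

text \<open>The positive part makes continuity across \<open>t = k L\<close> visible. For
  \<open>k = 0\<close> the zeroth power is 1, which is the right value only for nonnegative
  \<open>t\<close>.\<close>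

lemma We_max: "0 \<le> t \<Longrightarrow> We k t =
   (- lam) ^ k / fact k * (max 0 (t - real k * L)) ^ k * exp (lam * (t - real k * L))"
  by (cases k) (auto simp: We_def max_def power_0_left)

lemma continuous_W: "continuous_on {0..} W"
proof -
  have "continuous_on {0..<real M * L} W" for M
  proof -
    have "continuous_on {0..<real M * L} (\<lambda>t. \<Sum>k<M. (- lam) ^ k / fact k *
        (max 0 (t - real k * L)) ^ k * exp (lam * (t - real k * L)))"
      by (intro continuous_intros)
    then show ?thesis
      by (rule continuous_on_eq) (auto simp: W_eq[of _ M] We_max)
  qed
  note c = this
  show ?thesis unfolding continuous_on_eq_continuous_within
  proof
    fix t :: real assume t: "t \<in> {0..}"
    obtain M :: nat where "t / L < real M" using reals_Archimedean2 by blast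
    then have M: "t < real M * L" using L by (simp add: field_simps)
    have "continuous (at t within {0..<real M * L}) W"
      using c[of M] t M by (simp add: continuous_on_eq_continuous_within)
    moreover have "at t within {0..<real M * L} = at t within {0..}"
      by (rule at_within_nhd[where S = "{..<real M * L}"]) (use M in auto)
    ultimately show "continuous (at t within {0..}) W" by (simp add: continuous_within)
  qed
qed

text \<open>The terms satisfy \<open>We k' = lam * (We k - We (k - 1) shifted by L)\<close>, so
  their sum satisfies the delay equation after an index shift. The breakpoint \<open>k L\<close> is
  left out; later the fundamental theorem of calculus is applied with finitely many exceptional
  points.\<close>

lemma We_deriv:
  assumes "t \<noteq> real k * L"
  shows "(We k has_real_derivative lam * We k t - (if k = 0 then 0 else lam * We (k - 1) (t - L))) (at t)"
proof (cases "t < real k * L")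
  case True
  have "((\<lambda>_. 0) has_real_derivative 0) (at t)" by simp
  then have "(We k has_real_derivative 0) (at t)"
    by (rule has_field_derivative_transform_within_open[of _ _ _ "{..<real k * L}"])
      (use True in \<open>auto simp: We_def\<close>)
  moreover have "We (k - 1) (t - L) = 0" if "k > 0"
    using True that by (auto simp: We_def algebra_simps of_nat_diff)
  moreover have "We k t = 0" using True by (simp add: We_def)
  ultimately show ?thesis by (cases "k = 0") auto
next
  case False
  with assms have t: "t > real k * L" by simp
  let ?f = "\<lambda>t. (- lam) ^ k / fact k * (t - real k * L) ^ k * exp (lam * (t - real k * L))"
  let ?d = "lam * We k t - (if k = 0 then 0 else lam * We (k - 1) (t - L))"
  have "(?f has_real_derivative ?d) (at t)"
  proof (cases k)
    case 0
    then show ?thesis using t by (auto simp: We_def intro!: derivative_eq_intros)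
  next
    case (Suc j)
    have e: "t - L - real j * L = t - real k * L" using Suc by (simp add: algebra_simps)
    define ck cj Y E where "ck = (- lam) ^ k / fact k" and "cj = (- lam) ^ j / fact j"
      and "Y = t - real k * L" and "E = exp (lam * (t - real k * L))"
    have 1: "We (k - 1) (t - L) = cj * Y ^ j * E" "We k t = ck * Y ^ k * E"
      using t Suc e by (auto simp: We_def algebra_simps ck_def cj_def Y_def E_def)
    have 2: "ck * real k = - lam * cj"
      using Suc by (simp add: ck_def cj_def divide_simps del: of_nat_Suc)
    have "ck * (real k * Y ^ j) * E + ck * Y ^ k * (lam * E) = (ck * real k) * Y ^ j * E + lam * (ck * Y ^ k * E)"
      by (simp add: algebra_simps)
    also have "\<dots> = ?d" unfolding 1 2 using Suc by simp
    finally have "?d = (- lam) ^ k / fact k * (real k * (t - real k * L) ^ j) * exp (lam * (t - real k * L))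
       + (- lam) ^ k / fact k * (t - real k * L) ^ k * (lam * exp (lam * (t - real k * L)))"
      by (simp only: ck_def Y_def E_def)
    have d: "((\<lambda>t. c * (t - a) ^ k * exp (lam * (t - a))) has_real_derivative
        c * (real k * (t - a) ^ j) * exp (lam * (t - a)) + c * (t - a) ^ k * (lam * exp (lam * (t - a)))) (at t)" for c a
      unfolding Suc by (rule derivative_eq_intros refl | simp)+
    show ?thesis using d[of "(- lam) ^ k / fact k" "real k * L"]
      unfolding \<open>?d = _\<close> .
  qed
  then show ?thesis
    by (rule has_field_derivative_transform_within_open[of _ _ _ "{real k * L<..}"])
      (use t in \<open>auto simp: We_def\<close>)
qed

lemma W_deriv:
  assumes "\<And>k::nat. t \<noteq> real k * L"
  shows "(W has_real_derivative lam * (W t - W (t - L))) (at t)"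
proof -
  obtain M :: nat where "t / L < real M" using reals_Archimedean2 by blast
  then have M: "t < real (Suc M) * L" using L by (simp add: field_simps)
  have "((\<lambda>t. \<Sum>k<Suc M. We k t) has_real_derivative
     (\<Sum>k<Suc M. lam * We k t - (if k = 0 then 0 else lam * We (k - 1) (t - L)))) (at t)"
    by (intro derivative_intros We_deriv assms)
  moreover have "(\<Sum>k<Suc M. lam * We k t - (if k = 0 then 0 else lam * We (k - 1) (t - L)))
      = lam * (\<Sum>k<Suc M. We k t) - lam * (\<Sum>k<M. We k (t - L))"
    by (simp add: sum_subtractf sum_distrib_left distrib_left sum.lessThan_Suc_shift del: sum.lessThan_Suc)
  moreover have "(\<Sum>k<Suc M. We k t) = W t" by (rule W_eq[symmetric]) fact
  moreover have "(\<Sum>k<M. We k (t - L)) = W (t - L)"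
    by (rule W_eq[symmetric]) (use M in \<open>simp add: algebra_simps\<close>)
  ultimately have "((\<lambda>t. \<Sum>k<Suc M. We k t) has_real_derivative lam * (W t - W (t - L))) (at t)"
    by (simp add: right_diff_distrib del: sum.lessThan_Suc)
  then show ?thesis
    by (rule has_field_derivative_transform_within_open[of _ _ _ "{..<real (Suc M) * L}"])
      (use M W_eq[of _ "Suc M"] in auto)
qed

lemma finite_grid: "finite (range (\<lambda>k::nat. real k * L) \<inter> {a..b})"
proof -
  have "range (\<lambda>k::nat. real k * L) \<inter> {a..b} \<subseteq> (\<lambda>k. real k * L) ` {..nat \<lceil>b / L\<rceil>}"
  proof
    fix x assume "x \<in> range (\<lambda>k::nat. real k * L) \<inter> {a..b}"
    then obtain k :: nat where k: "x = real k * L" "x \<le> b" by auto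
    then have "real k \<le> b / L" using L by (simp add: field_simps)
    then have "k \<le> nat \<lceil>b / L\<rceil>" by linarith
    with k show "x \<in> (\<lambda>k. real k * L) ` {..nat \<lceil>b / L\<rceil>}" by auto
  qed
  then show ?thesis by (rule finite_subset) simp
qed

lemma W_integral:
  assumes "0 \<le> a" "a \<le> b"
  shows "((\<lambda>t. lam * (W t - W (t - L))) has_integral W b - W a) {a..b}"
proof (rule fundamental_theorem_of_calculus_interior_strong[where S = "range (\<lambda>k::nat. real k * L) \<inter> {a..b}"])
  show "finite (range (\<lambda>k::nat. real k * L) \<inter> {a..b})" by (rule finite_grid)
  fix x assume "x \<in> {a<..<b} - range (\<lambda>k::nat. real k * L) \<inter> {a..b}"
  then have "\<And>k::nat. x \<noteq> real k * L" by auto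
  then show "(W has_vector_derivative lam * (W x - W (x - L))) (at x)"
    using W_deriv by (simp add: has_real_derivative_iff_has_vector_derivative)
qed (use assms in \<open>auto intro: continuous_on_subset[OF continuous_W]\<close>)

text \<open>The increment \<open>W t - W (t - L)\<close> equals \<open>lam\<close> times its own integral over the preceding
  window, so it cannot have a first zero.\<close>

lemma W_increment_pos: assumes "0 \<le> t" shows "W t - W (t - L) > 0"
proof -
  have init: "W s - W (s - L) > 0" if "0 \<le> s" "s < L" for s
    using that by (simp add: W_neg W_init)
  have "W t - W (t - L) > 0" if "L \<le> t" for t
  proof (rule positive_if_no_first_zero[OF _ _ that])
    show "continuous_on {L..} (\<lambda>t. W t - W (t - L))"
      by (intro continuous_intros continuous_on_subset[OF continuous_W]
          continuous_on_compose2[OF continuous_W, of _ "\<lambda>x. x - L"]) (use L in auto)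
    fix s assume s: "L \<le> s" and before: "\<And>r. L \<le> r \<Longrightarrow> r < s \<Longrightarrow> W r - W (r - L) > 0"
    have "W r - W (r - L) > 0" if "0 \<le> r" "r < s" for r
      using init before that by (cases "r < L") auto
    then show "W s - W (s - L) > 0"
      by (intro integral_pos_strict[OF W_integral]) (use s L lam in auto)
  qed
  with init assms show ?thesis by (cases "t < L") auto
qed

lemma W_strict_mono: assumes "0 \<le> a" "a < b" shows "W a < W b"
proof -
  have "0 < W b - W a"
    by (rule integral_pos_strict[OF W_integral]) (use assms W_increment_pos lam in auto)
  then show ?thesis by simp
qed

lemma W_ge_1: "0 \<le> t \<Longrightarrow> W t \<ge> 1"
  using W_strict_mono[of 0 t] W_0 by (cases "t = 0") auto

lemma W_nonneg: "W t \<ge> 0"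
  using W_ge_1[of t] W_neg[of t] by (cases "t < 0") auto

lemma mono_W: "mono W"
proof
  fix a b :: real assume "a \<le> b"
  then show "W a \<le> W b"
    using W_strict_mono[of a b] W_neg[of a] W_nonneg[of b] by (cases "a < 0"; cases "a = b") auto
qed

lemma W_integrable: "W integrable_on {a..b}"
  by (rule integrable_on_mono_on) (use mono_W in \<open>auto simp: mono_on_def mono_def\<close>)

lemma W_measurable [measurable]: "W \<in> borel_measurable borel"
  by (rule borel_measurable_mono[OF mono_W])

lemma exp_W_integrable: "(\<lambda>u. exp (- \<beta> * (u + L)) * W u) integrable_on {a..b}"
proof (rule integrable_on_bounded_borel)
  fix u assume u: "u \<in> {a..b}"
  have "- \<beta> * (u + L) \<le> \<bar>\<beta>\<bar> * \<bar>u + L\<bar>"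
    using abs_ge_self[of "- \<beta> * (u + L)"] by (simp add: abs_mult)
  also have "\<dots> \<le> \<bar>\<beta>\<bar> * (\<bar>a\<bar> + \<bar>b\<bar> + L)"
    using u L by (intro mult_left_mono) auto
  finally have "- \<beta> * (u + L) \<le> \<bar>\<beta>\<bar> * (\<bar>a\<bar> + \<bar>b\<bar> + L)" .
  moreover have "W u \<le> W b" using mono_W u by (auto simp: mono_def)
  ultimately show "\<bar>exp (- \<beta> * (u + L)) * W u\<bar> \<le> exp (\<bar>\<beta>\<bar> * (\<bar>a\<bar> + \<bar>b\<bar> + L)) * W b"
    using W_nonneg[of u] by (auto simp: abs_mult intro!: mult_mono)
qed simp

text \<open>Integrated form of the delay equation. The constant is \<open>W 0\<close>; for
  \<open>t < L\<close> the window reaches into the negative half-line, where \<open>W\<close>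
  vanishes.\<close>

lemma W_renewal:
  assumes "0 \<le> t" shows "W t = 1 + lam * integral {t - L..t} W"
proof -
  define J where "J x = integral {- L..x} W" for x
  have J: "integral {a..b} W = J b - J a" if "- L \<le> a" "a \<le> b" for a b
    using Henstock_Kurzweil_Integration.integral_combine[of "- L" a b W] that W_integrable by (simp add: J_def)
  have J0: "J 0 = 0"
  proof -
    have "integral {- L..0} W = integral {- L..0} (\<lambda>_. 0)"
      by (rule integral_spike[of "{0}"]) (auto intro: W_neg)
    then show ?thesis by (simp add: J_def)
  qed
  have shift: "((\<lambda>u. W (u - L)) has_integral J (t - L)) {0..t}"
    using has_integral_shift_Icc_real[of W "- L" "J (t - L)" 0 t] integrable_integral[OF W_integrable, of "- L" "t - L"]
    by (simp add: J_def o_def)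
  have "(W has_integral J t) {0..t}"
    using integrable_integral[OF W_integrable, of 0 t] J[of 0 t] J0 L assms by simp
  from has_integral_mult_right[OF has_integral_diff[OF this shift], of lam]
  have "((\<lambda>u. lam * (W u - W (u - L))) has_integral lam * (J t - J (t - L))) {0..t}" .
  moreover have "((\<lambda>u. lam * (W u - W (u - L))) has_integral W t - W 0) {0..t}"
    by (rule W_integral) (use assms in auto)
  ultimately have "W t - W 0 = lam * (J t - J (t - L))" by (rule has_integral_unique[rotated])
  then show ?thesis using J[of "t - L" t] L assms W_0 by simp
qed

text \<open>By monotonicity the window integral lies between \<open>L\<close> times the value at its
  left end and \<open>L\<close> times the value at its right end.\<close>

lemma W_renewal_bounds:
  assumes "0 \<le> t"
  shows "W t \<le> 1 + lam * L * W t" "1 + lam * L * W (t - L) \<le> W t"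
proof -
  have "integral {t - L..t} W \<le> integral {t - L..t} (\<lambda>_. W t)"
    by (rule integral_le[OF W_integrable]) (use mono_W in \<open>auto simp: mono_def\<close>)
  also have "\<dots> = L * W t" using L by simp
  finally show "W t \<le> 1 + lam * L * W t" using W_renewal[OF assms] lam by (simp add: mult.assoc)
  have "integral {t - L..t} (\<lambda>_. W (t - L)) \<le> integral {t - L..t} W"
    by (rule integral_le[OF _ W_integrable]) (use mono_W in \<open>auto simp: mono_def\<close>)
  moreover have "integral {t - L..t} (\<lambda>_. W (t - L)) = L * W (t - L)" using L by simp
  ultimately show "1 + lam * L * W (t - L) \<le> W t" using W_renewal[OF assms] lam L by (simp add: mult.assoc)
qed

lemma W_subcritical_less:
  assumes "lam * L < 1" "0 \<le> t" shows "W t \<le> 1 / (1 - lam * L)"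
  using W_renewal_bounds(1)[OF assms(2)] assms(1) by (simp add: field_simps)

text \<open>Iterating the lower renewal bound along the grid produces the partial sums of the
  geometric series, whose limit is the upper bound \<open>W_subcritical_less\<close>.\<close>

lemma W_subcritical_tendsto:
  assumes "lam * L < 1" shows "(\<lambda>k. W (real k * L)) \<longlonglongrightarrow> 1 / (1 - lam * L)"
proof (rule tendsto_sandwich[of "\<lambda>k. \<Sum>j<Suc k. (lam * L) ^ j" _ _ "\<lambda>_. 1 / (1 - lam * L)"])
  have "(\<Sum>j<Suc k. (lam * L) ^ j) \<le> W (real k * L)" for k
  proof (induction k)
    case (Suc k)
    have "(\<Sum>j<Suc (Suc k). (lam * L) ^ j) = 1 + lam * L * (\<Sum>j<Suc k. (lam * L) ^ j)"
      by (subst sum.lessThan_Suc_shift) (simp add: sum_distrib_left del: sum.lessThan_Suc)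
    also have "\<dots> \<le> 1 + lam * L * W (real k * L)"
      using Suc lam L by (intro add_left_mono mult_left_mono) auto
    also have "\<dots> \<le> W (real (Suc k) * L)"
      using W_renewal_bounds(2)[of "real (Suc k) * L"] L by (simp add: algebra_simps)
    finally show ?case .
  qed (simp add: W_0)
  then show "\<forall>\<^sub>F k in sequentially. (\<Sum>j<Suc k. (lam * L) ^ j) \<le> W (real k * L)" by simp
  have "(\<lambda>k. \<Sum>j<k. (lam * L) ^ j) \<longlonglongrightarrow> 1 / (1 - lam * L)"
    using geometric_sums[of "lam * L"] assms lam L by (simp add: sums_def)
  then show "(\<lambda>k. \<Sum>j<Suc k. (lam * L) ^ j) \<longlonglongrightarrow> 1 / (1 - lam * L)" by (rule LIMSEQ_Suc)
qed (use W_subcritical_less[OF assms] L in auto)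

lemma isCont_W: assumes "t \<noteq> 0" shows "isCont W t"
proof (cases "t < 0")
  case True
  have "isCont (\<lambda>_. 0 :: real) t" by simp
  moreover have "\<forall>\<^sub>F x in nhds t. 0 = W x"
    by (rule eventually_mono[OF eventually_nhds_in_open[of "{..<0}"]]) (use True W_neg in auto)
  ultimately show ?thesis by (subst (asm) isCont_cong) auto
next
  case False
  then have "continuous_on {0<..} W" "t \<in> {0<..}" using assms
    by (auto intro: continuous_on_subset[OF continuous_W])
  then show ?thesis by (simp add: continuous_on_eq_continuous_at)
qed

text \<open>The weighted average below is the projection of \<open>W\<close> to the exponential solution
  \<open>exp (\<beta> t)\<close> of the delay equation; it is conserved.\<close>

lemma W_conserved:
  assumes \<beta>: "\<beta> = lam * (1 - exp (- \<beta> * L))" and t: "0 \<le> t"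
  shows "exp (- \<beta> * t) * W t - lam * integral {t - L..t} (\<lambda>u. exp (- \<beta> * (u + L)) * W u) = 1"
proof -
  define f where "f u = exp (- \<beta> * (u + L)) * W u" for u
  have fint: "f integrable_on {a..b}" for a b
    unfolding f_def by (rule exp_W_integrable)
  define J where "J x = integral {- L..x} f" for x
  have J: "integral {a..b} f = J b - J a" if "- L \<le> a" "a \<le> b" for a b
    using Henstock_Kurzweil_Integration.integral_combine[of "- L" a b f] that fint by (simp add: J_def)
  have J0: "J 0 = 0"
  proof -
    have "integral {- L..0} f = integral {- L..0} (\<lambda>_. 0)"
      by (rule integral_spike[of "{0}"]) (auto simp: W_neg f_def)
    then show ?thesis by (simp add: J_def)
  qed
  have Jd: "(J has_real_derivative f x) (at x)" if "x > - L" "x \<noteq> 0" for x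
  proof -
    have "isCont f x" unfolding f_def by (intro continuous_intros isCont_W that)
    then have "continuous (at x within {- L..x + 1}) f" by (rule continuous_at_imp_continuous_at_within)
    with integral_has_vector_derivative_continuous_at[OF fint[of "- L" "x + 1"], of x "{}"] that
    have "(J has_vector_derivative f x) (at x within {- L..x + 1})"
      by (simp add: J_def[abs_def])
    then have "(J has_vector_derivative f x) (at x within {- L<..<x + 1})"
      by (rule has_vector_derivative_within_subset) auto
    moreover have "at x within {- L<..<x + 1} = at x"
      by (rule at_within_open) (use that in auto)
    ultimately show ?thesis unfolding has_real_derivative_iff_has_vector_derivative by simp
  qed
  have Jc: "continuous_on {- L..b} J" for b
    unfolding J_def by (rule indefinite_integral_continuous_1[OF fint])
  define R where "R t = exp (- \<beta> * t) * W t - lam * (J t - J (t - L))" for t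
  have "((\<lambda>_. 0) has_integral R t - R 0) {0..t}"
  proof (rule fundamental_theorem_of_calculus_interior_strong[where S = "range (\<lambda>k::nat. real k * L) \<inter> {0..t}"])
    show "finite (range (\<lambda>k::nat. real k * L) \<inter> {0..t})" by (rule finite_grid)
    show "continuous_on {0..t} R" unfolding R_def
      by (intro continuous_intros continuous_on_subset[OF continuous_W]
          continuous_on_subset[OF Jc[of t]] continuous_on_compose2[OF Jc[of t], of _ "\<lambda>x. x - L"]) (use L in auto)
    fix x assume x: "x \<in> {0<..<t} - range (\<lambda>k::nat. real k * L) \<inter> {0..t}"
    then have xk: "\<And>k::nat. x \<noteq> real k * L" by auto
    \<comment> \<open>The integrand jumps at 0, where \<open>J\<close> need not be differentiable;
      \<open>x - L = 0\<close> is the grid point with \<open>k = 1\<close>.\<close>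
    from xk[of 1] have xL: "x - L \<noteq> 0" by simp
    have d2: "((\<lambda>x. J (x - L)) has_real_derivative f (x - L)) (at x)"
      using DERIV_shift[of J "f (x - L)" x "- L"] Jd[OF _ xL] x by (simp add: algebra_simps)
    have d1: "(J has_real_derivative f x) (at x)" by (rule Jd) (use x L in auto)
    have "(R has_real_derivative (- \<beta> * exp (- \<beta> * x)) * W x + lam * (W x - W (x - L)) * exp (- \<beta> * x)
       - lam * (f x - f (x - L))) (at x)"
      unfolding R_def
      by (rule derivative_eq_intros W_deriv[OF xk] d1 d2 refl | simp)+
    moreover have "(- \<beta> * exp (- \<beta> * x)) * W x + lam * (W x - W (x - L)) * exp (- \<beta> * x)
       - lam * (f x - f (x - L)) = exp (- \<beta> * x) * W x * (lam * (1 - exp (- \<beta> * L)) - \<beta>)"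
    proof -
      have "f x = exp (- \<beta> * x) * exp (- \<beta> * L) * W x" by (simp add: f_def exp_add[symmetric] algebra_simps)
      moreover have "f (x - L) = exp (- \<beta> * x) * W (x - L)" by (simp add: f_def)
      ultimately show ?thesis by (simp add: algebra_simps)
    qed
    ultimately have "(R has_real_derivative 0) (at x)" using \<beta> by simp
    then show "(R has_vector_derivative 0) (at x)"
      by (simp add: has_real_derivative_iff_has_vector_derivative)
  qed (use t in auto)
  then have "R t = R 0" using has_integral_unique[OF _ has_integral_0] by fastforce
  moreover have "J (0 - L) = 0" by (simp add: J_def)
  ultimately show ?thesis using J[of "t - L" t] L t by (simp add: R_def W_0 J0 f_def[abs_def])
qed

text \<open>The error \<open>E\<close> equals its own weighted average over the preceding window, so
  a maximum principle bounds it for all times by its values on the negative half-line, where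
  \<open>W = 0\<close> and \<open>E\<close> is at most \<open>C\<close> in absolute value.\<close>

lemma W_supercritical:
  assumes \<beta>: "\<beta> = lam * (1 - exp (- \<beta> * L))" "\<beta> > 0" and small: "lam * L * exp (- \<beta> * L) < 1"
  obtains C M where "C > 0" "\<And>t. t \<ge> - L \<Longrightarrow> \<bar>W t - C * exp (\<beta> * t)\<bar> < M"
proof -
  define \<zeta> where "\<zeta> = exp (- \<beta> * L)"
  \<comment> \<open>Averaging \<open>W\<close> against the kernel \<open>k\<close> below gives
    \<open>W t - exp (\<beta> t)\<close>, and averaging \<open>C * exp (\<beta> u)\<close> gives
    \<open>C * (lam * L * \<zeta>) * exp (\<beta> t)\<close>. This \<open>C\<close> makes the two
    defects cancel.\<close>
  define C where "C = 1 / (1 - lam * L * \<zeta>)"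
  have C: "C \<ge> 1" using small lam L by (simp add: C_def \<zeta>_def)
  have Cz: "C * (lam * L * \<zeta>) = C - 1" using small by (simp add: C_def \<zeta>_def field_simps)
  define E where "E t = W t - C * exp (\<beta> * t)" for t
  \<comment> \<open>By the characteristic equation for \<open>\<beta>\<close> this is a probability
    density on the window.\<close>
  define k where "k t u = lam * exp (- \<beta> * (u + L - t))" for t u
  have k1: "(k t has_integral 1) {t - L..t}" for t
  proof -
    have "((\<lambda>u. lam * exp (- \<beta> * (u + L - t))) has_integral
       (- lam / \<beta> * exp (- \<beta> * (t + L - t)) - - lam / \<beta> * exp (- \<beta> * (t - L + L - t)))) {t - L..t}"
      by (rule fundamental_theorem_of_calculus)
        (use L \<beta>(2) in \<open>auto intro!: derivative_eq_intros simp: has_real_derivative_iff_has_vector_derivative[symmetric]\<close>)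
    moreover have "- lam / \<beta> * exp (- \<beta> * (t + L - t)) - - lam / \<beta> * exp (- \<beta> * (t - L + L - t)) = 1"
    proof -
      have "- lam / \<beta> * exp (- \<beta> * (t + L - t)) - - lam / \<beta> * exp (- \<beta> * (t - L + L - t)) = lam * (1 - exp (- \<beta> * L)) / \<beta>"
        by (simp add: field_simps diff_divide_distrib)
      also have "\<dots> = 1" using \<beta> by simp
      finally show ?thesis .
    qed
    ultimately show ?thesis by (simp add: k_def[abs_def])
  qed
  have kE: "((\<lambda>u. k t u * E u) has_integral E t) {t - L..t}" if t: "0 \<le> t" for t
  proof -
    define I where "I = integral {t - L..t} (\<lambda>u. exp (- \<beta> * (u + L)) * W u)"
    have "((\<lambda>u. exp (- \<beta> * (u + L)) * W u) has_integral I) {t - L..t}"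
      unfolding I_def
      by (intro integrable_integral exp_W_integrable)
    from has_integral_mult_right[OF this, of "lam * exp (\<beta> * t)"]
    have 1: "((\<lambda>u. k t u * W u) has_integral lam * exp (\<beta> * t) * I) {t - L..t}"
      by (rule has_integral_eq[rotated]) (simp add: k_def exp_add[symmetric] exp_diff[symmetric] algebra_simps)
    have "((\<lambda>_. lam * C * \<zeta> * exp (\<beta> * t)) has_integral L * (lam * C * \<zeta> * exp (\<beta> * t))) {t - L..t}"
      using has_integral_const_real[of "lam * C * \<zeta> * exp (\<beta> * t)" "t - L" t] L by simp
    then have 2: "((\<lambda>u. k t u * (C * exp (\<beta> * u))) has_integral L * (lam * C * \<zeta> * exp (\<beta> * t))) {t - L..t}"
      by (rule has_integral_eq[rotated]) (simp add: k_def \<zeta>_def exp_add[symmetric] exp_diff[symmetric] algebra_simps)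
    have "lam * I = exp (- \<beta> * t) * W t - 1"
      using W_conserved[OF \<beta>(1) t] by (simp add: I_def)
    then have "lam * exp (\<beta> * t) * I = exp (\<beta> * t) * (exp (- \<beta> * t) * W t - 1)" by simp
    also have "\<dots> = W t - exp (\<beta> * t)" by (simp add: right_diff_distrib mult.assoc[symmetric] exp_add[symmetric])
    finally have I: "lam * exp (\<beta> * t) * I = W t - exp (\<beta> * t)" .
    have "L * (lam * C * \<zeta> * exp (\<beta> * t)) = (C * (lam * L * \<zeta>)) * exp (\<beta> * t)"
      by (simp add: algebra_simps)
    then have "L * (lam * C * \<zeta> * exp (\<beta> * t)) = (C - 1) * exp (\<beta> * t)" by (simp only: Cz)
    with I have "lam * exp (\<beta> * t) * I - L * (lam * C * \<zeta> * exp (\<beta> * t)) = W t - exp (\<beta> * t) - (C - 1) * exp (\<beta> * t)"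
      by simp
    also have "\<dots> = E t" by (simp add: E_def algebra_simps)
    finally have "lam * exp (\<beta> * t) * I - L * (lam * C * \<zeta> * exp (\<beta> * t)) = E t" .
    with has_integral_diff[OF 1 2] show ?thesis by (simp add: E_def right_diff_distrib)
  qed
  have neg: "\<bar>E t\<bar> \<le> C" if "t < 0" for t
    using that C mult_pos_neg[OF \<beta>(2) that] by (simp add: E_def W_neg abs_mult)
  \<comment> \<open>The added 1 gives strict positivity on the negative half-line, from which the
    first-zero argument can start. The two signs \<open>\<sigma>\<close> give both sides of the
    bound.\<close>
  have bound: "C + 1 - \<sigma> * E t > 0" if \<sigma>: "\<sigma> \<in> {1, -1}" and t: "0 \<le> t" for \<sigma> t
  proof (rule positive_if_no_first_zero[OF _ _ t])
    show "continuous_on {0..} (\<lambda>t. C + 1 - \<sigma> * E t)"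
      unfolding E_def by (intro continuous_intros continuous_W)
    fix s assume s: "0 \<le> s" and before: "\<And>r. 0 \<le> r \<Longrightarrow> r < s \<Longrightarrow> 0 < C + 1 - \<sigma> * E r"
    have pos: "0 < C + 1 - \<sigma> * E r" if "r < s" for r
      using before[of r] neg[of r] that \<sigma> by (cases "r < 0") auto
    have "((\<lambda>u. (C + 1) * k s u - \<sigma> * (k s u * E u)) has_integral (C + 1) * 1 - \<sigma> * E s) {s - L..s}"
      by (intro has_integral_diff has_integral_mult_right k1 kE s)
    then have "((\<lambda>u. k s u * (C + 1 - \<sigma> * E u)) has_integral C + 1 - \<sigma> * E s) {s - L..s}"
      by (simp add: algebra_simps)
    then show "0 < C + 1 - \<sigma> * E s"
      by (rule integral_pos_strict) (use L pos lam in \<open>auto simp: k_def\<close>)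
  qed
  have "\<bar>E t\<bar> < C + 1" for t
    using bound[of 1 t] bound[of "-1" t] neg[of t] by (cases "t < 0") auto
  then show ?thesis using that[of C "C + 1"] C by (simp add: E_def)
qed

end

section \<open>The limiting degree distribution\<close>

text \<open>Counts the compositions of \<open>k\<close> into \<open>j\<close> positive parts, the
  coefficient in a sum of \<open>j\<close> geometric variables on the positive integers. The case
  \<open>j = 0\<close> is separate because truncated subtraction would spoil
  \<open>j - 1\<close>.\<close>

definition negbin :: "nat \<Rightarrow> nat \<Rightarrow> nat" where
  "negbin j k = (if j = 0 then of_bool (k = 0) else if k < j then 0 else (k - 1) choose (j - 1))"

lemma negbin_sums:
  fixes q s :: real assumes "\<bar>q * s\<bar> < 1"
  shows "(\<lambda>k. real (negbin j k) * q ^ (k - j) * s ^ k) sums (s / (1 - q * s)) ^ j"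
proof (cases j)
  case 0
  have "(\<lambda>k. real (negbin j k) * q ^ (k - j) * s ^ k) = (\<lambda>k. if k = 0 then 1 else 0)"
    using 0 by (auto simp: negbin_def fun_eq_iff)
  then show ?thesis using sums_single[of 0 "\<lambda>_. 1::real"] 0 by simp
next
  case (Suc i)
  have "(\<lambda>n. (- real j gchoose n) * (- (q * s)) ^ n) sums (1 + - (q * s)) powr (- real j)"
    by (rule gen_binomial_real) (use assms in auto)
  moreover have "(- real j gchoose n) * (- (q * s)) ^ n = real ((n + i) choose i) * (q * s) ^ n" for n
  proof -
    have "(- real j gchoose n) = (- 1) ^ n * ((real (n + i)) gchoose n)"
      by (subst gbinomial_negated_upper) (simp add: Suc)
    also have "(real (n + i)) gchoose n = real ((n + i) choose i)"
      by (subst binomial_symmetric) (auto simp: binomial_gbinomial)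
    finally show ?thesis by (simp add: power_mult_distrib power_minus[of "q * s"] mult.assoc mult.left_commute)
  qed
  moreover have "(1 + - (q * s)) powr (- real j) = (1 / (1 - q * s)) ^ j"
    using assms by (simp add: powr_minus powr_realpow power_one_over power_inverse divide_inverse)
  ultimately have "(\<lambda>n. real ((n + i) choose i) * (q * s) ^ n) sums (1 / (1 - q * s)) ^ j" by simp
  from sums_mult[OF this, of "s ^ j"]
  have "(\<lambda>n. s ^ j * (real ((n + i) choose i) * (q * s) ^ n)) sums (s / (1 - q * s)) ^ j"
    by (simp add: power_divide)
  moreover have "s ^ j * (real ((n + i) choose i) * (q * s) ^ n)
      = real (negbin j (n + j)) * q ^ ((n + j) - j) * s ^ (n + j)" for n
    by (simp add: Suc negbin_def power_mult_distrib power_add)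
  ultimately have "(\<lambda>n. real (negbin j (n + j)) * q ^ ((n + j) - j) * s ^ (n + j)) sums (s / (1 - q * s)) ^ j"
    by simp
  then show ?thesis
    by (subst (asm) sums_iff_shift) (simp add: Suc negbin_def)
qed

context delay begin

text \<open>\<open>uu t\<close> is the extinction probability by age \<open>t\<close> of the line of
  one half-edge; given survival, its size is geometric with success probability
  \<open>1 / W t\<close>, and \<open>qq t\<close> is the failure probability.\<close>

definition uu :: "real \<Rightarrow> real" where "uu t = W (t - L) / W t"
definition qq :: "real \<Rightarrow> real" where "qq t = 1 - 1 / W t"

text \<open>Law of the total offspring of \<open>m\<close> independent lines: \<open>j\<close>
  counts the surviving ones, and each of these contributes a geometric number.\<close>

definition cf :: "nat \<Rightarrow> nat \<Rightarrow> real \<Rightarrow> real" where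
  "cf m k t = (\<Sum>j\<le>m. real (m choose j) * uu t ^ (m - j) * (1 - uu t) ^ j *
     (real (negbin j k) * (1 / W t) ^ j * qq t ^ (k - j)))"

definition FF :: "real \<Rightarrow> real \<Rightarrow> real" where
  "FF s t = (s + (1 - s) * W (t - L)) / (s + (1 - s) * W t)"

lemma uu_bounds: assumes "0 \<le> t" shows "0 \<le> uu t" "uu t < 1"
  using W_ge_1[OF assms] W_increment_pos[OF assms] W_nonneg[of "t - L"] by (auto simp: uu_def)

lemma uu_pos: "L \<le> t \<Longrightarrow> 0 < uu t"
  using W_ge_1[of t] W_ge_1[of "t - L"] L by (auto simp: uu_def)

lemma qq_bounds: assumes "0 \<le> t" shows "0 \<le> qq t" "qq t < 1"
  using W_ge_1[OF assms] by (auto simp: qq_def)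

lemma qq_pos: "0 < t \<Longrightarrow> 0 < qq t"
  using W_strict_mono[of 0 t] W_0 by (auto simp: qq_def)

lemma cf_term_nonneg: "0 \<le> t \<Longrightarrow> 0 \<le> real (m choose j) * uu t ^ (m - j) * (1 - uu t) ^ j *
     (real (negbin j k) * (1 / W t) ^ j * qq t ^ (k - j))"
  using uu_bounds[of t] qq_bounds[of t] W_nonneg[of t] by (intro mult_nonneg_nonneg zero_le_power) auto

lemma cf_nonneg: "0 \<le> t \<Longrightarrow> 0 \<le> cf m k t"
  unfolding cf_def by (intro sum_nonneg cf_term_nonneg)

lemma cf_ge_term: "0 \<le> t \<Longrightarrow> j \<le> m \<Longrightarrow> real (m choose j) * uu t ^ (m - j) * (1 - uu t) ^ j *
     (real (negbin j k) * (1 / W t) ^ j * qq t ^ (k - j)) \<le> cf m k t"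
  unfolding cf_def by (rule member_le_sum) (auto intro: cf_term_nonneg)

text \<open>Before age \<open>L\<close> no half-edge has died and \<open>uu t = 0\<close>, so small
  degrees may be impossible; hence the restriction on \<open>t\<close>.\<close>

lemma cf_pos: assumes "L < t" "1 \<le> m" shows "0 < cf m k t"
proof -
  have t: "0 \<le> t" "0 < t" using assms L by auto
  note b = uu_bounds[OF t(1)] uu_pos[of t] qq_pos[OF t(2)] W_ge_1[OF t(1)]
  show ?thesis
  proof (cases "k = 0")
    case True
    have "0 < uu t ^ m" using b assms by simp
    also have "\<dots> \<le> cf m k t" using cf_ge_term[OF t(1), of 0 m k] True by (simp add: negbin_def)
    finally show ?thesis .
  next
    case False
    have "0 < real m * uu t ^ (m - 1) * (1 - uu t) * (1 / W t * qq t ^ (k - 1))"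
      using b assms by simp
    also have "\<dots> \<le> cf m k t" using cf_ge_term[OF t(1), of 1 m k] False assms by (simp add: negbin_def)
    finally show ?thesis .
  qed
qed

lemma cf_sums:
  assumes t: "0 \<le> t" and s: "0 \<le> s" "s < 1"
  shows "(\<lambda>k. cf m k t * s ^ k) sums FF s t ^ m"
proof -
  note b = uu_bounds[OF t(1)] qq_bounds[OF t] W_ge_1[OF t(1)]
  define g where "g = s / (1 - qq t * s)"
  have qs: "0 \<le> qq t * s" "qq t * s < 1"
    using b s mult_mono[of "qq t" 1 s s] by auto
  have "(\<lambda>k. \<Sum>j\<le>m. real (m choose j) * uu t ^ (m - j) * (1 - uu t) ^ j * (1 / W t) ^ j *
      (real (negbin j k) * qq t ^ (k - j) * s ^ k)) sums
      (\<Sum>j\<le>m. real (m choose j) * uu t ^ (m - j) * (1 - uu t) ^ j * (1 / W t) ^ j * g ^ j)"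
    unfolding g_def by (intro sums_sum sums_mult negbin_sums) (use qs in auto)
  moreover have "(\<Sum>j\<le>m. real (m choose j) * uu t ^ (m - j) * (1 - uu t) ^ j * (1 / W t) ^ j * g ^ j)
     = ((1 - uu t) * g / W t + uu t) ^ m"
    by (subst binomial_ring) (rule sum.cong, auto simp: power_mult_distrib power_divide)
  moreover have "(1 - uu t) * g / W t + uu t = FF s t"
  proof -
    have W0: "W t > 0" using b by simp
    define den where "den = s + (1 - s) * W t"
    have den: "den > 0" using W0 s by (cases "s = 0") (auto simp: den_def add_pos_nonneg add_nonneg_pos)
    have "1 - qq t * s = den / W t" using W0 by (simp add: den_def qq_def field_simps)
    then have g: "g = s * W t / den" by (simp add: g_def)
    have frac: "(1 - w0 / w) * (s * w / d) / w + w0 / w = ((w - w0) * s + w0 * d) / (w * d)"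
      if "w \<noteq> 0" "d \<noteq> 0" for w w0 d :: real
    proof -
      have "1 - w0 / w = (w - w0) / w" using that by (simp add: diff_divide_distrib)
      then have "(1 - w0 / w) * (s * w / d) / w = (w - w0) * s / (w * d)" using that by simp
      moreover have "w0 / w = w0 * d / (w * d)" using that by simp
      ultimately show ?thesis by (simp only: add_divide_distrib)
    qed
    have "(1 - uu t) * g / W t + uu t = ((W t - W (t - L)) * s + W (t - L) * den) / (W t * den)"
      unfolding g uu_def by (rule frac) (use W0 den in auto)
    also have "(W t - W (t - L)) * s + W (t - L) * den = W t * (s + (1 - s) * W (t - L))"
      by (simp add: den_def algebra_simps)
    finally show ?thesis using W0 by (simp add: FF_def den_def)
  qed
  ultimately show ?thesis
    by (simp add: cf_def sum_distrib_left mult_ac)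
qed

lemma FF_bounds: assumes "0 \<le> t" "0 < s" "s < 1" shows "0 \<le> FF s t" "FF s t \<le> 1"
proof -
  have "(1 - s) * W (t - L) \<le> (1 - s) * W t"
    using assms W_increment_pos[of t] by (intro mult_left_mono) auto
  moreover have "0 \<le> (1 - s) * W (t - L)" using assms W_nonneg by simp
  moreover from calculation have "0 < s + (1 - s) * W t" using assms by linarith
  ultimately show "0 \<le> FF s t" "FF s t \<le> 1" using assms by (simp_all add: FF_def)
qed

text \<open>The generating function is at most 1 at \<open>s = 1/2\<close>. A bound uniform in
  \<open>t\<close> is what integrability over birth times needs.\<close>

lemma cf_le: assumes "0 \<le> t" shows "cf m k t \<le> 2 ^ k"
proof -
  note S = cf_sums[OF assms, of "1/2" m]
  have "cf m k t * (1/2) ^ k \<le> (\<Sum>k. cf m k t * (1/2) ^ k)"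
    using sum_le_suminf[OF sums_summable[OF S], of "{k}"] cf_nonneg[OF assms] by simp
  also have "\<dots> = FF (1/2) t ^ m" using S by (simp add: sums_iff)
  also have "\<dots> \<le> 1" using FF_bounds[OF assms, of "1/2"] by (intro power_le_one) auto
  finally show ?thesis by (simp add: field_simps)
qed

text \<open>The tail is compared with that of the series at \<open>1/2\<close>, whose sum is at most
  1. Uniformity in \<open>t\<close> lets the estimate pass to the integral, so coefficients can be
  read off by letting \<open>s\<close> tend to 0.\<close>

lemma cf_truncate:
  assumes t: "0 \<le> t" and s: "0 < s" "s < 1/2"
  shows "\<bar>FF s t ^ m - (\<Sum>k<n. cf m k t * s ^ k)\<bar> \<le> (2 * s) ^ n"
proof -
  have S: "(\<lambda>k. cf m k t * s ^ k) sums FF s t ^ m" by (rule cf_sums) (use t s in auto)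
  have S2: "(\<lambda>k. cf m k t * (1/2) ^ k) sums FF (1/2) t ^ m" by (rule cf_sums) (use t in auto)
  have "FF s t ^ m - (\<Sum>k<n. cf m k t * s ^ k) = (\<Sum>k. cf m (k + n) t * s ^ (k + n))"
    using suminf_minus_initial_segment[OF sums_summable[OF S], of n] S by (simp add: sums_iff)
  moreover have "0 \<le> \<dots>"
    using summable_ignore_initial_segment[OF sums_summable[OF S], of n] cf_nonneg[OF t] s
    by (intro suminf_nonneg) auto
  moreover have "(\<Sum>k. cf m (k + n) t * s ^ (k + n)) \<le> (\<Sum>k. (2 * s) ^ n * (cf m (k + n) t * (1/2) ^ (k + n)))"
  proof (rule suminf_le)
    fix k
    have "s ^ (k + n) = (2 * s) ^ n * ((2 * s) ^ k * (1/2) ^ (k + n))"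
      by (simp add: power_add power_mult_distrib power_one_over field_simps)
    also have "\<dots> \<le> (2 * s) ^ n * (1 * (1/2) ^ (k + n))"
      using s by (intro mult_left_mono mult_right_mono power_le_one) auto
    finally have "s ^ (k + n) \<le> (2 * s) ^ n * (1/2) ^ (k + n)" by simp
    from mult_left_mono[OF this cf_nonneg[OF t, of m "k + n"]]
    show "cf m (k + n) t * s ^ (k + n) \<le> (2 * s) ^ n * (cf m (k + n) t * (1/2) ^ (k + n))"
      by (simp add: mult_ac)
  qed (use summable_ignore_initial_segment[OF sums_summable[OF S], of n]
         summable_ignore_initial_segment[OF sums_summable[OF S2], of n] in \<open>auto intro!: summable_mult\<close>)
  moreover have "\<dots> = (2 * s) ^ n * (\<Sum>k. cf m (k + n) t * (1/2) ^ (k + n))"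
    using summable_ignore_initial_segment[OF sums_summable[OF S2], of n] by (intro suminf_mult)
  moreover have "(\<Sum>k. cf m (k + n) t * (1/2) ^ (k + n)) \<le> FF (1/2) t ^ m"
    using suminf_minus_initial_segment[OF sums_summable[OF S2], of n] S2 cf_nonneg[OF t]
    by (simp add: sums_iff sum_nonneg)
  moreover have "FF (1/2) t ^ m \<le> 1" using FF_bounds[OF t, of "1/2"] by (intro power_le_one) auto
  moreover have "(2 * s) ^ n * (\<Sum>k. cf m (k + n) t * (1/2) ^ (k + n)) \<le> (2 * s) ^ n * 1"
    using s calculation(5,6) by (intro mult_left_mono) auto
  ultimately show ?thesis by linarith
qed

lemma uu_measurable [measurable]: "uu \<in> borel_measurable borel"
  and qq_measurable [measurable]: "qq \<in> borel_measurable borel"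
  unfolding uu_def[abs_def] qq_def[abs_def] by measurable

lemma cf_measurable [measurable]: "cf m k \<in> borel_measurable borel"
  unfolding cf_def[abs_def] by measurable

lemma FF_measurable [measurable]: "FF s \<in> borel_measurable borel"
  unfolding FF_def[abs_def] by measurable

text \<open>The variable \<open>x\<close> is the birth time of a vertex as a fraction of the present time, and
  \<open>- ln x\<close> is its age on the logarithmic time scale.\<close>

definition xc :: "nat \<Rightarrow> nat \<Rightarrow> real" where
  "xc m k = integral {0..1} (\<lambda>x. cf m k (- ln x))"

lemma neg_ln_nonneg: "x \<in> {0..1} \<Longrightarrow> 0 \<le> - ln (x::real)"
  by (cases "x = 0") (auto simp: ln_le_zero_iff)

lemma cf_ln_integrable: "0 \<le> a \<Longrightarrow> b \<le> 1 \<Longrightarrow> (\<lambda>x. cf m k (- ln x)) integrable_on {a..b}"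
proof (rule integrable_on_bounded_borel[where B = "2 ^ k"])
  fix x :: real assume "0 \<le> a" "b \<le> 1" "x \<in> {a..b}"
  then have "0 \<le> - ln x" using neg_ln_nonneg[of x] by auto
  then show "\<bar>cf m k (- ln x)\<bar> \<le> 2 ^ k" using cf_le cf_nonneg by simp
qed measurable

lemma FF_ln_integrable: "0 \<le> a \<Longrightarrow> b \<le> 1 \<Longrightarrow> 0 < s \<Longrightarrow> s < 1 \<Longrightarrow> (\<lambda>x. FF s (- ln x) ^ m) integrable_on {a..b}"
proof (rule integrable_on_bounded_borel[where B = 1])
  fix x :: real assume "0 \<le> a" "b \<le> 1" "x \<in> {a..b}" and s: "0 < s" "s < 1"
  then have "0 \<le> - ln x" using neg_ln_nonneg[of x] by auto
  then show "\<bar>FF s (- ln x) ^ m\<bar> \<le> 1" using FF_bounds[OF _ s] by (simp add: power_abs[symmetric] power_le_one)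
qed measurable

lemma xc_ge: 
  assumes "0 \<le> a" "b \<le> 1" shows "integral {a..b} (\<lambda>x. cf m k (- ln x)) \<le> xc m k"
  unfolding xc_def
  by (rule integral_subset_le) (use assms in \<open>auto intro!: cf_ln_integrable cf_nonneg neg_ln_nonneg\<close>)

lemma xc_pos: assumes "1 \<le> m" shows "0 < xc m k"
proof -
  have "0 < integral {0..exp (- L)} (\<lambda>x. cf m k (- ln x))"
  proof (rule integral_pos_strict[OF integrable_integral])
    fix x assume "0 < x" "x < exp (- L)"
    then have "ln x < - L" using ln_less_cancel_iff[of x "exp (- L)"] by simp
    then show "0 < cf m k (- ln x)" using assms by (intro cf_pos) auto
  qed (use L in \<open>auto intro: cf_ln_integrable\<close>)
  then show ?thesis using xc_ge[of 0 "exp (- L)" m k] L by simp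
qed

lemma xc_truncate:
  assumes s: "0 < s" "s < 1/2"
  shows "\<bar>integral {0..1} (\<lambda>x. FF s (- ln x) ^ m) - (\<Sum>k<n. xc m k * s ^ k)\<bar> \<le> (2 * s) ^ n"
proof -
  have "((\<lambda>x. FF s (- ln x) ^ m - (\<Sum>k<n. cf m k (- ln x) * s ^ k)) has_integral
     integral {0..1} (\<lambda>x. FF s (- ln x) ^ m) - (\<Sum>k<n. xc m k * s ^ k)) {0..1}"
    unfolding xc_def using s
    by (intro has_integral_diff has_integral_sum has_integral_mult_left integrable_integral FF_ln_integrable cf_ln_integrable) auto
  from has_integral_bound[OF _ this[unfolded box_real(2)[symmetric]], of "(2 * s) ^ n"]
  show ?thesis using s cf_truncate[OF neg_ln_nonneg] by auto
qed

end

section \<open>Exponential decay of the coefficients in the subcritical regime\<close>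

context delay begin

text \<open>The bound on \<open>W\<close> forces \<open>qq t\<close> to be at most
  \<open>lam * L\<close> at every age, while the combinatorial factor grows only polynomially in
  \<open>k\<close>.\<close>

lemma xc_subcritical_upper:
  assumes a: "lam * L < 1" and k: "m \<le> k" "1 \<le> k"
  shows "xc m k \<le> 2 ^ m * real k ^ m * (lam * L) ^ k / (lam * L) ^ m"
proof -
  let ?a = "lam * L"
  have a0: "0 < ?a" using lam L by simp
  have bound: "cf m k t \<le> 2 ^ m * real k ^ m * ?a ^ k / ?a ^ m" if t: "0 \<le> t" for t
  proof -
    note b = uu_bounds[OF t] qq_bounds[OF t] W_ge_1[OF t]
    have "1 / W t \<ge> 1 - ?a"
      using W_renewal_bounds(1)[OF t] b by (simp add: field_simps)
    then have q: "qq t \<le> ?a" by (simp add: qq_def)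
    have "real (m choose j) * uu t ^ (m - j) * (1 - uu t) ^ j *
       (real (negbin j k) * (1 / W t) ^ j * qq t ^ (k - j)) \<le> real (m choose j) * (real k ^ m * (?a ^ k / ?a ^ m))"
      if j: "j \<le> m" for j
    proof -
      have "negbin j k \<le> k ^ m"
      proof (cases "j = 0 \<or> k < j")
        case False
        then have "negbin j k \<le> (k - 1) ^ (j - 1)"
          by (auto simp: negbin_def intro!: binomial_le_pow)
        also have "\<dots> \<le> k ^ (j - 1)" by (intro power_mono) auto
        also have "\<dots> \<le> k ^ m" using j k by (intro power_increasing) auto
        finally show ?thesis .
      qed (use k in \<open>auto simp: negbin_def\<close>)
      then have n: "real (negbin j k) \<le> real k ^ m" by (metis of_nat_le_iff of_nat_power)
      have "qq t ^ (k - j) \<le> ?a ^ (k - j)" using q b by (intro power_mono) auto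
      also have "\<dots> \<le> ?a ^ (k - m)" using a a0 j by (intro power_decreasing) auto
      also have "\<dots> = ?a ^ k / ?a ^ m" using k a0 by (intro power_diff) auto
      finally have q2: "qq t ^ (k - j) \<le> ?a ^ k / ?a ^ m" .
      have "real (negbin j k) * (1 / W t) ^ j * qq t ^ (k - j) \<le> real k ^ m * 1 * (?a ^ k / ?a ^ m)"
        using n q2 b by (intro mult_mono power_le_one) auto
      moreover have "real (m choose j) * uu t ^ (m - j) * (1 - uu t) ^ j \<le> real (m choose j) * 1 * 1"
        using b by (intro mult_mono power_le_one) auto
      from mult_mono[OF this calculation] have "real (m choose j) * uu t ^ (m - j) * (1 - uu t) ^ j *
       (real (negbin j k) * (1 / W t) ^ j * qq t ^ (k - j)) \<le> real (m choose j) * 1 * 1 * (real k ^ m * 1 * (?a ^ k / ?a ^ m))"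
        using b by (simp add: mult_ac)
      then show ?thesis by simp
    qed
    then have "cf m k t \<le> (\<Sum>j\<le>m. real (m choose j) * (real k ^ m * (?a ^ k / ?a ^ m)))"
      unfolding cf_def by (intro sum_mono) auto
    also have "\<dots> = real (\<Sum>j\<le>m. m choose j) * (real k ^ m * (?a ^ k / ?a ^ m))"
      by (simp only: of_nat_sum sum_distrib_right)
    also have "\<dots> = 2 ^ m * real k ^ m * ?a ^ k / ?a ^ m" by (simp only: choose_row_sum) simp
    finally show ?thesis .
  qed
  have "xc m k \<le> integral {0..1} (\<lambda>_::real. 2 ^ m * real k ^ m * ?a ^ k / ?a ^ m)"
    unfolding xc_def by (intro integral_le cf_ln_integrable bound neg_ln_nonneg) auto
  then show ?thesis by simp
qed

text \<open>Only the term \<open>j = m\<close> and only births \<open>x\<close> below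
  \<open>exp (- t0)\<close> are kept, with \<open>t0\<close> so large that \<open>qq\<close> exceeds
  \<open>r\<close> from then on. The integral of the remaining factor over these births is the
  positive constant \<open>c\<close>.\<close>

lemma xc_subcritical_lower:
  assumes a: "lam * L < 1" and r: "0 < r" "r < lam * L"
  obtains c where "0 < c" "\<And>k. m \<le> k \<Longrightarrow> 1 \<le> m \<Longrightarrow> c * r ^ k \<le> xc m k"
proof -
  have "1 / (1 - r) < 1 / (1 - lam * L)" using r a by (intro divide_strict_left_mono) auto
  from order_tendstoD(1)[OF W_subcritical_tendsto[OF a] this]
  obtain k0 where k0: "1 / (1 - r) < W (real k0 * L)" by (auto simp: eventually_sequentially)
  define t0 where "t0 = real k0 * L"
  have t0: "0 \<le> t0" using L by (simp add: t0_def)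
  have q: "r \<le> qq t" if "t0 \<le> t" for t
  proof -
    have "1 / (1 - r) \<le> W t" using k0 monoD[OF mono_W that] by (simp add: t0_def)
    moreover have "0 < 1 - r" using r a by simp
    moreover have "0 < W t" using W_ge_1[of t] t0 that by simp
    ultimately show ?thesis by (simp add: qq_def field_simps)
  qed
  define f where "f x = (if x = 0 then 0 else (1 - uu (- ln x)) ^ m * (1 / W (- ln x)) ^ m)" for x
  define b where "b = exp (- t0)"
  have b: "0 < b" "b \<le> 1" using t0 by (auto simp: b_def)
  have fb: "0 < f x" "f x \<le> 1" if "0 < x" "x \<le> 1" for x
  proof -
    have t: "0 \<le> - ln x" using neg_ln_nonneg that by auto
    show "0 < f x" "f x \<le> 1" using uu_bounds[OF t] W_ge_1[OF t] that
      by (auto simp: f_def intro!: mult_le_one power_le_one)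
  qed
  have fi: "f integrable_on {0..b}"
  proof (rule integrable_on_bounded_borel[where B = 1])
    show "f \<in> borel_measurable borel" unfolding f_def[abs_def] by measurable
    fix x assume "x \<in> {0..b}"
    then show "\<bar>f x\<bar> \<le> 1" using fb[of x] b by (cases "x = 0") (auto simp: f_def)
  qed
  have c: "0 < integral {0..b} f"
    by (rule integral_pos_strict[OF integrable_integral[OF fi]]) (use fb b in auto)
  have "integral {0..b} f * r ^ k \<le> xc m k" if k: "m \<le> k" "1 \<le> m" for k
  proof -
    have "integral {0..b} f * r ^ k = integral {0..b} (\<lambda>x. f x * r ^ k)" by simp
    also have "\<dots> \<le> integral {0..b} (\<lambda>x. cf m k (- ln x))"
    proof (rule integral_le)
      fix x assume x: "x \<in> {0..b}"
      show "f x * r ^ k \<le> cf m k (- ln x)"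
      proof (cases "x = 0")
        case True
        then show ?thesis using cf_nonneg[of 0 m k] by (simp add: f_def)
      next
      case False
      then have "ln x \<le> - t0" using ln_le_cancel_iff[of x b] b(1) x by (simp add: b_def)
      then have t: "t0 \<le> - ln x" "0 \<le> - ln x" using t0 by auto
      have "r ^ k \<le> r ^ (k - m)" using r a by (intro power_decreasing) auto
      also have "\<dots> \<le> qq (- ln x) ^ (k - m)" using q[OF t(1)] r by (intro power_mono) auto
      finally have "r ^ k \<le> qq (- ln x) ^ (k - m)" .
      moreover have "1 \<le> real (negbin m k)"
        using k by (simp add: negbin_def Suc_le_eq zero_less_binomial_iff) 
      ultimately have "1 * r ^ k \<le> real (negbin m k) * qq (- ln x) ^ (k - m)"
        using r by (intro mult_mono) auto
      then have "f x * r ^ k \<le> f x * (real (negbin m k) * qq (- ln x) ^ (k - m))"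
        using fb[of x] False x b by (intro mult_left_mono) auto
      also have "\<dots> \<le> cf m k (- ln x)"
        using cf_ge_term[OF t(2), of m m k] False by (simp add: f_def mult_ac)
      finally show "f x * r ^ k \<le> cf m k (- ln x)" .
      qed
    qed (use fi b in \<open>auto intro: cf_ln_integrable integrable_on_mult_left\<close>)
    also have "\<dots> \<le> xc m k" using b by (intro xc_ge) auto
    finally show ?thesis .
  qed
  with c show ?thesis using that by blast
qed

lemma xc_subcritical:
  assumes a: "lam * L < 1" and m: "1 \<le> m" and p: "0 < p"
  shows "\<exists>\<epsilon>. \<epsilon> \<longlonglongrightarrow> 0 \<and> (\<forall>\<^sub>F k in sequentially. p * xc m k = (lam * L) powr (real k * (1 + \<epsilon> k)))"
proof -
  let ?a = "lam * L"
  have a0: "0 < ?a" using lam L by simp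
  have la: "ln ?a < 0" using a0 a by simp
  define f where "f k = ln (p * xc m k) / real k" for k
  have lim: "f \<longlonglongrightarrow> ln ?a"
  proof (rule order_tendstoI)
    fix y assume y: "ln ?a < y"
    have "(\<lambda>k. ln (p * 2 ^ m / ?a ^ m) / real k + real m * (ln (real k) / real k) + ln ?a) \<longlonglongrightarrow> 0 + real m * 0 + ln ?a"
      by (intro tendsto_intros; real_asymp)
    then have "\<forall>\<^sub>F k in sequentially. ln (p * 2 ^ m / ?a ^ m) / real k + real m * (ln (real k) / real k) + ln ?a < y"
      using y by (intro order_tendstoD) auto
    then show "\<forall>\<^sub>F k in sequentially. f k < y"
      using eventually_ge_at_top[of "max m 1"]
    proof eventually_elim
      case (elim k)
      have "p * xc m k \<le> p * (2 ^ m * real k ^ m * ?a ^ k / ?a ^ m)"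
        using xc_subcritical_upper[OF a, of m k] elim p by (intro mult_left_mono) auto
      then have "ln (p * xc m k) \<le> ln (p * (2 ^ m * real k ^ m * ?a ^ k / ?a ^ m))"
        using p xc_pos[OF m] a0 elim by (subst ln_le_cancel_iff) auto
      also have "p * (2 ^ m * real k ^ m * ?a ^ k / ?a ^ m) = (p * 2 ^ m / ?a ^ m) * (real k ^ m * ?a ^ k)"
        by simp
      also have "ln \<dots> = ln (p * 2 ^ m / ?a ^ m) + (real m * ln (real k) + real k * ln ?a)"
        using p a0 elim lam L by (subst ln_mult_pos; simp add: ln_mult_pos ln_realpow)
      finally have "f k \<le> (ln (p * 2 ^ m / ?a ^ m) + (real m * ln (real k) + real k * ln ?a)) / real k"
        unfolding f_def by (intro divide_right_mono) auto
      also have "\<dots> = ln (p * 2 ^ m / ?a ^ m) / real k + real m * (ln (real k) / real k) + ln ?a"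
        using elim by (simp add: field_simps)
      finally show ?case using elim by linarith
    qed
  next
    fix y assume y: "y < ln ?a"
    \<comment> \<open>The geometric mean of \<open>exp y\<close> and \<open>lam * L\<close>, hence
      strictly between them.\<close>
    define r where "r = exp ((y + ln ?a) / 2)"
    have r: "0 < r" "r < ?a" "y < ln r"
    proof -
      have "r < exp (ln ?a)" unfolding r_def using y by (subst exp_less_cancel_iff) auto
      then show "r < ?a" using a0 by simp
    qed (use y in \<open>auto simp: r_def\<close>)
    obtain c where c: "0 < c" "\<And>k. m \<le> k \<Longrightarrow> 1 \<le> m \<Longrightarrow> c * r ^ k \<le> xc m k"
      using xc_subcritical_lower[OF a r(1,2)] by blast
    have "(\<lambda>k. ln (p * c) / real k + ln r) \<longlonglongrightarrow> 0 + ln r"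
      by (intro tendsto_intros; real_asymp)
    then have "\<forall>\<^sub>F k in sequentially. y < ln (p * c) / real k + ln r"
      using r by (intro order_tendstoD) auto
    then show "\<forall>\<^sub>F k in sequentially. y < f k"
      using eventually_ge_at_top[of "max m 1"]
    proof eventually_elim
      case (elim k)
      have "p * (c * r ^ k) \<le> p * xc m k" using c(2)[of k] elim m p by simp
      then have "ln (p * (c * r ^ k)) \<le> ln (p * xc m k)"
        using p c(1) r(1) by (intro ln_mono) auto
      also have "p * (c * r ^ k) = p * c * r ^ k" by simp
      also have "ln \<dots> = ln (p * c) + real k * ln r"
        using p c(1) r(1) by (subst ln_mult_pos; simp add: ln_realpow)
      finally have "(ln (p * c) + real k * ln r) / real k \<le> f k"
        unfolding f_def by (intro divide_right_mono) auto
      moreover have "(ln (p * c) + real k * ln r) / real k = ln (p * c) / real k + ln r"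
        using elim by (simp add: field_simps)
      ultimately show ?case using elim by linarith
    qed
  qed
  define \<epsilon> where "\<epsilon> k = f k / ln ?a - 1" for k
  have "\<epsilon> \<longlonglongrightarrow> ln ?a / ln ?a - 1" unfolding \<epsilon>_def by (intro tendsto_intros lim) (use la in auto)
  then have "\<epsilon> \<longlonglongrightarrow> 0" using la by simp
  moreover have "\<forall>\<^sub>F k in sequentially. p * xc m k = ?a powr (real k * (1 + \<epsilon> k))"
    using eventually_gt_at_top[of 0]
  proof eventually_elim
    case (elim k)
    have "?a powr (real k * (1 + \<epsilon> k)) = exp (ln (p * xc m k))"
      using a0 la elim lam L by (simp add: powr_def \<epsilon>_def f_def)
    then show ?case using p xc_pos[OF m, of k] by simp
  qed
  ultimately show ?thesis by blast
qed

end

section \<open>Power-law asymptotics of the coefficients in the supercritical regime\<close>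

lemma power_diff_bound:
  fixes a b z :: real
  assumes "0 \<le> a" "a \<le> z" "0 \<le> b" "b \<le> z"
  shows "\<bar>a ^ n - b ^ n\<bar> \<le> real n * \<bar>a - b\<bar> * z ^ (n - 1)"
proof (induction n)
  case (Suc n)
  have z: "0 \<le> z" using assms by simp
  have "a ^ Suc n - b ^ Suc n = a * (a ^ n - b ^ n) + (a - b) * b ^ n" by (simp add: algebra_simps)
  then have "\<bar>a ^ Suc n - b ^ Suc n\<bar> \<le> a * \<bar>a ^ n - b ^ n\<bar> + \<bar>a - b\<bar> * b ^ n"
    using abs_triangle_ineq[of "a * (a ^ n - b ^ n)" "(a - b) * b ^ n"] assms by (simp add: abs_mult)
  also have "\<dots> \<le> z * (real n * \<bar>a - b\<bar> * z ^ (n - 1)) + \<bar>a - b\<bar> * z ^ n"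
    using assms z Suc by (intro add_mono mult_mono power_mono) auto
  also have "\<dots> = real (Suc n) * \<bar>a - b\<bar> * z ^ (Suc n - 1)"
    by (cases n) (auto simp: algebra_simps)
  finally show ?case .
qed simp

lemma powr_exp_tendsto_0:
  assumes "\<beta> > 0" "c > (0::real)"
  shows "((\<lambda>z::real. z powr a * exp (- c * z powr \<beta>)) \<longlongrightarrow> 0) at_top"
  using assms by real_asymp

text \<open>Profile of the integrals over birth times after rescaling: \<open>y = z powr \<beta>\<close>.\<close>

definition prof :: "real \<Rightarrow> real \<Rightarrow> nat \<Rightarrow> real \<Rightarrow> real" where
  "prof \<beta> c j z = (z powr \<beta>) ^ j * exp (- c * z powr \<beta>)"

lemma prof_nonneg: "0 \<le> prof \<beta> c j z" by (simp add: prof_def)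

lemma prof_integrable:
  assumes \<beta>: "\<beta> > 0" "c > 0" shows "prof \<beta> c j integrable_on {0..}" "0 \<le> a \<Longrightarrow> prof \<beta> c j integrable_on {a..b}"
proof -
  have [measurable]: "prof \<beta> c j \<in> borel_measurable borel" unfolding prof_def[abs_def] by measurable
  have int: "prof \<beta> c j integrable_on {a..b}" if "0 \<le> a" for a b
  proof (rule integrable_on_bounded_borel)
    fix z assume "z \<in> {a..b}"
    then have "z powr \<beta> \<le> b powr \<beta>" using \<beta> that by (intro powr_mono2) auto
    then show "\<bar>prof \<beta> c j z\<bar> \<le> (b powr \<beta>) ^ j * 1" unfolding prof_def abs_mult
      using \<beta> by (intro mult_mono) (auto intro!: power_mono)
  qed simp
  have "((\<lambda>z::real. z powr (\<beta> * j + 2) * exp (- c * z powr \<beta>)) \<longlongrightarrow> 0) at_top"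
    by (rule powr_exp_tendsto_0) (use \<beta> in auto)
  then have "\<forall>\<^sub>F z in at_top. z powr (\<beta> * j + 2) * exp (- c * z powr \<beta>) < 1"
    by (rule order_tendstoD) simp
  then have "\<forall>\<^sub>F z in at_top. z powr (\<beta> * j + 2) * exp (- c * z powr \<beta>) < 1 \<and> z \<ge> 1"
    by (intro eventually_conj eventually_ge_at_top)
  then obtain Z where Z: "\<And>z. z \<ge> Z \<Longrightarrow> z powr (\<beta> * j + 2) * exp (- c * z powr \<beta>) < 1 \<and> z \<ge> 1"
    by (auto simp: eventually_at_top_linorder)
  have Z1: "Z \<ge> 1" using Z[of Z] by simp
  have "prof \<beta> c j integrable_on {Z..}"
  proof (rule measurable_bounded_by_integrable_imp_integrable[where g = "\<lambda>z. z powr (-2)"])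
    show "(\<lambda>z. z powr - 2) integrable_on {Z..}"
      using has_integral_powr_to_inf[of "-2" Z] Z1 by (auto simp: integrable_on_def)
    show "prof \<beta> c j \<in> borel_measurable (lebesgue_on {Z..})"
      by (intro measurable_restrict_space1 measurable_completion) simp
    fix z assume z: "z \<in> {Z..}"
    then have z1: "z \<ge> 1" using Z[of z] by simp
    have "prof \<beta> c j z = (z powr (\<beta> * j + 2) * exp (- c * z powr \<beta>)) * z powr (-2)"
    proof -
      have "(z powr \<beta>) ^ j = z powr (\<beta> * j)"
        using z1 powr_realpow[of "z powr \<beta>" j] by (simp add: powr_powr)
      also have "\<dots> = z powr (\<beta> * j + 2) * z powr (-2)"
        by (subst powr_add[symmetric]) simp
      finally show ?thesis by (simp add: prof_def)
    qed
    also have "\<dots> \<le> 1 * z powr (-2)" using Z[of z] z by (intro mult_right_mono) auto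
    finally show "norm (prof \<beta> c j z) \<le> z powr (-2)" using prof_nonneg[of \<beta> c j z] by simp
  qed auto
  moreover have "prof \<beta> c j integrable_on {0..Z}" by (rule int) simp
  moreover have "negligible ({0..Z} \<inter> {Z..})" by (rule negligible_subset[of "{Z}"]) auto
  ultimately have "prof \<beta> c j integrable_on ({0..Z} \<union> {Z..})"
    by (intro integrable_Un)
  moreover have "{0..Z} \<union> {Z..} = {0..}" using Z1 by auto
  ultimately show "prof \<beta> c j integrable_on {0..}" by simp
  show "0 \<le> a \<Longrightarrow> prof \<beta> c j integrable_on {a..b}" by (rule int)
qed

definition profI :: "real \<Rightarrow> real \<Rightarrow> nat \<Rightarrow> real" where
  "profI \<beta> c j = integral {0..} (prof \<beta> c j)"

lemma profI_pos: assumes "\<beta> > 0" "c > 0" shows "profI \<beta> c j > 0"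
proof -
  have "0 < integral {0..1} (prof \<beta> c j)"
    by (rule integral_pos_strict[OF integrable_integral[OF prof_integrable(2)]]) (use assms in \<open>auto simp: prof_def\<close>)
  also have "\<dots> \<le> profI \<beta> c j" unfolding profI_def
    by (rule integral_subset_le) (use assms prof_integrable prof_nonneg in auto)
  finally show ?thesis .
qed

text \<open>Substituting \<open>x = z / Z\<close> with \<open>Z = k powr (1 / \<beta>)\<close> turns
  the integral into the full profile integral cut off at \<open>Z\<close>. Beyond \<open>Z\<close>
  one has \<open>z powr \<beta> \<ge> k\<close>, so the tail is at most \<open>1 / k\<close> times
  the next profile integral; this is the gain of one power of \<open>k\<close>.\<close>

lemma prof_scaled:
  fixes \<beta> c :: real and j k :: nat
  assumes \<beta>: "\<beta> > 0" "c > 0" and k: "k \<ge> 1"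
  defines "I \<equiv> integral {0..1} (prof \<beta> (c * real k) j)"
  shows "I \<le> profI \<beta> c j * real k powr (- (1 / \<beta>) - j)"
    and "\<bar>I - profI \<beta> c j * real k powr (- (1 / \<beta>) - j)\<bar> \<le> profI \<beta> c (Suc j) * real k powr (- (1 / \<beta>) - j - 1)"
proof -
  let ?\<eta> = "1 / \<beta>"
  define Z where "Z = real k powr ?\<eta>"
  have Z: "Z > 0" "Z powr \<beta> = real k" using \<beta> k by (auto simp: Z_def powr_powr)
  define A where "A = integral {0..Z} (prof \<beta> c j)"
  have "(prof \<beta> c j has_integral A) {0..Z}"
    unfolding A_def by (intro integrable_integral prof_integrable \<beta>) simp
  from has_integral_stretch_real[OF this, of Z] Z
  have "((\<lambda>x. prof \<beta> c j (Z * x)) has_integral A / Z) {0..1}" by simp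
  from has_integral_mult_right[OF this, of "1 / real k ^ j"]
  have "((\<lambda>x. 1 / real k ^ j * prof \<beta> c j (Z * x)) has_integral 1 / real k ^ j * (A / Z)) {0..1}" .
  moreover have "1 / real k ^ j * prof \<beta> c j (Z * x) = prof \<beta> (c * real k) j x" if "x \<in> {0..1}" for x
    using that Z k by (simp add: prof_def powr_mult power_mult_distrib mult_ac)
  ultimately have "(prof \<beta> (c * real k) j has_integral 1 / real k ^ j * (A / Z)) {0..1}"
    by (rule has_integral_eq[rotated]) auto
  then have I: "I = A * real k powr (- ?\<eta> - j)"
    using k by (simp add: I_def integral_unique Z_def powr_diff powr_minus powr_realpow field_simps)
  define B where "B = integral {Z..} (prof \<beta> c j)"
  have iZ: "prof \<beta> c i integrable_on {Z..}" for i
    using set_integrable_subset[OF nonnegative_absolutely_integrable_1[OF prof_integrable(1)[OF \<beta>]], of i "{Z..}"]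
      Z prof_nonneg by (auto intro: set_lebesgue_integral_eq_integral(1))
  have "prof \<beta> c j integrable_on {0..Z}" by (intro prof_integrable \<beta>) simp
  then have "integral ({0..Z} \<union> {Z..}) (prof \<beta> c j) = A + B"
    unfolding A_def B_def by (intro integral_Un iZ negligible_subset[of "{Z}" "{0..Z} \<inter> {Z..}"]) auto
  moreover have "{0..Z} \<union> {Z..} = {0..}" using Z by auto
  ultimately have AB: "profI \<beta> c j = A + B" by (simp add: profI_def)
  have B0: "0 \<le> B" unfolding B_def by (intro integral_nonneg iZ prof_nonneg)
  have "B \<le> integral {Z..} (\<lambda>z. 1 / real k * prof \<beta> c (Suc j) z)"
    unfolding B_def
  proof (rule integral_le[OF iZ integrable_on_mult_right[OF iZ]])
    fix z assume z: "z \<in> {Z..}"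
    then have "real k \<le> z powr \<beta>" using Z powr_mono2[of \<beta> Z z] \<beta> by auto
    then have "prof \<beta> c j z * 1 \<le> prof \<beta> c j z * (z powr \<beta> / real k)"
      using k by (intro mult_left_mono prof_nonneg) auto
    then show "prof \<beta> c j z \<le> 1 / real k * prof \<beta> c (Suc j) z"
      by (simp add: prof_def mult_ac)
  qed
  also have "\<dots> = 1 / real k * integral {Z..} (prof \<beta> c (Suc j))" by simp
  also have "\<dots> \<le> 1 / real k * profI \<beta> c (Suc j)" unfolding profI_def
    by (intro mult_left_mono integral_subset_le iZ prof_integrable \<beta>) (use Z prof_nonneg in auto)
  finally have B: "B \<le> profI \<beta> c (Suc j) / real k" by simp
  show "I \<le> profI \<beta> c j * real k powr (- ?\<eta> - j)"
    unfolding I AB using B0 by (intro mult_right_mono) auto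
  have "\<bar>I - profI \<beta> c j * real k powr (- ?\<eta> - j)\<bar> = B * real k powr (- ?\<eta> - j)"
    unfolding I AB using B0 by (simp add: algebra_simps abs_mult)
  also have "\<dots> \<le> profI \<beta> c (Suc j) / real k * real k powr (- ?\<eta> - j)"
    using B by (intro mult_right_mono) auto
  also have "\<dots> = profI \<beta> c (Suc j) * real k powr (- ?\<eta> - j - 1)"
    using k by (simp add: powr_diff)
  finally show "\<bar>I - profI \<beta> c j * real k powr (- ?\<eta> - j)\<bar> \<le> \<dots>" .
qed

text \<open>Induction by \<open>(i + 1) * ((k - 1) choose (i + 1)) = (k - 1 - i) * ((k - 1) choose
  i)\<close>, where replacing \<open>k - 1 - i\<close> by \<open>k\<close> costs one order.\<close>

lemma binomial_asymp:
  "(\<lambda>k. real ((k - 1) choose i) - real k ^ i / fact i) \<in> O(\<lambda>k. real k powr (real i - 1))"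
proof (induction i)
  case (Suc i)
  define f where "f k = real ((k - 1) choose i)" for k
  define g where "g k = real k ^ i / fact i" for k :: nat
  have fg: "(\<lambda>k. f k - g k) \<in> O(\<lambda>k. real k powr (real i - 1))" using Suc by (simp add: f_def g_def)
  have "(\<lambda>k. (f k - g k) * real k) \<in> O(\<lambda>k. real k powr (real i - 1) * real k)"
    by (intro landau_o.big.mult fg) auto
  moreover have "(\<lambda>k. real k powr (real i - 1) * real k) \<in> O(\<lambda>k. real k powr real i)" by real_asymp
  ultimately have 1: "(\<lambda>k. (f k - g k) * real k) \<in> O(\<lambda>k. real k powr real i)"
    by (rule landau_o.big_trans)
  have "g \<in> O(\<lambda>k. real k powr real i)" 
    by (rule bigoI[of _ 1], rule eventually_mono[OF eventually_gt_at_top[of 0]])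
      (simp add: g_def powr_realpow divide_le_eq)
  moreover have "(\<lambda>k. real k powr (real i - 1)) \<in> O(\<lambda>k. real k powr real i)" by real_asymp
  with fg have "(\<lambda>k. f k - g k) \<in> O(\<lambda>k. real k powr real i)" by (rule landau_o.big_trans)
  ultimately have "(\<lambda>k. (f k - g k) + g k) \<in> O(\<lambda>k. real k powr real i)"
    using sum_in_bigo(1) by blast
  then have 2: "(\<lambda>k. f k * real (Suc i)) \<in> O(\<lambda>k. real k powr real i)" by (simp del: of_nat_Suc)
  have ev: "\<forall>\<^sub>F k in sequentially. real ((k - 1) choose (Suc i)) - real k ^ Suc i / fact (Suc i)
     = 1 / real (Suc i) * ((f k - g k) * real k - f k * real (Suc i))"
    using eventually_gt_at_top[of "Suc i"]
  proof eventually_elim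
    case (elim k)
    have "Suc i * ((k - 1) choose Suc i) = (k - 1 - i) * ((k - 1) choose i)"
      by (simp only: binomial_absorb_comp binomial_absorption)
    then have "real (Suc i) * real ((k - 1) choose Suc i) = (real k - real (Suc i)) * f k"
      unfolding of_nat_mult[symmetric] f_def using elim
      by (simp add: of_nat_diff del: of_nat_Suc flip: of_nat_mult) (simp add: of_nat_diff)
    moreover have "real k ^ Suc i / fact (Suc i) = g k * real k / real (Suc i)"
      by (simp add: g_def field_simps)
    ultimately show ?case by (simp add: field_simps)
  qed
  have "(\<lambda>k. 1 / real (Suc i) * ((f k - g k) * real k - f k * real (Suc i))) \<in> O(\<lambda>k. real k powr real i)"
    using sum_in_bigo(2)[OF 1 2] by (subst landau_o.big.cmult_in_iff) (auto simp del: of_nat_Suc)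
  then show ?case using landau_o.big.in_cong[OF ev] by simp
qed simp

lemma abs_power_diff_le:
  fixes u z :: real assumes "0 \<le> u" "u \<le> 1" "0 \<le> z" "z \<le> 1" shows "\<bar>u ^ n - z ^ n\<bar> \<le> real n * \<bar>u - z\<bar>"
  using power_diff_bound[of u 1 z n] assms by simp

text \<open>Four replacements are made one at a time: \<open>u\<close> by \<open>z\<close>, the
  power of \<open>v\<close> by that of \<open>y\<close>, \<open>1 - v\<close> by
  \<open>exp (- y)\<close>, and the exponent \<open>k - j\<close> by \<open>k\<close>. Each costs an
  extra factor \<open>y\<close> or \<open>k * y\<^sup>2\<close>, both of order \<open>1 / k\<close>
  after integration. The exponential carries only \<open>c * y\<close> because \<open>v\<close> is
  bounded below by \<open>c * y\<close>.\<close>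

lemma geometric_term_bound:
  fixes u z v y c c1 Y0 :: real and a j k :: nat
  assumes y: "0 \<le> y" "y \<le> Y0" and v: "c * y \<le> v" "v \<le> c1 * y" "v \<le> 1" "0 \<le> v" "\<bar>v - y\<bar> \<le> c1 * y\<^sup>2"
    and u: "0 \<le> u" "u \<le> 1" "0 \<le> z" "z \<le> 1" "\<bar>u - z\<bar> \<le> c1 * y"
    and c: "0 < c" "c \<le> 1" "0 \<le> c1" and k: "j \<le> k" "1 \<le> j"
  defines "K \<equiv> ((real a + real j) * c1 * c1 ^ j + real j * c1 * (max 1 c1) ^ (j - 1) + (c1 + 1) + real j) * exp (c * (real j + 1) * Y0)"
  shows "\<bar>u ^ a * (1 - u) ^ j * (v ^ j * (1 - v) ^ (k - j)) - z ^ a * (1 - z) ^ j * (y ^ j * exp (- (real k * y)))\<bar>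
    \<le> K * (y ^ (j + 1) * exp (- (c * real k * y)) + real k * (y ^ (j + 2) * exp (- (c * real k * y))))"
proof -
  define n where "n = k - j"
  \<comment> \<open>The exponents \<open>k - j\<close> and \<open>k - j - 1\<close> fall short of
    \<open>k\<close>; \<open>G\<close> pays for the missing \<open>j + 1\<close> factors.\<close>
  define G where "G = exp (c * (real j + 1) * Y0)"
  define E0 where "E0 = exp (- (c * real k * y))"
  define q where "q = 1 - v"
  define e where "e = exp (- y)"
  define A where "A = u ^ a * (1 - u) ^ j"
  define A0 where "A0 = z ^ a * (1 - z) ^ j"
  have Y0: "0 \<le> Y0" using y by simp
  have G1: "1 \<le> G" using c Y0 by (simp add: G_def)
  have E0: "0 \<le> E0" by (simp add: E0_def)
  have q: "0 \<le> q" "q \<le> 1" "q \<le> exp (- c * y)"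
    using v exp_ge_add_one_self[of "- c * y"] by (auto simp: q_def)
  have e: "0 \<le> e" "e \<le> exp (- c * y)" "e \<le> 1" using c y by (auto simp: e_def intro: mult_left_le_one_le)
  have expG: "exp (- c * y) ^ i \<le> G * E0" if "real k \<le> real i + (real j + 1)" for i
  proof -
    have "exp (- c * y) ^ i = exp (- (c * y * real i))" by (simp add: exp_of_nat_mult[symmetric] mult_ac)
    also have "\<dots> = exp (c * y * (real k - real i)) * E0" by (simp add: E0_def exp_add[symmetric] algebra_simps)
    also have "\<dots> \<le> G * E0"
    proof -
      have "c * y * (real k - real i) \<le> c * y * (real j + 1)" using that c y by (intro mult_left_mono) auto
      also have "\<dots> \<le> c * Y0 * (real j + 1)" using y c by (intro mult_right_mono mult_left_mono) auto
      finally have "c * y * (real k - real i) \<le> c * (real j + 1) * Y0" by (simp add: mult_ac)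
      then show ?thesis unfolding G_def using E0 by (intro mult_right_mono) auto
    qed
    finally show ?thesis .
  qed
  have qn: "q ^ n \<le> G * E0" 
    using power_mono[OF q(3,1), of n] expG[of n] k by (simp add: n_def)
  have en: "e ^ n \<le> G * E0"
    using power_mono[OF e(2,1), of n] expG[of n] k by (simp add: n_def)
  have AA: "\<bar>A - A0\<bar> \<le> (real a + real j) * c1 * y"
  proof -
    have "A - A0 = (u ^ a - z ^ a) * (1 - u) ^ j + z ^ a * ((1 - u) ^ j - (1 - z) ^ j)"
      by (simp add: A_def A0_def algebra_simps)
    then have "\<bar>A - A0\<bar> \<le> \<bar>u ^ a - z ^ a\<bar> * (1 - u) ^ j + z ^ a * \<bar>(1 - u) ^ j - (1 - z) ^ j\<bar>"
      using abs_triangle_ineq[of "(u ^ a - z ^ a) * (1 - u) ^ j" "z ^ a * ((1 - u) ^ j - (1 - z) ^ j)"] u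
      by (simp add: abs_mult)
    also have "\<dots> \<le> (real a * \<bar>u - z\<bar>) * 1 + 1 * (real j * \<bar>(1 - u) - (1 - z)\<bar>)"
      using u by (intro add_mono mult_mono abs_power_diff_le power_le_one) auto
    also have "\<dots> = (real a + real j) * \<bar>u - z\<bar>" by (simp add: algebra_simps abs_minus_commute)
    also have "\<dots> \<le> (real a + real j) * (c1 * y)" using u by (intro mult_left_mono) auto
    finally show ?thesis by simp
  qed
  have A0: "0 \<le> A0" "A0 \<le> 1" using u by (auto simp: A0_def intro!: mult_le_one power_le_one)
  have vj: "v ^ j \<le> c1 ^ j * y ^ j" using v power_mono[of v "c1 * y" j] by (simp add: power_mult_distrib)
  have t1: "\<bar>(A - A0) * (v ^ j * q ^ n)\<bar> \<le> (real a + real j) * c1 * c1 ^ j * G * (y ^ (j + 1) * E0)"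
  proof -
    have "\<bar>(A - A0) * (v ^ j * q ^ n)\<bar> = \<bar>A - A0\<bar> * (v ^ j * q ^ n)" using v q by (simp add: abs_mult)
    also have "\<dots> \<le> ((real a + real j) * c1 * y) * ((c1 ^ j * y ^ j) * (G * E0))"
      using AA vj qn v q c y by (intro mult_mono) auto
    finally show ?thesis by (simp add: mult_ac)
  qed
  have t2: "\<bar>A0 * ((v ^ j - y ^ j) * q ^ n)\<bar> \<le> real j * c1 * (max 1 c1) ^ (j - 1) * G * (y ^ (j + 1) * E0)"
  proof -
    let ?c2 = "max 1 c1"
    have "y \<le> ?c2 * y" "c1 * y \<le> ?c2 * y" using y mult_right_mono[of 1 ?c2 y] mult_right_mono[of c1 ?c2 y] by auto
    then have "\<bar>v ^ j - y ^ j\<bar> \<le> real j * \<bar>v - y\<bar> * (?c2 * y) ^ (j - 1)"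
      using v y by (intro power_diff_bound) auto
    also have "\<dots> \<le> real j * (c1 * y\<^sup>2) * (?c2 * y) ^ (j - 1)"
      using v y by (intro mult_right_mono mult_left_mono) auto
    also have "\<dots> = real j * c1 * ?c2 ^ (j - 1) * (y\<^sup>2 * y ^ (j - 1))" by (simp add: power_mult_distrib)
    also have "y\<^sup>2 * y ^ (j - 1) = y ^ (j + 1)" using k by (simp add: power_add[symmetric])
    finally have d: "\<bar>v ^ j - y ^ j\<bar> \<le> real j * c1 * ?c2 ^ (j - 1) * y ^ (j + 1)" .
    have "\<bar>A0 * ((v ^ j - y ^ j) * q ^ n)\<bar> = A0 * (\<bar>v ^ j - y ^ j\<bar> * q ^ n)" using A0 q by (simp add: abs_mult)
    also have "\<dots> \<le> 1 * ((real j * c1 * ?c2 ^ (j - 1) * y ^ (j + 1)) * (G * E0))"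
      using A0 d qn q y c by (intro mult_mono) auto
    finally show ?thesis by (simp add: mult_ac)
  qed
  have qe: "\<bar>q - e\<bar> \<le> (c1 + 1) * y\<^sup>2"
  proof -
    have e1: "1 - y \<le> e" using exp_ge_add_one_self[of "- y"] by (simp add: e_def)
    have e2: "e \<le> 1 - y + y\<^sup>2"
    proof -
      have "1 + y \<le> exp y" by (rule exp_ge_add_one_self)
      then have "e \<le> 1 / (1 + y)" using y by (simp add: e_def exp_minus inverse_eq_divide divide_left_mono mult_pos_pos)
      also have "\<dots> \<le> 1 - y + y\<^sup>2"
        using y by (simp add: divide_le_eq) (simp add: algebra_simps power2_eq_square power3_eq_cube)
      finally show ?thesis .
    qed
    have "q - e = (y - v) + (1 - y - e)" by (simp add: q_def)
    then have "\<bar>q - e\<bar> \<le> \<bar>v - y\<bar> + y\<^sup>2" using e1 e2 by linarith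
    then show ?thesis using v by (simp add: algebra_simps)
  qed
  have t3: "\<bar>A0 * (y ^ j * (q ^ n - e ^ n))\<bar> \<le> (c1 + 1) * G * (real k * (y ^ (j + 2) * E0))"
  proof -
    have "\<bar>q ^ n - e ^ n\<bar> \<le> real n * \<bar>q - e\<bar> * exp (- c * y) ^ (n - 1)"
      using q e by (intro power_diff_bound) auto
    also have "\<dots> \<le> real k * ((c1 + 1) * y\<^sup>2) * (G * E0)"
      using qe expG[of "n - 1"] c y k by (intro mult_mono) (auto simp: n_def)
    finally have d: "\<bar>q ^ n - e ^ n\<bar> \<le> real k * ((c1 + 1) * y\<^sup>2) * (G * E0)" .
    have "\<bar>A0 * (y ^ j * (q ^ n - e ^ n))\<bar> = A0 * (y ^ j * \<bar>q ^ n - e ^ n\<bar>)" using A0 y by (simp add: abs_mult)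
    also have "\<dots> \<le> 1 * (y ^ j * (real k * ((c1 + 1) * y\<^sup>2) * (G * E0)))"
      using A0 d y by (intro mult_mono) auto
    finally show ?thesis by (simp add: mult_ac power_add power2_eq_square)
  qed
  have t4: "\<bar>A0 * (y ^ j * (e ^ n - exp (- (real k * y))))\<bar> \<le> real j * G * (y ^ (j + 1) * E0)"
  proof -
    have "exp (- (real k * y)) = e ^ n * exp (- (real j * y))"
      using k by (simp add: e_def n_def exp_of_nat_mult[symmetric] exp_add[symmetric] of_nat_diff algebra_simps)
    then have "e ^ n - exp (- (real k * y)) = e ^ n * (1 - exp (- (real j * y)))" by (simp add: algebra_simps)
    moreover have "0 \<le> 1 - exp (- (real j * y))" "1 - exp (- (real j * y)) \<le> real j * y"
      using y exp_ge_add_one_self[of "- (real j * y)"] by auto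
    moreover from this have "e ^ n * (1 - exp (- (real j * y))) \<le> (G * E0) * (real j * y)"
      using en e G1 E0 by (intro mult_mono) auto
    ultimately have "\<bar>e ^ n - exp (- (real k * y))\<bar> \<le> (G * E0) * (real j * y)"
      using e by (simp add: abs_mult)
    then have "A0 * (y ^ j * \<bar>e ^ n - exp (- (real k * y))\<bar>) \<le> 1 * (y ^ j * ((G * E0) * (real j * y)))"
      using A0 y by (intro mult_mono) auto
    then show ?thesis using A0 y by (simp add: abs_mult mult_ac)
  qed
  have dec: "A * (v ^ j * q ^ n) - A0 * (y ^ j * exp (- (real k * y))) =
     (A - A0) * (v ^ j * q ^ n) + A0 * ((v ^ j - y ^ j) * q ^ n) + A0 * (y ^ j * (q ^ n - e ^ n))
      + A0 * (y ^ j * (e ^ n - exp (- (real k * y))))"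
    by (simp add: algebra_simps)
  have abs4: "\<bar>a + b + c + d\<bar> \<le> \<bar>a\<bar> + \<bar>b\<bar> + \<bar>c\<bar> + \<bar>d\<bar>" for a b c d :: real by linarith
  have "\<bar>A * (v ^ j * q ^ n) - A0 * (y ^ j * exp (- (real k * y)))\<bar> \<le>
     (real a + real j) * c1 * c1 ^ j * G * (y ^ (j + 1) * E0) + real j * c1 * (max 1 c1) ^ (j - 1) * G * (y ^ (j + 1) * E0)
     + (c1 + 1) * G * (real k * (y ^ (j + 2) * E0)) + real j * G * (y ^ (j + 1) * E0)"
    unfolding dec by (rule order_trans[OF abs4 add_mono[OF add_mono[OF add_mono[OF t1 t2] t3] t4]])
  also have "\<dots> \<le> K * (y ^ (j + 1) * E0 + real k * (y ^ (j + 2) * E0))"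
  proof -
    define X1 X2 where "X1 = y ^ (j + 1) * E0" and "X2 = real k * (y ^ (j + 2) * E0)"
    define k1 k2 k3 where "k1 = (real a + real j) * c1 * c1 ^ j" and "k2 = real j * c1 * (max 1 c1) ^ (j - 1)" and "k3 = c1 + 1"
    have pos: "0 \<le> X1" "0 \<le> X2" "0 \<le> k1" "0 \<le> k2" "0 \<le> k3" "0 \<le> G"
      using y E0 c G1 by (auto simp: X1_def X2_def k1_def k2_def k3_def)
    have "k1 * G * X1 + k2 * G * X1 + k3 * G * X2 + real j * G * X1
       + (k3 * G * X1 + (k1 + k2 + real j) * G * X2) = (k1 + k2 + k3 + real j) * G * (X1 + X2)"
      by (simp add: algebra_simps)
    moreover have "0 \<le> k3 * G * X1 + (k1 + k2 + real j) * G * X2" using pos by simp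
    ultimately show ?thesis unfolding K_def G_def[symmetric] X1_def[symmetric] X2_def[symmetric] k1_def[symmetric] k2_def[symmetric] k3_def[symmetric]
      by linarith
  qed
  finally show ?thesis by (simp add: A_def A0_def q_def n_def E0_def)
qed

context delay begin

text \<open>With \<open>1 / y = C * exp (\<beta> t)\<close> the bounded error of \<open>W\<close>
  says that \<open>1 / W t\<close> and \<open>y\<close> have reciprocals at bounded distance. All
  the estimates, including the one for \<open>uu\<close>, are consequences of this, with constants
  depending only on that distance and on \<open>C\<close>.\<close>

lemma W_supercritical_pointwise:
  assumes \<beta>: "\<beta> = lam * (1 - exp (- \<beta> * L))" "\<beta> > 0" and small: "lam * L * exp (- \<beta> * L) < 1"
  obtains C c c1 where "C > 0" "0 < c" "c \<le> 1" "0 \<le> c1"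
    "\<And>t y. 0 \<le> t \<Longrightarrow> y = exp (- \<beta> * t) / C \<Longrightarrow> c * y \<le> 1 / W t \<and> 1 / W t \<le> c1 * y \<and>
      \<bar>1 / W t - y\<bar> \<le> c1 * y\<^sup>2 \<and> \<bar>uu t - exp (- \<beta> * L)\<bar> \<le> c1 * y"
proof -
  obtain C M where C: "C > 0" and M: "\<And>t. t \<ge> - L \<Longrightarrow> \<bar>W t - C * exp (\<beta> * t)\<bar> < M"
    using W_supercritical[OF assms] by blast
  have M0: "M > 0" using M[of 0] L by simp
  define c where "c = 1 / (1 + M / C)"
  define c1 where "c1 = 2 * M * (1 + M) + (1 + M)"
  have bound: "c * y \<le> 1 / W t \<and> 1 / W t \<le> c1 * y \<and>
      \<bar>1 / W t - y\<bar> \<le> c1 * y\<^sup>2 \<and> \<bar>uu t - exp (- \<beta> * L)\<bar> \<le> c1 * y"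
    if t: "0 \<le> t" and y: "y = exp (- \<beta> * t) / C" for t y
  proof -
    define v where "v = 1 / W t"
    have W1: "W t \<ge> 1" using W_ge_1[OF t] .
    have v: "0 < v" "v \<le> 1" "W t = 1 / v" using W1 by (auto simp: v_def)
    have y0: "0 < y" using C y by simp
    have yC: "1 / y = C * exp (\<beta> * t)" using C by (simp add: y exp_minus field_simps)
    have E: "\<bar>1 / v - 1 / y\<bar> < M" using M[of t] t L v(3) yC by simp
    have y1: "y \<le> 1 / C" using C \<beta> t by (simp add: y divide_right_mono)
    have "1 / v \<le> 1 / y + M" using E by linarith
    also have "\<dots> \<le> 1 / y + M / C * (1 / y)"
    proof -
      have "C \<le> 1 / y" using y1 y0 C by (simp add: field_simps)
      then have "M / C * C \<le> M / C * (1 / y)" using M0 C by (intro mult_left_mono) auto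
      then show ?thesis using C by simp
    qed
    also have "\<dots> = 1 / (c * y)" by (simp add: c_def add_divide_distrib)
    finally have cv0: "1 / v \<le> 1 / (c * y)" .
    have cv: "c * y \<le> v"
    proof -
      have "0 < c * y" using y0 C M0 by (simp add: c_def add_pos_nonneg)
      then show ?thesis using cv0 le_imp_inverse_le[of "1 / v" "1 / (c * y)"] v by simp
    qed
    have "1 / y \<le> 1 / v + M * 1" using E by linarith
    also have "\<dots> \<le> 1 / v + M * (1 / v)" using v M0 by (intro add_left_mono mult_left_mono) auto
    also have "\<dots> = (1 + M) / v" by (simp add: add_divide_distrib)
    finally have vc: "v \<le> (1 + M) * y" using v y0 by (simp add: field_simps)
    also have "\<dots> \<le> c1 * y" using y0 M0 by (intro mult_right_mono) (auto simp: c1_def)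
    finally have vc1: "v \<le> c1 * y" .
    have "v - y = v * y * (1 / y - 1 / v)" using v y0 by (simp add: field_simps)
    then have "\<bar>v - y\<bar> = v * y * \<bar>1 / v - 1 / y\<bar>" using v y0 by (simp add: abs_mult abs_minus_commute)
    also have "\<dots> \<le> ((1 + M) * y) * y * M" using E vc v y0 by (intro mult_mono) auto
    also have "\<dots> = (M * (1 + M)) * y\<^sup>2" by (simp add: power2_eq_square mult_ac)
    also have "\<dots> \<le> c1 * y\<^sup>2" using M0 by (intro mult_right_mono) (auto simp: c1_def add_nonneg_nonneg)
    finally have vy: "\<bar>v - y\<bar> \<le> c1 * y\<^sup>2" .
    have "W (t - L) - exp (- \<beta> * L) * W t = (W (t - L) - C * exp (\<beta> * (t - L)))
        - exp (- \<beta> * L) * (W t - C * exp (\<beta> * t))"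
      by (simp add: algebra_simps exp_diff exp_minus divide_inverse)
    also have "\<bar>\<dots>\<bar> \<le> \<bar>W (t - L) - C * exp (\<beta> * (t - L))\<bar> + \<bar>exp (- \<beta> * L) * (W t - C * exp (\<beta> * t))\<bar>"
      by (rule abs_triangle_ineq4)
    also have "\<dots> \<le> M + 1 * M"
      unfolding abs_mult using M[of "t - L"] M[of t] t L \<beta> by (intro add_mono mult_mono) auto
    finally have "\<bar>W (t - L) - exp (- \<beta> * L) * W t\<bar> \<le> 2 * M" by simp
    moreover have "uu t - exp (- \<beta> * L) = (W (t - L) - exp (- \<beta> * L) * W t) * v"
      using W1 by (simp add: uu_def v_def field_simps)
    ultimately have "\<bar>uu t - exp (- \<beta> * L)\<bar> = \<bar>W (t - L) - exp (- \<beta> * L) * W t\<bar> * v"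
      using v(1) by (simp add: abs_mult)
    also have "\<dots> \<le> 2 * M * ((1 + M) * y)"
      by (rule mult_mono) (use \<open>_ \<le> 2 * M\<close> vc M0 v(1) in auto)
    also have "\<dots> = 2 * M * (1 + M) * y" by simp
    also have "\<dots> \<le> c1 * y" using y0 M0 by (intro mult_right_mono) (auto simp: c1_def)
    finally show ?thesis using cv vc1 vy by (simp add: v_def)
  qed
  show ?thesis
    by (rule that[of C c c1]) (use C M0 bound in \<open>auto simp: c_def c1_def field_simps\<close>)
qed

text \<open>Each number \<open>j \<ge> 1\<close> of surviving lines contributes at the same order:
  the integral behaves like \<open>k powr (- 1 / \<beta> - j)\<close>, the binomial coefficient like
  \<open>k ^ (j - 1)\<close>. The leading constant is therefore a sum over \<open>j\<close>,
  positive term by term.\<close>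

lemma xc_supercritical:
  assumes \<beta>: "\<beta> = lam * (1 - exp (- \<beta> * L))" "\<beta> > 0" and small: "lam * L * exp (- \<beta> * L) < 1"
    and m: "1 \<le> m"
  obtains a where "a > 0"
    "(\<lambda>k. xc m k - a * real k powr (- (1 / \<beta>) - 1)) \<in> O(\<lambda>k. real k powr (- (1 / \<beta>) - 2))"
proof -
  obtain C c c1 where C: "C > 0" and c: "0 < c" "c \<le> 1" "0 \<le> c1" and
    pw: "\<And>t y. 0 \<le> t \<Longrightarrow> y = exp (- \<beta> * t) / C \<Longrightarrow> c * y \<le> 1 / W t \<and> 1 / W t \<le> c1 * y \<and>
      \<bar>1 / W t - y\<bar> \<le> c1 * y\<^sup>2 \<and> \<bar>uu t - exp (- \<beta> * L)\<bar> \<le> c1 * y"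
    using W_supercritical_pointwise[OF \<beta> small] by blast
  define z where "z = exp (- \<beta> * L)"
  have z: "0 < z" "z < 1" using \<beta> L by (auto simp: z_def)
  define T where "T j k t = uu t ^ (m - j) * (1 - uu t) ^ j * ((1 / W t) ^ j * (1 - 1 / W t) ^ (k - j))" for j k t
  define TI where "TI j k = integral {0..1} (\<lambda>x. T j k (- ln x))" for j k
  define B where "B j = z ^ (m - j) * (1 - z) ^ j / C ^ j * profI \<beta> (1 / C) j" for j
  have Ti: "(\<lambda>x. T j k (- ln x)) integrable_on {0..1}" for j k
  proof (rule integrable_on_bounded_borel[where B = 1])
    show "(\<lambda>x. T j k (- ln x)) \<in> borel_measurable borel" unfolding T_def by measurable
    fix x :: real assume "x \<in> {0..1}"
    then have t: "0 \<le> - ln x" by (rule neg_ln_nonneg)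
    show "\<bar>T j k (- ln x)\<bar> \<le> 1"
      using uu_bounds[OF t] W_ge_1[OF t] by (auto simp: T_def abs_mult intro!: mult_le_one power_le_one)
  qed
  have TI: "(\<lambda>k. TI j k - B j * real k powr (- (1 / \<beta>) - j)) \<in> O(\<lambda>k. real k powr (- (1 / \<beta>) - j - 1))"
    if j: "1 \<le> j" "j \<le> m" for j
  proof -
    define K where "K = ((real (m - j) + real j) * c1 * c1 ^ j + real j * c1 * (max 1 c1) ^ (j - 1) + (c1 + 1) + real j) * exp (c * (real j + 1) * (1 / C))"
    have K0: "0 \<le> K" using c by (simp add: K_def)
    define b where "b = z ^ (m - j) * (1 - z) ^ j / C ^ j"
    have b0: "0 \<le> b" using z C by (simp add: b_def)
    define P1 where "P1 k = prof \<beta> (c / C * real k) (j + 1)" for k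
    define P2 where "P2 k = prof \<beta> (c / C * real k) (j + 2)" for k
    define P0 where "P0 k = prof \<beta> (1 / C * real k) j" for k
    define K1 where "K1 = K / C ^ (j + 1)"
    define K2 where "K2 = K / C ^ (j + 2)"
    have K12: "0 \<le> K1" "0 \<le> K2" using K0 C by (auto simp: K1_def K2_def)
    have Pi: "P0 k integrable_on {0..1}" "P1 k integrable_on {0..1}" "P2 k integrable_on {0..1}" if "1 \<le> k" for k
      unfolding P0_def P1_def P2_def using that c C \<beta> by (auto intro!: prof_integrable)
    have est: "\<bar>T j k (- ln x) - b * P0 k x\<bar> \<le> K1 * P1 k x + K2 * (real k * P2 k x)"
      if k: "j \<le> k" and x: "x \<in> {0<..1}" for k x
    proof -
      define t where "t = - ln x"
      have t: "0 \<le> t" using neg_ln_nonneg[of x] x by (simp add: t_def)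
      define y where "y = exp (- \<beta> * t) / C"
      have xy: "x powr \<beta> = C * y" using x C by (simp add: powr_def y_def t_def)
      have y: "0 \<le> y" "y \<le> 1 / C" using C \<beta> t by (auto simp: y_def divide_right_mono)
      have "\<bar>uu t ^ (m - j) * (1 - uu t) ^ j * ((1 / W t) ^ j * (1 - 1 / W t) ^ (k - j)) - z ^ (m - j) * (1 - z) ^ j * (y ^ j * exp (- (real k * y)))\<bar>
        \<le> K * (y ^ (j + 1) * exp (- (c * real k * y)) + real k * (y ^ (j + 2) * exp (- (c * real k * y))))"
        unfolding K_def
        by (rule geometric_term_bound) (use pw[OF t y_def] uu_bounds[OF t] W_ge_1[OF t] y z c k j in \<open>auto simp: z_def\<close>)
      moreover have "b * P0 k x = z ^ (m - j) * (1 - z) ^ j * (y ^ j * exp (- (real k * y)))"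
        using C by (simp add: b_def P0_def prof_def xy power_mult_distrib)
      moreover have "K1 * P1 k x = K * (y ^ (j + 1) * exp (- (c * real k * y)))"
        using C by (simp add: K1_def P1_def prof_def xy power_mult_distrib)
      moreover have "K2 * (real k * P2 k x) = K * (real k * (y ^ (j + 2) * exp (- (c * real k * y))))"
        using C by (simp add: K2_def P2_def prof_def xy power_mult_distrib)
      ultimately show ?thesis unfolding T_def t_def[symmetric] by (simp only: distrib_left)
    qed
    have I: "\<bar>TI j k - b * integral {0..1} (P0 k)\<bar> \<le> K1 * integral {0..1} (P1 k) + K2 * (real k * integral {0..1} (P2 k))"
      if k: "j \<le> k" for k
    proof -
      have k1: "1 \<le> k" using j k by simp
      define g where "g x = (if x = 0 then 0 else T j k (- ln x) - b * P0 k x)" for x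
      have "((\<lambda>x. T j k (- ln x) - b * P0 k x) has_integral TI j k - b * integral {0..1} (P0 k)) {0..1}"
        unfolding TI_def by (intro has_integral_diff has_integral_mult_right integrable_integral Ti Pi k1)
      then have g: "(g has_integral TI j k - b * integral {0..1} (P0 k)) {0..1}"
        by (rule has_integral_spike[of "{0}", rotated 2]) (auto simp: g_def)
      have h: "((\<lambda>x. K1 * P1 k x + K2 * (real k * P2 k x)) has_integral
         K1 * integral {0..1} (P1 k) + K2 * (real k * integral {0..1} (P2 k))) {0..1}"
        by (intro has_integral_add has_integral_mult_right integrable_integral Pi k1)
      have "norm (integral {0..1} g) \<le> integral {0..1} (\<lambda>x. K1 * P1 k x + K2 * (real k * P2 k x))"
      proof (rule integral_norm_bound_integral)
        fix x :: real assume "x \<in> {0..1}"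
        then show "norm (g x) \<le> K1 * P1 k x + K2 * (real k * P2 k x)"
          using est[OF k, of x] K12 prof_nonneg by (cases "x = 0") (auto simp: g_def P1_def P2_def)
      qed (use g h in auto)
      then show ?thesis using g h by (simp add: integral_unique)
    qed
    define K3 where "K3 = K1 * profI \<beta> (c / C) (j + 1) + K2 * profI \<beta> (c / C) (j + 2) + b * profI \<beta> (1 / C) (Suc j)"
    have "\<bar>TI j k - B j * real k powr (- (1 / \<beta>) - j)\<bar> \<le> K3 * real k powr (- (1 / \<beta>) - j - 1)" if k: "j \<le> k" for k
    proof -
      define X where "X = real k powr (- (1 / \<beta>) - j - 1)"
      have k1: "1 \<le> k" using j k by simp
      have e1: "real k powr (- (1 / \<beta>) - real (j + 1)) = X" by (simp add: X_def algebra_simps)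
      have e2: "real k * real k powr (- (1 / \<beta>) - real (j + 2)) = X"
      proof -
        have "real k * real k powr (- (1 / \<beta>) - real (j + 2)) = real k powr (1 + (- (1 / \<beta>) - real (j + 2)))"
          using k1 by (simp only: powr_add) simp
        also have "1 + (- (1 / \<beta>) - real (j + 2)) = - (1 / \<beta>) - j - 1" by simp
        finally show ?thesis by (simp only: X_def)
      qed
      have "integral {0..1} (P1 k) \<le> profI \<beta> (c / C) (j + 1) * X"
        unfolding P1_def e1[symmetric] by (rule prof_scaled(1)) (use \<beta> c C k1 in auto)
      then have 1: "K1 * integral {0..1} (P1 k) \<le> K1 * profI \<beta> (c / C) (j + 1) * X"
        using K12 by (simp add: mult.assoc mult_left_mono)
      have "integral {0..1} (P2 k) \<le> profI \<beta> (c / C) (j + 2) * real k powr (- (1 / \<beta>) - real (j + 2))"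
        unfolding P2_def by (rule prof_scaled(1)) (use \<beta> c C k1 in auto)
      then have "real k * integral {0..1} (P2 k) \<le> real k * (profI \<beta> (c / C) (j + 2) * real k powr (- (1 / \<beta>) - real (j + 2)))"
        by (rule mult_left_mono) simp
      also have "\<dots> = profI \<beta> (c / C) (j + 2) * X" unfolding e2[symmetric] by simp
      finally have 2: "K2 * (real k * integral {0..1} (P2 k)) \<le> K2 * profI \<beta> (c / C) (j + 2) * X"
        using K12 by (simp add: mult.assoc mult_left_mono)
      have "\<bar>integral {0..1} (P0 k) - profI \<beta> (1 / C) j * real k powr (- (1 / \<beta>) - j)\<bar> \<le> profI \<beta> (1 / C) (Suc j) * X"
        unfolding P0_def X_def by (rule prof_scaled(2)) (use \<beta> c C k1 in auto)
      have 3: "\<bar>b * integral {0..1} (P0 k) - B j * real k powr (- (1 / \<beta>) - j)\<bar> \<le> b * profI \<beta> (1 / C) (Suc j) * X"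
      proof -
        define A where "A = integral {0..1} (P0 k)"
        define A' where "A' = profI \<beta> (1 / C) j * real k powr (- (1 / \<beta>) - j)"
        have "\<bar>b * A - b * A'\<bar> = b * \<bar>A - A'\<bar>" using b0 by (simp add: right_diff_distrib[symmetric] abs_mult)
        moreover have "B j = b * profI \<beta> (1 / C) j" by (simp add: B_def b_def)
        ultimately show ?thesis
          using mult_left_mono[OF \<open>\<bar>integral {0..1} (P0 k) - _\<bar> \<le> _\<close> b0] by (simp add: A_def A'_def mult.assoc)
      qed
      show ?thesis unfolding X_def[symmetric] K3_def using I[OF k] 1 2 3 by (simp add: distrib_right)
    qed
    then show ?thesis
      by (intro bigoI[of _ K3] eventually_mono[OF eventually_ge_at_top[of j]]) auto
  qed
  define D where "D j = real (m choose j) * (B j / fact (j - 1))" for j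
  have xc_eq: "xc m k = (\<Sum>j=1..m. real (m choose j) * (real ((k - 1) choose (j - 1)) * TI j k))" if k: "m \<le> k" for k
  proof -
    have "cf m k t = (\<Sum>j=1..m. real (m choose j) * (real ((k - 1) choose (j - 1)) * T j k t))" for t
    proof -
      have "cf m k t = (\<Sum>j\<in>{1..m}. real (m choose j) * uu t ^ (m - j) * (1 - uu t) ^ j * (real (negbin j k) * (1 / W t) ^ j * qq t ^ (k - j)))"
        unfolding cf_def by (rule sum.mono_neutral_right) (use k m in \<open>auto simp: negbin_def not_le\<close>)
      also have "\<dots> = (\<Sum>j=1..m. real (m choose j) * (real ((k - 1) choose (j - 1)) * T j k t))"
        by (rule sum.cong) (use k in \<open>auto simp: negbin_def T_def qq_def mult_ac\<close>)
      finally show ?thesis .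
    qed
    then have "((\<lambda>x. cf m k (- ln x)) has_integral (\<Sum>j=1..m. real (m choose j) * (real ((k - 1) choose (j - 1)) * TI j k))) {0..1}"
      unfolding TI_def by (simp only:) (intro has_integral_sum has_integral_mult_right integrable_integral Ti finite_atLeastAtMost)
    then show ?thesis by (simp add: xc_def integral_unique)
  qed
  have summand: "(\<lambda>k. real (m choose j) * (real ((k - 1) choose (j - 1)) * TI j k) - D j * real k powr (- (1 / \<beta>) - 1))
     \<in> O(\<lambda>k. real k powr (- (1 / \<beta>) - 2))" if j: "1 \<le> j" "j \<le> m" for j
  proof -
    define i where "i = j - 1"
    have ji: "j = Suc i" using j by (simp add: i_def)
    define f where "f k = real ((k - 1) choose i)" for k
    define f0 where "f0 k = real k ^ i / fact i" for k :: nat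
    define g where "g k = TI j k" for k
    define g0 where "g0 k = B j * real k powr (- (1 / \<beta>) - j)" for k :: nat
    have ff: "(\<lambda>k. f k - f0 k) \<in> O(\<lambda>k. real k powr (real i - 1))" unfolding f_def f0_def by (rule binomial_asymp)
    have gg: "(\<lambda>k. g k - g0 k) \<in> O(\<lambda>k. real k powr (- (1 / \<beta>) - j - 1))" unfolding g_def g0_def by (rule TI[OF j])
    have f0: "f0 \<in> O(\<lambda>k. real k powr real i)"
      by (rule bigoI[of _ 1], rule eventually_mono[OF eventually_gt_at_top[of 0]])
        (simp add: f0_def powr_realpow divide_le_eq)
    have g0: "g0 \<in> O(\<lambda>k. real k powr (- (1 / \<beta>) - j))" unfolding g0_def by simp
    have "(\<lambda>k. real k powr (- (1 / \<beta>) - j - 1)) \<in> O(\<lambda>k. real k powr (- (1 / \<beta>) - j))" by real_asymp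
    with gg have "(\<lambda>k. g k - g0 k) \<in> O(\<lambda>k. real k powr (- (1 / \<beta>) - j))" by (rule landau_o.big_trans)
    from sum_in_bigo(1)[OF this g0] have g: "g \<in> O(\<lambda>k. real k powr (- (1 / \<beta>) - j))" by simp
    have "(\<lambda>k. (f k - f0 k) * g k) \<in> O(\<lambda>k. real k powr (real i - 1) * real k powr (- (1 / \<beta>) - j))"
      by (rule landau_o.big.mult[OF ff g])
    moreover have "(\<lambda>k. f0 k * (g k - g0 k)) \<in> O(\<lambda>k. real k powr real i * real k powr (- (1 / \<beta>) - j - 1))"
      by (rule landau_o.big.mult[OF f0 gg])
    moreover have "real k powr (real i - 1) * real k powr (- (1 / \<beta>) - j) = real k powr (- (1 / \<beta>) - 2)"
      "real k powr real i * real k powr (- (1 / \<beta>) - j - 1) = real k powr (- (1 / \<beta>) - 2)" for k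
      unfolding powr_add[symmetric] by (rule arg_cong[of _ _ "(powr) (real k)"], simp add: ji)+
    ultimately have "(\<lambda>k. (f k - f0 k) * g k + f0 k * (g k - g0 k)) \<in> O(\<lambda>k. real k powr (- (1 / \<beta>) - 2))"
      by (intro sum_in_bigo) simp_all
    then have "(\<lambda>k. real (m choose j) * (f k * g k - f0 k * g0 k)) \<in> O(\<lambda>k. real k powr (- (1 / \<beta>) - 2))"
      using j by (subst landau_o.big.cmult_in_iff) (auto simp: algebra_simps)
    moreover have "\<forall>\<^sub>F k in sequentially. real (m choose j) * (f k * g k - f0 k * g0 k) =
       real (m choose j) * (real ((k - 1) choose (j - 1)) * TI j k) - D j * real k powr (- (1 / \<beta>) - 1)"
      using eventually_gt_at_top[of 0]
    proof eventually_elim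
      case (elim k)
      have "real k ^ i * real k powr (- (1 / \<beta>) - j) = real k powr (- (1 / \<beta>) - 1)"
        using elim unfolding powr_realpow[OF elim[folded of_nat_0_less_iff[where 'a = real]], symmetric] powr_add[symmetric]
        by (intro arg_cong[of _ _ "(powr) (real k)"]) (simp add: ji)
      then have "f0 k * g0 k = B j / fact i * real k powr (- (1 / \<beta>) - 1)"
        by (simp add: f0_def g0_def)
      then show ?case by (simp add: f_def g_def D_def i_def right_diff_distrib)
    qed
    ultimately show ?thesis by (subst (asm) landau_o.big.in_cong)
  qed
  have "(\<lambda>k. \<Sum>j=1..m. (real (m choose j) * (real ((k - 1) choose (j - 1)) * TI j k) - D j * real k powr (- (1 / \<beta>) - 1)))
     \<in> O(\<lambda>k. real k powr (- (1 / \<beta>) - 2))"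
    by (rule big_sum_in_bigo) (use summand in auto)
  moreover have "\<forall>\<^sub>F k in sequentially. (\<Sum>j=1..m. (real (m choose j) * (real ((k - 1) choose (j - 1)) * TI j k) - D j * real k powr (- (1 / \<beta>) - 1)))
     = xc m k - (\<Sum>j=1..m. D j) * real k powr (- (1 / \<beta>) - 1)"
    using eventually_ge_at_top[of m]
    by eventually_elim (simp add: xc_eq sum_subtractf sum_distrib_right)
  ultimately have "(\<lambda>k. xc m k - (\<Sum>j=1..m. D j) * real k powr (- (1 / \<beta>) - 1)) \<in> O(\<lambda>k. real k powr (- (1 / \<beta>) - 2))"
    by (subst (asm) landau_o.big.in_cong)
  moreover have "0 < (\<Sum>j=1..m. D j)"
    by (rule sum_pos) (use m z C \<beta> profI_pos in \<open>auto simp: D_def B_def\<close>)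
  ultimately show ?thesis by (rule that[rotated])
qed

end

text \<open>The function \<open>ln z + \<alpha> (1 - z)\<close> increases up to \<open>1 / \<alpha> < 1\<close>, decreases afterwards, and vanishes at 1.\<close>

lemma zeta_props:
  assumes a: "alpha p > 1"
  shows "0 < zeta p" "zeta p < 1" "zeta p * exp (alpha p * (1 - zeta p)) = 1" "alpha p * zeta p < 1"
proof -
  define \<alpha> where "\<alpha> = alpha p"
  define f where "f z = ln z + \<alpha> * (1 - z)" for z :: real
  have \<alpha>: "\<alpha> > 1" using a by (simp add: \<alpha>_def)
  have deriv: "(f has_real_derivative 1 / z - \<alpha>) (at z)" if "z > 0" for z
    unfolding f_def using that by (auto intro!: derivative_eq_intros simp: divide_inverse)
  have inc: "f x < f y" if "0 < x" "x < y" "y \<le> 1 / \<alpha>" for x y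
  proof (rule DERIV_pos_imp_increasing_open[OF that(2)])
    fix z assume z: "x < z" "z < y"
    then have "z < 1 / \<alpha>" using that by simp
    then have "\<alpha> < 1 / z" using z that \<alpha> by (simp add: field_simps)
    then show "\<exists>d. (f has_real_derivative d) (at z) \<and> 0 < d" using deriv[of z] z that by (intro exI[of _ "1 / z - \<alpha>"]) auto
  qed (use that in \<open>auto simp: f_def intro!: continuous_intros\<close>)
  have dec: "f y < f x" if "1 / \<alpha> \<le> x" "x < y" for x y
  proof (rule DERIV_neg_imp_decreasing_open[OF that(2)])
    have x0: "0 < x" using that \<alpha> by (smt (verit) divide_pos_pos)
    fix z assume z: "x < z" "z < y"
    then have "1 / \<alpha> < z" using that by simp
    then have "1 / z < \<alpha>" using z x0 \<alpha> by (simp add: field_simps)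
    then show "\<exists>d. (f has_real_derivative d) (at z) \<and> d < 0" using deriv[of z] z x0 by (intro exI[of _ "1 / z - \<alpha>"]) auto
  next
    have x0: "0 < x" using that \<alpha> by (smt (verit) divide_pos_pos)
    show "continuous_on {x..y} f" unfolding f_def using x0 by (intro continuous_intros) auto
  qed
  have f1: "f 1 = 0" by (simp add: f_def)
  have a1: "1 / \<alpha> < 1" "0 < 1 / \<alpha>" using \<alpha> by auto
  have "0 < f (1 / \<alpha>)" using dec[of "1 / \<alpha>" 1] a1 f1 by simp
  \<comment> \<open>Left end for the intermediate value theorem; the value there is
    \<open>- \<alpha> * exp (- \<alpha>)\<close>.\<close>
  moreover have "f (exp (- \<alpha>)) \<le> 0" using \<alpha> by (simp add: f_def)
  moreover have "exp (- \<alpha>) \<le> 1 / \<alpha>"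
  proof -
    have "\<alpha> \<le> exp \<alpha>" using exp_ge_add_one_self[of \<alpha>] by linarith
    then show ?thesis using \<alpha> by (simp add: exp_minus inverse_eq_divide frac_le)
  qed
  ultimately have "\<exists>z\<ge>exp (- \<alpha>). z \<le> 1 / \<alpha> \<and> f z = 0"
    by (intro IVT') (auto simp: f_def intro!: continuous_intros)
  then obtain z0 where z0: "exp (- \<alpha>) \<le> z0" "z0 \<le> 1 / \<alpha>" "f z0 = 0" by blast
  have z0p: "0 < z0" using z0(1) by (meson exp_gt_zero less_le_trans)
  have z0l: "z0 < 1 / \<alpha>" using z0 \<open>0 < f (1 / \<alpha>)\<close> by (cases "z0 = 1 / \<alpha>") auto
  have iff: "z * exp (\<alpha> * (1 - z)) = 1 \<longleftrightarrow> f z = 0" if "0 < z" for z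
  proof -
    have "exp (f z) = z * exp (\<alpha> * (1 - z))" using that by (simp add: f_def exp_add)
    then show ?thesis by (metis exp_eq_one_iff)
  qed
  have zz: "zeta p = z0" unfolding zeta_def \<alpha>_def[symmetric]
  proof (rule the_equality)
    show "z0 \<noteq> 1 \<and> z0 * exp (\<alpha> * (1 - z0)) = 1" using z0 z0p z0l a1 iff by auto
    fix z assume z: "z \<noteq> 1 \<and> z * exp (\<alpha> * (1 - z)) = 1"
    then have zp: "0 < z" by (metis exp_gt_zero zero_less_mult_pos2 zero_less_one)
    with z iff have fz: "f z = 0" by blast
    show "z = z0"
    proof (cases "z \<le> 1 / \<alpha>")
      case True
      then show ?thesis using inc[of z z0] inc[of z0 z] fz z0 zp z0p by (cases z z0 rule: linorder_cases) auto
    next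
      case False
      then show ?thesis using dec[of z 1] dec[of 1 z] fz f1 z a1 by (cases z "1::real" rule: linorder_cases) auto
    qed
  qed
  have "z0 < 1" using z0l a1 by linarith
  then show "zeta p < 1" by (simp add: zz)
  show "0 < zeta p" using z0p by (simp add: zz)
  show "zeta p * exp (alpha p * (1 - zeta p)) = 1" using z0(3) iff[OF z0p] by (simp add: zz \<alpha>_def)
  show "alpha p * zeta p < 1" using z0l \<alpha> by (simp add: zz \<alpha>_def[symmetric] field_simps)
qed

section \<open>Half-edges and their birth times\<close>

text \<open>The invariant of both kinds of step. It admits \<open>oldest G = nverts G + 1\<close>,
  which is the extinct graph.\<close>

definition good_graph :: "nat \<Rightarrow> mgraph \<Rightarrow> bool" where
  "good_graph m G \<longleftrightarrow>
     (\<forall>e \<in># edges G. card e = 2 \<and> e \<subseteq> {1..nverts G}) \<and>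
     1 \<le> oldest G \<and> oldest G \<le> nverts G + 1 \<and>
     (\<forall>v \<in> {1..nverts G}. out_degree G v = (if oldest G \<le> v then m else 0))"

definition act :: "mgraph \<Rightarrow> nat" where "act G = nverts G + 1 - oldest G"

text \<open>The birth times of the half-edges at \<open>v\<close>: the edges created with vertex \<open>w\<close> are those with
  maximum \<open>w\<close>, and all of them disappear when \<open>w\<close> is processed as the oldest vertex.\<close>

definition births :: "mgraph \<Rightarrow> nat \<Rightarrow> nat multiset" where
  "births G v = image_mset Max (filter_mset (\<lambda>e. v \<in> e) (edges G))"

lemma size_births: "size (births G v) = degree G v"
  by (simp add: births_def degree_def)

lemma good_graph_class: "m \<ge> 1 \<Longrightarrow> G \<in> graph_class m \<Longrightarrow> good_graph m G"
  by (auto simp: graph_class_def good_graph_def)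

lemma sum_mset_fibres:
  assumes "finite A" "\<And>x. x \<in># M \<Longrightarrow> f x \<in> A"
  shows "(\<Sum>a\<in>A. \<Sum>x\<in>#filter_mset (\<lambda>x. f x = a) M. h x) = (\<Sum>x\<in>#M. h x :: 'b :: comm_monoid_add)"
  using assms(2)
proof (induction M)
  case (add x M)
  have "(\<Sum>a\<in>A. \<Sum>y\<in>#filter_mset (\<lambda>x. f x = a) (add_mset x M). h y)
     = (\<Sum>a\<in>A. (if f x = a then h x else 0) + (\<Sum>y\<in>#filter_mset (\<lambda>x. f x = a) M. h y))"
    by (rule sum.cong) auto
  also have "\<dots> = h x + (\<Sum>a\<in>A. \<Sum>y\<in>#filter_mset (\<lambda>x. f x = a) M. h y)"
    using add.prems assms(1) by (simp add: sum.distrib)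
  finally show ?case using add by simp
qed simp

lemma sum_mset_incidence:
  assumes "finite S"
  shows "(\<Sum>v\<in>S. \<Sum>e\<in>#filter_mset (\<lambda>e. v \<in> e) M. h e) = (\<Sum>e\<in>#M. real (card (e \<inter> S)) * h e)"
proof (induction M)
  case (add e M)
  have "(\<Sum>v\<in>S. \<Sum>y\<in>#filter_mset (\<lambda>e. v \<in> e) (add_mset e M). h y)
     = (\<Sum>v\<in>S. (if v \<in> e then h e else 0) + (\<Sum>y\<in>#filter_mset (\<lambda>e. v \<in> e) M. h y))"
    by (rule sum.cong) auto
  also have "\<dots> = real (card (e \<inter> S)) * h e + (\<Sum>v\<in>S. \<Sum>y\<in>#filter_mset (\<lambda>e. v \<in> e) M. h y)"
    using assms by (simp add: sum.distrib sum.If_cases Int_commute)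
  finally show ?case using add by simp
qed simp

context
  fixes m :: nat and G :: mgraph
  assumes good: "good_graph m G"
begin

lemma edge_card: "e \<in># edges G \<Longrightarrow> card e = 2"
  and edge_subset: "e \<in># edges G \<Longrightarrow> e \<subseteq> {1..nverts G}"
  using good by (auto simp: good_graph_def)

lemma edge_Max: assumes "e \<in># edges G" shows "Max e \<in> e" "Max e \<in> {1..nverts G}"
proof -
  have "finite e" "e \<noteq> {}" using edge_card[OF assms] by (auto intro: card_ge_0_finite)
  then show "Max e \<in> e" by simp
  then show "Max e \<in> {1..nverts G}" using edge_subset[OF assms] by auto
qed

lemma out_degree_eq: "v \<in> {1..nverts G} \<Longrightarrow> out_degree G v = (if oldest G \<le> v then m else 0)"
  using good by (auto simp: good_graph_def)

lemma edge_Max_ge: assumes "1 \<le> m" "e \<in># edges G" shows "oldest G \<le> Max e"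
proof (rule ccontr)
  assume "\<not> oldest G \<le> Max e"
  then have "out_degree G (Max e) = 0" using out_degree_eq edge_Max[OF assms(2)] by auto
  then show False using assms(2) by (auto simp: out_degree_def filter_mset_eq_conv)
qed

lemma sum_edges_by_Max:
  "(\<Sum>e\<in>#edges G. h (Max e)) = (\<Sum>w\<in>{oldest G..nverts G}. real m * h w)" for h :: "nat \<Rightarrow> real"
proof -
  have "(\<Sum>e\<in>#edges G. h (Max e)) = (\<Sum>w\<in>{1..nverts G}. \<Sum>e\<in>#filter_mset (\<lambda>e. Max e = w) (edges G). h (Max e))"
    by (rule sum_mset_fibres[symmetric]) (use edge_Max in auto)
  also have "\<dots> = (\<Sum>w\<in>{1..nverts G}. \<Sum>e\<in>#filter_mset (\<lambda>e. Max e = w) (edges G). h w)"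
    by (intro sum.cong refl arg_cong[of _ _ sum_mset] image_mset_cong) auto
  also have "\<dots> = (\<Sum>w\<in>{1..nverts G}. real (if oldest G \<le> w then m else 0) * h w)"
    by (intro sum.cong refl) (simp add: out_degree_eq[symmetric] out_degree_def)
  also have "\<dots> = (\<Sum>w\<in>{oldest G..nverts G}. real m * h w)"
    by (rule sum.mono_neutral_cong_right) (use good in \<open>auto simp: good_graph_def\<close>)
  finally show ?thesis .
qed

lemma size_edges: "size (edges G) = m * act G"
proof -
  have "real (size (edges G)) = (\<Sum>e\<in>#edges G. (\<lambda>_. 1) (Max e))" by simp
  also have "\<dots> = real (m * act G)" by (subst sum_edges_by_Max) (simp add: act_def)
  finally show ?thesis by (simp only: of_nat_eq_iff)
qed

text \<open>Handshake identity: both half-edges of an edge are born at its maximum, and each active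
  vertex is the maximum of exactly \<open>m\<close> edges.\<close>

lemma sum_births:
  "(\<Sum>v\<in>{1..nverts G}. \<Sum>b\<in>#births G v. h b) = 2 * (\<Sum>w\<in>{oldest G..nverts G}. real m * h w)" for h :: "nat \<Rightarrow> real"
proof -
  have "(\<Sum>v\<in>{1..nverts G}. \<Sum>b\<in>#births G v. h b) = (\<Sum>e\<in>#edges G. real (card (e \<inter> {1..nverts G})) * h (Max e))"
    using sum_mset_incidence[of "{1..nverts G}" "\<lambda>e. h (Max e)" "edges G"]
    by (simp add: births_def image_mset.compositionality comp_def)
  also have "\<dots> = (\<Sum>e\<in>#edges G. 2 * h (Max e))"
    by (intro arg_cong[of _ _ sum_mset] image_mset_cong) (use edge_card edge_subset in \<open>simp add: Int_absorb2\<close>)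
  also have "\<dots> = 2 * (\<Sum>e\<in>#edges G. h (Max e))" by (simp add: sum_mset_distrib_left)
  finally show ?thesis by (simp add: sum_edges_by_Max)
qed

lemma sum_degree: "(\<Sum>v\<in>{1..nverts G}. degree G v) = 2 * m * act G"
proof -
  have "real (\<Sum>v\<in>{1..nverts G}. degree G v) = (\<Sum>v\<in>{1..nverts G}. \<Sum>b\<in>#births G v. (\<lambda>_. 1) b)"
    by (simp add: size_births)
  also have "\<dots> = real (2 * m * act G)" by (subst sum_births) (simp add: act_def)
  finally show ?thesis by (simp only: of_nat_eq_iff)
qed

lemma degree_outside: "v \<notin> {1..nverts G} \<Longrightarrow> degree G v = 0"
  using edge_subset by (force simp: degree_def filter_mset_eq_conv)

lemma births_bounds: "1 \<le> m \<Longrightarrow> b \<in># births G v \<Longrightarrow> oldest G \<le> b \<and> b \<le> nverts G"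
  using edge_Max_ge edge_Max by (auto simp: births_def)

text \<open>Half of the total degree is carried by out-half-edges, of which every vertex has at most \<open>m\<close>.\<close>

lemma sum_degree_le:
  assumes S: "finite S" shows "(\<Sum>v\<in>S. degree G v) \<le> m * card S + m * act G"
proof -
  have "real (\<Sum>v\<in>S. degree G v) = (\<Sum>v\<in>S. \<Sum>e\<in>#filter_mset (\<lambda>e. v \<in> e) (edges G). 1)"
    by (simp add: degree_def)
  also have "\<dots> = (\<Sum>e\<in>#edges G. real (card (e \<inter> S)) * 1)" by (rule sum_mset_incidence[OF S])
  also have "\<dots> \<le> (\<Sum>e\<in>#edges G. of_bool (Max e \<in> S) + 1)"
  proof (rule sum_mset_mono)
    fix e assume e: "e \<in># edges G"
    have f: "finite e" using edge_card[OF e] by (auto intro: card_ge_0_finite)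
    have "card (e \<inter> S) \<le> card ({Max e} \<inter> S) + card (e - {Max e})"
      by (rule order_trans[OF card_mono card_Un_le]) (use f in auto)
    also have "card (e - {Max e}) = 1" using edge_card[OF e] edge_Max[OF e] f by simp
    finally show "real (card (e \<inter> S)) * 1 \<le> of_bool (Max e \<in> S) + 1"
      by (cases "Max e \<in> S") auto
  qed
  also have "\<dots> = (\<Sum>e\<in>#edges G. (\<lambda>w. of_bool (w \<in> S)) (Max e)) + real (m * act G)"
    by (simp add: sum_mset.distrib size_edges)
  also have "(\<Sum>e\<in>#edges G. (\<lambda>w. of_bool (w \<in> S)) (Max e)) = real m * real (card ({oldest G..nverts G} \<inter> S))"
    by (subst sum_edges_by_Max) (simp add: sum_distrib_left[symmetric] of_bool_def sum.If_cases Int_def)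
  also have "\<dots> \<le> real m * real (card S)" by (intro mult_left_mono) (auto intro!: card_mono S)
  finally have "real (\<Sum>v\<in>S. degree G v) \<le> real (m * card S + m * act G)" by simp
  then show ?thesis by (simp only: of_nat_le_iff)
qed

lemma edges_empty_iff: "1 \<le> m \<Longrightarrow> edges G = {#} \<longleftrightarrow> act G = 0"
  using size_edges by (metis mult_eq_0_iff not_one_le_zero size_eq_0_iff_empty)

end

lemma births_add_old:
  assumes "good_graph m G" "v \<in> {1..nverts G}" "set ws \<subseteq> {1..nverts G}"
  shows "births (add_vertex G ws) v = births G v + replicate_mset (count_list ws v) (nverts G + 1)"
proof -
  have M: "Max {nverts G + 1, w} = nverts G + 1" if "w \<in> set ws" for w using that assms(3) by (auto simp: max_def)
  have "image_mset Max (filter_mset (\<lambda>e. v \<in> e) (image_mset (\<lambda>w. {nverts G + 1, w}) (mset ws)))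
    = replicate_mset (count_list ws v) (nverts G + 1)"
    using M assms(2) by (induction ws) auto
  then show ?thesis by (simp add: births_def add_vertex_def)
qed

lemma births_add_new:
  assumes "good_graph m G" "set ws \<subseteq> {1..nverts G}"
  shows "births (add_vertex G ws) (nverts G + 1) = replicate_mset (length ws) (nverts G + 1)"
proof -
  have M: "Max {nverts G + 1, w} = nverts G + 1" if "w \<in> set ws" for w using that assms(2) by (auto simp: max_def)
  have "filter_mset (\<lambda>e. nverts G + 1 \<in> e) (edges G) = {#}"
    using edge_subset[OF assms(1)] by (force simp: filter_mset_eq_conv)
  moreover have "image_mset Max (image_mset (\<lambda>w. {nverts G + 1, w}) (mset ws)) = replicate_mset (length ws) (nverts G + 1)"
    using M by (induction ws) auto
  moreover have "filter_mset (\<lambda>e. nverts G + 1 \<in> e) (image_mset (\<lambda>w. {nverts G + 1, w}) (mset ws)) = image_mset (\<lambda>w. {nverts G + 1, w}) (mset ws)"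
    by (induction ws) auto
  ultimately show ?thesis by (simp add: births_def add_vertex_def)
qed

lemma births_delete: "births (delete_oldest G) v = filter_mset (\<lambda>b. b \<noteq> oldest G) (births G v)"
proof -
  have "image_mset Max (filter_mset (\<lambda>e. v \<in> e) (filter_mset (\<lambda>e. Max e \<noteq> k) M)) =
    filter_mset (\<lambda>b. b \<noteq> k) (image_mset Max (filter_mset (\<lambda>e. v \<in> e) M))" for k and M :: "nat set multiset"
    by (induction M) auto
  then show ?thesis by (simp add: births_def delete_oldest_def)
qed

lemma add_vertex_simps [simp]:
  "nverts (add_vertex G ws) = nverts G + 1" "oldest (add_vertex G ws) = oldest G"
  "nverts (delete_oldest G) = nverts G" "oldest (delete_oldest G) = oldest G + 1"
  by (simp_all add: add_vertex_def delete_oldest_def)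

lemma good_add_vertex:
  assumes g: "good_graph m G" and ws: "set ws \<subseteq> {1..nverts G}" "length ws = m"
  shows "good_graph m (add_vertex G ws)"
proof -
  have e: "edges (add_vertex G ws) = edges G + image_mset (\<lambda>w. {nverts G + 1, w}) (mset ws)"
    by (simp add: add_vertex_def)
  have M: "Max {nverts G + 1, w} = nverts G + 1" if "w \<in> set ws" for w using that ws by (auto simp: max_def)
  have o: "filter_mset (\<lambda>e. Max e = v) (image_mset (\<lambda>w. {nverts G + 1, w}) (mset ws)) =
     (if v = nverts G + 1 then image_mset (\<lambda>w. {nverts G + 1, w}) (mset ws) else {#})" for v
    using M by (induction ws) auto
  have z: "filter_mset (\<lambda>e. Max e = nverts G + 1) (edges G) = {#}"
    using edge_Max[OF g] by (force simp: filter_mset_eq_conv)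
  have "out_degree (add_vertex G ws) v = (if oldest G \<le> v then m else 0)" if v: "v \<in> {1..nverts G + 1}" for v
  proof (cases "v = nverts G + 1")
    case True
    then show ?thesis using g ws z o by (simp add: out_degree_def e good_graph_def)
  next
    case False
    then have "out_degree (add_vertex G ws) v = out_degree G v" using o by (simp add: out_degree_def e)
    then show ?thesis using out_degree_eq[OF g, of v] v False by auto
  qed
  moreover have "card ea = 2 \<and> ea \<subseteq> {1..nverts G + 1}" if "ea \<in># edges (add_vertex G ws)" for ea
    using that edge_card[OF g] edge_subset[OF g] ws by (fastforce simp: e card_insert_if)
  ultimately show ?thesis using g by (auto simp: good_graph_def)
qed

lemma good_delete_oldest:
  assumes g: "good_graph m G" and m: "1 \<le> m" and o: "oldest G \<le> nverts G"
  shows "good_graph m (delete_oldest G)"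
proof -
  have e: "edges (delete_oldest G) = filter_mset (\<lambda>e. Max e \<noteq> oldest G) (edges G)"
    by (simp add: delete_oldest_def)
  have "out_degree (delete_oldest G) v = (if v = oldest G then 0 else out_degree G v)" for v
    by (auto simp: out_degree_def e filter_filter_mset filter_mset_eq_conv intro!: arg_cong[of _ _ size] filter_mset_cong)
  then show ?thesis using g o by (auto simp: good_graph_def e)
qed

section \<open>Expectations over finitely supported distributions\<close>

abbreviation ex :: "'a pmf \<Rightarrow> ('a \<Rightarrow> real) \<Rightarrow> real" where
  "ex P f \<equiv> measure_pmf.expectation P f"

lemma ex_sum: "finite A \<Longrightarrow> set_pmf P \<subseteq> A \<Longrightarrow> ex P f = (\<Sum>x\<in>A. pmf P x * f x)"
  by (subst integral_measure_pmf[of A]) auto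
    
lemma ex_bind:
  assumes "finite (set_pmf P)" "\<And>x. x \<in> set_pmf P \<Longrightarrow> finite (set_pmf (K x))"
  shows "ex (bind_pmf P K) f = ex P (\<lambda>x. ex (K x) f)"
  using pmf_expectation_bind[OF assms(1,2) subset_refl, where h = f] by (simp add: ex_sum[OF assms(1) subset_refl])

lemma ex_mono:
  assumes "finite (set_pmf P)" "\<And>x. x \<in> set_pmf P \<Longrightarrow> f x \<le> g x" shows "ex P f \<le> ex P g"
  by (rule integral_mono_AE) (use assms in \<open>auto simp: integrable_measure_pmf_finite AE_measure_pmf_iff\<close>)

lemma ex_cong: "(\<And>x. x \<in> set_pmf P \<Longrightarrow> f x = g x) \<Longrightarrow> ex P f = ex P g"
  by (rule integral_cong_AE) (auto simp: AE_measure_pmf_iff)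

lemma ex_add: "finite (set_pmf P) \<Longrightarrow> ex P (\<lambda>x. f x + g x) = ex P f + ex P g"
  and ex_diff: "finite (set_pmf P) \<Longrightarrow> ex P (\<lambda>x. f x - g x) = ex P f - ex P g"
  by (auto simp: integrable_measure_pmf_finite)

lemma ex_setsum: "finite (set_pmf P) \<Longrightarrow> ex P (\<lambda>x. \<Sum>i\<in>I. f i x) = (\<Sum>i\<in>I. ex P (f i))"
  by (rule Bochner_Integration.integral_sum) (auto simp: integrable_measure_pmf_finite)

lemma ex_const [simp]: "ex P (\<lambda>_. c) = c" by simp

lemma ex_cmult: "ex P (\<lambda>x. c * f x) = c * ex P f" by simp

lemma ex_abs_le: "finite (set_pmf P) \<Longrightarrow> \<bar>ex P f\<bar> \<le> ex P (\<lambda>x. \<bar>f x\<bar>)"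
  by (rule integral_abs_bound)

lemma ex_nonneg: "finite (set_pmf P) \<Longrightarrow> (\<And>x. x \<in> set_pmf P \<Longrightarrow> 0 \<le> f x) \<Longrightarrow> 0 \<le> ex P f"
  using ex_mono[of P "\<lambda>_. 0" f] by simp

text \<open>Here \<open>a\<close> is the mass of a set, and \<open>y\<close> and \<open>x\<close>
  are the masses removed inside and outside it. After clearing denominators the difference of the
  two sides is \<open>(x + y) * (D - a - x)\<close>.\<close>

lemma cond_mass_bound:
  fixes a x y D :: real
  assumes "0 \<le> x" "0 \<le> y" "0 < D - x - y" "y \<le> a" "a + x \<le> D"
  shows "(a - y) / (D - x - y) \<le> a / D + x / D"
proof -
  have D: "0 < D" using assms by simp
  have "(a - y) * D \<le> (a + x) * (D - x - y)"
  proof -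
    have "(a + x) * (D - x - y) - (a - y) * D = (x + y) * (D - (a + x)) - 0 + 0 * x"
      by (simp add: algebra_simps)
    moreover have "0 \<le> (x + y) * (D - (a + x))" using assms by simp
    ultimately show ?thesis by simp
  qed
  then show ?thesis using D assms by (simp add: add_divide_distrib[symmetric] divide_simps mult.commute)
qed

section \<open>One step of the process\<close>

locale alive_graph =
  fixes m :: nat and G :: mgraph and repl :: bool
  assumes m: "1 \<le> m" and good: "good_graph m G" and act_pos: "0 < act G"
begin

definition V :: "nat set" where "V = {1..nverts G}"
definition D :: real where "D = 2 * real m * real (act G)"
definition q :: "nat \<Rightarrow> real" where "q v = real (degree G v) / D"
definition Q :: "nat set \<Rightarrow> real" where "Q S = (\<Sum>v\<in>S. q v)"
definition K :: "nat list \<Rightarrow> nat pmf" where "K ws = degree_biased G (candidates repl G ws)"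
definition kap :: "nat set \<Rightarrow> real" where "kap S = (\<Sum>v\<in>S. (q v)\<^sup>2)"

lemma finV [simp]: "finite V" by (simp add: V_def)

lemma D_pos: "0 < D" using m act_pos by (simp add: D_def)

lemma q_nonneg: "0 \<le> q v" using D_pos by (simp add: q_def)

lemma real_sum_degree: "real (\<Sum>v\<in>V. degree G v) = D"
  unfolding V_def sum_degree[OF good] D_def by simp

lemma Q_V: "Q V = 1"
proof -
  have "Q V = real (\<Sum>v\<in>V. degree G v) / D" by (simp add: Q_def q_def sum_divide_distrib)
  then show ?thesis using D_pos unfolding real_sum_degree by simp
qed

lemma Q_nonneg: "0 \<le> Q S" by (simp add: Q_def sum_nonneg q_nonneg)

lemma q_outside: "v \<notin> V \<Longrightarrow> q v = 0" using degree_outside[OF good] by (simp add: q_def V_def)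

text \<open>A draw is a draw from \<open>q\<close> conditioned to avoid the vertices already drawn, or an
  unconditioned one.\<close>

lemma pmf_K_cases:
  assumes ws: "set ws \<subseteq> V"
  obtains "\<And>v. pmf (K ws) v = q v"
  | "Q (set ws) < 1" "\<And>v. pmf (K ws) v = (if v \<in> set ws then 0 else q v / (1 - Q (set ws)))"
proof (cases "candidates repl G ws = {1..nverts G}")
  case True
  have "\<exists>u\<in>V. degree G u > 0"
  proof (rule ccontr)
    assume "\<not> ?thesis"
    then have "Q V = 0" by (simp add: Q_def q_def)
    then show False using Q_V by simp
  qed
  then obtain u where u: "u \<in> V" "degree G u > 0" by auto
  note s = real_sum_degree
  have "pmf (K ws) v = q v" for v
    unfolding K_def True V_def[symmetric] using pmf_degree_biased[OF finV u, of v] q_outside[of v] s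
    by (simp add: q_def)
  then show ?thesis by (rule that(1))
next
  case False
  define A where "A = {v \<in> {1..nverts G}. v \<notin> set ws \<and> degree G v > 0}"
  have cA: "candidates repl G ws = A" "A \<noteq> {}" using False by (auto simp: candidates_def A_def Let_def split: if_splits)
  then obtain u where u: "u \<in> A" by auto
  have fA: "finite A" by (simp add: A_def)
  have d: "degree G u > 0" using u by (simp add: A_def)
  have "(\<Sum>w\<in>V - set ws. degree G w) = (\<Sum>w\<in>A. degree G w)"
    by (rule sum.mono_neutral_right) (auto simp: A_def V_def)
  then have "real (\<Sum>w\<in>A. degree G w) / D = real (\<Sum>w\<in>V - set ws. degree G w) / D" by simp
  also have "\<dots> = Q (V - set ws)" by (simp add: Q_def q_def sum_divide_distrib)
  finally have "real (\<Sum>w\<in>A. degree G w) / D = Q (V - set ws)" .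
  also have "Q (V - set ws) = 1 - Q (set ws)"
    using sum_diff[OF finV ws, of q] Q_V by (simp add: Q_def)
  finally have s: "real (\<Sum>w\<in>A. degree G w) = D * (1 - Q (set ws))" using D_pos by (simp add: field_simps)
  have "0 < (\<Sum>w\<in>A. degree G w)" using u d fA by (intro sum_pos2[of A u]) auto
  then have "0 < real (\<Sum>w\<in>A. degree G w)" by (simp only: of_nat_0_less_iff)
  then have lt: "Q (set ws) < 1" using s D_pos by (simp add: zero_less_mult_iff)
  have "pmf (K ws) v = (if v \<in> set ws then 0 else q v / (1 - Q (set ws)))" for v
  proof -
    have "pmf (K ws) v = (if v \<in> A then real (degree G v) / (D * (1 - Q (set ws))) else 0)"
      unfolding K_def cA using pmf_degree_biased[OF fA u d, of v] s by simp
    also have "\<dots> = (if v \<in> set ws then 0 else q v / (1 - Q (set ws)))"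
      using q_outside[of v] by (auto simp: A_def q_def V_def)
    finally show ?thesis .
  qed
  with lt show ?thesis by (rule that(2))
qed

lemma set_K: assumes "set ws \<subseteq> V" shows "set_pmf (K ws) \<subseteq> V"
proof
  fix v assume "v \<in> set_pmf (K ws)"
  then have "pmf (K ws) v \<noteq> 0" by (simp add: set_pmf_iff)
  then show "v \<in> V" using q_outside[of v] by (cases rule: pmf_K_cases[OF assms]) (auto split: if_splits)
qed

lemma ex_K: assumes "set ws \<subseteq> V" shows "ex (K ws) f = (\<Sum>v\<in>V. pmf (K ws) v * f v)"
  by (rule ex_sum) (use set_K[OF assms] in auto)

lemma sum_pmf_K: assumes "set ws \<subseteq> V" shows "(\<Sum>v\<in>V. pmf (K ws) v) = 1"
  using ex_K[OF assms, of "\<lambda>_. 1"] by simp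

text \<open>Conditioning on avoiding the drawn vertices takes exactly their mass away and spreads
  the same amount over the others, whence the factor 2.\<close>

lemma K_tv: assumes "set ws \<subseteq> V" shows "(\<Sum>v\<in>V. \<bar>pmf (K ws) v - q v\<bar>) \<le> 2 * Q (set ws)"
proof (cases rule: pmf_K_cases[OF assms])
  case 1
  then show ?thesis using Q_nonneg[of "set ws"] by simp
next
  case 2
  let ?x = "Q (set ws)"
  have "(\<Sum>v\<in>V. \<bar>pmf (K ws) v - q v\<bar>) = (\<Sum>v\<in>set ws. \<bar>pmf (K ws) v - q v\<bar>) + (\<Sum>v\<in>V - set ws. \<bar>pmf (K ws) v - q v\<bar>)"
    using sum.subset_diff[OF assms finV] by (simp add: add.commute)
  also have "(\<Sum>v\<in>set ws. \<bar>pmf (K ws) v - q v\<bar>) = ?x" using 2 q_nonneg by (simp add: Q_def)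
  also have "(\<Sum>v\<in>V - set ws. \<bar>pmf (K ws) v - q v\<bar>) = (\<Sum>v\<in>V - set ws. q v * (1 / (1 - ?x) - 1))"
  proof (rule sum.cong)
    fix v assume v: "v \<in> V - set ws"
    have "1 \<le> 1 / (1 - ?x)" using 2(1) Q_nonneg[of "set ws"] by (simp add: field_simps)
    then have "0 \<le> q v * (1 / (1 - ?x) - 1)" using q_nonneg[of v] by simp
    then show "\<bar>pmf (K ws) v - q v\<bar> = q v * (1 / (1 - ?x) - 1)" using v 2(2)[of v] by (simp add: algebra_simps)
  qed simp
  also have "\<dots> = (1 - ?x) * (1 / (1 - ?x) - 1)"
    using sum_diff[OF finV assms, of q] Q_V by (simp add: sum_distrib_right[symmetric] Q_def)
  also have "\<dots> = ?x" using 2(1) by (simp add: field_simps)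
  finally show ?thesis by simp
qed

text \<open>The total-variation bound would be too weak when \<open>Old\<close> carries most of the
  degree: the supermartingale argument needs \<open>Q Old\<close> with coefficient 1. Drawn vertices
  inside \<open>Old\<close> only lower its conditional mass, so just those outside enter the
  error.\<close>

lemma K_mass_le:
  assumes ws: "set ws \<subseteq> V" and Old: "Old \<subseteq> V"
  shows "(\<Sum>v\<in>Old. pmf (K ws) v) \<le> Q Old + Q (set ws - Old)"
proof (cases rule: pmf_K_cases[OF ws])
  case 1
  then show ?thesis using Q_nonneg[of "set ws - Old"] by (simp add: Q_def)
next
  case 2
  have fO: "finite Old" using Old finV by (rule finite_subset)
  let ?x = "Q (set ws - Old)" and ?y = "Q (set ws \<inter> Old)"
  have xy: "?x + ?y = Q (set ws)" unfolding Q_def by (subst sum.union_disjoint[symmetric]) (auto intro!: sum.cong)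
  have "(\<Sum>v\<in>Old. pmf (K ws) v) = (\<Sum>v\<in>Old - set ws. q v / (1 - Q (set ws)))"
    by (rule sum.mono_neutral_cong_right) (use 2 fO in auto)
  also have "\<dots> = (Q Old - ?y) / (1 - ?x - ?y)"
  proof -
    have "Q (Old - set ws) = Q Old - ?y" unfolding Q_def using fO by (subst sum_diff[symmetric]) (auto intro!: sum.cong)
    moreover have "1 - Q (set ws) = 1 - ?x - ?y" using xy by simp
    ultimately show ?thesis by (simp add: sum_divide_distrib[symmetric] Q_def)
  qed
  also have "\<dots> \<le> Q Old / 1 + ?x / 1"
  proof (rule cond_mass_bound)
    show "0 < 1 - ?x - ?y" using 2(1) xy by simp
    show "?y \<le> Q Old" unfolding Q_def by (rule sum_mono2) (use fO q_nonneg in auto)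
    have "Q Old + ?x = Q (Old \<union> (set ws - Old))" unfolding Q_def using fO by (subst sum.union_disjoint) auto
    also have "\<dots> \<le> Q V" unfolding Q_def by (rule sum_mono2) (use Old ws q_nonneg in auto)
    finally show "Q Old + ?x \<le> 1" by (simp add: Q_V)
  qed (use Q_nonneg in auto)
  finally show ?thesis by simp
qed

definition dw :: "nat \<Rightarrow> nat list pmf" where "dw j = draw_targets repl G j"

lemma dw_Suc: "dw (Suc j) = bind_pmf (dw j) (\<lambda>ws. map_pmf (\<lambda>w. w # ws) (K ws))"
  by (simp add: dw_def K_def)

lemma set_dw: "ws \<in> set_pmf (dw j) \<Longrightarrow> set ws \<subseteq> V \<and> length ws = j"
proof (induction j arbitrary: ws)
  case (Suc j)
  then show ?case using set_K by (fastforce simp: dw_Suc)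
qed (simp add: dw_def)

lemma finite_dw [simp]: "finite (set_pmf (dw j))"
  by (rule finite_subset[OF _ finite_lists_length_eq[OF finV, of j]]) (use set_dw in auto)

lemma ex_dw_Suc: "ex (dw (Suc j)) f = ex (dw j) (\<lambda>ws. \<Sum>v\<in>V. pmf (K ws) v * f (v # ws))"
proof -
  have "ex (dw (Suc j)) f = ex (dw j) (\<lambda>ws. ex (map_pmf (\<lambda>w. w # ws) (K ws)) f)"
    unfolding dw_Suc
  proof (rule ex_bind)
    fix ws assume "ws \<in> set_pmf (dw j)"
    then have "finite (set_pmf (K ws))" using finite_subset[OF set_K finV] set_dw by blast
    then show "finite (set_pmf (map_pmf (\<lambda>w. w # ws) (K ws)))" by simp
  qed simp
  also have "\<dots> = ex (dw j) (\<lambda>ws. \<Sum>v\<in>V. pmf (K ws) v * f (v # ws))"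
    by (rule ex_cong) (use set_dw in \<open>simp add: ex_K\<close>)
  finally show ?thesis .
qed

lemma dw_0: "ex (dw 0) f = f []" by (simp add: dw_def)

lemma Q_insert_le: "finite S \<Longrightarrow> Q (insert v S) \<le> Q S + q v"
  using q_nonneg[of v] by (simp add: Q_def sum.insert_if)

lemma kap_nonneg: "0 \<le> kap S" by (simp add: kap_def sum_nonneg)

end

text \<open>Under \<open>3 * m \<le> act G\<close> fewer than \<open>m\<close> vertices carry at
  most two thirds of the total degree: out-half-edges give at most \<open>1/6\<close>, in-half-edges
  at most \<open>1/2\<close>. Conditioning on new vertices then costs at most a factor 3.\<close>

locale draws = alive_graph +
  assumes big: "3 * m \<le> act G"
begin

lemma Q_le: assumes "finite S" shows "Q S \<le> 1/2 + real (card S) / (6 * real m)"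
proof -
  have "real (\<Sum>v\<in>S. degree G v) \<le> real (m * card S + m * act G)"
    using sum_degree_le[OF good assms] by (simp only: of_nat_le_iff)
  then have "Q S \<le> real (m * card S + m * act G) / D"
    unfolding Q_def q_def sum_divide_distrib[symmetric] using D_pos by (intro divide_right_mono) auto
  also have "\<dots> = 1/2 + real (card S) / (2 * real (act G))"
    using m act_pos by (simp add: D_def field_simps)
  also have "\<dots> \<le> 1/2 + real (card S) / (6 * real m)"
  proof -
    have "6 * real m \<le> 2 * real (act G)" using big by linarith
    then show ?thesis using m by (intro add_left_mono divide_left_mono) auto
  qed
  finally show ?thesis .
qed

lemma Q_small: assumes "finite S" "card S < m" shows "Q S \<le> 2/3"
proof -
  have "real (card S) / (6 * real m) \<le> 1/6" using assms by (simp add: field_simps)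
  then show ?thesis using Q_le[OF assms(1)] by linarith
qed

lemma card_set_less: "length ws < m \<Longrightarrow> card (set ws) < m"
  using card_length[of ws] by linarith

lemma pmf_K_le: assumes "set ws \<subseteq> V" "length ws < m" shows "pmf (K ws) v \<le> 3 * q v"
proof (cases rule: pmf_K_cases[OF assms(1)])
  case 1
  then show ?thesis using q_nonneg[of v] by simp
next
  case 2
  have "1/3 \<le> 1 - Q (set ws)" using Q_small[OF _ card_set_less[OF assms(2)]] by simp
  then have "q v / (1 - Q (set ws)) \<le> q v / (1/3)" using q_nonneg by (intro divide_left_mono) auto
  then show ?thesis using 2 q_nonneg[of v] by simp
qed

text \<open>A draw adds \<open>q v\<close> to the drawn mass with probability at most
  \<open>3 * q v\<close>; hence the squares. This is how the squared proportions enter all error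
  terms.\<close>

lemma ex_Q_drawn:
  assumes j: "j \<le> m"
  shows "ex (dw j) (\<lambda>ws. Q (set ws - Old)) \<le> 3 * real j * kap (V - Old)"
  using j
proof (induction j)
  case (Suc j)
  have "ex (dw (Suc j)) (\<lambda>ws. Q (set ws - Old)) \<le> ex (dw j) (\<lambda>ws. Q (set ws - Old) + 3 * kap (V - Old))"
    unfolding ex_dw_Suc
  proof (rule ex_mono[OF finite_dw])
    fix ws assume "ws \<in> set_pmf (dw j)"
    then have ws: "set ws \<subseteq> V" "length ws < m" using set_dw[of ws j] Suc.prems by auto
    have "(\<Sum>v\<in>V. pmf (K ws) v * Q (set (v # ws) - Old)) \<le> (\<Sum>v\<in>V. pmf (K ws) v * Q (set ws - Old) + (if v \<in> Old then 0 else 3 * (q v)\<^sup>2))"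
    proof (rule sum_mono)
      fix v assume v: "v \<in> V"
      have "Q (set (v # ws) - Old) \<le> Q (set ws - Old) + (if v \<in> Old then 0 else q v)"
        using Q_insert_le[of "set ws - Old" v] by (auto simp: insert_Diff_if)
      then have "pmf (K ws) v * Q (set (v # ws) - Old) \<le> pmf (K ws) v * (Q (set ws - Old) + (if v \<in> Old then 0 else q v))"
        by (rule mult_left_mono) simp
      also have "\<dots> \<le> pmf (K ws) v * Q (set ws - Old) + (if v \<in> Old then 0 else 3 * (q v)\<^sup>2)"
        using mult_right_mono[OF pmf_K_le[OF ws, of v] q_nonneg[of v]]
        by (simp add: distrib_left power2_eq_square mult_ac)
      finally show "pmf (K ws) v * Q (set (v # ws) - Old) \<le> pmf (K ws) v * Q (set ws - Old) + (if v \<in> Old then 0 else 3 * (q v)\<^sup>2)" .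
    qed
    also have "\<dots> = Q (set ws - Old) + 3 * kap (V - Old)"
    proof -
      have "(\<Sum>v\<in>V. if v \<in> Old then 0 else 3 * (q v)\<^sup>2) = (\<Sum>v\<in>V - Old. 3 * (q v)\<^sup>2)"
        by (rule sum.mono_neutral_cong_right) auto
      then show ?thesis
        using sum_pmf_K[OF ws(1)] by (simp add: sum.distrib sum_distrib_right[symmetric] kap_def sum_distrib_left)
    qed
    finally show "(\<Sum>v\<in>V. pmf (K ws) v * Q (set (v # ws) - Old)) \<le> Q (set ws - Old) + 3 * kap (V - Old)" .
  qed
  also have "\<dots> = ex (dw j) (\<lambda>ws. Q (set ws - Old)) + 3 * kap (V - Old)" by (simp add: ex_add)
  also have "\<dots> \<le> 3 * real (Suc j) * kap (V - Old)" using Suc by (simp add: algebra_simps)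
  finally show ?case .
qed (simp add: dw_0 Q_def kap_def)

lemma ex_count_le: "j \<le> m \<Longrightarrow> ex (dw j) (\<lambda>ws. real (count_list ws u)) \<le> 3 * real j * q u"
proof (induction j)
  case (Suc j)
  have "ex (dw (Suc j)) (\<lambda>ws. real (count_list ws u)) \<le> ex (dw j) (\<lambda>ws. real (count_list ws u) + 3 * q u)"
    unfolding ex_dw_Suc
  proof (rule ex_mono[OF finite_dw])
    fix ws assume "ws \<in> set_pmf (dw j)"
    then have ws: "set ws \<subseteq> V" "length ws < m" using set_dw[of ws j] Suc.prems by auto
    have "(\<Sum>v\<in>V. pmf (K ws) v * real (count_list (v # ws) u)) = (\<Sum>v\<in>V. pmf (K ws) v * real (count_list ws u) + (if v = u then pmf (K ws) u else 0))"
      by (rule sum.cong) (auto simp: algebra_simps)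
    also have "\<dots> = real (count_list ws u) + (if u \<in> V then pmf (K ws) u else 0)"
      using sum_pmf_K[OF ws(1)] by (simp add: sum.distrib sum_distrib_right[symmetric])
    also have "\<dots> \<le> real (count_list ws u) + 3 * q u"
      using pmf_K_le[OF ws, of u] q_nonneg[of u] by auto
    finally show "(\<Sum>v\<in>V. pmf (K ws) v * real (count_list (v # ws) u)) \<le> real (count_list ws u) + 3 * q u" .
  qed
  also have "\<dots> = ex (dw j) (\<lambda>ws. real (count_list ws u)) + 3 * q u" by (simp add: ex_add)
  finally show ?case using Suc by (simp add: algebra_simps)
qed (simp add: dw_0)

text \<open>The main term is the one for independent draws from \<open>q\<close>, with the exact
  constant; the dependence between draws is charged to the squared proportions outside
  \<open>Old\<close>.\<close>

lemma ex_count_set_le: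
  assumes Old: "Old \<subseteq> V" and j: "j \<le> m"
  shows "ex (dw j) (\<lambda>ws. \<Sum>v\<in>Old. real (count_list ws v)) \<le> real j * Q Old + 3 * (real j)\<^sup>2 * kap (V - Old)"
  using j
proof (induction j)
  case (Suc j)
  have fO: "finite Old" using Old finV by (rule finite_subset)
  have "ex (dw (Suc j)) (\<lambda>ws. \<Sum>v\<in>Old. real (count_list ws v)) \<le> ex (dw j) (\<lambda>ws. (\<Sum>v\<in>Old. real (count_list ws v)) + (Q Old + Q (set ws - Old)))"
    unfolding ex_dw_Suc
  proof (rule ex_mono[OF finite_dw])
    fix ws assume "ws \<in> set_pmf (dw j)"
    then have ws: "set ws \<subseteq> V" using set_dw[of ws j] by auto
    have "(\<Sum>u\<in>Old. real (count_list (v # ws) u)) = (\<Sum>u\<in>Old. real (count_list ws u)) + (if v \<in> Old then 1 else 0)" for v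
    proof -
      have "(\<Sum>u\<in>Old. real (count_list (v # ws) u)) = (\<Sum>u\<in>Old. real (count_list ws u) + (if u = v then 1 else 0))"
        by (rule sum.cong) auto
      then show ?thesis using fO by (simp add: sum.distrib)
    qed
    then have "(\<Sum>v\<in>V. pmf (K ws) v * (\<Sum>u\<in>Old. real (count_list (v # ws) u)))
      = (\<Sum>v\<in>V. pmf (K ws) v * (\<Sum>u\<in>Old. real (count_list ws u)) + (if v \<in> Old then pmf (K ws) v else 0))"
      by (intro sum.cong) (auto simp: algebra_simps)
    also have "\<dots> = (\<Sum>u\<in>Old. real (count_list ws u)) + (\<Sum>v\<in>Old. pmf (K ws) v)"
    proof -
      have "(\<Sum>v\<in>V. if v \<in> Old then pmf (K ws) v else 0) = (\<Sum>v\<in>Old. pmf (K ws) v)"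
        by (rule sum.mono_neutral_cong_right) (use Old in auto)
      then show ?thesis using sum_pmf_K[OF ws] by (simp add: sum.distrib sum_distrib_right[symmetric])
    qed
    also have "\<dots> \<le> (\<Sum>u\<in>Old. real (count_list ws u)) + (Q Old + Q (set ws - Old))"
      using K_mass_le[OF ws Old] by simp
    finally show "(\<Sum>v\<in>V. pmf (K ws) v * (\<Sum>u\<in>Old. real (count_list (v # ws) u))) \<le> \<dots>" .
  qed
  also have "\<dots> = ex (dw j) (\<lambda>ws. \<Sum>v\<in>Old. real (count_list ws v)) + (Q Old + ex (dw j) (\<lambda>ws. Q (set ws - Old)))"
    by (simp add: ex_add)
  also have "\<dots> \<le> (real j * Q Old + 3 * (real j)\<^sup>2 * kap (V - Old)) + (Q Old + 3 * real j * kap (V - Old))"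
    using Suc ex_Q_drawn[of j Old] by (intro add_mono) auto
  also have "\<dots> \<le> real (Suc j) * Q Old + 3 * (real (Suc j))\<^sup>2 * kap (V - Old)"
    using kap_nonneg[of "V - Old"] by (simp add: algebra_simps power2_eq_square)
  finally show ?case .
qed (simp add: dw_0)

text \<open>If the draws were independent and never repeated, each would replace one
  \<open>g v\<close> by \<open>g v * \<psi>\<close> with probability \<open>q v\<close>, giving the
  linear main term. The deviation at each draw is bounded by the mass already drawn.\<close>

lemma ex_product_functional:
  assumes g: "\<And>v. v \<in> V \<Longrightarrow> 0 \<le> g v \<and> g v \<le> 1" and \<psi>: "0 \<le> \<psi>" "\<psi> \<le> 1" and j: "j \<le> m"
  shows "\<bar>ex (dw j) (\<lambda>ws. \<Sum>v\<in>V. g v * \<psi> ^ count_list ws v) - ((\<Sum>v\<in>V. g v) - real j * (1 - \<psi>) * (\<Sum>v\<in>V. g v * q v))\<bar>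
    \<le> 9 * (real j)\<^sup>2 * kap V"
  using j
proof (induction j)
  case (Suc j)
  define A where "A ws = (\<Sum>v\<in>V. g v * \<psi> ^ count_list ws v)" for ws
  define gq where "gq = (\<Sum>v\<in>V. g v * q v)"
  \<comment> \<open>Two of the three units come from the total-variation distance between the draw
    and \<open>q\<close>, the third from vertices hit before, whose term has already been multiplied
    by a power of \<open>\<psi>\<close>.\<close>
  have step: "\<bar>(\<Sum>v\<in>V. pmf (K ws) v * A (v # ws)) - (A ws - (1 - \<psi>) * gq)\<bar> \<le> 3 * Q (set ws)"
    if "ws \<in> set_pmf (dw j)" for ws
  proof -
    have ws: "set ws \<subseteq> V" using that set_dw[of ws j] by auto
    have "A (v # ws) = A ws - (1 - \<psi>) * (g v * \<psi> ^ count_list ws v)" if "v \<in> V" for v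
    proof -
      have "A (v # ws) = (\<Sum>u\<in>V. g u * \<psi> ^ count_list ws u - (if u = v then (1 - \<psi>) * (g v * \<psi> ^ count_list ws v) else 0))"
        unfolding A_def by (rule sum.cong) (auto simp: algebra_simps)
      then show ?thesis using that by (simp add: sum_subtractf A_def)
    qed
    then have "(\<Sum>v\<in>V. pmf (K ws) v * A (v # ws)) = (\<Sum>v\<in>V. pmf (K ws) v * A ws - (1 - \<psi>) * (pmf (K ws) v * (g v * \<psi> ^ count_list ws v)))"
      by (intro sum.cong refl) (simp add: right_diff_distrib mult.left_commute)
    also have "\<dots> = A ws - (1 - \<psi>) * (\<Sum>v\<in>V. pmf (K ws) v * (g v * \<psi> ^ count_list ws v))"
      using sum_pmf_K[OF ws] by (simp add: sum_subtractf sum_distrib_right[symmetric] sum_distrib_left[symmetric])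
    finally have eq: "(\<Sum>v\<in>V. pmf (K ws) v * A (v # ws)) - (A ws - (1 - \<psi>) * gq) =
       - ((1 - \<psi>) * ((\<Sum>v\<in>V. pmf (K ws) v * (g v * \<psi> ^ count_list ws v)) - gq))"
      by (simp add: algebra_simps)
    have "(\<Sum>v\<in>V. pmf (K ws) v * (g v * \<psi> ^ count_list ws v)) - gq
       = (\<Sum>v\<in>V. (pmf (K ws) v - q v) * (g v * \<psi> ^ count_list ws v) - q v * g v * (1 - \<psi> ^ count_list ws v))"
      unfolding gq_def sum_subtractf[symmetric] by (rule sum.cong) (auto simp: algebra_simps)
    also have "\<bar>\<dots>\<bar> \<le> (\<Sum>v\<in>V. \<bar>pmf (K ws) v - q v\<bar> + (if v \<in> set ws then q v else 0))"
    proof (rule order_trans[OF sum_abs sum_mono])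
      fix v assume v: "v \<in> V"
      have b: "0 \<le> \<psi> ^ count_list ws v" "\<psi> ^ count_list ws v \<le> 1" using \<psi> by (auto intro: power_le_one)
      have b1: "\<bar>(pmf (K ws) v - q v) * (g v * \<psi> ^ count_list ws v)\<bar> \<le> \<bar>pmf (K ws) v - q v\<bar> * 1"
        unfolding abs_mult using g[OF v] b by (intro mult_left_mono) (auto intro: mult_le_one)
      have b2: "\<bar>q v * g v * (1 - \<psi> ^ count_list ws v)\<bar> \<le> (if v \<in> set ws then q v else 0)"
      proof (cases "v \<in> set ws")
        case True
        have "\<bar>q v * g v * (1 - \<psi> ^ count_list ws v)\<bar> = q v * (g v * (1 - \<psi> ^ count_list ws v))"
          using q_nonneg[of v] g[OF v] b by (simp add: abs_mult)
        also have "\<dots> \<le> q v * 1" using q_nonneg[of v] g[OF v] b by (intro mult_left_mono mult_le_one) auto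
        finally show ?thesis using True by simp
      qed simp
      show "\<bar>(pmf (K ws) v - q v) * (g v * \<psi> ^ count_list ws v) - q v * g v * (1 - \<psi> ^ count_list ws v)\<bar>
        \<le> \<bar>pmf (K ws) v - q v\<bar> + (if v \<in> set ws then q v else 0)"
        by (rule order_trans[OF abs_triangle_ineq4 add_mono[OF b1[unfolded mult_1_right] b2]])
    qed
    also have "\<dots> \<le> 2 * Q (set ws) + Q (set ws)"
    proof -
      have "(\<Sum>v\<in>V. if v \<in> set ws then q v else 0) = Q (set ws)"
        unfolding Q_def by (rule sum.mono_neutral_cong_right) (use ws in auto)
      then show ?thesis using K_tv[OF ws] by (simp add: sum.distrib)
    qed
    finally have "\<bar>(\<Sum>v\<in>V. pmf (K ws) v * (g v * \<psi> ^ count_list ws v)) - gq\<bar> \<le> 3 * Q (set ws)" by simp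
    then have "(1 - \<psi>) * \<bar>(\<Sum>v\<in>V. pmf (K ws) v * (g v * \<psi> ^ count_list ws v)) - gq\<bar> \<le> 1 * (3 * Q (set ws))"
      using \<psi> by (intro mult_mono) auto
    then show ?thesis unfolding eq using \<psi> by (simp add: abs_mult)
  qed
  have "\<bar>ex (dw (Suc j)) A - (ex (dw j) A - (1 - \<psi>) * gq)\<bar> = \<bar>ex (dw j) (\<lambda>ws. (\<Sum>v\<in>V. pmf (K ws) v * A (v # ws)) - (A ws - (1 - \<psi>) * gq))\<bar>"
    by (simp add: ex_dw_Suc ex_diff)
  also have "\<dots> \<le> ex (dw j) (\<lambda>ws. 3 * Q (set ws))"
    by (rule order_trans[OF ex_abs_le[OF finite_dw] ex_mono[OF finite_dw]]) (use step in auto)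
  also have "\<dots> \<le> 9 * real j * kap V" using ex_Q_drawn[of j "{}"] Suc.prems by simp
  finally have 1: "\<bar>ex (dw (Suc j)) A - (ex (dw j) A - (1 - \<psi>) * gq)\<bar> \<le> 9 * real j * kap V" .
  have 2: "\<bar>ex (dw j) A - ((\<Sum>v\<in>V. g v) - real j * (1 - \<psi>) * gq)\<bar> \<le> 9 * (real j)\<^sup>2 * kap V"
    using Suc by (simp add: A_def[abs_def] gq_def)
  have "ex (dw (Suc j)) A - ((\<Sum>v\<in>V. g v) - real (Suc j) * (1 - \<psi>) * gq) =
     (ex (dw (Suc j)) A - (ex (dw j) A - (1 - \<psi>) * gq)) + (ex (dw j) A - ((\<Sum>v\<in>V. g v) - real j * (1 - \<psi>) * gq))"
    by (simp add: algebra_simps)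
  then have "\<bar>ex (dw (Suc j)) A - ((\<Sum>v\<in>V. g v) - real (Suc j) * (1 - \<psi>) * gq)\<bar> \<le> 9 * real j * kap V + 9 * (real j)\<^sup>2 * kap V"
    using 1 2 by linarith
  also have "\<dots> \<le> 9 * (real (Suc j))\<^sup>2 * kap V" using kap_nonneg[of V] by (simp add: algebra_simps power2_eq_square)
  finally show ?case by (simp add: A_def[abs_def] gq_def)
qed (simp add: dw_0)

end

section \<open>Functionals of the graph and their one-step drifts\<close>

definition Ssq :: "nat \<Rightarrow> mgraph \<Rightarrow> real" where
  "Ssq v0 G = (\<Sum>v\<in>{v0<..nverts G}. (real (degree G v))\<^sup>2)"

text \<open>The split at \<open>v0\<close> separates vertices whose squared degrees cannot be
  controlled from those born with degree \<open>m\<close> inside the observed period. For the former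
  only the linear sum is tracked.\<close>

definition Bold :: "nat \<Rightarrow> mgraph \<Rightarrow> real" where
  "Bold v0 G = (\<Sum>v\<in>{1..v0}. real (degree G v))"

text \<open>The weight \<open>1 / i - 1 / b\<close> of a half-edge vanishes when the half-edge is about to be deleted;
  this makes the weighted degree of the old vertices a supermartingale.\<close>

definition Uold :: "nat \<Rightarrow> mgraph \<Rightarrow> real" where
  "Uold v0 G = (\<Sum>v\<in>{1..v0}. \<Sum>b\<in>#births G v. 1 / real (oldest G) - 1 / real b)"

text \<open>The weight of a vertex is the conditional probability generating function of its final degree
  in the limiting branching process, where \<open>\<beta>\<close> is to solve the delay equation.\<close>

definition Ypot :: "(nat \<Rightarrow> real) \<Rightarrow> mgraph \<Rightarrow> real" where
  "Ypot \<beta> G = (\<Sum>v\<in>{1..nverts G}. \<Prod>b\<in>#births G v. \<beta> b / \<beta> (oldest G))"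

lemma Ssq_nonneg: "0 \<le> Ssq v0 G" by (simp add: Ssq_def sum_nonneg)
lemma Bold_nonneg: "0 \<le> Bold v0 G" by (simp add: Bold_def sum_nonneg)

lemma sum_mset_nonneg_real: "(\<And>b. b \<in># M \<Longrightarrow> (0::real) \<le> f b) \<Longrightarrow> 0 \<le> (\<Sum>b\<in>#M. f b)"
  by (induction M) auto

lemma Uold_nonneg:
  assumes "good_graph m G" "1 \<le> m" shows "0 \<le> Uold v0 G"
  unfolding Uold_def
proof (intro sum_nonneg sum_mset_nonneg_real)
  fix v b assume "b \<in># births G v"
  then have "oldest G \<le> b" using births_bounds[OF assms(1,2)] by auto
  moreover have "1 \<le> oldest G" using assms by (simp add: good_graph_def)
  ultimately show "0 \<le> 1 / real (oldest G) - 1 / real b" by (simp add: frac_le)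
qed

lemma sum_mset_const: "(\<Sum>b\<in>#M. c) = real (size M) * c"
  by (induction M) (auto simp: algebra_simps)

lemma Uold_le_Bold:
  assumes "good_graph m G" shows "Uold v0 G \<le> Bold v0 G / real (oldest G)"
proof -
  have "Uold v0 G \<le> (\<Sum>v\<in>{1..v0}. \<Sum>b\<in>#births G v. 1 / real (oldest G))"
    unfolding Uold_def by (intro sum_mono sum_mset_mono) auto
  also have "\<dots> = Bold v0 G / real (oldest G)"
    by (simp add: sum_mset_const size_births Bold_def sum_divide_distrib)
  finally show ?thesis .
qed

text \<open>A half-edge born at \<open>(1 + c) * oldest\<close> or later has weight at least
  \<open>c / ((1 + c) * oldest)\<close> and is counted by \<open>Uold\<close>. Half-edges born
  before that are few, whichever vertex they belong to, since each birth time has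
  \<open>2 * m\<close> of them.\<close>

lemma Bold_le_Uold:
  assumes g: "good_graph m G" and m: "1 \<le> m" and c: "0 < c"
  shows "Bold v0 G \<le> 2 * real m * (c * real (oldest G) + 1) + (1 + c) / c * real (oldest G) * Uold v0 G"
proof -
  let ?i = "real (oldest G)"
  have i: "1 \<le> ?i" using g by (simp add: good_graph_def)
  have "Bold v0 G = (\<Sum>v\<in>{1..v0}. \<Sum>b\<in>#births G v. 1)"
    by (simp add: sum_mset_const size_births Bold_def)
  also have "\<dots> \<le> (\<Sum>v\<in>{1..v0}. \<Sum>b\<in>#births G v. of_bool (real b < (1 + c) * ?i) + (1 + c) / c * ?i * (1 / ?i - 1 / real b))"
  proof (intro sum_mono sum_mset_mono)
    fix v b assume "b \<in># births G v"
    then have b: "?i \<le> real b" using births_bounds[OF g m] by auto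
    show "1 \<le> of_bool (real b < (1 + c) * ?i) + (1 + c) / c * ?i * (1 / ?i - 1 / real b)"
    proof (cases "real b < (1 + c) * ?i")
      case True
      have "0 \<le> 1 / ?i - 1 / real b" using b i by (simp add: frac_le)
      then show ?thesis using True c i by simp
    next
      case False
      have "1 / real b \<le> 1 / ((1 + c) * ?i)" using False c i b by (intro divide_left_mono mult_pos_pos) auto
      then have "(1 + c) / c * ?i * (1 / ?i - 1 / ((1 + c) * ?i)) \<le> (1 + c) / c * ?i * (1 / ?i - 1 / real b)"
        using c i by (intro mult_left_mono) auto
      moreover have "(1 + c) / c * ?i * (1 / ?i - 1 / ((1 + c) * ?i)) = 1"
      proof -
        have key: "(1 + c) / c * x * (1 / x - 1 / ((1 + c) * x)) = 1" if "0 < x" for x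
        proof -
          have 1: "x * (1 / x - 1 / ((1 + c) * x)) = 1 - 1 / (1 + c)" using that by (simp add: right_diff_distrib)
          have 2: "1 - 1 / (1 + c) = c / (1 + c)" using c by (simp add: field_simps)
          have "(1 + c) / c * x * (1 / x - 1 / ((1 + c) * x)) = (1 + c) / c * (c / (1 + c))"
            by (simp only: mult.assoc 1 2)
          then show ?thesis using c by simp
        qed
        show ?thesis by (rule key) (use i in simp)
      qed
      ultimately show ?thesis using False by simp
    qed
  qed
  also have "\<dots> = (\<Sum>v\<in>{1..v0}. \<Sum>b\<in>#births G v. of_bool (real b < (1 + c) * ?i)) + (1 + c) / c * ?i * Uold v0 G"
    by (simp add: sum_mset.distrib sum.distrib Uold_def sum_distrib_left sum_mset_distrib_left)
  also have "(\<Sum>v\<in>{1..v0}. \<Sum>b\<in>#births G v. (of_bool (real b < (1 + c) * ?i) :: real))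
      \<le> (\<Sum>v\<in>{1..v0} \<union> {1..nverts G}. \<Sum>b\<in>#births G v. of_bool (real b < (1 + c) * ?i))"
    by (rule sum_mono2) (auto intro!: sum_mset_nonneg_real)
  also have "\<dots> = (\<Sum>v\<in>{1..nverts G}. \<Sum>b\<in>#births G v. of_bool (real b < (1 + c) * ?i))"
  proof (rule sum.mono_neutral_right)
    show "\<forall>v\<in>{1..v0} \<union> {1..nverts G} - {1..nverts G}. (\<Sum>b\<in>#births G v. of_bool (real b < (1 + c) * ?i)) = (0::real)"
      using degree_outside[OF g] by (auto simp: size_births[symmetric])
  qed auto
  also have "\<dots> = 2 * (\<Sum>w\<in>{oldest G..nverts G}. real m * of_bool (real w < (1 + c) * ?i))"
    by (rule sum_births[OF g])
  also have "(\<Sum>w\<in>{oldest G..nverts G}. real m * of_bool (real w < (1 + c) * ?i)) \<le> real m * (c * ?i + 1)"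
  proof -
    have "(\<Sum>w\<in>{oldest G..nverts G}. real m * of_bool (real w < (1 + c) * ?i))
       = real m * real (card {w\<in>{oldest G..nverts G}. real w < (1 + c) * ?i})"
      by (simp add: sum_distrib_left[symmetric] of_bool_def sum.If_cases Int_def)
    also have "real (card {w\<in>{oldest G..nverts G}. real w < (1 + c) * ?i}) \<le> c * ?i + 1"
    proof -
      have "{w\<in>{oldest G..nverts G}. real w < (1 + c) * ?i} \<subseteq> {oldest G..<oldest G + nat \<lceil>c * ?i\<rceil>}"
      proof
        fix w assume "w \<in> {w\<in>{oldest G..nverts G}. real w < (1 + c) * ?i}"
        then have w: "oldest G \<le> w" "real w < ?i + c * ?i" by (auto simp: algebra_simps)
        have "c * ?i \<le> real (nat \<lceil>c * ?i\<rceil>)" by linarith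
        then have "real w < real (oldest G + nat \<lceil>c * ?i\<rceil>)" unfolding of_nat_add using w by linarith
        then show "w \<in> {oldest G..<oldest G + nat \<lceil>c * ?i\<rceil>}" using w by simp
      qed
      then have "card {w\<in>{oldest G..nverts G}. real w < (1 + c) * ?i} \<le> nat \<lceil>c * ?i\<rceil>"
        by (metis (no_types, lifting) add_diff_cancel_left' card_atLeastLessThan card_mono finite_atLeastLessThan)
      moreover have "real (nat \<lceil>c * ?i\<rceil>) \<le> c * ?i + 1" using c i by (simp add: of_nat_nat zero_le_mult_iff)
      ultimately show ?thesis by linarith
    qed
    finally show ?thesis by (simp add: mult_left_mono)
  qed
  finally show ?thesis by simp
qed

lemma count_list_le_length: "count_list ws v \<le> length ws"
  by (induction ws) auto

context alive_graph begin

lemma nonempty: "edges G \<noteq> {#}" using edges_empty_iff[OF good m] act_pos by simp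

lemma oldest_pos: "1 \<le> oldest G" "oldest G \<le> nverts G"
  using good act_pos by (auto simp: good_graph_def act_def)

lemma set_step: "set_pmf (step repl m p G) \<subseteq> add_vertex G ` set_pmf (dw m) \<union> {delete_oldest G}"
  using nonempty by (auto simp: step_def dw_def split: if_splits)

lemma ex_step:
  assumes "0 \<le> p" "p \<le> 1"
  shows "ex (step repl m p G) f = p * ex (dw m) (\<lambda>ws. f (add_vertex G ws)) + (1 - p) * f (delete_oldest G)"
proof -
  have "ex (step repl m p G) f = ex (bernoulli_pmf p) (\<lambda>b. ex (if b then map_pmf (add_vertex G) (dw m) else return_pmf (delete_oldest G)) f)"
  proof -
    have "step repl m p G = bind_pmf (bernoulli_pmf p) (\<lambda>b. if b then map_pmf (add_vertex G) (dw m) else return_pmf (delete_oldest G))"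
      unfolding step_def dw_def using nonempty by simp
    then show ?thesis by (simp only:) (rule ex_bind, auto)
  qed
  also have "\<dots> = p * ex (dw m) (\<lambda>ws. f (add_vertex G ws)) + (1 - p) * f (delete_oldest G)"
    using assms by (simp add: mult.commute)
  finally show ?thesis .
qed

lemma births_add_old': "ws \<in> set_pmf (dw j) \<Longrightarrow> v \<in> V \<Longrightarrow>
    births (add_vertex G ws) v = births G v + replicate_mset (count_list ws v) (nverts G + 1)"
  using births_add_old[OF good] set_dw[of ws j] by (simp add: V_def)

lemma births_add_new': "ws \<in> set_pmf (dw j) \<Longrightarrow>
    births (add_vertex G ws) (nverts G + 1) = replicate_mset j (nverts G + 1)"
  using births_add_new[OF good] set_dw[of ws j] by (simp add: V_def)

lemma degree_add: "ws \<in> set_pmf (dw m) \<Longrightarrow> v \<in> V \<Longrightarrow> degree (add_vertex G ws) v = degree G v + count_list ws v"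
  using births_add_old'[of ws m v] by (metis size_births size_union size_replicate_mset)

lemma degree_add_new: "ws \<in> set_pmf (dw m) \<Longrightarrow> degree (add_vertex G ws) (nverts G + 1) = m"
  using births_add_new'[of ws m] by (metis size_births size_replicate_mset)

lemma degree_delete_le: "degree (delete_oldest G) v \<le> degree G v"
  by (simp add: size_births[symmetric] births_delete size_filter_mset_lesseq)

end

context draws begin

text \<open>A degree \<open>d\<close> that grows by \<open>X \<le> m\<close> has its square
  increased by at most \<open>(2 * d + m) * X\<close>, and \<open>X\<close> has mean at most
  \<open>3 * m * d / D\<close>. As \<open>d\<close> is an integer, \<open>d \<le> d\<^sup>2\<close>
  makes the bound linear in \<open>Ssq\<close>; the new vertex adds
  \<open>m\<^sup>2\<close>.\<close>

lemma S_step: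
  assumes p: "0 \<le> p" "p \<le> 1"
  shows "ex (step repl m p G) (Ssq v0) \<le> Ssq v0 G * (1 + 3 * real m * (real m + 2) / D) + (real m)\<^sup>2"
proof -
  define A where "A = {v0<..nverts G}"
  have A: "A \<subseteq> V" "finite A" by (auto simp: A_def V_def)
  have add: "Ssq v0 (add_vertex G ws) \<le> Ssq v0 G + (\<Sum>v\<in>A. (2 * real (degree G v) + real m) * real (count_list ws v)) + (real m)\<^sup>2"
    if ws: "ws \<in> set_pmf (dw m)" for ws
  proof -
    have "Ssq v0 (add_vertex G ws) \<le> (\<Sum>v\<in>A. (real (degree (add_vertex G ws) v))\<^sup>2) + (real (degree (add_vertex G ws) (nverts G + 1)))\<^sup>2"
    proof -
      have "{v0<..nverts G + 1} \<subseteq> insert (nverts G + 1) A" by (auto simp: A_def)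
      then have "Ssq v0 (add_vertex G ws) \<le> (\<Sum>v\<in>insert (nverts G + 1) A. (real (degree (add_vertex G ws) v))\<^sup>2)"
        unfolding Ssq_def using A by (intro sum_mono2) auto
      also have "\<dots> = (\<Sum>v\<in>A. (real (degree (add_vertex G ws) v))\<^sup>2) + (real (degree (add_vertex G ws) (nverts G + 1)))\<^sup>2"
        using A by (subst sum.insert) (auto simp: A_def)
      finally show ?thesis .
    qed
    also have "(\<Sum>v\<in>A. (real (degree (add_vertex G ws) v))\<^sup>2) \<le> (\<Sum>v\<in>A. (real (degree G v))\<^sup>2 + (2 * real (degree G v) + real m) * real (count_list ws v))"
    proof (rule sum_mono)
      fix v assume "v \<in> A"
      then have d: "degree (add_vertex G ws) v = degree G v + count_list ws v" using A degree_add[OF ws] by auto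
      have "count_list ws v \<le> m" using count_list_le_length[of ws v] set_dw[OF ws] by simp
      then have "real (count_list ws v) * real (count_list ws v) \<le> real m * real (count_list ws v)"
        by (intro mult_right_mono) auto
      then show "(real (degree (add_vertex G ws) v))\<^sup>2 \<le> (real (degree G v))\<^sup>2 + (2 * real (degree G v) + real m) * real (count_list ws v)"
        unfolding d by (simp add: power2_eq_square algebra_simps)
    qed
    finally show ?thesis unfolding degree_add_new[OF ws] by (simp add: sum.distrib Ssq_def A_def)
  qed
  have "ex (dw m) (\<lambda>ws. Ssq v0 (add_vertex G ws)) \<le> ex (dw m) (\<lambda>ws. Ssq v0 G + (\<Sum>v\<in>A. (2 * real (degree G v) + real m) * real (count_list ws v)) + (real m)\<^sup>2)"
    by (rule ex_mono[OF finite_dw add])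
  also have "\<dots> = Ssq v0 G + (\<Sum>v\<in>A. (2 * real (degree G v) + real m) * ex (dw m) (\<lambda>ws. real (count_list ws v))) + (real m)\<^sup>2"
    by (simp add: ex_add ex_setsum)
  also have "(\<Sum>v\<in>A. (2 * real (degree G v) + real m) * ex (dw m) (\<lambda>ws. real (count_list ws v)))
     \<le> (\<Sum>v\<in>A. (real (degree G v))\<^sup>2 * (3 * real m * (real m + 2) / D))"
  proof (rule sum_mono)
    fix v
    have d: "real (degree G v) \<le> (real (degree G v))\<^sup>2"
      by (cases "degree G v") (auto simp: power2_eq_square)
    have "(2 * real (degree G v) + real m) * ex (dw m) (\<lambda>ws. real (count_list ws v)) \<le> (2 * real (degree G v) + real m) * (3 * real m * q v)"
      by (rule mult_left_mono[OF ex_count_le]) auto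
    also have "\<dots> = 3 * real m / D * (2 * (real (degree G v))\<^sup>2 + real m * real (degree G v))"
      by (simp add: q_def power2_eq_square algebra_simps add_divide_distrib)
    also have "\<dots> \<le> 3 * real m / D * (2 * (real (degree G v))\<^sup>2 + real m * (real (degree G v))\<^sup>2)"
      using d D_pos by (intro mult_left_mono add_left_mono) auto
    finally show "(2 * real (degree G v) + real m) * ex (dw m) (\<lambda>ws. real (count_list ws v)) \<le> (real (degree G v))\<^sup>2 * (3 * real m * (real m + 2) / D)"
      by (simp add: algebra_simps add_divide_distrib)
  qed
  also have "\<dots> = Ssq v0 G * (3 * real m * (real m + 2) / D)"
    unfolding Ssq_def A_def by (rule sum_distrib_right[symmetric])
  finally have 1: "ex (dw m) (\<lambda>ws. Ssq v0 (add_vertex G ws)) \<le> Ssq v0 G * (1 + 3 * real m * (real m + 2) / D) + (real m)\<^sup>2"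
    by (simp add: algebra_simps)
  have 2: "Ssq v0 (delete_oldest G) \<le> Ssq v0 G * (1 + 3 * real m * (real m + 2) / D) + (real m)\<^sup>2"
  proof -
    have "Ssq v0 (delete_oldest G) \<le> Ssq v0 G" unfolding Ssq_def
      by (simp, intro sum_mono power_mono) (use degree_delete_le in auto)
    moreover have "0 \<le> Ssq v0 G * (3 * real m * (real m + 2) / D)" using Ssq_nonneg D_pos by simp
    ultimately show ?thesis unfolding distrib_left mult_1_right using zero_le_power2[of "real m"] by linarith
  qed
  have "ex (step repl m p G) (Ssq v0) \<le> p * (Ssq v0 G * (1 + 3 * real m * (real m + 2) / D) + (real m)\<^sup>2) + (1 - p) * (Ssq v0 G * (1 + 3 * real m * (real m + 2) / D) + (real m)\<^sup>2)"
    unfolding ex_step[OF p] using p by (intro add_mono mult_left_mono 1 2) auto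
  moreover have "p * x + (1 - p) * x = x" for x by (simp add: algebra_simps)
  ultimately show ?thesis by simp
qed

text \<open>An addition gains \<open>p * Bold / (2 * i * n)\<close>, since the factor
  \<open>n - i\<close> in \<open>1 / i - 1 / n\<close> cancels against \<open>D\<close>; a deletion
  loses about \<open>(1 - p) * Bold / (i * (i + 1))\<close>. For \<open>n / i\<close> near
  \<open>p / (1 - p)\<close> the gain is half the loss. The hypothesis \<open>ratio\<close> allows
  three quarters, and the remaining quarter is the rate \<open>(1 - p) / 4\<close>, with
  \<open>Bold / i\<close> bounding \<open>Uold\<close> from above.\<close>

lemma U_step:
  assumes p: "0 \<le> p" "p \<le> 1" and v0: "v0 \<le> nverts G"
    and ratio: "2 * p * (real (oldest G) + 1) \<le> 3 * (1 - p) * (real (nverts G) + 1)"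
  shows "ex (step repl m p G) (Uold v0) \<le> Uold v0 G * (1 - (1 - p) / (4 * (real (oldest G) + 1)))
     + 3 * (real m)\<^sup>2 * (Ssq v0 G / D\<^sup>2) / real (oldest G) + 2 * real m / (real (oldest G))\<^sup>2"
proof -
  define i where "i = real (oldest G)"
  define n where "n = real (nverts G) + 1"
  define A where "A = {1..v0}"
  have A: "A \<subseteq> V" "finite A" using v0 by (auto simp: A_def V_def)
  have i: "1 \<le> i" "i < n" using oldest_pos by (auto simp: i_def n_def)
  have in_pos: "0 < i" "0 < n" "0 < i * n" using i by auto
  have act: "real (act G) = n - i" using oldest_pos by (simp add: act_def n_def i_def of_nat_diff)
  have add: "Uold v0 (add_vertex G ws) = Uold v0 G + (1 / i - 1 / n) * (\<Sum>v\<in>A. real (count_list ws v))"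
    if ws: "ws \<in> set_pmf (dw m)" for ws
  proof -
    have "Uold v0 (add_vertex G ws) = (\<Sum>v\<in>A. (\<Sum>b\<in>#births G v. 1 / i - 1 / real b) + real (count_list ws v) * (1 / i - 1 / n))"
      unfolding Uold_def A_def[symmetric]
      using A births_add_old'[OF ws] by (intro sum.cong) (auto simp: i_def n_def sum_mset_const add.commute)
    then show ?thesis by (simp add: sum.distrib Uold_def A_def i_def sum_distrib_left mult.commute)
  qed
  have kapV: "kap (V - A) = Ssq v0 G / D\<^sup>2"
  proof -
    have "V - A = {v0<..nverts G}" by (auto simp: V_def A_def)
    then show ?thesis by (simp add: kap_def q_def Ssq_def power_divide sum_divide_distrib)
  qed
  have QA: "Q A = Bold v0 G / D" by (simp add: Q_def q_def Bold_def A_def sum_divide_distrib)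
  have "ex (dw m) (\<lambda>ws. Uold v0 (add_vertex G ws)) = ex (dw m) (\<lambda>ws. Uold v0 G + (1 / i - 1 / n) * (\<Sum>v\<in>A. real (count_list ws v)))"
    by (rule ex_cong) (rule add)
  also have "\<dots> = Uold v0 G + (1 / i - 1 / n) * ex (dw m) (\<lambda>ws. \<Sum>v\<in>A. real (count_list ws v))"
    by (simp add: ex_add)
  also have "\<dots> \<le> Uold v0 G + (1 / i - 1 / n) * (real m * Q A + 3 * (real m)\<^sup>2 * kap (V - A))"
    using i by (intro add_left_mono mult_left_mono ex_count_set_le A) (auto simp: frac_le)
  also have "\<dots> = Uold v0 G + (1 / i - 1 / n) * (real m * Q A) + (1 / i - 1 / n) * (3 * (real m)\<^sup>2 * (Ssq v0 G / D\<^sup>2))"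
    by (simp add: kapV algebra_simps)
  also have "(1 / i - 1 / n) * (real m * Q A) = Bold v0 G / (2 * i * n)"
  proof -
    have "1 / i - 1 / n = (n - i) / (i * n)" using in_pos by (simp add: field_simps)
    then have "(1 / i - 1 / n) * (real m * Q A) = (n - i) / (i * n) * (real m * (Bold v0 G / (2 * real m * (n - i))))"
      by (simp add: QA D_def act)
    also have "\<dots> = Bold v0 G / (2 * i * n)"
    proof -
      have "x / y * (c * (b / (2 * c * x))) = b / (2 * y)" if "x \<noteq> 0" "c \<noteq> 0" for x y b c :: real
        using that by simp
      from this[of "n - i" "real m" "i * n" "Bold v0 G"] show ?thesis using i m by (simp add: mult.assoc)
    qed
    finally show ?thesis .
  qed
  also have "(1 / i - 1 / n) * (3 * (real m)\<^sup>2 * (Ssq v0 G / D\<^sup>2)) \<le> 1 / i * (3 * (real m)\<^sup>2 * (Ssq v0 G / D\<^sup>2))"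
    using in_pos Ssq_nonneg[of v0 G] by (intro mult_right_mono) auto
  finally have addE: "ex (dw m) (\<lambda>ws. Uold v0 (add_vertex G ws)) \<le> Uold v0 G + Bold v0 G / (2 * i * n) + 3 * (real m)\<^sup>2 * (Ssq v0 G / D\<^sup>2) / i"
    by (simp add: mult.commute)
  \<comment> \<open>Half-edges born at \<open>oldest G\<close> have weight 0 already, so their
    removal changes nothing; there are at most \<open>2 * m\<close> of them, and all others lose
    \<open>1 / i - 1 / (i + 1)\<close>.\<close>
  have del: "Uold v0 (delete_oldest G) \<le> Uold v0 G - (Bold v0 G - 2 * real m) * (1 / i - 1 / (i + 1))"
  proof -
    have f0: "(\<Sum>b\<in>#filter_mset (\<lambda>b. b \<noteq> k) M. y - h b) =
        (\<Sum>b\<in>#M. x - h b) - (real (size M) - (\<Sum>b\<in>#M. of_bool (b = k))) * (x - y)"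
      if "h k = x" for x y :: real and h and k :: nat and M
      using that by (induction M) (auto simp: algebra_simps)
    have f: "(\<Sum>b\<in>#filter_mset (\<lambda>b. b \<noteq> oldest G) M. 1 / (i + 1) - 1 / real b) =
        (\<Sum>b\<in>#M. 1 / i - 1 / real b) - (real (size M) - (\<Sum>b\<in>#M. of_bool (b = oldest G))) * (1 / i - 1 / (i + 1))" for M
      by (rule f0) (simp add: i_def)
    have "Uold v0 (delete_oldest G) = (\<Sum>v\<in>A. (\<Sum>b\<in>#births G v. 1 / i - 1 / real b) - (real (degree G v) - (\<Sum>b\<in>#births G v. of_bool (b = oldest G))) * (1 / i - 1 / (i + 1)))"
      unfolding Uold_def births_delete A_def[symmetric] using f by (simp add: i_def size_births add.commute)
    also have "\<dots> = Uold v0 G - (Bold v0 G - (\<Sum>v\<in>A. \<Sum>b\<in>#births G v. of_bool (b = oldest G))) * (1 / i - 1 / (i + 1))"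
      by (simp add: sum_subtractf sum_distrib_right[symmetric] Uold_def Bold_def A_def i_def)
    also have "\<dots> \<le> Uold v0 G - (Bold v0 G - 2 * real m) * (1 / i - 1 / (i + 1))"
    proof -
      have "(\<Sum>v\<in>A. \<Sum>b\<in>#births G v. of_bool (b = oldest G)) \<le> (\<Sum>v\<in>V. \<Sum>b\<in>#births G v. of_bool (b = oldest G) :: real)"
        using A by (intro sum_mono2) (auto intro!: sum_mset_nonneg_real)
      also have "\<dots> = 2 * (\<Sum>w\<in>{oldest G..nverts G}. real m * of_bool (w = oldest G))"
        unfolding V_def by (rule sum_births[OF good])
      also have "\<dots> = 2 * real m" using oldest_pos by (simp add: of_bool_def if_distrib cong: if_cong)
      finally show ?thesis using in_pos by (intro diff_left_mono mult_right_mono) (auto simp: frac_le)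
    qed
    finally show ?thesis .
  qed
  define B where "B = Bold v0 G"
  define E where "E = 3 * (real m)\<^sup>2 * (Ssq v0 G / D\<^sup>2) / i"
  have E0: "0 \<le> E" using Ssq_nonneg in_pos by (simp add: E_def)
  have B0: "0 \<le> B" by (simp add: B_def Bold_nonneg)
  have d1: "1 / i - 1 / (i + 1) = 1 / (i * (i + 1))" using in_pos by (simp add: field_simps)
  have "ex (step repl m p G) (Uold v0) \<le> p * (Uold v0 G + B / (2 * i * n) + E) + (1 - p) * (Uold v0 G - (B - 2 * real m) * (1 / (i * (i + 1))))"
    unfolding ex_step[OF p] using p addE del by (intro add_mono mult_left_mono) (auto simp: B_def E_def d1)
  also have "\<dots> = Uold v0 G + (p * B / (2 * i * n) - (1 - p) * B / (i * (i + 1))) + p * E + (1 - p) * (2 * real m / (i * (i + 1)))"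
  proof -
    have "p * (u + x + E) + (1 - p) * (u - (B - c) * y) = u + (p * x - (1 - p) * (B * y)) + p * E + (1 - p) * (c * y)"
      for u x y c :: real by (simp add: algebra_simps)
    from this[of "Uold v0 G" "B / (2 * i * n)" "2 * real m" "1 / (i * (i + 1))"] show ?thesis
      by (simp only: times_divide_eq_right mult_1_right)
  qed
  also have "p * B / (2 * i * n) - (1 - p) * B / (i * (i + 1)) \<le> - ((1 - p) / (4 * (i + 1)) * Uold v0 G)"
  proof -
    have "p * B / (2 * i * n) = B / i * (p / (2 * n))" by (simp add: mult_ac)
    also have "p / (2 * n) \<le> 3 * (1 - p) / (4 * (i + 1))"
      using ratio in_pos by (simp add: i_def n_def field_simps)
    then have "B / i * (p / (2 * n)) \<le> B / i * (3 * (1 - p) / (4 * (i + 1)))"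
      using B0 in_pos by (intro mult_left_mono) auto
    finally have "p * B / (2 * i * n) - (1 - p) * B / (i * (i + 1)) \<le> B / i * (3 * (1 - p) / (4 * (i + 1))) - (1 - p) * B / (i * (i + 1))" by simp
    also have "\<dots> = - ((1 - p) / (4 * (i + 1)) * (B / i))"
    proof -
      have "x * (3 * y / (4 * z)) - y * x / z = - (y / (4 * z) * x)" if "z \<noteq> 0" for x y z :: real
        using that by (simp add: field_simps)
      from this[of "i + 1" "B / i" "1 - p"] in_pos show ?thesis by (simp add: mult.commute)
    qed
    also have "\<dots> \<le> - ((1 - p) / (4 * (i + 1)) * Uold v0 G)"
    proof -
      have "(1 - p) / (4 * (i + 1)) * Uold v0 G \<le> (1 - p) / (4 * (i + 1)) * (B / i)"
        unfolding B_def i_def by (rule mult_left_mono[OF Uold_le_Bold[OF good]]) (use p in auto)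
      then show ?thesis by (simp only: neg_le_iff_le)
    qed
    finally show ?thesis .
  qed
  also have "p * E \<le> E" using p E0 by (simp add: mult_left_le_one_le)
  also have "(1 - p) * (2 * real m / (i * (i + 1))) \<le> 2 * real m / i\<^sup>2"
  proof -
    have "(1 - p) * (2 * real m / (i * (i + 1))) \<le> 1 * (2 * real m / (i * i))"
      using p in_pos by (intro mult_mono divide_left_mono) auto
    then show ?thesis by (simp add: power2_eq_square)
  qed
  finally show ?thesis by (simp add: E_def i_def right_diff_distrib mult.commute)
qed

end

lemma power_minus_1_le:
  fixes r :: real assumes "1 \<le> r" shows "r ^ d - 1 \<le> real d * (r - 1) * r ^ d"
proof (induction d)
  case (Suc d)
  have r: "1 \<le> r ^ d" using assms by simp
  have "r ^ Suc d - 1 = (r ^ d - 1) + (r - 1) * r ^ d" by (simp add: algebra_simps)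
  also have "\<dots> \<le> real d * (r - 1) * r ^ d + (r - 1) * r ^ d" using Suc by simp
  also have "\<dots> = real (Suc d) * (r - 1) * r ^ d" by (simp add: algebra_simps)
  also have "\<dots> \<le> real (Suc d) * (r - 1) * r ^ Suc d"
    using assms r by (intro mult_left_mono) auto
  finally show ?case .
qed simp

text \<open>Degrees are unbounded, so \<open>r ^ d\<close> cannot be replaced by a constant. It
  stays in the remainder and is later absorbed by the weight of the vertex.\<close>

lemma power_second_order:
  fixes r :: real assumes r: "1 \<le> r"
  shows "0 \<le> r ^ d - 1 - real d * (r - 1)" "r ^ d - 1 - real d * (r - 1) \<le> (real d)\<^sup>2 * (r - 1)\<^sup>2 * r ^ d"
proof -
  show "0 \<le> r ^ d - 1 - real d * (r - 1)" using Bernoulli_inequality[of "r - 1" d] r by simp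
  show "r ^ d - 1 - real d * (r - 1) \<le> (real d)\<^sup>2 * (r - 1)\<^sup>2 * r ^ d"
  proof (induction d)
    case (Suc d)
    have "r ^ Suc d - 1 - real (Suc d) * (r - 1) = (r ^ d - 1 - real d * (r - 1)) + (r - 1) * (r ^ d - 1)"
      by (simp add: algebra_simps)
    also have "\<dots> \<le> (real d)\<^sup>2 * (r - 1)\<^sup>2 * r ^ d + (r - 1) * (real d * (r - 1) * r ^ d)"
      using Suc r power_minus_1_le[OF r, of d] by (intro add_mono mult_left_mono) auto
    also have "\<dots> = ((real d)\<^sup>2 + real d) * ((r - 1)\<^sup>2 * r ^ d)" by (simp add: algebra_simps power2_eq_square)
    also have "\<dots> \<le> (real (Suc d))\<^sup>2 * ((r - 1)\<^sup>2 * r ^ Suc d)"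
    proof (rule mult_mono)
      show "(real d)\<^sup>2 + real d \<le> (real (Suc d))\<^sup>2" by (simp add: power2_eq_square algebra_simps)
      show "(r - 1)\<^sup>2 * r ^ d \<le> (r - 1)\<^sup>2 * r ^ Suc d" using r by (intro mult_left_mono power_increasing) auto
    qed (use r in auto)
    finally show ?case by (simp add: mult.assoc)
  qed simp
qed

lemma prod_mset_bounds:
  fixes f :: "'a \<Rightarrow> real"
  assumes "\<And>x. x \<in># M \<Longrightarrow> 0 \<le> f x \<and> f x \<le> 1"
  shows "0 \<le> (\<Prod>x\<in>#M. f x) \<and> (\<Prod>x\<in>#M. f x) \<le> 1"
  using assms by (induction M) (auto intro: mult_le_one)

context draws begin

context
  fixes \<beta> :: "nat \<Rightarrow> real"
  assumes \<beta>_pos: "\<And>b. 0 < \<beta> b" and \<beta>_anti: "\<And>a b. a \<le> b \<Longrightarrow> \<beta> b \<le> \<beta> a"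
begin

definition Phi :: "nat \<Rightarrow> real" where "Phi v = (\<Prod>b\<in>#births G v. \<beta> b / \<beta> (oldest G))"
text \<open>\<open>rr\<close> is the factor gained by each surviving half-edge when the oldest
  vertex advances, \<open>psi\<close> the factor contributed by a half-edge of a newly added
  vertex.\<close>

definition rr :: real where "rr = \<beta> (oldest G) / \<beta> (oldest G + 1)"
definition psi :: real where "psi = \<beta> (nverts G + 1) / \<beta> (oldest G)"
definition XX :: real where "XX = (\<Sum>v\<in>V. Phi v * real (degree G v))"
definition alive_deg :: "nat \<Rightarrow> nat" where "alive_deg v = size (filter_mset (\<lambda>b. b \<noteq> oldest G) (births G v))"

lemma Phi_bounds: "0 \<le> Phi v" "Phi v \<le> 1"
proof -
  have "0 \<le> \<beta> b / \<beta> (oldest G) \<and> \<beta> b / \<beta> (oldest G) \<le> 1" if "b \<in># births G v" for b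
    using births_bounds[OF good m that] \<beta>_pos[of b] \<beta>_pos[of "oldest G"] \<beta>_anti[of "oldest G" b] by simp
  from prod_mset_bounds[of "births G v", OF this] show "0 \<le> Phi v" "Phi v \<le> 1" by (auto simp: Phi_def)
qed

lemma rr_ge: "1 \<le> rr"
  using \<beta>_pos \<beta>_anti[of "oldest G" "oldest G + 1"] by (simp add: rr_def)

lemma psi_bounds: "0 \<le> psi" "psi \<le> 1"
  using \<beta>_pos[of "nverts G + 1"] \<beta>_pos[of "oldest G"] \<beta>_anti[of "oldest G" "nverts G + 1"] oldest_pos by (auto simp: psi_def)

lemma Ypot_eq: "Ypot \<beta> G = (\<Sum>v\<in>V. Phi v)" by (simp add: Ypot_def V_def Phi_def)

lemma XX_bounds: "0 \<le> XX" "XX \<le> D"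
proof -
  show "0 \<le> XX" unfolding XX_def using Phi_bounds by (intro sum_nonneg mult_nonneg_nonneg) auto
  have "XX \<le> (\<Sum>v\<in>V. 1 * real (degree G v))" unfolding XX_def using Phi_bounds by (intro sum_mono mult_right_mono) auto
  then show "XX \<le> D" using real_sum_degree by simp
qed

lemma Ypot_add:
  assumes ws: "ws \<in> set_pmf (dw m)"
  shows "Ypot \<beta> (add_vertex G ws) = (\<Sum>v\<in>V. Phi v * psi ^ count_list ws v) + psi ^ m"
proof -
  have "{1..nverts G + 1} = insert (nverts G + 1) V" by (auto simp: V_def)
  then have "Ypot \<beta> (add_vertex G ws) = (\<Prod>b\<in>#births (add_vertex G ws) (nverts G + 1). \<beta> b / \<beta> (oldest G))
     + (\<Sum>v\<in>V. \<Prod>b\<in>#births (add_vertex G ws) v. \<beta> b / \<beta> (oldest G))"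
    unfolding Ypot_def add_vertex_simps by (simp add: V_def)
  also have "(\<Prod>b\<in>#births (add_vertex G ws) (nverts G + 1). \<beta> b / \<beta> (oldest G)) = psi ^ m"
    unfolding births_add_new'[OF ws] by (simp add: psi_def)
  also have "(\<Sum>v\<in>V. \<Prod>b\<in>#births (add_vertex G ws) v. \<beta> b / \<beta> (oldest G)) = (\<Sum>v\<in>V. Phi v * psi ^ count_list ws v)"
    by (rule sum.cong) (auto simp: births_add_old'[OF ws] Phi_def psi_def)
  finally show ?thesis by simp
qed

text \<open>A half-edge about to be deleted carries the factor
  \<open>\<beta> (oldest G) / \<beta> (oldest G) = 1\<close>, so deletion itself leaves the product
  unchanged and only the renormalisation by \<open>rr\<close> remains.\<close>

lemma prod_delete:
  "(\<Prod>b\<in>#filter_mset (\<lambda>b. b \<noteq> oldest G) M. \<beta> b / \<beta> (oldest G + 1)) =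
    (\<Prod>b\<in>#M. \<beta> b / \<beta> (oldest G)) * rr ^ size (filter_mset (\<lambda>b. b \<noteq> oldest G) M)"
proof (induction M)
  case (add b M)
  have "\<beta> (oldest G) \<noteq> 0" "\<beta> (oldest G + 1) \<noteq> 0" using \<beta>_pos less_irrefl by metis+
  then show ?case using add by (auto simp: rr_def)
qed simp

lemma Ypot_delete: "Ypot \<beta> (delete_oldest G) = (\<Sum>v\<in>V. Phi v * rr ^ alive_deg v)"
  by (simp add: Ypot_def V_def births_delete prod_delete[simplified] Phi_def alive_deg_def)

text \<open>The left side is again a product of ratios at most 1, namely those of the graph after
  deletion. This tames the powers of \<open>rr\<close> for vertices of large degree.\<close>

lemma Phi_rr_le: "Phi v * rr ^ alive_deg v \<le> 1"
proof -
  have "0 \<le> \<beta> b / \<beta> (oldest G + 1) \<and> \<beta> b / \<beta> (oldest G + 1) \<le> 1"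
    if "b \<in># filter_mset (\<lambda>b. b \<noteq> oldest G) (births G v)" for b
  proof -
    have "oldest G + 1 \<le> b" using that births_bounds[OF good m, of b v] by auto
    then show ?thesis using \<beta>_pos[of b] \<beta>_pos[of "oldest G + 1"] \<beta>_anti[of "oldest G + 1" b] by simp
  qed
  with prod_mset_bounds[of "filter_mset (\<lambda>b. b \<noteq> oldest G) (births G v)" "\<lambda>b. \<beta> b / \<beta> (oldest G + 1)"]
  have "(\<Prod>b\<in>#filter_mset (\<lambda>b. b \<noteq> oldest G) (births G v). \<beta> b / \<beta> (oldest G + 1)) \<le> 1" by blast
  then show ?thesis by (simp only: prod_delete Phi_def alive_deg_def)
qed

lemma alive_deg_le: "alive_deg v \<le> degree G v"
  by (simp add: alive_deg_def size_births[symmetric] size_filter_mset_lesseq)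

lemma sum_alive_deg: "(\<Sum>v\<in>V. real (degree G v) - real (alive_deg v)) = 2 * real m"
proof -
  have f: "real (size M) - real (size (filter_mset (\<lambda>b. b \<noteq> oldest G) M)) = (\<Sum>b\<in>#M. of_bool (b = oldest G))" for M
    by (induction M) auto
  have "(\<Sum>v\<in>V. real (degree G v) - real (alive_deg v)) = (\<Sum>v\<in>V. \<Sum>b\<in>#births G v. of_bool (b = oldest G))"
    using f by (intro sum.cong refl) (simp add: alive_deg_def size_births[symmetric])
  also have "\<dots> = 2 * (\<Sum>w\<in>{oldest G..nverts G}. real m * of_bool (w = oldest G))"
    unfolding V_def by (rule sum_births[OF good])
  also have "\<dots> = 2 * real m" using oldest_pos by (simp add: of_bool_def if_distrib cong: if_cong)
  finally show ?thesis .
qed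

lemma kap_V: "kap V = Ssq 0 G / D\<^sup>2"
proof -
  have "V = {0<..nverts G}" by (auto simp: V_def)
  then show ?thesis by (simp add: kap_def q_def Ssq_def power_divide sum_divide_distrib)
qed

text \<open>The new vertex contributes \<open>psi ^ m\<close>. Every other first-order effect is
  proportional to \<open>XX\<close>, and its coefficient nearly vanishes once \<open>\<beta>\<close>
  follows the delay equation. The errors are, in order: dependent draws, second-order growth in a
  deletion, and the half-edges that die.\<close>

lemma Y_step:
  assumes p: "0 \<le> p" "p \<le> 1"
  shows "\<bar>ex (step repl m p G) (Ypot \<beta>) - Ypot \<beta> G - (p * psi ^ m + XX * ((1 - p) * (rr - 1) - p * real m * (1 - psi) / D))\<bar>
    \<le> 9 * (real m)\<^sup>2 * kap V + (rr - 1)\<^sup>2 * Ssq 0 G + 2 * real m * (rr - 1)"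
proof -
  define ea where "ea = ex (dw m) (\<lambda>ws. Ypot \<beta> (add_vertex G ws)) - (Ypot \<beta> G - real m * (1 - psi) * (XX / D) + psi ^ m)"
  define ed where "ed = Ypot \<beta> (delete_oldest G) - (Ypot \<beta> G + (rr - 1) * XX)"
  have Xq: "(\<Sum>v\<in>V. Phi v * q v) = XX / D" by (simp add: XX_def q_def sum_divide_distrib)
  have "ex (dw m) (\<lambda>ws. Ypot \<beta> (add_vertex G ws)) = ex (dw m) (\<lambda>ws. \<Sum>v\<in>V. Phi v * psi ^ count_list ws v) + psi ^ m"
    by (subst ex_cong[OF Ypot_add]) (auto simp: ex_add)
  then have "ea = ex (dw m) (\<lambda>ws. \<Sum>v\<in>V. Phi v * psi ^ count_list ws v)
      - ((\<Sum>v\<in>V. Phi v) - real m * (1 - psi) * (\<Sum>v\<in>V. Phi v * q v))"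
    by (simp add: ea_def Ypot_eq Xq)
  then have ea: "\<bar>ea\<bar> \<le> 9 * (real m)\<^sup>2 * kap V"
    using ex_product_functional[of Phi psi m] Phi_bounds psi_bounds by simp
  have ed: "\<bar>ed\<bar> \<le> (rr - 1)\<^sup>2 * Ssq 0 G + 2 * real m * (rr - 1)"
  proof -
    have edq: "ed = (\<Sum>v\<in>V. Phi v * (rr ^ alive_deg v - 1 - real (alive_deg v) * (rr - 1)) - (rr - 1) * (Phi v * (real (degree G v) - real (alive_deg v))))"
      by (simp add: ed_def Ypot_delete Ypot_eq XX_def sum_distrib_left sum.distrib sum_subtractf algebra_simps)
    have "\<bar>ed\<bar> \<le> (\<Sum>v\<in>V. (rr - 1)\<^sup>2 * (real (degree G v))\<^sup>2 + (rr - 1) * (real (degree G v) - real (alive_deg v)))"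
      unfolding edq
    proof (rule order_trans[OF sum_abs sum_mono], rule order_trans[OF abs_triangle_ineq4 add_mono])
      fix v
      have "\<bar>Phi v * (rr ^ alive_deg v - 1 - real (alive_deg v) * (rr - 1))\<bar> \<le> Phi v * ((real (alive_deg v))\<^sup>2 * (rr - 1)\<^sup>2 * rr ^ alive_deg v)"
        using power_second_order[OF rr_ge, of "alive_deg v"] Phi_bounds[of v] by (simp add: abs_mult mult_left_mono)
      also have "\<dots> = (Phi v * rr ^ alive_deg v) * ((real (alive_deg v))\<^sup>2 * (rr - 1)\<^sup>2)" by simp
      also have "\<dots> \<le> 1 * ((real (degree G v))\<^sup>2 * (rr - 1)\<^sup>2)"
        using Phi_rr_le alive_deg_le Phi_bounds rr_ge by (intro mult_mono mult_right_mono power_mono) auto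
      finally show "\<bar>Phi v * (rr ^ alive_deg v - 1 - real (alive_deg v) * (rr - 1))\<bar> \<le> (rr - 1)\<^sup>2 * (real (degree G v))\<^sup>2"
        by (simp add: mult.commute)
      have "0 \<le> Phi v * (real (degree G v) - real (alive_deg v))" "Phi v * (real (degree G v) - real (alive_deg v)) \<le> real (degree G v) - real (alive_deg v)"
        using Phi_bounds[of v] alive_deg_le[of v] by (auto simp: mult_left_le_one_le)
      then show "\<bar>(rr - 1) * (Phi v * (real (degree G v) - real (alive_deg v)))\<bar> \<le> (rr - 1) * (real (degree G v) - real (alive_deg v))"
        using rr_ge by (simp add: abs_mult mult_left_mono)
    qed
    also have "\<dots> = (rr - 1)\<^sup>2 * Ssq 0 G + (rr - 1) * (2 * real m)"
    proof -
      have "V = {0<..nverts G}" by (auto simp: V_def)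
      then show ?thesis using sum_alive_deg by (simp add: sum.distrib sum_distrib_left[symmetric] Ssq_def)
    qed
    finally show ?thesis by (simp add: mult_ac)
  qed
  have eqn: "ex (step repl m p G) (Ypot \<beta>) - Ypot \<beta> G - (p * psi ^ m + XX * ((1 - p) * (rr - 1) - p * real m * (1 - psi) / D)) = p * ea + (1 - p) * ed"
  proof -
    have "p * EA + (1 - p) * ED - Y - (p * P + X * ((1 - p) * r - p * real m * (1 - \<psi>) * d)) =
      p * (EA - (Y - real m * (1 - \<psi>) * (X * d) + P)) + (1 - p) * (ED - (Y + r * X))" for EA ED Y P X r \<psi> d :: real
      by (simp add: algebra_simps)
    from this[where d = "1 / D"] show ?thesis
      unfolding ex_step[OF p] ea_def ed_def by (simp only: times_divide_eq_right mult_1_right)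
  qed
  have "\<bar>p * ea + (1 - p) * ed\<bar> \<le> 1 * (9 * (real m)\<^sup>2 * kap V) + 1 * ((rr - 1)\<^sup>2 * Ssq 0 G + 2 * real m * (rr - 1))"
  proof (rule order_trans[OF abs_triangle_ineq add_mono])
    show "\<bar>p * ea\<bar> \<le> 1 * (9 * (real m)\<^sup>2 * kap V)" unfolding abs_mult using ea p by (intro mult_mono) auto
    show "\<bar>(1 - p) * ed\<bar> \<le> 1 * ((rr - 1)\<^sup>2 * Ssq 0 G + 2 * real m * (rr - 1))" unfolding abs_mult using ed p by (intro mult_mono) auto
  qed
  then show ?thesis unfolding eqn by simp
qed

text \<open>A bound for every outcome, needed for the quadratic term of the second moment: an
  addition changes at most \<open>m\<close> old factors and adds one term, a deletion changes the
  sum by at most \<open>D * (rr - 1)\<close>.\<close>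

lemma Y_increment:
  assumes "G' \<in> set_pmf (step repl m p G)"
  shows "\<bar>Ypot \<beta> G' - Ypot \<beta> G\<bar> \<le> real m + 1 + D * (rr - 1)"
proof -
  have D0: "0 \<le> D * (rr - 1)" using D_pos rr_ge by simp
  from assms set_step consider ws where "ws \<in> set_pmf (dw m)" "G' = add_vertex G ws" | "G' = delete_oldest G" by blast
  then show ?thesis
  proof cases
    case 1
    have "Ypot \<beta> G' - Ypot \<beta> G = psi ^ m - (\<Sum>v\<in>V. Phi v * (1 - psi ^ count_list ws v))"
      using Ypot_add[OF 1(1)] 1(2) by (simp add: Ypot_eq sum_subtractf algebra_simps)
    moreover have "0 \<le> psi ^ m" "psi ^ m \<le> 1" using psi_bounds by (auto intro: power_le_one)
    moreover have "0 \<le> (\<Sum>v\<in>V. Phi v * (1 - psi ^ count_list ws v))"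
      using Phi_bounds psi_bounds by (intro sum_nonneg mult_nonneg_nonneg) (auto intro: power_le_one)
    moreover have "(\<Sum>v\<in>V. Phi v * (1 - psi ^ count_list ws v)) \<le> (\<Sum>v\<in>V. real (count_list ws v))"
    proof (rule sum_mono)
      fix v
      have "Phi v * (1 - psi ^ count_list ws v) \<le> 1 * (1 - psi ^ count_list ws v)"
        using Phi_bounds psi_bounds by (intro mult_right_mono) (auto intro: power_le_one)
      also have "\<dots> \<le> real (count_list ws v)"
        using zero_le_power[OF psi_bounds(1), of "count_list ws v"] by (cases "count_list ws v = 0") auto
      finally show "Phi v * (1 - psi ^ count_list ws v) \<le> real (count_list ws v)" .
    qed
    moreover have "(\<Sum>v\<in>V. real (count_list ws v)) = real m"
      using sum_count_set[of ws V] set_dw[OF 1(1)] by (simp flip: of_nat_sum)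
    ultimately show ?thesis using D0 by linarith
  next
    case 2
    have eq: "Ypot \<beta> G' - Ypot \<beta> G = (\<Sum>v\<in>V. Phi v * (rr ^ alive_deg v - 1))"
      unfolding 2 Ypot_delete Ypot_eq by (simp add: sum_subtractf algebra_simps)
    have "0 \<le> (\<Sum>v\<in>V. Phi v * (rr ^ alive_deg v - 1))"
      using Phi_bounds rr_ge by (intro sum_nonneg mult_nonneg_nonneg) auto
    moreover have "(\<Sum>v\<in>V. Phi v * (rr ^ alive_deg v - 1)) \<le> (\<Sum>v\<in>V. real (degree G v) * (rr - 1))"
    proof (rule sum_mono)
      fix v
      have "Phi v * (rr ^ alive_deg v - 1) \<le> Phi v * (real (alive_deg v) * (rr - 1) * rr ^ alive_deg v)"
        using power_minus_1_le[OF rr_ge] Phi_bounds by (intro mult_left_mono) auto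
      also have "\<dots> = (Phi v * rr ^ alive_deg v) * (real (alive_deg v) * (rr - 1))" by simp
      also have "\<dots> \<le> 1 * (real (degree G v) * (rr - 1))"
        using Phi_rr_le alive_deg_le rr_ge by (intro mult_mono) auto
      finally show "Phi v * (rr ^ alive_deg v - 1) \<le> real (degree G v) * (rr - 1)" by simp
    qed
    moreover have "(\<Sum>v\<in>V. real (degree G v) * (rr - 1)) = D * (rr - 1)"
      using real_sum_degree by (simp flip: sum_distrib_right)
    ultimately show ?thesis unfolding eq by linarith
  qed
qed

end
end

lemma exp_le_quadratic: "\<bar>x\<bar> \<le> 1 \<Longrightarrow> exp x \<le> 1 + x + x\<^sup>2" for x :: real
proof (cases "0 \<le> x")
  case False
  assume "\<bar>x\<bar> \<le> 1"
  define y where "y = - x"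
  have y: "0 \<le> y" using False by (simp add: y_def)
  have "1 + y \<le> exp y" by (rule exp_ge_add_one_self)
  then have "exp x \<le> 1 / (1 + y)" using y by (simp add: y_def exp_minus[of "- x", simplified] inverse_eq_divide divide_left_mono mult_pos_pos)
  also have "\<dots> \<le> 1 - y + y\<^sup>2"
    using y by (simp add: divide_le_eq) (simp add: algebra_simps power2_eq_square power3_eq_cube)
  finally show ?thesis by (simp add: y_def)
qed (rule exp_bound, auto)

text \<open>The law at a single time as a finitely supported distribution. All estimates are made
  here; the link with the trajectory measure is \<open>process_coordinate\<close>.\<close>

primrec law :: "bool \<Rightarrow> nat \<Rightarrow> real \<Rightarrow> mgraph \<Rightarrow> nat \<Rightarrow> mgraph pmf" where
  "law repl m p H 0 = return_pmf H"
| "law repl m p H (Suc i) = bind_pmf (law repl m p H i) (step repl m p)"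

section \<open>Survival and the number of vertices\<close>

locale process_run =
  fixes m :: nat and p :: real and repl :: bool and H :: mgraph
  assumes m: "1 \<le> m" and p: "1 / 2 < p" "p < 1" and good_H: "good_graph m H" and alive_H: "edges H \<noteq> {#}"
begin

lemma p01: "0 \<le> p" "p \<le> 1" using p by auto

definition t0 :: nat where "t0 = oldest H + nverts H"

abbreviation L :: "nat \<Rightarrow> mgraph pmf" where "L i \<equiv> law repl m p H i"

lemma alive_graphI: "good_graph m G \<Longrightarrow> edges G \<noteq> {#} \<Longrightarrow> alive_graph m G"
  using edges_empty_iff[of m G] m by unfold_locales auto

lemma step_facts:
  assumes g: "good_graph m G"
  shows "finite (set_pmf (step repl m p G))"
    "G' \<in> set_pmf (step repl m p G) \<Longrightarrow> good_graph m G'"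
    "edges G \<noteq> {#} \<Longrightarrow> G' \<in> set_pmf (step repl m p G) \<Longrightarrow> oldest G' + nverts G' = oldest G + nverts G + 1"
proof -
  have dead: "edges G = {#} \<Longrightarrow> step repl m p G = return_pmf G" by (simp add: step_def)
  have al: "finite (set_pmf (step repl m p G)) \<and> (\<forall>G'\<in>set_pmf (step repl m p G). good_graph m G' \<and> oldest G' + nverts G' = oldest G + nverts G + 1)"
    if ne: "edges G \<noteq> {#}"
  proof -
    interpret alive_graph m G repl by (rule alive_graphI[OF g ne])
    have "finite (set_pmf (step repl m p G))" by (rule finite_subset[OF set_step]) simp
    moreover have "good_graph m (add_vertex G ws)" if "ws \<in> set_pmf (dw m)" for ws
      using set_dw[OF that] by (intro good_add_vertex[OF g]) (auto simp: V_def)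
    moreover have "good_graph m (delete_oldest G)" by (rule good_delete_oldest[OF g m oldest_pos(2)])
    ultimately show ?thesis using set_step[of p] by fastforce
  qed
  show "finite (set_pmf (step repl m p G))" using al dead by (cases "edges G = {#}") auto
  show "G' \<in> set_pmf (step repl m p G) \<Longrightarrow> good_graph m G'" using al dead g by (cases "edges G = {#}") auto
  show "edges G \<noteq> {#} \<Longrightarrow> G' \<in> set_pmf (step repl m p G) \<Longrightarrow> oldest G' + nverts G' = oldest G + nverts G + 1"
    using al by auto
qed

lemma law_facts: "finite (set_pmf (L i)) \<and> (\<forall>G\<in>set_pmf (L i). good_graph m G \<and> (edges G \<noteq> {#} \<longrightarrow> oldest G + nverts G = t0 + i))"
proof (induction i)
  case 0
  then show ?case using good_H by (simp add: t0_def)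
next
  case (Suc i)
  have dead: "edges G = {#} \<Longrightarrow> step repl m p G = return_pmf G" for G by (simp add: step_def)
  have "oldest G' + nverts G' = t0 + Suc i"
    if "G \<in> set_pmf (L i)" "G' \<in> set_pmf (step repl m p G)" "edges G' \<noteq> {#}" for G G'
  proof (cases "edges G = {#}")
    case False
    then show ?thesis using step_facts(3)[of G G'] Suc that by auto
  qed (use that dead in auto)
  then show ?case using Suc step_facts by auto
qed

lemmas finite_law [simp] = law_facts[THEN conjunct1]

lemma law_good: "G \<in> set_pmf (L i) \<Longrightarrow> good_graph m G" using law_facts by blast
lemma law_time: "G \<in> set_pmf (L i) \<Longrightarrow> edges G \<noteq> {#} \<Longrightarrow> oldest G + nverts G = t0 + i" using law_facts by blast

text \<open>Unnormalised expectation on survival up to step \<open>i\<close>. Since extinction is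
  absorbing, one-step inequalities for live graphs pass directly to \<open>Ea\<close>.\<close>

definition Ea :: "nat \<Rightarrow> (mgraph \<Rightarrow> real) \<Rightarrow> real" where
  "Ea i f = ex (L i) (\<lambda>G. if edges G = {#} then 0 else f G)"

definition live :: "nat \<Rightarrow> mgraph \<Rightarrow> bool" where
  "live i G \<longleftrightarrow> G \<in> set_pmf (L i) \<and> edges G \<noteq> {#}"

lemma live_alive: "live i G \<Longrightarrow> alive_graph m G"
  using alive_graphI law_good by (auto simp: live_def)

lemma live_time: "live i G \<Longrightarrow> oldest G + nverts G = t0 + i"
  using law_time by (auto simp: live_def)

lemma live_pos: "live i G \<Longrightarrow> 1 \<le> oldest G \<and> oldest G \<le> nverts G"
  using alive_graph.oldest_pos[OF live_alive] by blast

lemma Ea_mono: "(\<And>G. live i G \<Longrightarrow> f G \<le> g G) \<Longrightarrow> Ea i f \<le> Ea i g"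
  unfolding Ea_def by (rule ex_mono) (auto simp: live_def)

lemma Ea_nonneg: "(\<And>G. live i G \<Longrightarrow> 0 \<le> f G) \<Longrightarrow> 0 \<le> Ea i f"
  unfolding Ea_def by (rule ex_nonneg) (auto simp: live_def)

lemma Ea_add: "Ea i (\<lambda>G. f G + g G) = Ea i f + Ea i g"
  unfolding Ea_def by (subst ex_add[symmetric]) (auto intro!: ex_cong)

lemma Ea_cmult: "Ea i (\<lambda>G. c * f G) = c * Ea i f"
  unfolding Ea_def by (subst ex_cmult[symmetric], rule ex_cong) auto

lemma Ea_const_le: "0 \<le> c \<Longrightarrow> Ea i (\<lambda>_. c) \<le> c"
  unfolding Ea_def by (rule order_trans[OF ex_mono[of _ _ "\<lambda>_. c"]]) auto

lemma Ea_step: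
  assumes "\<And>G. live i G \<Longrightarrow> ex (step repl m p G) (\<lambda>G'. if edges G' = {#} then 0 else f G') \<le> g G"
  shows "Ea (Suc i) f \<le> Ea i g"
proof -
  have "Ea (Suc i) f = ex (L i) (\<lambda>G. ex (step repl m p G) (\<lambda>G'. if edges G' = {#} then 0 else f G'))"
    unfolding Ea_def law.simps by (rule ex_bind) (use step_facts(1) law_good in auto)
  also have "\<dots> \<le> Ea i g" unfolding Ea_def
  proof (rule ex_mono)
    fix G assume G: "G \<in> set_pmf (L i)"
    show "ex (step repl m p G) (\<lambda>G'. if edges G' = {#} then 0 else f G') \<le> (if edges G = {#} then 0 else g G)"
      using assms[of G] G by (cases "edges G = {#}") (auto simp: live_def step_def)
  qed simp
  finally show ?thesis .
qed

lemma Ea_step_nonneg: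
  assumes "\<And>G. live i G \<Longrightarrow> ex (step repl m p G) f \<le> g G" and "\<And>G. 0 \<le> f G"
  shows "Ea (Suc i) f \<le> Ea i g"
proof (rule Ea_step)
  fix G assume G: "live i G"
  have "ex (step repl m p G) (\<lambda>G'. if edges G' = {#} then 0 else f G') \<le> ex (step repl m p G) f"
    using step_facts(1) law_good G assms(2) by (intro ex_mono) (auto simp: live_def)
  then show "ex (step repl m p G) (\<lambda>G'. if edges G' = {#} then 0 else f G') \<le> g G" using assms(1)[OF G] by simp
qed

lemma Ea_0: "Ea 0 f = f H" using alive_H by (simp add: Ea_def)

text \<open>While the graph is alive the exponent is \<open>\<theta>\<close> times a martingale: it
  moves by \<open>1 - p\<close> with probability \<open>p\<close> and by \<open>- p\<close>
  otherwise.\<close>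

lemma exp_moment:
  assumes \<theta>: "\<bar>\<theta>\<bar> \<le> 1"
  shows "Ea i (\<lambda>G. exp (\<theta> * (real (nverts G) - p * (real (oldest G) + real (nverts G))))) \<le> exp (\<bar>\<theta>\<bar> * real t0 + \<theta>\<^sup>2 * real i)"
proof (induction i)
  case 0
  have "\<theta> * (real (nverts H) - p * real t0) \<le> \<bar>\<theta>\<bar> * real t0"
  proof -
    have "p * real t0 \<le> real t0" "0 \<le> p * real t0" using p by (auto simp: mult_left_le_one_le)
    moreover have "real (nverts H) \<le> real t0" by (simp add: t0_def)
    ultimately have "\<bar>real (nverts H) - p * real t0\<bar> \<le> real t0" by linarith
    then have "\<bar>\<theta>\<bar> * \<bar>real (nverts H) - p * real t0\<bar> \<le> \<bar>\<theta>\<bar> * real t0" by (intro mult_left_mono) auto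
    then show ?thesis by (simp add: abs_mult[symmetric])
  qed
  then show ?case by (simp add: Ea_0 t0_def)
next
  case (Suc i)
  define f where "f G = exp (\<theta> * (real (nverts G) - p * (real (oldest G) + real (nverts G))))" for G :: mgraph
  have "Ea (Suc i) f \<le> Ea i (\<lambda>G. exp (\<theta>\<^sup>2) * f G)"
  proof (rule Ea_step_nonneg)
    fix G assume G: "live i G"
    interpret alive_graph m G repl by (rule live_alive[OF G])
    have 1: "f (add_vertex G ws) = exp (\<theta> * (1 - p)) * f G" for ws
      by (simp add: f_def exp_add[symmetric] algebra_simps)
    have 2: "f (delete_oldest G) = exp (- \<theta> * p) * f G"
      by (simp add: f_def exp_add[symmetric] algebra_simps)
    have "\<bar>\<theta> * (1 - p)\<bar> \<le> 1" "\<bar>- \<theta> * p\<bar> \<le> 1"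
      using \<theta> p by (auto simp: abs_mult intro!: mult_le_one)
    then have "p * exp (\<theta> * (1 - p)) + (1 - p) * exp (- \<theta> * p) \<le> p * (1 + \<theta> * (1 - p) + (\<theta> * (1 - p))\<^sup>2) + (1 - p) * (1 + - \<theta> * p + (- \<theta> * p)\<^sup>2)"
      using p by (intro add_mono mult_left_mono exp_le_quadratic) auto
    also have "\<dots> = 1 + \<theta>\<^sup>2 * (p * (1 - p))" by (simp add: algebra_simps power2_eq_square)
    also have "\<dots> \<le> 1 + \<theta>\<^sup>2 * 1" using p by (intro add_left_mono mult_left_mono mult_le_one) auto
    also have "\<dots> \<le> exp (\<theta>\<^sup>2)" using exp_ge_add_one_self[of "\<theta>\<^sup>2"] by simp
    finally have "(p * exp (\<theta> * (1 - p)) + (1 - p) * exp (- \<theta> * p)) * f G \<le> exp (\<theta>\<^sup>2) * f G"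
      by (rule mult_right_mono) (simp add: f_def)
    then show "ex (step repl m p G) f \<le> exp (\<theta>\<^sup>2) * f G"
      unfolding ex_step[OF p01] by (simp add: 1 2 distrib_right mult.assoc)
  qed (simp add: f_def)
  also have "\<dots> = exp (\<theta>\<^sup>2) * Ea i f" by (rule Ea_cmult)
  also have "\<dots> \<le> exp (\<theta>\<^sup>2) * exp (\<bar>\<theta>\<bar> * real t0 + \<theta>\<^sup>2 * real i)"
    using Suc by (simp add: f_def[abs_def])
  finally show ?case by (simp add: f_def[abs_def] exp_add[symmetric] algebra_simps)
qed

definition typical :: "real \<Rightarrow> mgraph \<Rightarrow> bool" where
  "typical K G \<longleftrightarrow> \<bar>real (nverts G) - p * (real (oldest G) + real (nverts G))\<bar> \<le> K"

text \<open>Chernoff bound with parameter \<open>1 / sqrt n\<close> and both signs. The start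
  contributes at most 1 to the exponent because \<open>t0 \<le> sqrt n\<close>, the variance term at
  most 1 because \<open>i \<le> n\<close>.\<close>

lemma atypical:
  assumes n: "1 \<le> n" "real t0 \<le> sqrt n" "real (t0 + i) \<le> n"
  shows "Ea i (\<lambda>G. of_bool (\<not> typical K G)) \<le> 2 * exp (2 - K / sqrt n)"
proof -
  define \<theta> where "\<theta> = 1 / sqrt n"
  have \<theta>: "0 < \<theta>" "\<theta> \<le> 1" using n by (auto simp: \<theta>_def)
  define d where "d G = real (nverts G) - p * (real (oldest G) + real (nverts G))" for G :: mgraph
  have bound: "Ea i (\<lambda>G. exp (\<sigma> * d G)) \<le> exp 2" if "\<bar>\<sigma>\<bar> = \<theta>" for \<sigma>
  proof -
    have "Ea i (\<lambda>G. exp (\<sigma> * d G)) \<le> exp (\<bar>\<sigma>\<bar> * real t0 + \<sigma>\<^sup>2 * real i)"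
      unfolding d_def by (rule exp_moment) (use that \<theta> in auto)
    also have "\<bar>\<sigma>\<bar> * real t0 + \<sigma>\<^sup>2 * real i \<le> 1 + 1"
    proof (rule add_mono)
      show "\<bar>\<sigma>\<bar> * real t0 \<le> 1" using n that by (simp add: \<theta>_def divide_le_eq)
      have "\<sigma>\<^sup>2 = 1 / n" using that n by (metis \<theta>_def power2_abs power_one_over real_sqrt_pow2_iff zero_le_one order_trans)
      moreover have "real i \<le> n" using n(3) by simp
      ultimately show "\<sigma>\<^sup>2 * real i \<le> 1" using n by (simp add: divide_le_eq)
    qed
    finally show ?thesis by simp
  qed
  have "Ea i (\<lambda>G. of_bool (\<not> typical K G)) \<le> Ea i (\<lambda>G. exp (- \<theta> * K) * exp (\<theta> * d G) + exp (- \<theta> * K) * exp (- \<theta> * d G))"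
  proof (rule Ea_mono)
    fix G
    show "of_bool (\<not> typical K G) \<le> exp (- \<theta> * K) * exp (\<theta> * d G) + exp (- \<theta> * K) * exp (- \<theta> * d G)"
    proof (cases "typical K G")
      case False
      then have "K < d G \<or> K < - d G" unfolding typical_def d_def by linarith
      then consider "K < d G" | "K < - d G" by blast
      then show ?thesis
      proof cases
        case 1
        then have "1 \<le> exp (\<theta> * (d G - K))" using \<theta> by simp
        then have "1 \<le> exp (- \<theta> * K) * exp (\<theta> * d G)" by (simp add: exp_add[symmetric] algebra_simps)
        moreover have "0 \<le> exp (- \<theta> * K) * exp (- \<theta> * d G)" by simp
        ultimately show ?thesis using False by (simp only: not_False_eq_True of_bool_eq)
      next
        case 2
        then have "1 \<le> exp (\<theta> * (- d G - K))" using \<theta> by simp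
        then have "1 \<le> exp (- \<theta> * K) * exp (- \<theta> * d G)" by (simp add: exp_add[symmetric] algebra_simps)
        moreover have "0 \<le> exp (- \<theta> * K) * exp (\<theta> * d G)" by simp
        ultimately show ?thesis using False by (simp only: not_False_eq_True of_bool_eq)
      qed
    qed simp
  qed
  also have "\<dots> = exp (- \<theta> * K) * Ea i (\<lambda>G. exp (\<theta> * d G)) + exp (- \<theta> * K) * Ea i (\<lambda>G. exp (- \<theta> * d G))"
    by (simp only: Ea_add Ea_cmult)
  also have "\<dots> \<le> exp (- \<theta> * K) * exp 2 + exp (- \<theta> * K) * exp 2"
    using \<theta> by (intro add_mono mult_left_mono bound) auto
  also have "\<dots> = 2 * exp (2 - K / sqrt n)" by (simp add: \<theta>_def exp_diff exp_minus field_simps)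
  finally show ?thesis .
qed

text \<open>Gambler's ruin: \<open>act\<close> is a walk with upward probability \<open>p\<close>
  absorbed at 0, and \<open>g ^ act\<close> with \<open>g = (1 - p) / p\<close> is a martingale
  equal to 1 on extinct graphs and at most \<open>g\<close> at the start.\<close>

lemma survival: "ex (L i) (\<lambda>G. of_bool (edges G = {#})) \<le> (1 - p) / p"
proof -
  define g where "g = (1 - p) / p"
  have g: "0 < g" "g \<le> 1" using p by (auto simp: g_def field_simps)
  have "ex (L i) (\<lambda>G. g ^ act G) \<le> g"
  proof (induction i)
    case 0
    have "1 \<le> act H" using alive_graph.act_pos[OF alive_graphI[OF good_H alive_H]] by simp
    then have "g ^ act H \<le> g ^ 1" using g by (intro power_decreasing) auto
    then show ?case by simp
  next
    case (Suc i)
    have "ex (L (Suc i)) (\<lambda>G. g ^ act G) = ex (L i) (\<lambda>G. ex (step repl m p G) (\<lambda>G. g ^ act G))"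
      unfolding law.simps by (rule ex_bind) (use step_facts(1) law_good in auto)
    also have "\<dots> \<le> ex (L i) (\<lambda>G. g ^ act G)"
    proof (rule ex_mono)
      fix G assume G: "G \<in> set_pmf (L i)"
      show "ex (step repl m p G) (\<lambda>G. g ^ act G) \<le> g ^ act G"
      proof (cases "edges G = {#}")
        case False
        interpret alive_graph m G repl by (rule alive_graphI[OF law_good[OF G] False])
        obtain a where a: "act G = Suc a" using act_pos by (cases "act G") auto
        have "act (add_vertex G ws) = Suc (Suc a)" for ws using a oldest_pos by (simp add: act_def)
        moreover have "act (delete_oldest G) = a" using a oldest_pos by (simp add: act_def)
        ultimately have "ex (step repl m p G) (\<lambda>G. g ^ act G) = p * g ^ Suc (Suc a) + (1 - p) * g ^ a"
          unfolding ex_step[OF p01] by simp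
        also have "\<dots> = (p * g + (1 - p) / g) * g ^ Suc a" using g by (simp add: field_simps)
        also have "p * g + (1 - p) / g = 1" using p by (simp add: g_def)
        finally show ?thesis by (simp add: a)
      qed (simp add: step_def)
    qed simp
    finally show ?case using Suc by simp
  qed
  moreover have "ex (L i) (\<lambda>G. of_bool (edges G = {#})) \<le> ex (L i) (\<lambda>G. g ^ act G)"
  proof (rule ex_mono)
    fix G assume G: "G \<in> set_pmf (L i)"
    show "of_bool (edges G = {#}) \<le> g ^ act G"
      using edges_empty_iff[OF law_good[OF G] m] g by (cases "edges G = {#}") auto
  qed simp
  ultimately show ?thesis by (simp add: g_def)
qed

end

section \<open>Decay of the squared degree proportions\<close>

lemma linear_recursion_bound:
  fixes a :: "nat \<Rightarrow> real"
  assumes x: "0 \<le> x" and b: "0 \<le> b"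
    and step: "\<And>j. j < k \<Longrightarrow> a (i0 + Suc j) \<le> (1 + x) * a (i0 + j) + b"
  shows "a (i0 + k) \<le> (1 + x) ^ k * (\<bar>a i0\<bar> + real k * b)"
  using step
proof (induction k)
  case (Suc k)
  have x1: "1 \<le> (1 + x) ^ Suc k" using x by (intro one_le_power) auto
  have "a (i0 + Suc k) \<le> (1 + x) * a (i0 + k) + b" using Suc.prems by simp
  also have "\<dots> \<le> (1 + x) * ((1 + x) ^ k * (\<bar>a i0\<bar> + real k * b)) + (1 + x) ^ Suc k * b"
  proof (rule add_mono)
    show "(1 + x) * a (i0 + k) \<le> (1 + x) * ((1 + x) ^ k * (\<bar>a i0\<bar> + real k * b))"
      using Suc x by (intro mult_left_mono) auto
    show "b \<le> (1 + x) ^ Suc k * b" using mult_right_mono[OF x1 b] by simp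
  qed
  also have "\<dots> = (1 + x) ^ Suc k * (\<bar>a i0\<bar> + real (Suc k) * b)" by (simp add: algebra_simps)
  finally show ?case .
qed simp

text \<open>Multiplication by \<open>(t + 1) powr c\<close> turns a recursion with contraction
  \<open>1 - c / (t + 1)\<close> into a non-increasing one; hence the polynomial decay of the next
  lemma.\<close>

lemma decay_factor:
  fixes c :: real assumes c: "0 \<le> c" "c \<le> 1"
  shows "(1 - c / (real t + 1)) * (real t + 2) powr c \<le> (real t + 1) powr c"
proof -
  define x where "x = 1 / (real t + 1)"
  have x: "0 < x" "x \<le> 1" by (auto simp: x_def)
  have "real t + 2 = (1 + x) * (real t + 1)" by (simp add: x_def field_simps)
  then have e: "(real t + 2) powr c = (1 + x) powr c * (real t + 1) powr c" using x by (simp add: powr_mult)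
  have "c * x \<le> 1" using c x by (intro mult_le_one) auto
  then have "0 \<le> 1 - c * x" "1 - c * x \<le> exp (- (c * x))" using exp_ge_add_one_self[of "- (c * x)"] by auto
  moreover have "(1 + x) powr c \<le> exp (c * x)"
    using x c ln_add_one_self_le_self[of x] by (simp add: powr_def mult_left_mono)
  ultimately have "(1 - c * x) * (1 + x) powr c \<le> exp (- (c * x)) * exp (c * x)"
    by (intro mult_mono) auto
  also have "\<dots> = 1" by (simp add: exp_add[symmetric])
  finally have "(1 - c * x) * (1 + x) powr c * (real t + 1) powr c \<le> 1 * (real t + 1) powr c"
    by (rule mult_right_mono) simp
  then show ?thesis by (simp add: e x_def mult.assoc)
qed

lemma decay_recursion_bound:
  fixes a :: "nat \<Rightarrow> real"
  assumes c: "0 \<le> c" "c \<le> 1" and b: "0 \<le> b" and a0: "\<And>j. j \<le> k \<Longrightarrow> 0 \<le> a (i0 + j)"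
    and step: "\<And>j. j < k \<Longrightarrow> a (i0 + Suc j) \<le> (1 - c / (real (T + j) + 1)) * a (i0 + j) + b"
  shows "a (i0 + k) \<le> ((real T + 1) / (real (T + k) + 1)) powr c * a i0 + real k * b"
  using step a0
proof (induction k)
  case (Suc k)
  define t where "t = T + k"
  define F where "F = (1 - c / (real t + 1))"
  have F: "0 \<le> F" "F \<le> 1" using c by (auto simp: F_def field_simps)
  have df: "F * (real t + 2) powr c \<le> (real t + 1) powr c" unfolding F_def by (rule decay_factor[OF c])
  have "a (i0 + Suc k) \<le> F * a (i0 + k) + b" using Suc.prems by (simp add: F_def t_def)
  also have "\<dots> \<le> F * (((real T + 1) / (real t + 1)) powr c * a i0 + real k * b) + b"
    using Suc F by (intro add_right_mono mult_left_mono) (auto simp: t_def)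
  also have "\<dots> = F * ((real T + 1) / (real t + 1)) powr c * a i0 + F * (real k * b) + b" by (simp add: algebra_simps)
  also have "\<dots> \<le> ((real T + 1) / (real t + 2)) powr c * a i0 + 1 * (real k * b) + b"
  proof (intro add_mono mult_right_mono F)
    have "F \<le> (real t + 1) powr c / (real t + 2) powr c" using df by (simp add: pos_le_divide_eq)
    then have "F * ((real T + 1) / (real t + 1)) powr c \<le> (real t + 1) powr c / (real t + 2) powr c * ((real T + 1) / (real t + 1)) powr c"
      by (rule mult_right_mono) simp
    also have "\<dots> = ((real T + 1) / (real t + 2)) powr c" by (simp add: powr_divide)
    finally show "F * ((real T + 1) / (real t + 1)) powr c \<le> ((real T + 1) / (real t + 2)) powr c" .
    show "0 \<le> a i0" using Suc.prems(2)[of 0] by simp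
  qed (use b in auto)
  also have "\<dots> = ((real T + 1) / (real (T + Suc k) + 1)) powr c * a i0 + real (Suc k) * b"
    by (simp add: t_def algebra_simps)
  finally show ?case .
qed simp

definition kappa :: "nat \<Rightarrow> mgraph \<Rightarrow> real" where
  "kappa m G = Ssq 0 G / (2 * real m * real (act G))\<^sup>2"

lemma sum_degree_sq_le: "good_graph m G \<Longrightarrow> Ssq v0 G \<le> (2 * real m * real (act G))\<^sup>2"
proof -
  assume g: "good_graph m G"
  have dle: "real (degree G v) \<le> 2 * real m * real (act G)" if "v \<in> {1..nverts G}" for v
  proof -
    have "degree G v \<le> (\<Sum>v\<in>{1..nverts G}. degree G v)" by (rule member_le_sum) (use that in auto)
    then have "real (degree G v) \<le> real (2 * m * act G)" using sum_degree[OF g] by (simp only: of_nat_le_iff)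
    then show ?thesis by simp
  qed
  have "Ssq v0 G \<le> (\<Sum>v\<in>{1..nverts G}. (real (degree G v))\<^sup>2)"
    unfolding Ssq_def by (rule sum_mono2) auto
  also have "\<dots> \<le> (\<Sum>v\<in>{1..nverts G}. (2 * real m * real (act G)) * real (degree G v))"
    by (rule sum_mono) (use dle in \<open>auto simp: power2_eq_square intro!: mult_right_mono\<close>)
  also have "\<dots> = (2 * real m * real (act G)) * real (\<Sum>v\<in>{1..nverts G}. degree G v)" by (simp add: sum_distrib_left)
  also have "\<dots> = (2 * real m * real (act G))\<^sup>2" unfolding sum_degree[OF g] by (simp add: power2_eq_square)
  finally show ?thesis .
qed

lemma Bold_le: "good_graph m G \<Longrightarrow> Bold v0 G \<le> 2 * real m * real (act G)"
proof -
  assume g: "good_graph m G"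
  have "Bold v0 G \<le> (\<Sum>v\<in>{1..v0} \<union> {1..nverts G}. real (degree G v))" unfolding Bold_def by (rule sum_mono2) auto
  also have "\<dots> = (\<Sum>v\<in>{1..nverts G}. real (degree G v))"
    by (rule sum.mono_neutral_right) (use degree_outside[OF g] in auto)
  also have "\<dots> = real (\<Sum>v\<in>{1..nverts G}. degree G v)" by simp
  also have "\<dots> = 2 * real m * real (act G)" unfolding sum_degree[OF g] by simp
  finally show ?thesis .
qed

text \<open>For vertices up to \<open>v0\<close> one of the two degrees in the square is bounded by
  the total degree, which leaves the linear quantity \<open>Bold\<close>.\<close>

lemma kappa_le_Bold:
  assumes g: "good_graph m G" and a: "0 < 2 * real m * real (act G)"
  shows "kappa m G \<le> Bold v0 G / (2 * real m * real (act G)) + Ssq v0 G / (2 * real m * real (act G))\<^sup>2"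
proof -
  define D where "D = 2 * real m * real (act G)"
  have dle: "real (degree G v) \<le> D" for v
  proof (cases "v \<in> {1..nverts G}")
    case True
    then have "degree G v \<le> (\<Sum>v\<in>{1..nverts G}. degree G v)" by (intro member_le_sum) auto
    then have "real (degree G v) \<le> real (2 * m * act G)" using sum_degree[OF g] by (simp only: of_nat_le_iff)
    then show ?thesis by (simp add: D_def)
  next
    case False
    then show ?thesis using degree_outside[OF g False] a by (simp add: D_def)
  qed
  have "Ssq 0 G \<le> (\<Sum>v\<in>{1..v0} \<union> {v0<..nverts G}. (real (degree G v))\<^sup>2)"
    unfolding Ssq_def by (rule sum_mono2) auto
  also have "\<dots> = (\<Sum>v\<in>{1..v0}. (real (degree G v))\<^sup>2) + Ssq v0 G"
    unfolding Ssq_def by (rule sum.union_disjoint) auto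
  also have "(\<Sum>v\<in>{1..v0}. (real (degree G v))\<^sup>2) \<le> (\<Sum>v\<in>{1..v0}. D * real (degree G v))"
    by (rule sum_mono) (use dle in \<open>auto simp: power2_eq_square intro!: mult_right_mono\<close>)
  also have "\<dots> = D * Bold v0 G" by (simp add: Bold_def sum_distrib_left)
  finally have "Ssq 0 G / D\<^sup>2 \<le> (D * Bold v0 G + Ssq v0 G) / D\<^sup>2" by (intro divide_right_mono) auto
  also have "\<dots> = Bold v0 G / D + Ssq v0 G / D\<^sup>2" using a by (simp add: D_def[symmetric] add_divide_distrib power2_eq_square)
  finally show ?thesis by (simp add: kappa_def D_def)
qed

context process_run begin

lemma live_good: "live i G \<Longrightarrow> good_graph m G"
  using law_good by (auto simp: live_def)

lemma live_act: assumes "live i G" shows "real (act G) = 2 * real (nverts G) + 1 - real (t0 + i)"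
  using live_time[OF assms] live_pos[OF assms] by (simp add: act_def of_nat_diff)

lemma typical_iff: "live i G \<Longrightarrow> typical K G \<longleftrightarrow> \<bar>real (nverts G) - p * real (t0 + i)\<bar> \<le> K"
  using live_time[of i G] unfolding typical_def of_nat_add[symmetric] by simp

lemma typical_act_ge: assumes "live i G" "typical K G" shows "(2 * p - 1) * real (t0 + i) - 2 * K \<le> real (act G)"
  using assms(2) unfolding typical_iff[OF assms(1)] live_act[OF assms(1)] by (simp add: algebra_simps abs_le_iff)

lemma typical_oldest: assumes "live i G" "typical K G"
  shows "(1 - p) * real (t0 + i) - K \<le> real (oldest G)" "real (oldest G) \<le> (1 - p) * real (t0 + i) + K"
proof -
  have "real (oldest G) = real (t0 + i) - real (nverts G)" using live_time[OF assms(1)] by linarith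
  then show "(1 - p) * real (t0 + i) - K \<le> real (oldest G)" "real (oldest G) \<le> (1 - p) * real (t0 + i) + K"
    using assms(2) unfolding typical_iff[OF assms(1)] by (auto simp: algebra_simps abs_le_iff)
qed

lemma act_le: assumes "live i G" shows "real (act G) \<le> real (t0 + i)"
proof -
  have "nverts G + 1 \<le> oldest G + nverts G" using live_pos[OF assms] by simp
  then show ?thesis using live_time[OF assms] by (simp add: act_def)
qed

text \<open>At time \<open>v0\<close> no vertex beyond \<open>v0\<close> exists, so the sum starts
  at 0. Afterwards it grows by a relative amount of order \<open>1 / A\<close> per step, with
  \<open>A\<close> a lower bound for \<open>act\<close> on typical graphs, so a total of order
  \<open>n\<close> is kept when \<open>A\<close> has order \<open>n\<close>. Atypical graphs enter
  through the crude bound by the squared total degree times their probability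
  \<open>\<pi>\<close>.\<close>

lemma S_bound:
  fixes n v0 :: nat and K A \<pi> :: real
  defines "A \<equiv> (2 * p - 1) * real v0 - 2 * K"
  assumes v0: "t0 \<le> v0" and A: "3 * real m \<le> A"
    and \<pi>: "\<And>i. t0 + i \<le> n \<Longrightarrow> Ea i (\<lambda>G. of_bool (\<not> typical K G)) \<le> \<pi>" "0 \<le> \<pi>"
    and t: "v0 \<le> t0 + i" "t0 + i \<le> n"
  shows "Ea i (Ssq v0) \<le> exp (2 * (real m + 2) * real n / A) * (real n * ((real m)\<^sup>2 + (2 * real m * (real n + 1))\<^sup>2 * \<pi>))"
proof -
  define i0 where "i0 = v0 - t0"
  define k where "k = i - i0"
  have i: "i = i0 + k" "t0 + i0 = v0" using v0 t by (auto simp: i0_def k_def)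
  have A0: "0 < A" using A m by linarith
  define x where "x = 2 * (real m + 2) / A"
  define M where "M = (2 * real m * (real n + 1))\<^sup>2"
  define b where "b = (real m)\<^sup>2 + M * \<pi>"
  have x0: "0 \<le> x" using A0 by (simp add: x_def)
  have b0: "0 \<le> b" using \<pi> by (simp add: b_def M_def)
  have start: "Ea i0 (Ssq v0) = 0"
  proof -
    have "Ea i0 (Ssq v0) \<le> Ea i0 (\<lambda>_. 0)"
    proof (rule Ea_mono)
      fix G assume "live i0 G"
      from live_time[OF this] i have "nverts G \<le> v0" by simp
      then show "Ssq v0 G \<le> 0" by (simp add: Ssq_def)
    qed
    moreover have "0 \<le> Ea i0 (Ssq v0)" by (rule Ea_nonneg) (rule Ssq_nonneg)
    moreover have "Ea i0 (\<lambda>_. 0) \<le> 0" by (rule Ea_const_le) simp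
    ultimately show ?thesis by simp
  qed
  have "Ea (i0 + k) (Ssq v0) \<le> (1 + x) ^ k * (\<bar>Ea i0 (Ssq v0)\<bar> + real k * b)"
  proof (rule linear_recursion_bound[of x b k "\<lambda>i. Ea i (Ssq v0)", OF x0 b0])
    fix j assume j: "j < k"
    define l where "l = i0 + j"
    have l: "v0 \<le> t0 + l" "t0 + Suc l \<le> n" using i j t by (auto simp: l_def)
    have "Ea (Suc l) (Ssq v0) \<le> Ea l (\<lambda>G. ((1 + x) * Ssq v0 G + (real m)\<^sup>2) + M * of_bool (\<not> typical K G))"
    proof (rule Ea_step_nonneg)
      fix G assume G: "live l G"
      show "ex (step repl m p G) (Ssq v0) \<le> ((1 + x) * Ssq v0 G + (real m)\<^sup>2) + M * of_bool (\<not> typical K G)"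
      proof (cases "typical K G")
        case True
        have "A \<le> (2 * p - 1) * real (t0 + l) - 2 * K"
          unfolding A_def using l p by (intro diff_right_mono mult_left_mono) auto
        then have act: "A \<le> real (act G)" using typical_act_ge[OF G True] by linarith
        then have "3 * m \<le> act G" using A by linarith
        then interpret draws m G repl using live_alive[OF G] by (simp add: draws_def draws_axioms_def)
        have "3 * real m * (real m + 2) / D \<le> x"
        proof -
          have "3 * real m * (real m + 2) / D = 3 / 2 * (real m + 2) / real (act G)"
            using m act_pos by (simp add: D_def field_simps)
          also have "\<dots> \<le> 2 * (real m + 2) / A" using act A0 by (intro frac_le) auto
          finally show ?thesis by (simp add: x_def)
        qed
        then have "Ssq v0 G * (1 + 3 * real m * (real m + 2) / D) \<le> Ssq v0 G * (1 + x)"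
          using Ssq_nonneg by (intro mult_left_mono) auto
        then show ?thesis using S_step[OF p01, of v0] True by (simp add: mult.commute)
      next
        case False
        have "Ssq v0 G' \<le> M" if G': "G' \<in> set_pmf (step repl m p G)" for G'
        proof -
          have "good_graph m G'" "oldest G' + nverts G' = t0 + l + 1"
            using step_facts(2,3)[OF live_good[OF G]] G' G live_time[OF G] by (auto simp: live_def)
          moreover from this have "act G' \<le> n + 1" using l by (auto simp: act_def)
          ultimately have "Ssq v0 G' \<le> (2 * real m * real (act G'))\<^sup>2" "real (act G') \<le> real n + 1"
            using sum_degree_sq_le by auto
          moreover from this have "(2 * real m * real (act G'))\<^sup>2 \<le> M"
            unfolding M_def by (intro power_mono mult_left_mono) auto
          ultimately show ?thesis by linarith
        qed
        then have "ex (step repl m p G) (Ssq v0) \<le> ex (step repl m p G) (\<lambda>_. M)"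
          using step_facts(1)[OF live_good[OF G]] by (intro ex_mono)
        moreover have "0 \<le> (1 + x) * Ssq v0 G + (real m)\<^sup>2" using x0 Ssq_nonneg by simp
        ultimately show ?thesis using False by simp
      qed
    qed (rule Ssq_nonneg)
    also have "\<dots> = ((1 + x) * Ea l (Ssq v0) + Ea l (\<lambda>_. (real m)\<^sup>2)) + M * Ea l (\<lambda>G. of_bool (\<not> typical K G))"
      by (simp only: Ea_add Ea_cmult)
    also have "\<dots> \<le> ((1 + x) * Ea l (Ssq v0) + (real m)\<^sup>2) + M * \<pi>"
      using l \<pi> x0 by (intro add_mono mult_left_mono Ea_const_le \<pi>(1)) (auto simp: M_def)
    finally show "Ea (i0 + Suc j) (Ssq v0) \<le> (1 + x) * Ea (i0 + j) (Ssq v0) + b" by (simp add: b_def l_def)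
  qed
  also have "\<dots> = (1 + x) ^ k * (real k * b)" by (simp add: start)
  also have "\<dots> \<le> exp (2 * (real m + 2) * real n / A) * (real n * b)"
  proof (rule mult_mono)
    have "(1 + x) ^ k \<le> exp x ^ k" using exp_ge_add_one_self[of x] x0 by (intro power_mono) auto
    also have "\<dots> = exp (real k * x)" by (simp add: exp_of_nat_mult)
    also have "\<dots> \<le> exp (real n * x)" using i t x0 by (simp add: mult_right_mono)
    finally show "(1 + x) ^ k \<le> exp (2 * (real m + 2) * real n / A)" by (simp add: x_def mult_ac)
    show "real k * b \<le> real n * b" using i t b0 by (intro mult_right_mono) auto
  qed (use b0 in auto)
  finally show ?thesis using i by (simp add: b_def M_def)
qed

text \<open>Two times are involved. Vertices up to \<open>v0\<close> count as old, and decay is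
  observed from the later time \<open>T\<close> on, when a typical graph contains all of them and
  its oldest vertex is at least \<open>I\<close>. The square sums \<open>s\<close> of the younger
  vertices drive the inhomogeneous term.\<close>

lemma U_bound:
  fixes n v0 T :: nat and K A \<pi> s :: real
  defines "A \<equiv> (2 * p - 1) * real v0 - 2 * K" and "I \<equiv> (1 - p) * real T - K"
  assumes v0: "t0 \<le> v0" "v0 \<le> T" "real v0 \<le> p * real T - K" and A: "3 * real m \<le> A" and K: "0 \<le> K"
    and ratio: "5 * K + 2 \<le> p * (1 - p) * real T" and I: "0 < I"
    and \<pi>: "\<And>i. t0 + i \<le> n \<Longrightarrow> Ea i (\<lambda>G. of_bool (\<not> typical K G)) \<le> \<pi>" "0 \<le> \<pi>"
    and s: "\<And>i. v0 \<le> t0 + i \<Longrightarrow> t0 + i \<le> n \<Longrightarrow> Ea i (Ssq v0) \<le> s" "0 \<le> s"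
    and t: "T \<le> t0 + i" "t0 + i \<le> n"
  shows "Ea i (Uold v0) \<le> ((real T + 1) / (real (t0 + i) + 1)) powr ((1 - p) / 4) * (2 * real m * real T / I + 2 * real m * (real n + 1) * \<pi>)
     + real n * (s / (A\<^sup>2 * I) + 2 * real m / I\<^sup>2 + 2 * real m * (real n + 1) * \<pi>)"
proof -
  define i0 where "i0 = T - t0"
  define k where "k = i - i0"
  have i: "i = i0 + k" "t0 + i0 = T" using v0 t by (auto simp: i0_def k_def)
  have A0: "0 < A" using A m by linarith
  define c where "c = (1 - p) / 4"
  have c: "0 \<le> c" "c \<le> 1" using p by (auto simp: c_def)
  define M where "M = 2 * real m * (real n + 1)"
  have M0: "0 \<le> M" by (simp add: M_def)
  define b where "b = s / (A\<^sup>2 * I) + 2 * real m / I\<^sup>2 + M * \<pi>"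
  have b0: "0 \<le> b" using s \<pi> I M0 by (auto simp: b_def)
  have Inn: "0 \<le> Uold v0 G" if "live l G" for l G using Uold_nonneg[OF live_good[OF that] m] .
  have UM: "Uold v0 G \<le> 2 * real m * real (act G) / real (oldest G)" if g: "good_graph m G" for G
    using Uold_le_Bold[OF g, of v0] divide_right_mono[OF Bold_le[OF g, of v0], of "real (oldest G)"] by simp
  have UM': "Uold v0 G \<le> M" if g: "good_graph m G" and "oldest G + nverts G \<le> n + 1" for G
  proof -
    have o: "1 \<le> oldest G" using g by (simp add: good_graph_def)
    have "2 * real m * real (act G) / real (oldest G) \<le> 2 * real m * real (act G) / 1"
      using o by (intro divide_left_mono) auto
    moreover have "real (act G) \<le> real n + 1" using that o by (simp add: act_def)
    then have "2 * real m * real (act G) \<le> M" unfolding M_def by (intro mult_left_mono) auto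
    ultimately show ?thesis using UM[OF g] by linarith
  qed
  have oI: "I \<le> real (oldest G)" if "live l G" "typical K G" "T \<le> t0 + l" for l G
  proof -
    have "I \<le> (1 - p) * real (t0 + l) - K" unfolding I_def using that(3) p by (intro diff_right_mono mult_left_mono) auto
    then show ?thesis using typical_oldest(1)[OF that(1,2)] by linarith
  qed
  have start: "Ea i0 (Uold v0) \<le> 2 * real m * real T / I + M * \<pi>"
  proof -
    have "Ea i0 (Uold v0) \<le> Ea i0 (\<lambda>G. 2 * real m * real T / I + M * of_bool (\<not> typical K G))"
    proof (rule Ea_mono)
      fix G assume G: "live i0 G"
      show "Uold v0 G \<le> 2 * real m * real T / I + M * of_bool (\<not> typical K G)"
      proof (cases "typical K G")
        case True
        have "2 * real m * real (act G) / real (oldest G) \<le> 2 * real m * real T / I"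
          using act_le[OF G] oI[OF G True] i I by (intro frac_le mult_left_mono) auto
        then show ?thesis using UM[OF live_good[OF G]] True by simp
      next
        case False
        have "0 \<le> 2 * real m * real T / I" using I by simp
        then show ?thesis using UM'[OF live_good[OF G]] live_time[OF G] i t False by simp
      qed
    qed
    also have "\<dots> \<le> 2 * real m * real T / I + M * \<pi>"
      unfolding Ea_add Ea_cmult using M0 I i t by (intro add_mono Ea_const_le mult_left_mono \<pi>(1)) auto
    finally show ?thesis .
  qed
  have "Ea (i0 + k) (Uold v0) \<le> ((real T + 1) / (real (T + k) + 1)) powr c * Ea i0 (Uold v0) + real k * b"
  proof (rule decay_recursion_bound[of c b k "\<lambda>i. Ea i (Uold v0)", OF c b0])
    show "0 \<le> Ea (i0 + j) (Uold v0)" for j by (rule Ea_nonneg) (rule Inn)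
    fix j assume j: "j < k"
    define l where "l = i0 + j"
    have l: "T \<le> t0 + l" "t0 + Suc l \<le> n" "t0 + l = T + j" using i j t by (auto simp: l_def)
    define x where "x = 1 - c / (real (T + j) + 1)"
    have x: "0 \<le> x" using c by (simp add: x_def field_simps)
    have "Ea (Suc l) (Uold v0) \<le> Ea l (\<lambda>G. (x * Uold v0 G + 1 / (A\<^sup>2 * I) * Ssq v0 G) + (2 * real m / I\<^sup>2 + M * of_bool (\<not> typical K G)))"
    proof (rule Ea_step)
      fix G assume G: "live l G"
      have g: "good_graph m G" by (rule live_good[OF G])
      have g': "good_graph m G'" "oldest G' + nverts G' = t0 + l + 1" if "G' \<in> set_pmf (step repl m p G)" for G'
        using step_facts(2,3)[OF g] that G live_time[OF G] by (auto simp: live_def)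
      show "ex (step repl m p G) (\<lambda>G'. if edges G' = {#} then 0 else Uold v0 G') \<le> (x * Uold v0 G + 1 / (A\<^sup>2 * I) * Ssq v0 G) + (2 * real m / I\<^sup>2 + M * of_bool (\<not> typical K G))"
      proof (cases "typical K G")
        case True
        have "A \<le> (2 * p - 1) * real (t0 + l) - 2 * K"
          unfolding A_def using l v0 p by (intro diff_right_mono mult_left_mono) auto
        then have act: "A \<le> real (act G)" using typical_act_ge[OF G True] by linarith
        then have "3 * m \<le> act G" using A by linarith
        then interpret draws m G repl using live_alive[OF G] by (simp add: draws_def draws_axioms_def)
        have nv: "p * real (t0 + l) - K \<le> real (nverts G)"
          using True unfolding typical_iff[OF G] by (simp add: abs_le_iff)
        have Tl: "p * real T \<le> p * real (t0 + l)" using l p by (intro mult_left_mono) auto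
        then have v: "v0 \<le> nverts G" using v0(3) nv by linarith
        have o: "real (oldest G) \<le> (1 - p) * real (t0 + l) + K" by (rule typical_oldest(2)[OF G True])
        have oi: "I \<le> real (oldest G)" by (rule oI[OF G True l(1)])
        \<comment> \<open>With \<open>X = p * (1 - p) * t\<close> this reduces to
          \<open>2 * p * K + 2 * p + 3 * (1 - p) * K \<le> X\<close>, which explains the hypothesis
          with \<open>5 * K + 2\<close>.\<close>
        have rt: "2 * p * (real (oldest G) + 1) \<le> 3 * (1 - p) * (real (nverts G) + 1)"
        proof -
          have r1: "5 * K + 2 \<le> p * (1 - p) * real (t0 + l)"
          proof -
            have "p * (1 - p) * real T \<le> p * (1 - p) * real (t0 + l)" using l p by (intro mult_left_mono) auto
            then show ?thesis using ratio by linarith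
          qed
          have "2 * p * (real (oldest G) + 1) \<le> 2 * p * ((1 - p) * real (t0 + l) + K + 1)"
            using o p by (intro mult_left_mono) auto
          also have "\<dots> = 2 * (p * (1 - p) * real (t0 + l)) + 2 * p * K + 2 * p" by (simp add: algebra_simps)
          also have "\<dots> \<le> 3 * (p * (1 - p) * real (t0 + l)) - 3 * (1 - p) * K"
          proof -
            have "2 * p * K \<le> 2 * K" "3 * (1 - p) * K \<le> 3 * K" using mult_right_mono[of "2 * p" 2 K] mult_right_mono[of "3 * (1 - p)" 3 K] p K by auto
            then show ?thesis using r1 p by linarith
          qed
          also have "\<dots> = 3 * (1 - p) * (p * real (t0 + l) - K)" by (simp add: algebra_simps)
          also have "\<dots> \<le> 3 * (1 - p) * (real (nverts G) + 1)" using nv p by (intro mult_left_mono) auto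
          finally show ?thesis .
        qed
        have "ex (step repl m p G) (\<lambda>G'. if edges G' = {#} then 0 else Uold v0 G') \<le> ex (step repl m p G) (Uold v0)"
          using step_facts(1)[OF g] g'(1) Uold_nonneg[OF _ m] by (intro ex_mono) auto
        also have "\<dots> \<le> Uold v0 G * (1 - (1 - p) / (4 * (real (oldest G) + 1)))
          + 3 * (real m)\<^sup>2 * (Ssq v0 G / D\<^sup>2) / real (oldest G) + 2 * real m / (real (oldest G))\<^sup>2"
          by (rule U_step[OF p01 v rt])
        also have "Uold v0 G * (1 - (1 - p) / (4 * (real (oldest G) + 1))) \<le> Uold v0 G * x"
        proof (rule mult_left_mono[OF _ Inn[OF G]])
          have "oldest G \<le> T + j" using live_time[OF G] l by simp
          then have "c / (real (T + j) + 1) \<le> c / (real (oldest G) + 1)" using c by (intro divide_left_mono) auto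
          then show "1 - (1 - p) / (4 * (real (oldest G) + 1)) \<le> x" by (simp add: x_def c_def)
        qed
        also have "3 * (real m)\<^sup>2 * (Ssq v0 G / D\<^sup>2) / real (oldest G) \<le> 1 / (A\<^sup>2 * I) * Ssq v0 G"
        proof -
          have "3 * (real m)\<^sup>2 * (Ssq v0 G / D\<^sup>2) / real (oldest G) = 3 / 4 * Ssq v0 G / ((real (act G))\<^sup>2 * real (oldest G))"
            using m act_pos by (simp add: D_def field_simps power2_eq_square)
          also have "\<dots> \<le> Ssq v0 G / (A\<^sup>2 * I)"
            using Ssq_nonneg[of v0 G] act A0 oi I by (intro frac_le mult_mono power_mono mult_pos_pos) auto
          finally show ?thesis by simp
        qed
        also have "2 * real m / (real (oldest G))\<^sup>2 \<le> 2 * real m / I\<^sup>2"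
          using oi I by (intro divide_left_mono power_mono mult_pos_pos) auto
        finally show ?thesis using True by (simp add: mult.commute)
      next
        case False
        have "(if edges G' = {#} then 0 else Uold v0 G') \<le> M" if "G' \<in> set_pmf (step repl m p G)" for G'
          using UM'[OF g'(1)[OF that]] g'(2)[OF that] l M0 by auto
        then have "ex (step repl m p G) (\<lambda>G'. if edges G' = {#} then 0 else Uold v0 G') \<le> ex (step repl m p G) (\<lambda>_. M)"
          using step_facts(1)[OF g] by (intro ex_mono)
        moreover have "0 \<le> x * Uold v0 G" "0 \<le> 1 / (A\<^sup>2 * I) * Ssq v0 G" "0 \<le> 2 * real m / I\<^sup>2"
          using x Inn[OF G] Ssq_nonneg[of v0 G] I by auto
        moreover have "M * of_bool (\<not> typical K G) = M" using False by simp
        moreover have "ex (step repl m p G) (\<lambda>_. M) = M" by simp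
        ultimately show ?thesis by linarith
      qed
    qed
    also have "\<dots> = (x * Ea l (Uold v0) + 1 / (A\<^sup>2 * I) * Ea l (Ssq v0)) + (Ea l (\<lambda>_. 2 * real m / I\<^sup>2) + M * Ea l (\<lambda>G. of_bool (\<not> typical K G)))"
      by (simp only: Ea_add Ea_cmult)
    also have "\<dots> \<le> (x * Ea l (Uold v0) + 1 / (A\<^sup>2 * I) * s) + (2 * real m / I\<^sup>2 + M * \<pi>)"
      using l v0 I M0 x by (intro add_mono mult_left_mono Ea_const_le \<pi>(1) s(1)) auto
    finally show "Ea (i0 + Suc j) (Uold v0) \<le> (1 - c / (real (T + j) + 1)) * Ea (i0 + j) (Uold v0) + b"
      by (simp add: b_def x_def l_def)
  qed
  also have "\<dots> \<le> ((real T + 1) / (real (t0 + i) + 1)) powr c * (2 * real m * real T / I + M * \<pi>) + real n * b"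
  proof -
    have Tk: "T + k = t0 + i" using i by simp
    show ?thesis unfolding Tk by (intro add_mono mult_left_mono[OF start] mult_right_mono) (use b0 i t in auto)
  qed
  finally show ?thesis using i by (simp add: b_def M_def c_def)
qed

end

context process_run begin

text \<open>The parameter \<open>c\<close> trades the half-edges born shortly after the oldest
  vertex, of proportion about \<open>c\<close>, against a factor \<open>1 / c\<close> on
  \<open>Uold\<close>.\<close>

lemma kappa_pointwise:
  assumes G: "live i G" "typical K G" and t: "4 * K \<le> (2 * p - 1) * real (t0 + i)"
    and c: "0 < c" "c \<le> 1" and A: "0 < A" "A \<le> real (act G)"
  shows "kappa m G \<le> 2 / (2 * p - 1) * (c + 1 / real (t0 + i)) + (2 / (c * real m * (2 * p - 1)) * Uold v0 G + 1 / A\<^sup>2 * Ssq v0 G)"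
proof -
  define tt where "tt = real (t0 + i)"
  define D where "D = 2 * real m * real (act G)"
  define a where "a = 2 * p - 1"
  have g: "good_graph m G" by (rule live_good[OF G(1)])
  have a: "0 < a" using p by (simp add: a_def)
  have tpos: "0 < tt" using live_time[OF G(1)] live_pos[OF G(1)] by (simp add: tt_def)
  have o: "real (oldest G) \<le> tt" "0 < real (oldest G)" using live_time[OF G(1)] live_pos[OF G(1)] by (auto simp: tt_def)
  have act: "a * tt / 2 \<le> real (act G)" using typical_act_ge[OF G] t by (simp add: a_def tt_def)
  have D: "real m * (a * tt) \<le> D" using act m by (simp add: D_def)
  have D0: "0 < real m * (a * tt)" using m a tpos by simp
  have U0: "0 \<le> Uold v0 G" by (rule Uold_nonneg[OF g m])
  have "Bold v0 G \<le> 2 * real m * (c * real (oldest G) + 1) + (1 + c) / c * real (oldest G) * Uold v0 G"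
    by (rule Bold_le_Uold[OF g m c(1)])
  also have "\<dots> \<le> 2 * real m * (c * tt + 1) + 2 / c * tt * Uold v0 G"
    using o c U0 by (intro add_mono mult_mono add_right_mono mult_left_mono divide_right_mono) auto
  finally have B: "Bold v0 G \<le> 2 * real m * (c * tt + 1) + 2 / c * tt * Uold v0 G" .
  have "Bold v0 G / D \<le> (2 * real m * (c * tt + 1) + 2 / c * tt * Uold v0 G) / (real m * (a * tt))"
    using B D D0 Bold_nonneg by (intro frac_le) (auto intro: order_trans[OF Bold_nonneg])
  also have "\<dots> = 2 / a * (c + 1 / tt) + 2 / (c * real m * a) * Uold v0 G"
    using a tpos c m by (simp add: field_simps)
  finally have 1: "Bold v0 G / D \<le> 2 / a * (c + 1 / tt) + 2 / (c * real m * a) * Uold v0 G" .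
  have "A \<le> D" 
  proof -
    have "1 * real (act G) \<le> 2 * real m * real (act G)" using m by (intro mult_right_mono) auto
    then show ?thesis using A unfolding D_def by linarith
  qed
  then have 2: "Ssq v0 G / D\<^sup>2 \<le> 1 / A\<^sup>2 * Ssq v0 G"
    using A Ssq_nonneg[of v0 G] by (simp add: divide_left_mono power_mono)
  have "kappa m G \<le> Bold v0 G / D + Ssq v0 G / D\<^sup>2"
    unfolding D_def by (rule kappa_le_Bold[OF g]) (use D0 D in \<open>simp add: D_def\<close>)
  then show ?thesis using 1 2 by (simp add: a_def tt_def)
qed

end

section \<open>Concentration of the potential\<close>

text \<open>The exponent lies strictly between \<open>1/2\<close> and 1: deviations of this size are
  negligible against \<open>n\<close>, while \<open>KK n / sqrt n\<close> is a power of
  \<open>n\<close>, so \<open>PIE n\<close> beats every polynomial loss.\<close>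

definition KK :: "nat \<Rightarrow> real" where "KK n = real n powr (3/4)"
definition PIE :: "nat \<Rightarrow> real" where "PIE n = 2 * exp (2 - KK n / sqrt (real n))"

lemma PIE_bound:
  assumes "process_run m p H" "1 \<le> n" "real (oldest H + nverts H) \<le> sqrt (real n)" "process_run.t0 H + i \<le> n"
  shows "process_run.Ea m p repl H i (\<lambda>G. of_bool (\<not> process_run.typical p (KK n) G)) \<le> PIE n"
proof -
  interpret process_run m p repl H by (rule assms)
  show ?thesis unfolding PIE_def by (rule atypical) (use assms in \<open>auto simp: t0_def\<close>)
qed

lemma nat_ceiling_div_tendsto:
  assumes "0 \<le> c" shows "(\<lambda>n. real (nat \<lceil>c * real n\<rceil>) / real n) \<longlonglongrightarrow> c"
proof (rule tendsto_sandwich[of "\<lambda>_. c" _ _ "\<lambda>n. c + 1 / real n"])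
  have "c * real n \<le> real (nat \<lceil>c * real n\<rceil>)" "real (nat \<lceil>c * real n\<rceil>) \<le> c * real n + 1" for n
  proof -
    have "0 \<le> c * real n" using assms by simp
    then show "c * real n \<le> real (nat \<lceil>c * real n\<rceil>)" "real (nat \<lceil>c * real n\<rceil>) \<le> c * real n + 1" by linarith+
  qed
  then show "\<forall>\<^sub>F n in sequentially. c \<le> real (nat \<lceil>c * real n\<rceil>) / real n"
    "\<forall>\<^sub>F n in sequentially. real (nat \<lceil>c * real n\<rceil>) / real n \<le> c + 1 / real n"
    by (auto intro!: eventually_mono[OF eventually_gt_at_top[of 0]] simp: field_simps)
  show "(\<lambda>n. c + 1 / real n) \<longlonglongrightarrow> c" by real_asymp
qed simp

lemma eventually_pos_of_ratio:
  assumes "(\<lambda>n. f n / real n) \<longlonglongrightarrow> c" "0 < c"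
  shows "\<forall>\<^sub>F n in sequentially. 0 < f n"
  using order_tendstoD(1)[OF assms] eventually_gt_at_top[of 0]
  by eventually_elim (auto simp: zero_less_divide_iff)

text \<open>\<open>c\<close> is fixed by \<open>\<eta>\<close>, then \<open>e1\<close> by
  \<open>c\<close>; old means born before time \<open>e1 * n\<close>. Between times of order
  \<open>e1 * n\<close> and \<open>\<epsilon> * n\<close> the old weight shrinks by a power of
  \<open>e1 / \<epsilon>\<close>, and all other terms vanish as \<open>n\<close> grows.\<close>

lemma kappa_small:
  fixes m :: nat and p \<eta> \<epsilon> :: real and repl :: bool
  assumes m: "1 \<le> m" and p: "1 / 2 < p" "p < 1" and \<eta>: "0 < \<eta>" and \<epsilon>: "0 < \<epsilon>"
  shows "\<forall>\<^sub>F n in sequentially. \<forall>H i. process_run m p H \<longrightarrow> real (oldest H + nverts H) \<le> sqrt (real n) \<longrightarrow>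
     \<epsilon> * real n \<le> real (process_run.t0 H + i) \<longrightarrow> process_run.t0 H + i \<le> n \<longrightarrow>
     process_run.Ea m p repl H i (\<lambda>G. if process_run.typical p (KK n) G then kappa m G else 0) \<le> \<eta>"
proof -
  define a where "a = 2 * p - 1"
  have a: "0 < a" "a < 1" using p by (auto simp: a_def)
  define c where "c = min 1 (\<eta> * a / 16)"
  have c: "0 < c" "c \<le> 1" "2 / a * c \<le> \<eta> / 8" using \<eta> a by (auto simp: c_def min_def field_simps)
  define C5 where "C5 = 2 / (c * real m * a)"
  have C5: "0 < C5" using c m a by (simp add: C5_def)
  \<comment> \<open>The first summand is the limit of \<open>2 * m * T n / I n\<close>, which bounds
    the initial value of \<open>Uold\<close>; the 1 is slack.\<close>
  define C4 where "C4 = 2 * real m / (1 - p) + 1"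
  have C4: "0 < C4" using p m by (simp add: C4_def add_pos_pos)
  define c0 where "c0 = (1 - p) / 4"
  have c0: "0 < c0" using p by (simp add: c0_def)
  have "((\<lambda>x. (4 * x / \<epsilon>) powr c0 * (C4 * C5)) \<longlongrightarrow> (4 * 0 / \<epsilon>) powr c0 * (C4 * C5)) (at_right 0)"
    using c0 \<epsilon> by (intro tendsto_intros tendsto_powr2) (auto simp: eventually_at_right_less intro!: eventually_at_right_less[THEN eventually_mono])
  then have "\<forall>\<^sub>F x in at_right 0. (4 * x / \<epsilon>) powr c0 * (C4 * C5) < \<eta> / 4"
    by (rule order_tendstoD) (use \<eta> in simp)
  moreover have "\<forall>\<^sub>F x in at_right 0. x < \<epsilon> / 4" using \<epsilon> by (intro eventually_at_right_field[THEN iffD2] exI[of _ "\<epsilon> / 4"]) auto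
  moreover have "\<forall>\<^sub>F x in at_right 0. (0::real) < x" by (rule eventually_at_right_less)
  ultimately have "\<forall>\<^sub>F x in at_right 0. (4 * x / \<epsilon>) powr c0 * (C4 * C5) < \<eta> / 4 \<and> x < \<epsilon> / 4 \<and> 0 < x"
    by eventually_elim simp
  then obtain e1 where e1: "0 < e1" "e1 < \<epsilon> / 4" "(4 * e1 / \<epsilon>) powr c0 * (C4 * C5) < \<eta> / 4"
    using eventually_happens'[OF trivial_limit_at_right_real] by blast
  define v where "v n = nat \<lceil>e1 * real n\<rceil>" for n
  \<comment> \<open>The factor 3 suffices for \<open>v n \<le> p * T n - KK n\<close>, as
    \<open>3 * p > 1\<close>; together with \<open>e1 < \<epsilon> / 4\<close> it keeps
    \<open>T n\<close> below \<open>\<epsilon> * n\<close>.\<close>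
  define T where "T n = nat \<lceil>3 * e1 * real n\<rceil>" for n
  define A where "A n = a * real (v n) - 2 * KK n" for n
  define I where "I n = (1 - p) * real (T n) - KK n" for n
  define S where "S n = exp (2 * (real m + 2) * real n / A n) * (real n * ((real m)\<^sup>2 + (2 * real m * (real n + 1))\<^sup>2 * PIE n))" for n
  define M where "M n = 2 * real m * (real n + 1) * PIE n" for n
  have K: "(\<lambda>n. KK n / real n) \<longlonglongrightarrow> 0" unfolding KK_def by real_asymp
  have v: "(\<lambda>n. real (v n) / real n) \<longlonglongrightarrow> e1" unfolding v_def by (rule nat_ceiling_div_tendsto) (use e1 in simp)
  have T: "(\<lambda>n. real (T n) / real n) \<longlonglongrightarrow> 3 * e1" unfolding T_def by (rule nat_ceiling_div_tendsto) (use e1 in simp)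
  have A: "(\<lambda>n. A n / real n) \<longlonglongrightarrow> a * e1"
  proof -
    have "(\<lambda>n. a * (real (v n) / real n) - 2 * (KK n / real n)) \<longlonglongrightarrow> a * e1 - 2 * 0" by (intro tendsto_intros v K)
    then show ?thesis by (simp add: A_def diff_divide_distrib)
  qed
  have I: "(\<lambda>n. I n / real n) \<longlonglongrightarrow> (1 - p) * (3 * e1)"
  proof -
    have "(\<lambda>n. (1 - p) * (real (T n) / real n) - KK n / real n) \<longlonglongrightarrow> (1 - p) * (3 * e1) - 0" by (intro tendsto_intros T K)
    then show ?thesis by (simp add: I_def diff_divide_distrib)
  qed
  have nM: "(\<lambda>n. real n * M n) \<longlonglongrightarrow> 0" unfolding M_def PIE_def KK_def by real_asymp
  have M: "M \<longlonglongrightarrow> 0" unfolding M_def PIE_def KK_def by real_asymp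
  have Pi2: "(\<lambda>n. (2 * real m * (real n + 1))\<^sup>2 * PIE n) \<longlonglongrightarrow> 0"
  proof -
    have "(\<lambda>n. (real n + 1)\<^sup>2 * PIE n) \<longlonglongrightarrow> 0" unfolding PIE_def KK_def by real_asymp
    from tendsto_mult_right_zero[OF this, of "(2 * real m)\<^sup>2"] show ?thesis by (simp add: power_mult_distrib mult.assoc)
  qed
  have ae: "a * e1 \<noteq> 0" "(1 - p) * (3 * e1) \<noteq> 0" using a e1 p by auto
  have S: "(\<lambda>n. S n / real n) \<longlonglongrightarrow> exp (2 * (real m + 2) * (1 / (a * e1))) * ((real m)\<^sup>2 + 0)"
  proof (rule Lim_transform_eventually)
    show "(\<lambda>n. exp (2 * (real m + 2) * (1 / (A n / real n))) * ((real m)\<^sup>2 + (2 * real m * (real n + 1))\<^sup>2 * PIE n)) \<longlonglongrightarrow>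
       exp (2 * (real m + 2) * (1 / (a * e1))) * ((real m)\<^sup>2 + 0)"
      by (intro tendsto_intros A Pi2 ae)
    show "\<forall>\<^sub>F n in sequentially. exp (2 * (real m + 2) * (1 / (A n / real n))) * ((real m)\<^sup>2 + (2 * real m * (real n + 1))\<^sup>2 * PIE n) = S n / real n"
      by (rule eventually_mono[OF eventually_gt_at_top[of 0]]) (simp add: S_def)
  qed
  have SA: "(\<lambda>n. S n / (A n)\<^sup>2) \<longlonglongrightarrow> 0"
  proof (rule Lim_transform_eventually)
    show "(\<lambda>n. (S n / real n) / (A n / real n)\<^sup>2 * (1 / real n)) \<longlonglongrightarrow> 0"
      using tendsto_mult[OF tendsto_divide[OF S tendsto_power[OF A, of 2]] lim_1_over_n] ae by simp
    show "\<forall>\<^sub>F n in sequentially. (S n / real n) / (A n / real n)\<^sup>2 * (1 / real n) = S n / (A n)\<^sup>2"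
      by (rule eventually_mono[OF eventually_gt_at_top[of 0]]) (simp add: power2_eq_square)
  qed
  have err: "(\<lambda>n. real n * (S n / ((A n)\<^sup>2 * I n) + 2 * real m / (I n)\<^sup>2 + M n)) \<longlonglongrightarrow> 0"
  proof (rule Lim_transform_eventually)
    show "(\<lambda>n. (S n / (A n)\<^sup>2) / (I n / real n) + 2 * real m / (I n / real n)\<^sup>2 * (1 / real n) + real n * M n) \<longlonglongrightarrow> 0"
      using tendsto_add[OF tendsto_add[OF tendsto_divide[OF SA I ae(2)] tendsto_mult[OF tendsto_divide[OF tendsto_const tendsto_power[OF I, of 2]] lim_1_over_n]] nM, of "2 * real m"] ae
      by simp
    show "\<forall>\<^sub>F n in sequentially. (S n / (A n)\<^sup>2) / (I n / real n) + 2 * real m / (I n / real n)\<^sup>2 * (1 / real n) + real n * M n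
      = real n * (S n / ((A n)\<^sup>2 * I n) + 2 * real m / (I n)\<^sup>2 + M n)"
      by (rule eventually_mono[OF eventually_gt_at_top[of 0]]) (simp add: power2_eq_square field_simps)
  qed
  have TI: "(\<lambda>n. 2 * real m * real (T n) / I n + M n) \<longlonglongrightarrow> C4 - 1"
  proof (rule Lim_transform_eventually)
    have "(\<lambda>n. 2 * real m * (real (T n) / real n) / (I n / real n) + M n) \<longlonglongrightarrow> 2 * real m * (3 * e1) / ((1 - p) * (3 * e1)) + 0"
      by (intro tendsto_intros T I M ae)
    moreover have "2 * real m * x / ((1 - p) * x) + 0 = C4 - 1" if "x \<noteq> 0" for x
      using that by (simp add: C4_def)
    from this[of "3 * e1"] have "2 * real m * (3 * e1) / ((1 - p) * (3 * e1)) + 0 = C4 - 1" using e1 by simp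
    ultimately show "(\<lambda>n. 2 * real m * (real (T n) / real n) / (I n / real n) + M n) \<longlonglongrightarrow> C4 - 1" by (simp only:)
    show "\<forall>\<^sub>F n in sequentially. 2 * real m * (real (T n) / real n) / (I n / real n) + M n = 2 * real m * real (T n) / I n + M n"
      by (rule eventually_mono[OF eventually_gt_at_top[of 0]]) simp
  qed
  have ev: "\<forall>\<^sub>F n in sequentially. 1 \<le> n \<and> sqrt (real n) \<le> real (v n) \<and> v n \<le> T n \<and> real (v n) \<le> p * real (T n) - KK n
     \<and> 3 * real m \<le> A n \<and> 5 * KK n + 2 \<le> p * (1 - p) * real (T n) \<and> 0 < I n \<and> real (T n) \<le> \<epsilon> * real n
     \<and> 4 * KK n \<le> a * (\<epsilon> * real n) \<and> 2 * real m * real (T n) / I n + M n \<le> C4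
     \<and> C5 * (real n * (S n / ((A n)\<^sup>2 * I n) + 2 * real m / (I n)\<^sup>2 + M n)) \<le> \<eta> / 4
     \<and> S n / (A n)\<^sup>2 \<le> \<eta> / 4 \<and> 2 / a * (1 / (\<epsilon> * real n)) \<le> \<eta> / 8
     \<and> (real (T n) + 1) \<le> 4 * e1 * real n"
  proof (intro eventually_conj)
    show "\<forall>\<^sub>F n in sequentially. 1 \<le> n" by (rule eventually_ge_at_top)
    have sq: "(\<lambda>n. sqrt (real n) / real n) \<longlonglongrightarrow> 0" by real_asymp
    have c1: "(\<lambda>n. b / real n) \<longlonglongrightarrow> 0" for b :: real by real_asymp
    have "(\<lambda>n. (real (v n) - sqrt (real n)) / real n) \<longlonglongrightarrow> e1 - 0"
      unfolding diff_divide_distrib by (intro tendsto_intros v sq)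
    from eventually_pos_of_ratio[OF this] e1 show "\<forall>\<^sub>F n in sequentially. sqrt (real n) \<le> real (v n)"
      by (auto elim: eventually_mono)
    have "(\<lambda>n. (real (T n) - real (v n)) / real n) \<longlonglongrightarrow> 3 * e1 - e1"
      unfolding diff_divide_distrib by (intro tendsto_intros v T)
    from eventually_pos_of_ratio[OF this] e1 show "\<forall>\<^sub>F n in sequentially. v n \<le> T n"
      by (auto elim: eventually_mono)
    have "(\<lambda>n. p * (real (T n) / real n) - KK n / real n - real (v n) / real n) \<longlonglongrightarrow> p * (3 * e1) - 0 - e1"
      by (intro tendsto_intros v T K)
    then have "(\<lambda>n. (p * real (T n) - KK n - real (v n)) / real n) \<longlonglongrightarrow> p * (3 * e1) - 0 - e1"
      by (simp add: diff_divide_distrib)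
    from eventually_pos_of_ratio[OF this] e1 p show "\<forall>\<^sub>F n in sequentially. real (v n) \<le> p * real (T n) - KK n"
      by (auto elim: eventually_mono simp: algebra_simps)
    have "(\<lambda>n. (A n - 3 * real m) / real n) \<longlonglongrightarrow> a * e1 - 0"
      unfolding diff_divide_distrib by (intro tendsto_intros A c1)
    from eventually_pos_of_ratio[OF this] e1 a show "\<forall>\<^sub>F n in sequentially. 3 * real m \<le> A n"
      by (auto elim: eventually_mono)
    have "(\<lambda>n. p * (1 - p) * (real (T n) / real n) - (5 * (KK n / real n) + 2 / real n)) \<longlonglongrightarrow> p * (1 - p) * (3 * e1) - (5 * 0 + 0)"
      by (intro tendsto_intros T K c1)
    then have "(\<lambda>n. (p * (1 - p) * real (T n) - (5 * KK n + 2)) / real n) \<longlonglongrightarrow> p * (1 - p) * (3 * e1) - (5 * 0 + 0)"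
      by (simp add: diff_divide_distrib add_divide_distrib)
    from eventually_pos_of_ratio[OF this] e1 p show "\<forall>\<^sub>F n in sequentially. 5 * KK n + 2 \<le> p * (1 - p) * real (T n)"
      by (auto elim: eventually_mono)
    from eventually_pos_of_ratio[OF I] e1 p show "\<forall>\<^sub>F n in sequentially. 0 < I n" by auto
    have "(\<lambda>n. \<epsilon> - real (T n) / real n) \<longlonglongrightarrow> \<epsilon> - 3 * e1" by (intro tendsto_intros T)
    then have "(\<lambda>n. (\<epsilon> * real n - real (T n)) / real n) \<longlonglongrightarrow> \<epsilon> - 3 * e1"
      by (rule Lim_transform_eventually)
        (rule eventually_mono[OF eventually_gt_at_top[of 0]], simp add: diff_divide_distrib)
    from eventually_pos_of_ratio[OF this] e1 show "\<forall>\<^sub>F n in sequentially. real (T n) \<le> \<epsilon> * real n"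
      by (auto elim: eventually_mono)
    show "\<forall>\<^sub>F n in sequentially. 4 * KK n \<le> a * (\<epsilon> * real n)"
      unfolding KK_def using a \<epsilon> by real_asymp
    have "C4 - 1 < C4" by simp
    from order_tendstoD(2)[OF TI this] show "\<forall>\<^sub>F n in sequentially. 2 * real m * real (T n) / I n + M n \<le> C4"
      by (auto elim: eventually_mono)
    have "0 < \<eta> / 4" using \<eta> by simp
    from order_tendstoD(2)[OF tendsto_mult_right_zero[OF err, of C5] this]
    show "\<forall>\<^sub>F n in sequentially. C5 * (real n * (S n / ((A n)\<^sup>2 * I n) + 2 * real m / (I n)\<^sup>2 + M n)) \<le> \<eta> / 4"
      by (auto elim: eventually_mono)
    from order_tendstoD(2)[OF SA \<open>0 < \<eta> / 4\<close>] show "\<forall>\<^sub>F n in sequentially. S n / (A n)\<^sup>2 \<le> \<eta> / 4"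
      by (auto elim: eventually_mono)
    show "\<forall>\<^sub>F n in sequentially. 2 / a * (1 / (\<epsilon> * real n)) \<le> \<eta> / 8"
      using a \<epsilon> \<eta> by real_asymp
    have "(\<lambda>n. 4 * e1 - (real (T n) / real n + 1 / real n)) \<longlonglongrightarrow> 4 * e1 - (3 * e1 + 0)"
      by (intro tendsto_intros T c1)
    then have "(\<lambda>n. (4 * e1 * real n - (real (T n) + 1)) / real n) \<longlonglongrightarrow> 4 * e1 - (3 * e1 + 0)"
      by (rule Lim_transform_eventually)
        (rule eventually_mono[OF eventually_gt_at_top[of 0]], simp add: diff_divide_distrib add_divide_distrib)
    from eventually_pos_of_ratio[OF this] e1 show "\<forall>\<^sub>F n in sequentially. real (T n) + 1 \<le> 4 * e1 * real n"
      by (auto elim: eventually_mono)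
  qed
  then show ?thesis
  proof (eventually_elim, intro allI impI)
    case (elim n)
    fix H i assume run: "process_run m p H" and H: "real (oldest H + nverts H) \<le> sqrt (real n)"
      and t: "\<epsilon> * real n \<le> real (process_run.t0 H + i)" "process_run.t0 H + i \<le> n"
    interpret process_run m p repl H by (rule run)
    have pi: "Ea i (\<lambda>G. of_bool (\<not> typical (KK n) G)) \<le> PIE n" if "t0 + i \<le> n" for i
      by (rule PIE_bound[OF run]) (use elim H that in auto)
    have PIE0: "0 \<le> PIE n" by (simp add: PIE_def)
    have K0: "0 \<le> KK n" by (simp add: KK_def)
    have v0: "t0 \<le> v n" using H elim by (simp add: t0_def)
    have Ti: "T n \<le> t0 + i" using elim t by linarith
    have A0: "0 < A n" using elim m by linarith
    have S0: "0 \<le> S n" using PIE0 by (simp add: S_def)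
    have M0: "0 \<le> M n" using PIE0 by (simp add: M_def)
    have s: "Ea j (Ssq (v n)) \<le> S n" if "v n \<le> t0 + j" "t0 + j \<le> n" for j
      using S_bound[OF v0, of "KK n" n "PIE n" j] pi PIE0 that elim by (simp add: A_def a_def S_def)
    have u: "Ea i (Uold (v n)) \<le> ((real (T n) + 1) / (real (t0 + i) + 1)) powr c0 * (2 * real m * real (T n) / I n + M n)
       + real n * (S n / ((A n)\<^sup>2 * I n) + 2 * real m / (I n)\<^sup>2 + M n)"
      unfolding M_def c0_def A_def I_def a_def
      by (rule U_bound[of "v n" "T n" "KK n" n "PIE n" "S n" i]) (use v0 elim K0 pi PIE0 s S0 Ti t in \<open>auto simp: A_def a_def I_def\<close>)
    also have "\<dots> \<le> (4 * e1 / \<epsilon>) powr c0 * C4 + real n * (S n / ((A n)\<^sup>2 * I n) + 2 * real m / (I n)\<^sup>2 + M n)"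
    proof (intro add_right_mono mult_mono)
      have "(real (T n) + 1) / (real (t0 + i) + 1) \<le> (4 * e1 * real n) / (\<epsilon> * real n)"
        using elim t \<epsilon> e1 by (intro frac_le) auto
      also have "\<dots> = 4 * e1 / \<epsilon>" using elim by simp
      finally show "((real (T n) + 1) / (real (t0 + i) + 1)) powr c0 \<le> (4 * e1 / \<epsilon>) powr c0"
        using c0 by (intro powr_mono2) auto
    qed (use elim M0 in auto)
    finally have "C5 * Ea i (Uold (v n)) \<le> C5 * ((4 * e1 / \<epsilon>) powr c0 * C4 + real n * (S n / ((A n)\<^sup>2 * I n) + 2 * real m / (I n)\<^sup>2 + M n))"
      using C5 by (intro mult_left_mono) auto
    also have "\<dots> = (4 * e1 / \<epsilon>) powr c0 * (C4 * C5) + C5 * (real n * (S n / ((A n)\<^sup>2 * I n) + 2 * real m / (I n)\<^sup>2 + M n))"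
      by (simp add: algebra_simps)
    also have "\<dots> \<le> \<eta> / 4 + \<eta> / 4" using e1 elim by (intro add_mono) auto
    finally have U: "C5 * Ea i (Uold (v n)) \<le> \<eta> / 4 + \<eta> / 4" .
    have "Ea i (\<lambda>G. if typical (KK n) G then kappa m G else 0) \<le>
       Ea i (\<lambda>G. 2 / a * (c + 1 / (\<epsilon> * real n)) + (C5 * Uold (v n) G + 1 / (A n)\<^sup>2 * Ssq (v n) G))"
    proof (rule Ea_mono)
      fix G assume G: "live i G"
      have en: "0 < \<epsilon> * real n" using \<epsilon> elim by simp
      have nonneg: "0 \<le> 2 / a * (c + 1 / (\<epsilon> * real n)) + (C5 * Uold (v n) G + 1 / (A n)\<^sup>2 * Ssq (v n) G)"
        using a c en C5 Uold_nonneg[OF live_good[OF G] m, of "v n"] Ssq_nonneg[of "v n" G] by (auto intro!: add_nonneg_nonneg)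
      show "(if typical (KK n) G then kappa m G else 0) \<le> 2 / a * (c + 1 / (\<epsilon> * real n)) + (C5 * Uold (v n) G + 1 / (A n)\<^sup>2 * Ssq (v n) G)"
      proof (cases "typical (KK n) G")
        case True
        have vt: "v n \<le> t0 + i" using elim Ti by simp
        have "a * real (v n) \<le> a * real (t0 + i)" using vt a by (intro mult_left_mono) auto
        then have act: "A n \<le> real (act G)" using typical_act_ge[OF G True] by (simp add: A_def a_def)
        have "a * (\<epsilon> * real n) \<le> a * real (t0 + i)" using t a by (intro mult_left_mono) auto
        then have "4 * KK n \<le> (2 * p - 1) * real (t0 + i)" using elim by (simp add: a_def)
        from kappa_pointwise[OF G True this c(1,2) A0 act, of "v n"]
        have "kappa m G \<le> 2 / a * (c + 1 / real (t0 + i)) + (C5 * Uold (v n) G + 1 / (A n)\<^sup>2 * Ssq (v n) G)"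
          by (simp add: a_def C5_def)
        also have "2 / a * (c + 1 / real (t0 + i)) \<le> 2 / a * (c + 1 / (\<epsilon> * real n))"
          using t en a by (intro mult_left_mono add_left_mono divide_left_mono) auto
        finally show ?thesis using True by simp
      qed (use nonneg in simp)
    qed
    also have "\<dots> \<le> 2 / a * (c + 1 / (\<epsilon> * real n)) + (C5 * Ea i (Uold (v n)) + 1 / (A n)\<^sup>2 * Ea i (Ssq (v n)))"
    proof -
      define k where "k = 2 / a * (c + 1 / (\<epsilon> * real n))"
      have "0 \<le> k" using a c \<epsilon> by (simp add: k_def)
      from Ea_const_le[OF this, of i] show ?thesis unfolding k_def[symmetric] by (simp only: Ea_add Ea_cmult add_right_mono)
    qed
    also have "\<dots> \<le> (\<eta> / 8 + \<eta> / 8) + ((\<eta> / 4 + \<eta> / 4) + \<eta> / 4)"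
    proof (intro add_mono U)
      show "2 / a * (c + 1 / (\<epsilon> * real n)) \<le> \<eta> / 8 + \<eta> / 8"
        unfolding distrib_left using c(3) elim by (intro add_mono) auto
      have "1 / (A n)\<^sup>2 * Ea i (Ssq (v n)) \<le> 1 / (A n)\<^sup>2 * S n"
        by (intro mult_left_mono s) (use elim Ti t in auto)
      also have "1 / (A n)\<^sup>2 * S n = S n / (A n)\<^sup>2" by simp
      also have "\<dots> \<le> \<eta> / 4" using elim by blast
      finally show "1 / (A n)\<^sup>2 * Ea i (Ssq (v n)) \<le> \<eta> / 4" .
    qed
    also have "\<dots> = \<eta>" by simp
    finally show "Ea i (\<lambda>G. if typical (KK n) G then kappa m G else 0) \<le> \<eta>" .
  qed
qed

section \<open>The weight function and the cancellation in its drift\<close>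

context delay begin

definition bf :: "real \<Rightarrow> real \<Rightarrow> real" where "bf s x = s + (1 - s) * W (- ln x)"

context
  fixes s :: real
  assumes s: "0 < s" "s < 1"
begin

lemma bf_ge: "s \<le> bf s x" using s W_nonneg by (simp add: bf_def)

lemma bf_pos: "0 < bf s x" using bf_ge[of x] s by linarith

lemma bf_antimono: "0 < x \<Longrightarrow> x \<le> y \<Longrightarrow> bf s y \<le> bf s x"
  using s monoD[OF mono_W, of "- ln y" "- ln x"] by (simp add: bf_def)

lemma FF_eq: assumes "0 < x" shows "FF s (- ln x) = bf s (exp L * x) / bf s x"
proof -
  have "- ln (exp L * x) = - ln x - L" using assms by (simp add: ln_mult_pos)
  then show ?thesis by (simp add: FF_def bf_def)
qed

lemma ratio_diff:
  fixes a b a' b' e :: real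
  assumes "s \<le> b" "s \<le> b'" "0 \<le> a'" "a' \<le> b'" "\<bar>a - a'\<bar> + \<bar>b - b'\<bar> \<le> e"
  shows "\<bar>a / b - a' / b'\<bar> \<le> e / s"
proof -
  have b: "0 < b" "0 < b'" using assms s by auto
  have "a / b - a' / b' = (a - a') / b + a' / b' * ((b' - b) / b)" using b by (simp add: field_simps)
  then have "\<bar>a / b - a' / b'\<bar> \<le> \<bar>(a - a') / b\<bar> + \<bar>a' / b' * ((b' - b) / b)\<bar>" by (metis abs_triangle_ineq)
  also have "\<dots> \<le> \<bar>a - a'\<bar> / s + 1 * (\<bar>b - b'\<bar> / s)"
    unfolding abs_mult abs_divide using assms b s by (intro add_mono mult_mono frac_le) auto
  also have "\<dots> = (\<bar>a - a'\<bar> + \<bar>b - b'\<bar>) / s" by (simp add: add_divide_distrib)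
  also have "\<dots> \<le> e / s" using assms s by (intro divide_right_mono) auto
  finally show ?thesis .
qed

text \<open>Variation of the weight over a window of positions and over the image of that window
  under multiplication by \<open>exp L\<close>, where the newest vertices sit. It need not be small
  for a window around a jump.\<close>

definition osc :: "real \<Rightarrow> real \<Rightarrow> real" where
  "osc xl xh = bf s xl - bf s xh + (bf s (exp L * xl) - bf s (exp L * xh))"

lemma osc_window:
  assumes x: "0 < xl" "xl \<le> x" "x \<le> xh" "xl \<le> y" "y \<le> xh" "exp L * xl \<le> z" "z \<le> exp L * xh"
  shows "\<bar>bf s x - bf s y\<bar> + \<bar>bf s z - bf s (exp L * y)\<bar> \<le> osc xl xh"
proof -
  have g: "0 < exp L * xl" using x by simp
  have z: "0 < z" using g x by linarith
  have gy: "exp L * xl \<le> exp L * y" "exp L * y \<le> exp L * xh" using x by auto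
  have "bf s xh \<le> bf s x" "bf s x \<le> bf s xl" "bf s xh \<le> bf s y" "bf s y \<le> bf s xl"
    using x by (auto intro!: bf_antimono)
  moreover have "bf s (exp L * xh) \<le> bf s z" "bf s z \<le> bf s (exp L * xl)"
    "bf s (exp L * xh) \<le> bf s (exp L * y)" "bf s (exp L * y) \<le> bf s (exp L * xl)"
    using g gy x z by (auto intro!: bf_antimono)
  ultimately show ?thesis unfolding osc_def by linarith
qed

lemma osc_nonneg: "0 < xl \<Longrightarrow> xl \<le> xh \<Longrightarrow> 0 \<le> osc xl xh"
  using osc_window[of xl xl xh xl "exp L * xl"] by simp

text \<open>The increment is the integral of the delay equation over an interval of length
  \<open>ln (1 + 1 / i)\<close>, between \<open>1 / (i + 1)\<close> and \<open>1 / i\<close>;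
  freezing the integrand at \<open>x0\<close> costs one oscillation. \<open>xh \<le> 1\<close> keeps
  the ages nonnegative, where the integrated equation holds.\<close>

lemma bf_increment:
  fixes i N :: real
  assumes i: "1 \<le> i" "0 < N" and x: "0 < xl" "xl \<le> i / N" "(i + 1) / N \<le> xh" "xh \<le> 1" "xl \<le> x0" "x0 \<le> xh"
  defines "\<Delta> \<equiv> bf s x0 - bf s (exp L * x0)"
  shows "\<bar>bf s (i / N) - bf s ((i + 1) / N) - lam * \<Delta> / i\<bar> \<le> lam / i * (osc xl xh + bf s xl / i)"
    and "bf s (i / N) - bf s ((i + 1) / N) \<le> lam / i * bf s xl"
    and "0 \<le> \<Delta>" "\<Delta> \<le> bf s xl"
proof -
  define a b where "a = - ln ((i + 1) / N)" and "b = - ln (i / N)"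
  have iN: "0 < i / N" "i / N < (i + 1) / N" using i by (auto simp: divide_strict_right_mono)
  have a0: "0 \<le> a" using iN x by (simp add: a_def)
  have ab: "b - a = ln (1 + 1 / i)"
  proof -
    have "b - a = ln (((i + 1) / N) / (i / N))" using iN by (subst ln_div) (auto simp: a_def b_def)
    also have "((i + 1) / N) / (i / N) = (i + 1) / i" using i by simp
    also have "\<dots> = 1 + 1 / i" using i by (simp add: add_divide_distrib)
    finally show ?thesis .
  qed
  have l1: "ln (1 + 1 / i) \<le> 1 / i" using i by (intro ln_add_one_self_le_self) simp
  have l2: "1 / (i + 1) \<le> ln (1 + 1 / i)"
  proof -
    have "ln (i / (i + 1)) \<le> i / (i + 1) - 1" using i by (intro ln_le_minus_one) simp
    also have "\<dots> = - (1 / (i + 1))" using i by (simp add: field_simps)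
    finally have "1 / (i + 1) \<le> - ln (i / (i + 1))" by simp
    also have "\<dots> = ln ((i + 1) / i)" using i by (simp add: ln_div)
    also have "(i + 1) / i = 1 + 1 / i" using i by (simp add: field_simps)
    finally show ?thesis .
  qed
  have l0: "0 \<le> ln (1 + 1 / i)" using i by simp
  have abl: "a \<le> b" using ab l0 by linarith
  have dd: "bf s (exp (- u)) - bf s (exp L * exp (- u)) = (1 - s) * (W u - W (u - L))" for u
    by (simp add: bf_def ln_mult_pos algebra_simps)
  have "((\<lambda>u. (1 - s) * (lam * (W u - W (u - L)))) has_integral (1 - s) * (W b - W a)) {a..b}"
    by (intro has_integral_mult_right W_integral a0 abl)
  moreover have "(1 - s) * (W b - W a) = bf s (i / N) - bf s ((i + 1) / N)"
    by (simp add: bf_def a_def b_def algebra_simps)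
  moreover have "(1 - s) * (lam * (W u - W (u - L))) = lam * (bf s (exp (- u)) - bf s (exp L * exp (- u)))" for u
    unfolding dd by simp
  ultimately have I: "((\<lambda>u. lam * (bf s (exp (- u)) - bf s (exp L * exp (- u)))) has_integral bf s (i / N) - bf s ((i + 1) / N)) {a..b}"
    by simp
  define o' where "o' = osc xl xh"
  have o0: "0 \<le> o'" unfolding o'_def by (rule osc_nonneg) (use x in auto)
  have win: "xl \<le> exp (- u)" "exp (- u) \<le> xh" if "u \<in> {a..b}" for u
  proof -
    have "exp (- b) \<le> exp (- u)" "exp (- u) \<le> exp (- a)" using that by auto
    moreover have "exp (- b) = i / N" "exp (- a) = (i + 1) / N" using iN by (auto simp: a_def b_def)
    ultimately show "xl \<le> exp (- u)" "exp (- u) \<le> xh" using x by auto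
  qed
  have near: "\<bar>bf s (exp (- u)) - bf s (exp L * exp (- u)) - \<Delta>\<bar> \<le> o'" if "u \<in> {a..b}" for u
    using osc_window[of xl "exp (- u)" xh x0 "exp L * exp (- u)"] win[OF that] x unfolding o'_def \<Delta>_def by force
  have mass: "((\<lambda>u. lam * c) has_integral ln (1 + 1 / i) * (lam * c)) {a..b}" for c
    using has_integral_const_real[of "lam * c" a b] abl ab by simp
  have up: "bf s (i / N) - bf s ((i + 1) / N) \<le> ln (1 + 1 / i) * (lam * (\<Delta> + o'))"
  proof (rule has_integral_le[OF I mass])
    fix u assume "u \<in> {a..b}"
    with near[OF this] lam show "lam * (bf s (exp (- u)) - bf s (exp L * exp (- u))) \<le> lam * (\<Delta> + o')"
      by (intro mult_left_mono) auto
  qed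
  have lo: "ln (1 + 1 / i) * (lam * (\<Delta> - o')) \<le> bf s (i / N) - bf s ((i + 1) / N)"
  proof (rule has_integral_le[OF mass I])
    fix u assume "u \<in> {a..b}"
    with near[OF this] lam show "lam * (\<Delta> - o') \<le> lam * (bf s (exp (- u)) - bf s (exp L * exp (- u)))"
      by (intro mult_left_mono) auto
  qed
  have x0: "0 < x0" using x by simp
  have "x0 \<le> exp L * x0" using x0 L by (simp add: mult_le_cancel_right1)
  then show D0: "0 \<le> \<Delta>" unfolding \<Delta>_def using bf_antimono[OF x0] by simp
  show DB: "\<Delta> \<le> bf s xl" unfolding \<Delta>_def using bf_antimono[of xl x0] x bf_pos[of "exp L * x0"] by simp
  have "bf s (i / N) - bf s ((i + 1) / N) \<le> ln (1 + 1 / i) * (lam * bf s xl)"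
  proof (rule has_integral_le[OF I mass])
    fix u assume u: "u \<in> {a..b}"
    have "bf s (exp (- u)) - bf s (exp L * exp (- u)) \<le> bf s xl"
      using bf_antimono[of xl "exp (- u)"] win[OF u] x bf_pos[of "exp L * exp (- u)"] by simp
    then show "lam * (bf s (exp (- u)) - bf s (exp L * exp (- u))) \<le> lam * bf s xl" using lam by simp
  qed
  also have "\<dots> \<le> 1 / i * (lam * bf s xl)" using l1 lam bf_pos[of xl] by (intro mult_right_mono) auto
  finally show "bf s (i / N) - bf s ((i + 1) / N) \<le> lam / i * bf s xl" by simp
  define B where "B = bf s xl"
  define ll where "ll = ln (1 + 1 / i)"
  define d where "d = bf s (i / N) - bf s ((i + 1) / N)"
  have B: "0 \<le> B" "\<Delta> \<le> B" using bf_pos[of xl] DB by (auto simp: B_def)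
  have l3: "1 / i - 1 / i\<^sup>2 \<le> ll"
  proof -
    have "1 / i - 1 / (i + 1) = 1 / (i * (i + 1))" using i by (simp add: field_simps)
    also have "\<dots> \<le> 1 / i\<^sup>2" using i by (intro divide_left_mono) (auto simp: power2_eq_square)
    finally show ?thesis using l2 by (simp add: ll_def)
  qed
  have u1: "d \<le> lam * \<Delta> / i + lam / i * (o' + B / i)"
  proof -
    have "d \<le> ll * (lam * (\<Delta> + o'))" using up by (simp add: d_def ll_def)
    also have "\<dots> \<le> 1 / i * (lam * (\<Delta> + o'))" using l1 lam D0 o0 by (intro mult_right_mono) (auto simp: ll_def)
    also have "\<dots> = lam * \<Delta> / i + lam / i * (o' + 0)" using i by (simp add: field_simps)
    also have "\<dots> \<le> lam * \<Delta> / i + lam / i * (o' + B / i)"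
      using lam i B by (intro add_left_mono mult_left_mono) auto
    finally show ?thesis .
  qed
  have l4: "lam * \<Delta> / i - lam / i * (o' + B / i) \<le> d"
  proof -
    have "lam * \<Delta> / i - lam / i * (o' + B / i) = (1 / i) * (lam * \<Delta>) - 1 / i\<^sup>2 * (lam * B) - 1 / i * (lam * o')"
      using i by (simp add: field_simps power2_eq_square)
    also have "\<dots> \<le> (1 / i) * (lam * \<Delta>) - 1 / i\<^sup>2 * (lam * \<Delta>) - ll * (lam * o')"
      using B lam l1 o0 i by (intro diff_mono mult_left_mono mult_right_mono) (auto simp: ll_def)
    also have "\<dots> = (1 / i - 1 / i\<^sup>2) * (lam * \<Delta>) - ll * (lam * o')" by (simp add: algebra_simps)
    also have "\<dots> \<le> ll * (lam * \<Delta>) - ll * (lam * o')" using l3 lam D0 by (intro diff_right_mono mult_right_mono) auto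
    also have "\<dots> = ll * (lam * (\<Delta> - o'))" by (simp add: algebra_simps)
    also have "\<dots> \<le> d" using lo by (simp add: d_def ll_def)
    finally show ?thesis .
  qed
  show "\<bar>bf s (i / N) - bf s ((i + 1) / N) - lam * \<Delta> / i\<bar> \<le> lam / i * (osc xl xh + bf s xl / i)"
    unfolding d_def[symmetric] o'_def[symmetric] B_def[symmetric] using u1 l4 by linarith
qed

text \<open>Both parts are to first order multiples of the same difference \<open>\<Delta>\<close>,
  with factors \<open>(1 - q) * lam / i\<close> and \<open>q / (2 * act)\<close>. For
  \<open>i\<close> near \<open>(1 - p) t\<close>, \<open>act\<close> near \<open>(2 p - 1) t\<close>
  and \<open>q = p\<close> both are \<open>lam / t\<close>; \<open>\<kappa>\<close> measures the
  mismatch.\<close>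

lemma drift_balance:
  fixes i N n' act q :: real
  assumes i: "1 \<le> i" "0 < N" and x: "0 < xl" "xl \<le> i / N" "(i + 1) / N \<le> xh" "xh \<le> 1"
    and n': "exp L * xl \<le> n' / N" "n' / N \<le> exp L * xh"
    and act: "0 < act" and q: "0 \<le> q" "q \<le> 1"
    and kap: "\<bar>(1 - q) * lam / i - q / (2 * act)\<bar> \<le> \<kappa>"
  shows "\<bar>(1 - q) * (bf s (i / N) / bf s ((i + 1) / N) - 1) - q * (1 - bf s (n' / N) / bf s (i / N)) / (2 * act)\<bar>
     \<le> lam / i * (osc xl xh + bf s xl / i) / s + \<kappa> * bf s xl / s + q / (2 * act) * (bf s xl * osc xl xh / s\<^sup>2 + osc xl xh / s)"
proof -
  define b0 b1 bn where "b0 = bf s (i / N)" and "b1 = bf s ((i + 1) / N)" and "bn = bf s (n' / N)"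
  define o' B where "o' = osc xl xh" and "B = bf s xl"
  define \<Delta> where "\<Delta> = bf s (i / N) - bf s (exp L * (i / N))"
  define A Q where "A = (1 - q) * lam / i" and "Q = q / (2 * act)"
  have iN: "i / N \<le> xh" using x i by (auto simp: add_divide_distrib intro: order_trans[rotated])
  have o0: "0 \<le> o'" unfolding o'_def by (rule osc_nonneg) (use x iN in auto)
  have bs: "s \<le> b0" "s \<le> b1" "0 < b0" "0 < b1" using bf_ge bf_pos by (auto simp: b0_def b1_def)
  have I: "\<bar>b0 - b1 - lam * \<Delta> / i\<bar> \<le> lam / i * (o' + B / i)" and D: "0 \<le> \<Delta>" "\<Delta> \<le> B"
    unfolding b0_def b1_def o'_def B_def \<Delta>_def using bf_increment[OF i x, of "i / N"] x iN by auto
  have b01: "\<bar>b0 - b1\<bar> \<le> o'"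
  proof -
    have i1: "xl \<le> (i + 1) / N" using x(2) i divide_right_mono[of i "i + 1" N] by linarith
    have i2: "exp L * xl \<le> exp L * (i / N)" "exp L * (i / N) \<le> exp L * xh"
      using x iN by (intro mult_left_mono; simp)+
    have "\<bar>b1 - b0\<bar> + \<bar>bf s (exp L * (i / N)) - bf s (exp L * (i / N))\<bar> \<le> o'"
      unfolding b0_def b1_def o'_def by (rule osc_window) (fact x(1) x(2) iN i1 x(3) i2)+
    then show ?thesis by (simp add: abs_minus_commute)
  qed
  have bn: "\<bar>\<Delta> - (b0 - bn)\<bar> \<le> o'"
    using osc_window[of xl "i / N" xh "i / N" "n' / N"] x iN n' unfolding b0_def bn_def o'_def \<Delta>_def by force
  have Q0: "0 \<le> Q" using q act by (simp add: Q_def)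
  have B0: "0 \<le> B" using bf_pos by (simp add: B_def less_imp_le)
  have T1: "\<bar>(1 - q) * (b0 - b1 - lam * \<Delta> / i) / b1\<bar> \<le> lam / i * (o' + B / i) / s"
  proof -
    have "\<bar>(1 - q) * (b0 - b1 - lam * \<Delta> / i) / b1\<bar> = (1 - q) * \<bar>b0 - b1 - lam * \<Delta> / i\<bar> / b1"
      using q bs by (simp add: abs_mult)
    also have "\<dots> \<le> 1 * (lam / i * (o' + B / i)) / s"
      using I q bs s lam i o0 B0 by (intro frac_le mult_mono) auto
    finally show ?thesis by simp
  qed
  have T2: "\<bar>(A - Q) * \<Delta> / b1\<bar> \<le> \<kappa> * B / s"
    unfolding abs_mult abs_divide using kap D bs s B0 by (intro frac_le mult_mono) (auto simp: A_def Q_def)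
  have T3: "\<bar>Q * (\<Delta> * (b0 - b1) / (b0 * b1))\<bar> \<le> Q * (B * o' / s\<^sup>2)"
  proof -
    have "\<bar>\<Delta> * (b0 - b1) / (b0 * b1)\<bar> \<le> B * o' / (s * s)"
      unfolding abs_mult abs_divide using D b01 bs s o0 B0 by (intro frac_le mult_mono) auto
    from mult_left_mono[OF this Q0] show ?thesis by (simp only: abs_mult[of Q] abs_of_nonneg[OF Q0] power2_eq_square)
  qed
  have T4: "\<bar>Q * ((\<Delta> - (b0 - bn)) / b0)\<bar> \<le> Q * (o' / s)"
  proof -
    have "\<bar>(\<Delta> - (b0 - bn)) / b0\<bar> \<le> o' / s" unfolding abs_divide using bn bs s o0 by (intro frac_le) auto
    from mult_left_mono[OF this Q0] show ?thesis by (simp only: abs_mult[of Q] abs_of_nonneg[OF Q0])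
  qed
  have e1: "(1 - q) * (b0 / b1 - 1) = (1 - q) * (b0 - b1 - lam * \<Delta> / i) / b1 + A * \<Delta> / b1"
  proof -
    have "b0 / b1 - 1 = (b0 - b1) / b1" using bs by (simp add: diff_divide_distrib)
    moreover have "(1 - q) * (b0 - b1 - lam * \<Delta> / i) / b1 + A * \<Delta> / b1 = ((1 - q) * (b0 - b1 - lam * \<Delta> / i) + A * \<Delta>) / b1"
      by (simp add: add_divide_distrib)
    moreover have "(1 - q) * (b0 - b1 - lam * \<Delta> / i) + A * \<Delta> = (1 - q) * (b0 - b1)" by (simp add: A_def algebra_simps)
    ultimately show ?thesis by simp
  qed
  have e2: "q * (1 - bn / b0) / (2 * act) = Q * (\<Delta> / b0) - Q * ((\<Delta> - (b0 - bn)) / b0)"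
  proof -
    have "1 - bn / b0 = \<Delta> / b0 - (\<Delta> - (b0 - bn)) / b0" using bs by (simp add: diff_divide_distrib)
    then have "q * (1 - bn / b0) / (2 * act) = Q * (\<Delta> / b0 - (\<Delta> - (b0 - bn)) / b0)" by (simp add: Q_def)
    then show ?thesis by (simp only: right_diff_distrib)
  qed
  have e3: "Q * (\<Delta> / b1) - Q * (\<Delta> / b0) = Q * (\<Delta> * (b0 - b1) / (b0 * b1))"
    using bs by (simp add: field_simps)
  have abs4: "\<bar>a + b + c + d\<bar> \<le> \<bar>a\<bar> + \<bar>b\<bar> + \<bar>c\<bar> + \<bar>d\<bar>" for a b c d :: real by linarith
  \<comment> \<open>In order: freezing the integrand, mismatch of the two rates, \<open>b1\<close>
    in place of \<open>b0\<close> in the denominator, and the true position of the newest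
    vertex.\<close>
  have split: "(1 - q) * (b0 / b1 - 1) - q * (1 - bn / b0) / (2 * act) =
     (1 - q) * (b0 - b1 - lam * \<Delta> / i) / b1 + (A - Q) * \<Delta> / b1 + Q * (\<Delta> * (b0 - b1) / (b0 * b1)) + Q * ((\<Delta> - (b0 - bn)) / b0)"
    unfolding e1 e2 e3[symmetric] by (simp add: left_diff_distrib diff_divide_distrib)
  have "\<bar>(1 - q) * (b0 / b1 - 1) - q * (1 - bn / b0) / (2 * act)\<bar> \<le>
     \<bar>(1 - q) * (b0 - b1 - lam * \<Delta> / i) / b1\<bar> + \<bar>(A - Q) * \<Delta> / b1\<bar> + \<bar>Q * (\<Delta> * (b0 - b1) / (b0 * b1))\<bar> + \<bar>Q * ((\<Delta> - (b0 - bn)) / b0)\<bar>"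
    unfolding split by (rule abs4)
  also have "\<dots> \<le> lam / i * (o' + B / i) / s + \<kappa> * B / s + Q * (B * o' / s\<^sup>2) + Q * (o' / s)"
    by (intro add_mono T1 T2 T3 T4)
  finally show ?thesis unfolding b0_def b1_def bn_def o'_def B_def Q_def by (simp only: distrib_left add.assoc)
qed

end
end

text \<open>The replacement for Lipschitz continuity: for a monotone function the oscillations over
  overlapping windows of half-width \<open>K\<close> telescope to \<open>2 * K\<close> boundary
  terms, wherever its jumps are.\<close>

lemma telescoping_window:
  fixes f :: "nat \<Rightarrow> real"
  assumes anti: "\<And>u v. a - K \<le> u \<Longrightarrow> u \<le> v \<Longrightarrow> f v \<le> f u" and nn: "\<And>u. 0 \<le> f u" and K: "K \<le> a" and ab: "a \<le> b"
  shows "(\<Sum>t\<in>{a..<b}. f (t - K) - f (t + K)) \<le> 2 * real K * f (a - K)"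
proof -
  have "(\<Sum>t\<in>{a..<b}. f (t - K) - f (t + K)) = (\<Sum>u\<in>{a - K..<a + K}. f u) - (\<Sum>u\<in>{b - K..<b + K}. f u)"
    using ab
  proof (induction b rule: dec_induct)
    case (step b)
    have "(\<Sum>u\<in>{b - K..<b + K}. f u) + f (b + K) = (\<Sum>u\<in>{b - K..<Suc (b + K)}. f u)" by simp
    also have "\<dots> = f (b - K) + (\<Sum>u\<in>{Suc (b - K)..<Suc (b + K)}. f u)" by (rule sum.atLeast_Suc_lessThan) simp
    also have "Suc (b - K) = Suc b - K" using step K by simp
    finally show ?case using step by simp
  qed simp
  also have "\<dots> \<le> (\<Sum>u\<in>{a - K..<a + K}. f u)" using nn by (simp add: sum_nonneg)
  also have "\<dots> \<le> (\<Sum>u\<in>{a - K..<a + K}. f (a - K))" using anti by (intro sum_mono) auto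
  also have "\<dots> = 2 * real K * f (a - K)" using K by simp
  finally show ?thesis .
qed

locale pa_limit =
  fixes m :: nat and p :: real and repl :: bool and s :: real
  assumes m: "1 \<le> m" and p: "1 / 2 < p" "p < 1" and s: "0 < s" "s < 1"
begin

definition lm :: real where "lm = p / (4 * p - 2)"
definition Lg :: real where "Lg = ln (p / (1 - p))"

sublocale delay lm Lg
  using p by unfold_locales (auto simp: lm_def Lg_def)

lemma exp_L: "exp Lg = p / (1 - p)" using p by (simp add: Lg_def)

text \<open>Half-width in time of a window that absorbs a deviation \<open>KK n\<close> of
  \<open>oldest\<close> or \<open>nverts\<close>, the 2 allowing for rounding by one vertex.
  Enlarging \<open>n\<close> to \<open>RR n\<close> keeps every window up to time \<open>n\<close>
  inside the unit interval, so that ages stay nonnegative.\<close>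

definition Kp :: "nat \<Rightarrow> nat" where "Kp n = nat \<lceil>(KK n + 2) / (1 - p)\<rceil>"
definition RR :: "nat \<Rightarrow> real" where "RR n = real n + 2 * real (Kp n)"
definition NN :: "nat \<Rightarrow> real" where "NN n = (1 - p) * RR n"
text \<open>The \<open>max\<close> avoids the default value of \<open>ln\<close> at 0, so that the
  weight is antitone on all natural numbers.\<close>

definition beta :: "nat \<Rightarrow> nat \<Rightarrow> real" where "beta n j = bf s (real (max 1 j) / NN n)"
definition lo :: "nat \<Rightarrow> nat \<Rightarrow> real" where "lo n t = (real t - real (Kp n)) / RR n"
definition hi :: "nat \<Rightarrow> nat \<Rightarrow> real" where "hi n t = (real t + real (Kp n)) / RR n"
text \<open>Deterministic compensator of the potential: births occur at rate \<open>p\<close>, and a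
  vertex born at the fraction \<open>x\<close> of the time enters with weight close to
  \<open>FF s (- ln x) ^ m\<close>.\<close>

definition cn :: "nat \<Rightarrow> nat \<Rightarrow> real" where
  "cn n t = p * RR n * integral {0..real t / RR n} (\<lambda>x. FF s (- ln x) ^ m)"

lemma KK_nonneg: "0 \<le> KK n" by (simp add: KK_def)

lemma Kp_ge: "KK n + 2 \<le> (1 - p) * real (Kp n)"
proof -
  have "(KK n + 2) / (1 - p) \<le> real (Kp n)" unfolding Kp_def using KK_nonneg[of n] p by (simp add: real_nat_ceiling_ge)
  then show ?thesis using p by (simp add: pos_divide_le_eq mult.commute)
qed

lemma Kp_ge': "KK n + 2 \<le> p * real (Kp n)" "KK n + 2 \<le> real (Kp n)"
proof -
  have "(1 - p) * real (Kp n) \<le> p * real (Kp n)" "p * real (Kp n) \<le> 1 * real (Kp n)" using p by (intro mult_right_mono; simp)+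
  then show "KK n + 2 \<le> p * real (Kp n)" "KK n + 2 \<le> real (Kp n)" using Kp_ge[of n] by auto
qed

lemma RR_pos: "0 < RR n" using Kp_ge'[of n] KK_nonneg[of n] by (simp add: RR_def)
lemma NN_pos: "0 < NN n" using RR_pos[of n] p by (simp add: NN_def)

lemma beta_pos: "0 < beta n b" unfolding beta_def by (rule bf_pos[OF s])

lemma beta_anti: "a \<le> b \<Longrightarrow> beta n b \<le> beta n a"
  unfolding beta_def using NN_pos[of n] by (intro bf_antimono[OF s]) (auto simp: divide_right_mono)

lemma FFm_integrable: "0 \<le> a \<Longrightarrow> b \<le> 1 \<Longrightarrow> (\<lambda>x. FF s (- ln x) ^ m) integrable_on {a..b}"
  by (rule FF_ln_integrable) (use s in auto)

lemma FFm_bounds: assumes "x \<in> {0..1}" shows "0 \<le> FF s (- ln x) ^ m" "FF s (- ln x) ^ m \<le> 1"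
  using FF_bounds[OF neg_ln_nonneg[OF assms] s] by (auto intro: power_le_one)

lemma cn_step:
  assumes "Suc t \<le> n"
  shows "cn n (Suc t) - cn n t = p * RR n * integral {real t / RR n..real (Suc t) / RR n} (\<lambda>x. FF s (- ln x) ^ m)"
proof -
  have R: "0 < RR n" by (rule RR_pos)
  have o: "0 \<le> real t / RR n" "real t / RR n \<le> real (Suc t) / RR n" "real (Suc t) / RR n \<le> 1"
    using R assms by (auto simp: divide_right_mono divide_le_eq_1 RR_def)
  define g where "g x = FF s (- ln x) ^ m" for x
  have "integral {real t / RR n..real (Suc t) / RR n} g = integral {0..real (Suc t) / RR n} g - integral {0..real t / RR n} g"
    using Henstock_Kurzweil_Integration.integral_combine[OF o(1,2) FFm_integrable[OF order_refl o(3)]]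
    unfolding g_def by linarith
  then show ?thesis unfolding cn_def g_def[symmetric] by (simp only: right_diff_distrib)
qed

lemma integral_FFm_bounds:
  assumes "0 \<le> a" "a \<le> b" "b \<le> 1"
  shows "0 \<le> integral {a..b} (\<lambda>x. FF s (- ln x) ^ m)" "integral {a..b} (\<lambda>x. FF s (- ln x) ^ m) \<le> b - a"
proof -
  show "0 \<le> integral {a..b} (\<lambda>x. FF s (- ln x) ^ m)"
    by (rule integral_nonneg[OF FFm_integrable]) (use assms FFm_bounds in auto)
  have "integral {a..b} (\<lambda>x. FF s (- ln x) ^ m) \<le> integral {a..b} (\<lambda>_. 1)"
    by (rule integral_le[OF FFm_integrable]) (use assms FFm_bounds in auto)
  then show "integral {a..b} (\<lambda>x. FF s (- ln x) ^ m) \<le> b - a" using assms by simp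
qed

lemma cn_bounds: assumes "t \<le> n" shows "0 \<le> cn n t" "cn n t \<le> real t"
proof -
  have R: "0 < RR n" by (rule RR_pos)
  have o: "0 \<le> real t / RR n" "real t / RR n \<le> 1" using R assms by (auto simp: divide_le_eq_1 RR_def)
  note b = integral_FFm_bounds[OF order_refl o]
  show "0 \<le> cn n t" using b R p by (simp add: cn_def)
  have "cn n t \<le> p * RR n * (real t / RR n - 0)" unfolding cn_def using b R p by (intro mult_left_mono) auto
  also have "\<dots> = p * real t" using R by simp
  also have "\<dots> \<le> 1 * real t" using p by (intro mult_right_mono) auto
  finally show "cn n t \<le> real t" by simp
qed

lemma cn_step_bounds: assumes "Suc t \<le> n" shows "0 \<le> cn n (Suc t) - cn n t" "cn n (Suc t) - cn n t \<le> 1"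
proof -
  have R: "0 < RR n" by (rule RR_pos)
  have o: "0 \<le> real t / RR n" "real t / RR n \<le> real (Suc t) / RR n" "real (Suc t) / RR n \<le> 1"
    using R assms by (auto simp: divide_right_mono divide_le_eq_1 RR_def)
  note b = integral_FFm_bounds[OF o]
  show "0 \<le> cn n (Suc t) - cn n t" unfolding cn_step[OF assms] using b R p by simp
  have "p * RR n * integral {real t / RR n..real (Suc t) / RR n} (\<lambda>x. FF s (- ln x) ^ m) \<le> p * RR n * (real (Suc t) / RR n - real t / RR n)"
    using b R p by (intro mult_left_mono) auto
  also have "\<dots> = p" using R by (simp add: diff_divide_distrib[symmetric])
  finally show "cn n (Suc t) - cn n t \<le> 1" unfolding cn_step[OF assms] using p by linarith
qed

definition osn :: "nat \<Rightarrow> nat \<Rightarrow> real" where "osn n t = osc s (lo n t) (hi n t)"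

text \<open>The telescoping estimate is applied to the weight and to its version at
  \<open>p / (1 - p)\<close> times the position; both are bounded by the weight at the left end of
  the first window.\<close>

lemma sum_osn:
  assumes T: "Kp n < T" and T2: "T \<le> n" and B: "bf s (lo n T) \<le> B"
  shows "(\<Sum>t\<in>{T..<n}. osn n t) \<le> 4 * real (Kp n) * B"
proof -
  have R: "0 < RR n" by (rule RR_pos)
  define f g where "f u = bf s (real u / RR n)" and "g u = bf s (p / (1 - p) * (real u / RR n))" for u :: nat
  have pos: "0 < real u / RR n" if "T - Kp n \<le> u" for u using that T R by auto
  have gam: "1 \<le> p / (1 - p)" using p by simp
  have loT: "lo n T = real (T - Kp n) / RR n" using T by (simp add: lo_def of_nat_diff)
  have 1: "(\<Sum>t\<in>{T..<n}. f (t - Kp n) - f (t + Kp n)) \<le> 2 * real (Kp n) * f (T - Kp n)"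
    by (rule telescoping_window)
      (use T T2 pos R bf_pos[OF s] in \<open>auto simp: f_def divide_right_mono less_imp_le intro!: bf_antimono[OF s]\<close>)
  have 2: "(\<Sum>t\<in>{T..<n}. g (t - Kp n) - g (t + Kp n)) \<le> 2 * real (Kp n) * g (T - Kp n)"
  proof (rule telescoping_window)
    fix u v assume uv: "T - Kp n \<le> u" "u \<le> v"
    show "g v \<le> g u" unfolding g_def
      by (rule bf_antimono[OF s mult_pos_pos[OF _ pos[OF uv(1)]] mult_left_mono]) (use uv R p in \<open>auto simp: divide_right_mono\<close>)
  qed (use T T2 bf_pos[OF s] in \<open>auto simp: g_def less_imp_le\<close>)
  have fB: "f (T - Kp n) \<le> B" using B loT by (simp add: f_def)
  have gB: "g (T - Kp n) \<le> B"
  proof -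
    have "1 * (real (T - Kp n) / RR n) \<le> p / (1 - p) * (real (T - Kp n) / RR n)"
      by (rule mult_right_mono[OF gam less_imp_le[OF pos]]) simp
    then have "real (T - Kp n) / RR n \<le> p / (1 - p) * (real (T - Kp n) / RR n)" by (simp only: mult_1)
    then have "g (T - Kp n) \<le> f (T - Kp n)" unfolding f_def g_def by (rule bf_antimono[OF s pos[OF order_refl]])
    then show ?thesis using fB by simp
  qed
  have "(\<Sum>t\<in>{T..<n}. osn n t) = (\<Sum>t\<in>{T..<n}. f (t - Kp n) - f (t + Kp n)) + (\<Sum>t\<in>{T..<n}. g (t - Kp n) - g (t + Kp n))"
    unfolding sum.distrib[symmetric]
    by (rule sum.cong) (use T in \<open>auto simp: osn_def osc_def[OF s] lo_def hi_def f_def g_def exp_L of_nat_diff\<close>)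
  also have "\<dots> \<le> 2 * real (Kp n) * B + 2 * real (Kp n) * B"
    using 1 2 fB gB by (intro add_mono order_trans[OF 1] order_trans[OF 2] mult_left_mono) auto
  finally show ?thesis by (simp add: algebra_simps)
qed

text \<open>\<open>rho B c / n\<close> will bound \<open>rr - 1\<close> when the weights are at most
  \<open>B\<close> and \<open>oldest\<close> is at least \<open>c * n\<close>; \<open>C1\<close>
  collects the constants of the drift estimate.\<close>

definition rho :: "real \<Rightarrow> real \<Rightarrow> real" where "rho B c = lm * B / (s * c)"
definition C1 :: "real \<Rightarrow> real \<Rightarrow> real" where
  "C1 B c = 9 * (real m)\<^sup>2 + (2 * real m * rho B c)\<^sup>2
     + (real m / s + 2 * real m / c * (lm) / s + real m * (B / s\<^sup>2 + 1 / s))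
     + (2 * real m * rho B c + 2 * real m / c * (lm) / s * (B / c) + real m * B / ((2 * p - 1) * c * s))"

text \<open>For a typical graph \<open>oldest\<close>, its successor and the newest vertex all have
  positions inside the windows given by \<open>lo\<close> and \<open>hi\<close>, so the abstract
  balance applies with \<open>osn\<close> as oscillation.\<close>

lemma Y_drift:
  assumes run: "process_run m p H"
    and G: "process_run.live m p repl H i G" "process_run.typical p (KK n) G"
    and t: "t = process_run.t0 H + i" "Suc t \<le> n" "Kp n < t"
    and B: "bf s (lo n t) \<le> B" and c: "0 < c" "c * real n \<le> real (oldest G)" "c * real n \<le> real (act G)"
    and act3: "3 * m \<le> act G"
  shows "\<bar>ex (step repl m p G) (Ypot (beta n)) - Ypot (beta n) G - (cn n (Suc t) - cn n t)\<bar>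
      \<le> C1 B c * (kappa m G + osn n t + (KK n + 2) / real n)"
    and "G' \<in> set_pmf (step repl m p G) \<Longrightarrow> \<bar>Ypot (beta n) G' - Ypot (beta n) G\<bar> \<le> real m + 1 + 2 * real m * rho B c"
proof -
  interpret process_run m p repl H by (rule run)
  interpret D: draws m G repl using live_alive[OF G(1)] act3 by (simp add: draws_def draws_axioms_def)
  have lam0: "0 < lm" by (rule lam)
  define o' where "o' = osn n t"
  define k where "k = (KK n + 2) / real n"
  have n0: "0 < real n" using t by simp
  have R: "0 < RR n" by (rule RR_pos)
  have N: "0 < NN n" by (rule NN_pos)
  define i' where "i' = real (oldest G)"
  define n' where "n' = real (nverts G) + 1"
  have i1: "1 \<le> i'" using D.oldest_pos by (simp add: i'_def)
  have time: "real (oldest G) + real (nverts G) = real t" using live_time[OF G(1)] t by (simp flip: of_nat_add)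
  have nu: "\<bar>real (nverts G) - p * real t\<bar> \<le> KK n" using G(2) time by (simp add: typical_def)
  have lo0: "0 < lo n t" using t R by (simp add: lo_def)
  have hi1: "hi n t \<le> 1" using t R by (simp add: hi_def RR_def divide_le_eq_1)
  have xi: "lo n t \<le> i' / NN n"
  proof -
    have "(1 - p) * (real t - real (Kp n)) \<le> i'" using nu Kp_ge[of n] KK_nonneg[of n] time by (simp add: i'_def algebra_simps abs_le_iff)
    then have "(1 - p) * (real t - real (Kp n)) / NN n \<le> i' / NN n" using N by (intro divide_right_mono) auto
    then show ?thesis using p by (simp add: lo_def NN_def)
  qed
  have xi1: "(i' + 1) / NN n \<le> hi n t"
  proof -
    have "i' + 1 \<le> (1 - p) * (real t + real (Kp n))" using nu Kp_ge[of n] KK_nonneg[of n] time by (simp add: i'_def algebra_simps abs_le_iff)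
    then have "(i' + 1) / NN n \<le> (1 - p) * (real t + real (Kp n)) / NN n" using N by (intro divide_right_mono) auto
    then show ?thesis using p by (simp add: hi_def NN_def)
  qed
  have xn: "exp (Lg) * lo n t \<le> n' / NN n" "n' / NN n \<le> exp (Lg) * hi n t"
  proof -
    have "p * (real t - real (Kp n)) \<le> n'" "n' \<le> p * (real t + real (Kp n))"
      using nu Kp_ge'(1)[of n] KK_nonneg[of n] by (simp_all add: n'_def algebra_simps abs_le_iff)
    then have "p * (real t - real (Kp n)) / NN n \<le> n' / NN n" "n' / NN n \<le> p * (real t + real (Kp n)) / NN n"
      using N by (auto intro!: divide_right_mono)
    then show "exp (Lg) * lo n t \<le> n' / NN n" "n' / NN n \<le> exp (Lg) * hi n t"
      unfolding exp_L by (simp_all add: lo_def hi_def NN_def)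
  qed
  have be: "beta n (oldest G) = bf s (i' / NN n)" "beta n (oldest G + 1) = bf s ((i' + 1) / NN n)"
    "beta n (nverts G + 1) = bf s (n' / NN n)"
    using D.oldest_pos by (auto simp: beta_def i'_def n'_def max_def add.commute)
  have bpos: "0 < beta n b" and banti: "a \<le> b \<Longrightarrow> beta n b \<le> beta n a" for a b
    using beta_pos beta_anti by auto
  define r where "r = D.rr (beta n)"
  define \<psi> where "\<psi> = D.psi (beta n)"
  have r: "r = bf s (i' / NN n) / bf s ((i' + 1) / NN n)" by (simp only: r_def D.rr_def[where \<beta> = "beta n", OF bpos banti] be)
  have psi: "\<psi> = bf s (n' / NN n) / bf s (i' / NN n)" by (simp only: \<psi>_def D.psi_def[where \<beta> = "beta n", OF bpos banti] be)
  have r1: "1 \<le> r" unfolding r_def by (rule D.rr_ge[where \<beta> = "beta n", OF bpos banti])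
  have psib: "0 \<le> \<psi>" "\<psi> \<le> 1" unfolding \<psi>_def using D.psi_bounds[where \<beta> = "beta n", OF bpos banti] by auto
  have iN: "i' / NN n \<le> hi n t" using xi1 N divide_right_mono[of i' "i' + 1" "NN n"] by linarith
  have B0: "0 \<le> B" using B bf_pos[OF s, of "lo n t"] by linarith
  have o0: "0 \<le> o'" unfolding o'_def osn_def by (rule osc_nonneg[OF s]) (use lo0 xi iN in auto)
  have k0: "0 \<le> k" "1 / real n \<le> k" "(KK n + 1) / real n \<le> k"
    using KK_nonneg[of n] n0 by (auto simp: k_def divide_right_mono)
  have cn0: "0 < c * real n" using c n0 by simp
  have iinv: "1 / i' \<le> 1 / (c * real n)" using c cn0 by (intro divide_left_mono) (auto simp: i'_def)
  have rr: "r - 1 \<le> rho B c * (1 / real n)"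
  proof -
    have "r - 1 = (bf s (i' / NN n) - bf s ((i' + 1) / NN n)) / bf s ((i' + 1) / NN n)"
      using bf_pos[OF s, of "(i' + 1) / NN n"] by (simp add: r diff_divide_distrib)
    also have "\<dots> \<le> (lm / i' * bf s (lo n t)) / s"
      using bf_increment(2)[OF s i1 N lo0 xi xi1 hi1 xi iN] bf_ge[OF s, of "(i' + 1) / NN n"] s lam0 i1 bf_pos[OF s, of "lo n t"]
      by (intro frac_le) auto
    also have "\<dots> \<le> (lm * (1 / (c * real n)) * B) / s"
      using B iinv lam0 s bf_pos[OF s, of "lo n t"] c n0 mult_left_mono[OF iinv, of lm] by (intro divide_right_mono mult_mono) auto
    also have "\<dots> = rho B c * (1 / real n)" by (simp add: rho_def)
    finally show ?thesis .
  qed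
  have rho0: "0 \<le> rho B c" using B0 c s lam0 by (simp add: rho_def)
  have Dn: "D.D \<le> 2 * real m * real n" "D.D = 2 * real m * real (act G)" "0 < D.D"
    using act_le[OF G(1)] t D.D_pos by (auto simp: D.D_def intro!: mult_left_mono)
  have Dr: "D.D * (r - 1) \<le> 2 * real m * rho B c"
  proof -
    have "D.D * (r - 1) \<le> (2 * real m * real n) * (rho B c * (1 / real n))" using Dn rr r1 by (intro mult_mono) auto
    then show ?thesis using n0 by simp
  qed
  show "\<bar>Ypot (beta n) G' - Ypot (beta n) G\<bar> \<le> real m + 1 + 2 * real m * rho B c" if "G' \<in> set_pmf (step repl m p G)"
    using D.Y_increment[where \<beta> = "beta n", OF bpos banti that] Dr by (simp add: r_def)
  have kap: "D.kap D.V = kappa m G" by (simp add: D.kap_V[where \<beta> = "beta n", OF bpos banti] kappa_def D.D_def)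
  have kap0: "0 \<le> kappa m G" using D.kap_nonneg[of D.V] kap by simp
  \<comment> \<open>\<open>Ssq\<close> is the squared total degree times \<open>kappa\<close>, and
    the total degree times \<open>r - 1\<close> is bounded.\<close>
  have e1: "(r - 1)\<^sup>2 * Ssq 0 G \<le> (2 * real m * rho B c)\<^sup>2 * kappa m G"
  proof -
    have "D.D \<noteq> 0" using Dn(3) by simp
    then have "Ssq 0 G = D.D\<^sup>2 * kappa m G" unfolding kappa_def Dn(2)[symmetric] by simp
    then have "(r - 1)\<^sup>2 * Ssq 0 G = (D.D * (r - 1))\<^sup>2 * kappa m G" by (simp add: power_mult_distrib mult_ac)
    also have "\<dots> \<le> (2 * real m * rho B c)\<^sup>2 * kappa m G" using Dr Dn r1 kap0 by (intro mult_right_mono power_mono) auto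
    finally show ?thesis .
  qed
  have e2: "2 * real m * (r - 1) \<le> 2 * real m * rho B c * k"
  proof -
    have "2 * real m * (r - 1) \<le> 2 * real m * (rho B c * k)"
      using rr rho0 k0 mult_left_mono[OF k0(2) rho0] by (intro mult_left_mono) auto
    then show ?thesis by simp
  qed
  \<comment> \<open>\<open>\<psi>\<close> is the ratio of weights at the newest and the oldest
    vertex, whose positions differ by a factor close to \<open>exp Lg\<close>; the generating
    function is the same ratio at the exact factor.\<close>
  have e3: "\<bar>p * \<psi> ^ m - (cn n (Suc t) - cn n t)\<bar> \<le> real m / s * o'"
  proof -
    have cell: "real t / RR n \<le> real (Suc t) / RR n" "lo n t \<le> real t / RR n" "real (Suc t) / RR n \<le> hi n t" "real (Suc t) / RR n \<le> 1"
      using R t KK_nonneg[of n] Kp_ge'(2)[of n] by (auto simp: lo_def hi_def divide_right_mono divide_le_eq_1 RR_def)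
    have near: "norm (FF s (- ln x) ^ m - \<psi> ^ m) \<le> real m * (o' / s)" if x: "x \<in> cbox (real t / RR n) (real (Suc t) / RR n)" for x
    proof -
      have xb: "lo n t \<le> x" "x \<le> hi n t" "0 < x" "x \<le> 1" using x cell lo0 by auto
      have w: "\<bar>bf s (i' / NN n) - bf s x\<bar> + \<bar>bf s (n' / NN n) - bf s (exp (Lg) * x)\<bar> \<le> o'"
        unfolding o'_def osn_def by (rule osc_window[OF s]) (use lo0 xi iN xb xn in auto)
      have "bf s (exp (Lg) * x) \<le> bf s x"
        using xb p by (intro bf_antimono[OF s]) (auto simp: exp_L field_simps)
      then have "\<bar>\<psi> - FF s (- ln x)\<bar> \<le> o' / s"
        unfolding psi FF_eq[OF s xb(3)] using w bf_ge[OF s] bf_pos[OF s]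
        by (intro ratio_diff[OF s]) (auto simp: less_imp_le)
      then have "real m * \<bar>FF s (- ln x) - \<psi>\<bar> \<le> real m * (o' / s)" by (intro mult_left_mono) (auto simp: abs_minus_commute)
      moreover have "0 \<le> - ln x" using xb neg_ln_nonneg[of x] by simp
      then have "\<bar>FF s (- ln x) ^ m - \<psi> ^ m\<bar> \<le> real m * \<bar>FF s (- ln x) - \<psi>\<bar>"
        using FF_bounds[OF _ s] psib by (intro abs_power_diff_le) auto
      ultimately show ?thesis by simp
    qed
    define J where "J = integral {real t / RR n..real (Suc t) / RR n} (\<lambda>x. FF s (- ln x) ^ m)"
    have w: "real (Suc t) / RR n - real t / RR n = 1 / RR n" by (simp add: diff_divide_distrib[symmetric])
    have "((\<lambda>x. FF s (- ln x) ^ m - \<psi> ^ m) has_integral J - 1 / RR n * \<psi> ^ m) (cbox (real t / RR n) (real (Suc t) / RR n))"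
      unfolding box_real J_def using has_integral_const_real[of "\<psi> ^ m" "real t / RR n" "real (Suc t) / RR n"] cell w lo0
      by (intro has_integral_diff integrable_integral FFm_integrable) auto
    from has_integral_bound[OF _ this near] have "\<bar>J - 1 / RR n * \<psi> ^ m\<bar> \<le> real m * (o' / s) * (1 / RR n)"
      using o0 s cell w by (simp add: mult_ac)
    then have "(p * RR n) * \<bar>J - 1 / RR n * \<psi> ^ m\<bar> \<le> (p * RR n) * (real m * (o' / s) * (1 / RR n))"
      using p R by (intro mult_left_mono) auto
    also have "\<dots> = p * (real m * (o' / s))" using R by simp
    also have "\<dots> \<le> 1 * (real m * (o' / s))" using p o0 s by (intro mult_right_mono) auto
    also have "(p * RR n) * \<bar>J - 1 / RR n * \<psi> ^ m\<bar> = \<bar>p * RR n * (J - 1 / RR n * \<psi> ^ m)\<bar>" using p R by (simp add: abs_mult)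
    also have "p * RR n * (J - 1 / RR n * \<psi> ^ m) = p * RR n * J - p * \<psi> ^ m" using R by (simp add: right_diff_distrib)
    finally show ?thesis unfolding cn_step[OF t(2)] J_def by (simp add: abs_minus_commute)
  qed
  define A where "A = real (act G)"
  have A0: "0 < A" using D.act_pos by (simp add: A_def)
  define \<kappa> where "\<kappa> = p * (KK n + 1) / (2 * (2 * p - 1) * i' * A)"
  \<comment> \<open>Exactly, \<open>(1 - p) * A - (2 * p - 1) * i'\<close> equals the deviation of
    \<open>nverts\<close> from \<open>p * t\<close> plus \<open>1 - p\<close>, so typicality bounds
    the mismatch.\<close>
  have bal: "\<bar>(1 - p) * lm / i' - p / (2 * A)\<bar> \<le> \<kappa>"
  proof -
    have actE: "A = 2 * real (nverts G) + 1 - real t" using live_act[OF G(1)] t by (simp add: A_def)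
    have q: "2 * p - 1 \<noteq> 0" "i' \<noteq> 0" "A \<noteq> 0" using p i1 A0 by auto
    have "(1 - p) * (p / (2 * d)) / i' - p / (2 * A) = p * ((1 - p) * A - d * i') / (2 * d * i' * A)" if "d \<noteq> 0" for d
      using q that by (simp add: field_simps)
    moreover have "lm = p / (2 * (2 * p - 1))" by (simp add: lm_def algebra_simps)
    ultimately have "(1 - p) * lm / i' - p / (2 * A) = p * ((1 - p) * A - (2 * p - 1) * i') / (2 * (2 * p - 1) * i' * A)"
      using q by metis
    also have "(1 - p) * A - (2 * p - 1) * i' = real (nverts G) - p * real t + (1 - p)"
    proof -
      have "real t = i' + real (nverts G)" using time by (simp add: i'_def)
      then show ?thesis unfolding actE by (simp add: algebra_simps)
    qed
    finally have "\<bar>(1 - p) * lm / i' - p / (2 * A)\<bar> = p * \<bar>real (nverts G) - p * real t + (1 - p)\<bar> / (2 * (2 * p - 1) * i' * A)"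
      using p i1 A0 by (simp add: abs_mult)
    also have "\<dots> \<le> \<kappa>" unfolding \<kappa>_def using nu p i1 A0 by (intro divide_right_mono mult_left_mono) auto
    finally show ?thesis .
  qed
  have e4: "\<bar>D.XX (beta n) * ((1 - p) * (r - 1) - p * real m * (1 - \<psi>) / D.D)\<bar> \<le>
     (2 * real m / c * lm / s + real m * (B / s\<^sup>2 + 1 / s)) * o' + (2 * real m / c * lm / s * (B / c) + real m * B / ((2 * p - 1) * c * s)) * k"
  proof -
    define X where "X = lm / i' * (o' + B / i') / s + \<kappa> * B / s + p / (2 * A) * (B * o' / s\<^sup>2 + o' / s)"
    have "p * real m * (1 - \<psi>) / D.D = p * (1 - \<psi>) / (2 * A)" using m by (simp add: Dn A_def)
    then have "\<bar>(1 - p) * (r - 1) - p * real m * (1 - \<psi>) / D.D\<bar> \<le> lm / i' * (o' + bf s (lo n t) / i') / s + \<kappa> * bf s (lo n t) / s + p / (2 * A) * (bf s (lo n t) * o' / s\<^sup>2 + o' / s)"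
      using drift_balance[OF s i1 N lo0 xi xi1 hi1 xn A0 _ _ bal] p
      by (simp add: r psi o'_def osn_def)
    also have "\<dots> \<le> X"
      unfolding X_def using B lam0 i1 s p A0 o0 nu KK_nonneg[of n]
      by (intro add_mono divide_right_mono mult_left_mono mult_right_mono order_refl) (auto simp: \<kappa>_def)
    finally have a: "\<bar>(1 - p) * (r - 1) - p * real m * (1 - \<psi>) / D.D\<bar> \<le> X" .
    have X0: "0 \<le> X" using a by linarith
    have "\<bar>D.XX (beta n) * ((1 - p) * (r - 1) - p * real m * (1 - \<psi>) / D.D)\<bar> \<le> D.D * X"
      unfolding abs_mult using a D.XX_bounds[where \<beta> = "beta n", OF bpos banti] X0 Dn by (intro mult_mono) auto
    also have "D.D * X = D.D / i' * (lm / s) * (o' + B / i') + D.D * \<kappa> * (B / s) + D.D / A * (p / 2) * (B / s\<^sup>2 + 1 / s) * o'"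
      by (simp add: X_def algebra_simps add_divide_distrib)
    also have "\<dots> \<le> 2 * real m / c * (lm / s) * (o' + B / c * k) + real m / ((2 * p - 1) * c) * k * (B / s) + 2 * real m * (1 / 2) * (B / s\<^sup>2 + 1 / s) * o'"
    proof (intro add_mono)
      have Di: "D.D / i' \<le> 2 * real m / c"
      proof -
        have "D.D / i' \<le> (2 * real m * real n) / (c * real n)" using Dn c cn0 by (intro frac_le) (auto simp: i'_def)
        then show ?thesis using n0 by simp
      qed
      have Bi: "B / i' \<le> B / c * k"
      proof -
        have "B * (1 / i') \<le> B * (1 / (c * real n))" using iinv B0 by (intro mult_left_mono) auto
        also have "\<dots> = B / c * (1 / real n)" by simp
        also have "\<dots> \<le> B / c * k" using k0 B0 c by (intro mult_left_mono) auto
        finally show ?thesis by simp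
      qed
      show "D.D / i' * (lm / s) * (o' + B / i') \<le> 2 * real m / c * (lm / s) * (o' + B / c * k)"
        using Di Bi lam0 s o0 B0 i1 c Dn m by (intro mult_mono add_left_mono mult_right_mono) auto
      have "D.D * \<kappa> = real m * p * (KK n + 1) / ((2 * p - 1) * i')"
      proof -
        have "2 * real m * A * (p * (KK n + 1) / (2 * d * i' * A)) = real m * p * (KK n + 1) / (d * i')" for d using A0 by simp
        from this[of "2 * p - 1"] show ?thesis unfolding \<kappa>_def Dn(2) A_def[symmetric] .
      qed
      also have "\<dots> \<le> real m * 1 * (KK n + 1) / ((2 * p - 1) * (c * real n))"
        using c cn0 p KK_nonneg[of n] m by (intro frac_le mult_mono mult_left_mono) (auto simp: i'_def)
      also have "\<dots> = real m / ((2 * p - 1) * c) * ((KK n + 1) / real n)" by simp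
      also have "\<dots> \<le> real m / ((2 * p - 1) * c) * k" using k0 p c by (intro mult_left_mono) auto
      finally show "D.D * \<kappa> * (B / s) \<le> real m / ((2 * p - 1) * c) * k * (B / s)" using B0 s by (intro mult_right_mono) auto
      have "D.D / A = 2 * real m" using A0 by (simp add: Dn A_def)
      then show "D.D / A * (p / 2) * (B / s\<^sup>2 + 1 / s) * o' \<le> 2 * real m * (1 / 2) * (B / s\<^sup>2 + 1 / s) * o'"
        using p B0 s o0 mult_left_mono[of p 1 "real m"] by (intro mult_right_mono) auto
    qed
    also have "\<dots> = (2 * real m / c * lm / s + real m * (B / s\<^sup>2 + 1 / s)) * o' + (2 * real m / c * lm / s * (B / c) + real m * B / ((2 * p - 1) * c * s)) * k"
      by (simp add: algebra_simps add_divide_distrib)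
    finally show ?thesis .
  qed
  define E where "E = ex (step repl m p G) (Ypot (beta n))"
  define Q where "Q = D.XX (beta n) * ((1 - p) * (r - 1) - p * real m * (1 - \<psi>) / D.D)"
  have "\<bar>E - Ypot (beta n) G - (p * \<psi> ^ m + Q)\<bar> \<le> 9 * (real m)\<^sup>2 * kappa m G + (r - 1)\<^sup>2 * Ssq 0 G + 2 * real m * (r - 1)"
    using D.Y_step[where \<beta> = "beta n", OF bpos banti, of p] p kap by (simp add: E_def Q_def r_def \<psi>_def)
  then have main: "\<bar>E - Ypot (beta n) G - (cn n (Suc t) - cn n t)\<bar> \<le> 9 * (real m)\<^sup>2 * kappa m G + (2 * real m * rho B c)\<^sup>2 * kappa m G + 2 * real m * rho B c * k + real m / s * o' + \<bar>Q\<bar>"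
    using e1 e2 e3 by linarith
  define a1 a2 a3 a4 a5 where "a1 = 9 * (real m)\<^sup>2" and "a2 = (2 * real m * rho B c)\<^sup>2" and "a3 = 2 * real m * rho B c"
    and "a4 = real m / s + (2 * real m / c * lm / s + real m * (B / s\<^sup>2 + 1 / s))"
    and "a5 = (2 * real m / c * lm / s * (B / c) + real m * B / ((2 * p - 1) * c * s))"
  have nn: "0 \<le> a1" "0 \<le> a2" "0 \<le> a3" "0 \<le> a4" "0 \<le> a5"
    using rho0 s c B0 lam0 p by (auto simp: a1_def a2_def a3_def a4_def a5_def)
  have "\<bar>E - Ypot (beta n) G - (cn n (Suc t) - cn n t)\<bar> \<le> (a1 + a2) * kappa m G + a4 * o' + (a3 + a5) * k"
    using main e4 unfolding Q_def[symmetric] a1_def a2_def a3_def a4_def a5_def by (simp add: distrib_right)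
  also have "\<dots> \<le> (a1 + a2 + a4 + (a3 + a5)) * (kappa m G + o' + k)"
  proof -
    have "(a1 + a2 + a4 + (a3 + a5)) * (kappa m G + o' + k) - ((a1 + a2) * kappa m G + a4 * o' + (a3 + a5) * k)
      = (a1 + a2) * (o' + k) + a4 * (kappa m G + k) + (a3 + a5) * (kappa m G + o')" by (simp add: algebra_simps)
    moreover have "0 \<le> \<dots>" using nn kap0 o0 k0 by (intro add_nonneg_nonneg mult_nonneg_nonneg) auto
    ultimately show ?thesis by linarith
  qed
  also have "a1 + a2 + a4 + (a3 + a5) = C1 B c" by (simp add: C1_def a1_def a2_def a3_def a4_def a5_def)
  finally show "\<bar>ex (step repl m p G) (Ypot (beta n)) - Ypot (beta n) G - (cn n (Suc t) - cn n t)\<bar>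
      \<le> C1 B c * (kappa m G + osn n t + (KK n + 2) / real n)"
    by (simp add: E_def o'_def k_def)
qed

end

context pa_limit begin

lemma Ypot_bounds: assumes "process_run m p H" "process_run.live m p repl H i G"
  shows "0 \<le> Ypot (beta n) G" "Ypot (beta n) G \<le> real (nverts G)"
proof -
  interpret process_run m p repl H by (rule assms)
  interpret D: alive_graph m G repl by (rule live_alive[OF assms(2)])
  have f: "0 \<le> beta n b / beta n (oldest G) \<and> beta n b / beta n (oldest G) \<le> 1" if "b \<in># births G v" for b v
    using births_bounds[OF live_good[OF assms(2)] m that] beta_pos[of n b] beta_pos[of n "oldest G"] beta_anti[of "oldest G" b n] by simp
  note pb = prod_mset_bounds[OF f]
  show "0 \<le> Ypot (beta n) G" unfolding Ypot_def by (rule sum_nonneg, rule pb[THEN conjunct1])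
  have "Ypot (beta n) G \<le> (\<Sum>v\<in>{1..nverts G}. 1)" unfolding Ypot_def by (rule sum_mono, rule pb[THEN conjunct2])
  then show "Ypot (beta n) G \<le> real (nverts G)" by simp
qed

text \<open>In the expansion of the square the cross term is at most \<open>2 * n\<close> times the
  drift error, because the deviation is at most \<open>n\<close>. \<open>kappa\<close> thus enters
  linearly, and control of its mean suffices.\<close>

lemma second_moment_step:
  assumes run: "process_run m p H" and n: "1 \<le> n" "real (oldest H + nverts H) \<le> sqrt (real n)"
    and t: "t = process_run.t0 H + i" "Suc t \<le> n" "Kp n < t" and B: "bf s (lo n t) \<le> B" and c: "0 < c"
    and tyc: "\<And>G. process_run.live m p repl H i G \<Longrightarrow> process_run.typical p (KK n) G \<Longrightarrow>
      c * real n \<le> real (oldest G) \<and> c * real n \<le> real (act G) \<and> 3 * m \<le> act G"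
  shows "process_run.Ea m p repl H (Suc i) (\<lambda>G. (Ypot (beta n) G - cn n (Suc t))\<^sup>2) \<le>
    process_run.Ea m p repl H i (\<lambda>G. (Ypot (beta n) G - cn n t)\<^sup>2)
    + 2 * real n * C1 B c * process_run.Ea m p repl H i (\<lambda>G. if process_run.typical p (KK n) G then kappa m G else 0)
    + 2 * real n * C1 B c * (osn n t + (KK n + 2) / real n) + (real m + 2 + 2 * real m * rho B c)\<^sup>2 + (real n + 1)\<^sup>2 * PIE n"
proof -
  interpret process_run m p repl H by (rule run)
  define d where "d = cn n (Suc t) - cn n t"
  define C3 where "C3 = real m + 2 + 2 * real m * rho B c"
  define w where "w = osn n t + (KK n + 2) / real n"
  define CC where "CC = C1 B c"
  have d: "0 \<le> d" "d \<le> 1" using cn_step_bounds[OF t(2)] by (auto simp: d_def)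
  have B0: "0 \<le> B" using B bf_pos[OF s, of "lo n t"] by linarith
  have CC0: "0 \<le> CC"
  proof -
    have "0 \<le> rho B c" using B0 c s lam by (simp add: rho_def)
    then show ?thesis unfolding CC_def C1_def using B0 c s lam p by (intro add_nonneg_nonneg mult_nonneg_nonneg divide_nonneg_nonneg) auto
  qed
  have w0: "0 \<le> w"
  proof -
    have "0 \<le> osn n t" unfolding osn_def by (rule osc_nonneg[OF s]) (use t RR_pos[of n] in \<open>auto simp: lo_def hi_def divide_right_mono\<close>)
    then show ?thesis using KK_nonneg[of n] by (simp add: w_def)
  qed
  define ka where "ka G = (if typical (KK n) G then kappa m G else 0)" for G
  define aty where "aty G = (of_bool (\<not> typical (KK n) G) :: real)" for G
  have ka0: "0 \<le> ka G" for G by (simp add: ka_def kappa_def Ssq_nonneg)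
  have "Ea (Suc i) (\<lambda>G. (Ypot (beta n) G - cn n (Suc t))\<^sup>2) \<le>
    Ea i (\<lambda>G. ((Ypot (beta n) G - cn n t)\<^sup>2 + 2 * real n * CC * ka G) + ((2 * real n * CC * w + C3\<^sup>2) + (real n + 1)\<^sup>2 * aty G))"
  proof (rule Ea_step)
    fix G assume G: "live i G"
    define f where "f G' = (if edges G' = {#} then 0 else (Ypot (beta n) G' - cn n (Suc t))\<^sup>2)" for G'
    define Z where "Z = Ypot (beta n) G - cn n t"
    have nv: "nverts G \<le> t" using live_time[OF G] t by simp
    have Yb: "0 \<le> Ypot (beta n) G" "Ypot (beta n) G \<le> real t" using Ypot_bounds[OF run G, of n] nv by auto
    have Z: "\<bar>Z\<bar> \<le> real n" using Yb cn_bounds[of t n] t by (simp add: Z_def abs_le_iff)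
    have fin: "finite (set_pmf (step repl m p G))" by (rule step_facts(1)[OF live_good[OF G]])
    show "ex (step repl m p G) f \<le> ((Ypot (beta n) G - cn n t)\<^sup>2 + 2 * real n * CC * ka G) + ((2 * real n * CC * w + C3\<^sup>2) + (real n + 1)\<^sup>2 * aty G)"
    proof (cases "typical (KK n) G")
      case True
      note tg = tyc[OF G True]
      note dr = Y_drift[OF run G True t B c _ _ _]
      have e: "\<bar>ex (step repl m p G) (Ypot (beta n)) - Ypot (beta n) G - d\<bar> \<le> CC * (kappa m G + w)"
        using dr(1) tg by (simp add: d_def CC_def w_def add.assoc)
      have inc: "\<bar>Ypot (beta n) G' - Ypot (beta n) G - d\<bar> \<le> C3" if "G' \<in> set_pmf (step repl m p G)" for G'
        using dr(2)[of G'] tg that d by (simp add: C3_def abs_le_iff)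
      have "ex (step repl m p G) f \<le> ex (step repl m p G) (\<lambda>G'. Z\<^sup>2 + (2 * Z * (Ypot (beta n) G' - Ypot (beta n) G - d) + C3\<^sup>2))"
      proof (rule ex_mono[OF fin])
        fix G' assume G': "G' \<in> set_pmf (step repl m p G)"
        define x where "x = Ypot (beta n) G' - Ypot (beta n) G - d"
        have "x\<^sup>2 \<le> C3\<^sup>2" using inc[OF G'] by (simp add: x_def abs_le_square_iff[symmetric])
        moreover have "Ypot (beta n) G' - cn n (Suc t) = Z + x" by (simp add: Z_def x_def d_def)
        moreover have "(Z + x)\<^sup>2 = Z\<^sup>2 + 2 * Z * x + x\<^sup>2" by (simp add: power2_eq_square algebra_simps)
        moreover have "0 \<le> (Z + x)\<^sup>2" by simp
        ultimately have "f G' \<le> Z\<^sup>2 + (2 * Z * x + C3\<^sup>2)" by (simp add: f_def)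
        then show "f G' \<le> Z\<^sup>2 + (2 * Z * (Ypot (beta n) G' - Ypot (beta n) G - d) + C3\<^sup>2)" by (simp add: x_def)
      qed
      also have "\<dots> = Z\<^sup>2 + (2 * Z * (ex (step repl m p G) (Ypot (beta n)) - Ypot (beta n) G - d) + C3\<^sup>2)"
        using fin by (simp add: integrable_measure_pmf_finite)
      also have "2 * Z * (ex (step repl m p G) (Ypot (beta n)) - Ypot (beta n) G - d) \<le> 2 * real n * (CC * (kappa m G + w))"
      proof -
        have "2 * Z * (ex (step repl m p G) (Ypot (beta n)) - Ypot (beta n) G - d) \<le> \<bar>2 * Z * (ex (step repl m p G) (Ypot (beta n)) - Ypot (beta n) G - d)\<bar>" by simp
        also have "\<dots> = 2 * \<bar>Z\<bar> * \<bar>ex (step repl m p G) (Ypot (beta n)) - Ypot (beta n) G - d\<bar>" by (simp add: abs_mult)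
        also have "\<dots> \<le> 2 * real n * (CC * (kappa m G + w))" using Z e by (intro mult_mono) auto
        finally show ?thesis .
      qed
      finally show ?thesis using True by (simp add: ka_def aty_def Z_def algebra_simps)
    next
      case False
      have "f G' \<le> (real n + 1)\<^sup>2" if G': "G' \<in> set_pmf (step repl m p G)" for G'
      proof (cases "edges G' = {#}")
        case False
        have "live (Suc i) G'" using G G' False by (auto simp: live_def)
        moreover have "nverts G' \<le> n" using live_time[OF calculation] t by simp
        ultimately have "0 \<le> Ypot (beta n) G'" "Ypot (beta n) G' \<le> real n" using Ypot_bounds[OF run, of "Suc i" G' n] by auto
        then have "\<bar>Ypot (beta n) G' - cn n (Suc t)\<bar> \<le> real n + 1" using cn_bounds[OF t(2)] t by (simp add: abs_le_iff)
        then have "(Ypot (beta n) G' - cn n (Suc t))\<^sup>2 \<le> (real n + 1)\<^sup>2" by (simp add: abs_le_square_iff[symmetric])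
        then show ?thesis using False by (simp add: f_def)
      qed (simp add: f_def)
      then have "ex (step repl m p G) f \<le> ex (step repl m p G) (\<lambda>_. (real n + 1)\<^sup>2)" by (rule ex_mono[OF fin])
      moreover have "0 \<le> (Ypot (beta n) G - cn n t)\<^sup>2" "0 \<le> 2 * real n * CC * ka G" "0 \<le> 2 * real n * CC * w" "0 \<le> C3\<^sup>2"
        using CC0 ka0 w0 by auto
      moreover have "ex (step repl m p G) (\<lambda>_. (real n + 1)\<^sup>2) = (real n + 1)\<^sup>2" by simp
      moreover have "(real n + 1)\<^sup>2 * aty G = (real n + 1)\<^sup>2" using False by (simp add: aty_def)
      ultimately show ?thesis by linarith
    qed
  qed
  also have "\<dots> \<le> (Ea i (\<lambda>G. (Ypot (beta n) G - cn n t)\<^sup>2) + 2 * real n * CC * Ea i ka) + ((2 * real n * CC * w + C3\<^sup>2) + (real n + 1)\<^sup>2 * PIE n)"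
  proof -
    define k where "k = 2 * real n * CC * w + C3\<^sup>2"
    have "0 \<le> k" using CC0 w0 by (simp add: k_def)
    from Ea_const_le[OF this, of i] have 1: "Ea i (\<lambda>_. k) \<le> k" .
    have 2: "(real n + 1)\<^sup>2 * Ea i aty \<le> (real n + 1)\<^sup>2 * PIE n"
      unfolding aty_def[abs_def] using PIE_bound[OF run n, of i] t by (intro mult_left_mono) auto
    show ?thesis unfolding k_def[symmetric] Ea_add Ea_cmult by (intro add_mono order_refl 1 2)
  qed
  finally show ?thesis by (simp add: ka_def[abs_def] CC_def w_def C3_def)
qed

lemma Kp_ratio: "(\<lambda>n. real (Kp n) / real n) \<longlonglongrightarrow> 0"
proof (rule tendsto_sandwich[of "\<lambda>_. 0" _ _ "\<lambda>n. (KK n + 2) / (1 - p) / real n + 1 / real n"])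
  have "real (Kp n) \<le> (KK n + 2) / (1 - p) + 1" for n
  proof -
    have "0 \<le> (KK n + 2) / (1 - p)" using KK_nonneg[of n] p by simp
    then show ?thesis unfolding Kp_def by linarith
  qed
  then have "real (Kp n) / real n \<le> ((KK n + 2) / (1 - p) + 1) / real n" for n by (intro divide_right_mono) auto
  then show "\<forall>\<^sub>F n in sequentially. real (Kp n) / real n \<le> (KK n + 2) / (1 - p) / real n + 1 / real n"
    by (simp add: add_divide_distrib)
  have "(\<lambda>n. (KK n + 2) / real n) \<longlonglongrightarrow> 0" unfolding KK_def by real_asymp
  from tendsto_divide[OF this tendsto_const[of "1 - p"]] p
  have "(\<lambda>n. (KK n + 2) / (1 - p) / real n) \<longlonglongrightarrow> 0" by (simp add: divide_divide_eq_left mult.commute)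
  from tendsto_add[OF this lim_1_over_n] show "(\<lambda>n. (KK n + 2) / (1 - p) / real n + 1 / real n) \<longlonglongrightarrow> 0" by simp
qed auto

text \<open>Up to time \<open>T n\<close>, about \<open>\<epsilon> * n\<close>, potential and
  compensator are trivially at most \<open>T n\<close>, which costs a term of order
  \<open>\<epsilon>\<^sup>2 * n\<^sup>2\<close>. From then on positions stay above
  \<open>\<epsilon> / 2\<close>, so the weights are uniformly bounded by \<open>B\<close> and the
  summed errors are small against \<open>n\<^sup>2\<close>.\<close>

lemma Y_small:
  assumes \<eta>: "0 < \<eta>"
  shows "\<forall>\<^sub>F n in sequentially. \<forall>H i. process_run m p H \<longrightarrow> real (oldest H + nverts H) \<le> sqrt (real n) \<longrightarrow>
     process_run.t0 H + i = n \<longrightarrow>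
     process_run.Ea m p repl H i (\<lambda>G. (Ypot (beta n) G - cn n n)\<^sup>2) \<le> \<eta> * (real n)\<^sup>2"
proof -
  define \<epsilon> where "\<epsilon> = min (1/2) (sqrt (\<eta> / 16))"
  have \<epsilon>: "0 < \<epsilon>" "\<epsilon> \<le> 1/2" "\<epsilon>\<^sup>2 \<le> \<eta> / 16"
  proof -
    show "0 < \<epsilon>" "\<epsilon> \<le> 1/2" using \<eta> by (auto simp: \<epsilon>_def)
    have "\<epsilon> \<le> sqrt (\<eta> / 16)" by (simp add: \<epsilon>_def)
    then have "\<epsilon>\<^sup>2 \<le> (sqrt (\<eta> / 16))\<^sup>2" using \<open>0 < \<epsilon>\<close> by (intro power_mono) auto
    then show "\<epsilon>\<^sup>2 \<le> \<eta> / 16" using \<eta> by simp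
  qed
  define a where "a = 2 * p - 1"
  have a: "0 < a" using p by (simp add: a_def)
  \<comment> \<open>Half of the lower limits of \<open>oldest / n\<close> and \<open>act / n\<close>
    at time \<open>\<epsilon> * n\<close>; the other half absorbs the deviation
    \<open>2 * KK n\<close>.\<close>
  define c where "c = min (1 - p) a * \<epsilon> / 2"
  have c: "0 < c" "2 * c \<le> (1 - p) * \<epsilon>" "2 * c \<le> a * \<epsilon>" using a p \<epsilon> by (auto simp: c_def min_def mult_right_mono)
  define B where "B = bf s (\<epsilon> / 2)"
  define C where "C = C1 B c"
  define C3 where "C3 = (real m + 2 + 2 * real m * rho B c)\<^sup>2"
  have B0: "0 \<le> B" using bf_pos[OF s] by (simp add: B_def less_imp_le)
  have C0: "0 \<le> C"
  proof -
    have "0 \<le> rho B c" using B0 c s lam by (simp add: rho_def)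
    then show ?thesis unfolding C_def C1_def using B0 c s lam p by (intro add_nonneg_nonneg mult_nonneg_nonneg divide_nonneg_nonneg) auto
  qed
  define \<eta>' where "\<eta>' = \<eta> / (16 * (C + 1))"
  have \<eta>': "0 < \<eta>'" "2 * C * \<eta>' \<le> \<eta> / 8"
    using \<eta> C0 by (auto simp: \<eta>'_def field_simps)
  define T where "T n = nat \<lceil>\<epsilon> * real n\<rceil>" for n
  have T: "(\<lambda>n. real (T n) / real n) \<longlonglongrightarrow> \<epsilon>" unfolding T_def by (rule nat_ceiling_div_tendsto) (use \<epsilon> in simp)
  have kap: "\<forall>\<^sub>F n in sequentially. \<forall>H i. process_run m p H \<longrightarrow> real (oldest H + nverts H) \<le> sqrt (real n) \<longrightarrow>
     \<epsilon> * real n \<le> real (process_run.t0 H + i) \<longrightarrow> process_run.t0 H + i \<le> n \<longrightarrow>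
     process_run.Ea m p repl H i (\<lambda>G. if process_run.typical p (KK n) G then kappa m G else 0) \<le> \<eta>'"
    by (rule kappa_small[OF m p \<eta>'(1) \<epsilon>(1)])
  have e1: "(\<lambda>n. 2 * C * (4 * (real (Kp n) / real n) * B + (KK n + 2) / real n)) \<longlonglongrightarrow> 2 * C * (4 * 0 * B + 0)"
  proof -
    have "(\<lambda>n. (KK n + 2) / real n) \<longlonglongrightarrow> 0" unfolding KK_def by real_asymp
    then show ?thesis by (intro tendsto_intros Kp_ratio)
  qed
  have e2: "(\<lambda>n. C3 / real n + (real n + 1)\<^sup>2 * PIE n / real n) \<longlonglongrightarrow> 0 + 0"
    by (intro tendsto_add; (unfold PIE_def KK_def)?; real_asymp)
  have lo_lim: "(\<lambda>n. (real (T n) / real n - real (Kp n) / real n) / (1 + 2 * (real (Kp n) / real n))) \<longlonglongrightarrow> (\<epsilon> - 0) / (1 + 2 * 0)"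
    by (intro tendsto_intros T Kp_ratio) auto
  have ev: "\<forall>\<^sub>F n in sequentially. 1 \<le> n \<and> sqrt (real n) \<le> \<epsilon> * real n \<and> Kp n < T n \<and> T n \<le> n \<and> real (T n) \<le> 2 * \<epsilon> * real n
      \<and> \<epsilon> / 2 \<le> lo n (T n) \<and> 2 * KK n \<le> c * real n \<and> 3 * real m \<le> c * real n
      \<and> 2 * C * (4 * (real (Kp n) / real n) * B + (KK n + 2) / real n) \<le> \<eta> / 8
      \<and> C3 / real n + (real n + 1)\<^sup>2 * PIE n / real n \<le> \<eta> / 8"
  proof (intro eventually_conj)
    show "\<forall>\<^sub>F n in sequentially. 1 \<le> n" by (rule eventually_ge_at_top)
    show "\<forall>\<^sub>F n in sequentially. sqrt (real n) \<le> \<epsilon> * real n" using \<epsilon> by real_asymp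
    have "(\<lambda>n. (real (T n) - real (Kp n)) / real n) \<longlonglongrightarrow> \<epsilon> - 0" unfolding diff_divide_distrib by (intro tendsto_intros T Kp_ratio)
    from eventually_pos_of_ratio[OF this] \<epsilon> show "\<forall>\<^sub>F n in sequentially. Kp n < T n" by auto
    have "(\<lambda>n. 1 - real (T n) / real n) \<longlonglongrightarrow> 1 - \<epsilon>" by (intro tendsto_intros T)
    then have "(\<lambda>n. (real n - real (T n)) / real n) \<longlonglongrightarrow> 1 - \<epsilon>"
      by (rule Lim_transform_eventually) (rule eventually_mono[OF eventually_gt_at_top[of 0]], simp add: diff_divide_distrib)
    from eventually_pos_of_ratio[OF this] \<epsilon> show "\<forall>\<^sub>F n in sequentially. T n \<le> n" by (auto elim: eventually_mono)
    have "(\<lambda>n. 2 * \<epsilon> - real (T n) / real n) \<longlonglongrightarrow> 2 * \<epsilon> - \<epsilon>" by (intro tendsto_intros T)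
    then have "(\<lambda>n. (2 * \<epsilon> * real n - real (T n)) / real n) \<longlonglongrightarrow> 2 * \<epsilon> - \<epsilon>"
      by (rule Lim_transform_eventually) (rule eventually_mono[OF eventually_gt_at_top[of 0]], simp add: diff_divide_distrib)
    from eventually_pos_of_ratio[OF this] \<epsilon> show "\<forall>\<^sub>F n in sequentially. real (T n) \<le> 2 * \<epsilon> * real n" by (auto elim: eventually_mono)
    have "(\<lambda>n. lo n (T n)) \<longlonglongrightarrow> (\<epsilon> - 0) / (1 + 2 * 0)"
    proof (rule Lim_transform_eventually[OF lo_lim], rule eventually_mono[OF eventually_gt_at_top[of 0]])
      fix n :: nat assume n: "0 < n"
      have "lo n (T n) = ((real (T n) - real (Kp n)) / real n) / ((real n + 2 * real (Kp n)) / real n)"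
        using n by (simp add: lo_def RR_def)
      then show "(real (T n) / real n - real (Kp n) / real n) / (1 + 2 * (real (Kp n) / real n)) = lo n (T n)"
        using n by (simp add: diff_divide_distrib add_divide_distrib)
    qed
    from order_tendstoD(1)[OF this, of "\<epsilon> / 2"] \<epsilon> show "\<forall>\<^sub>F n in sequentially. \<epsilon> / 2 \<le> lo n (T n)" by (auto elim: eventually_mono)
    show "\<forall>\<^sub>F n in sequentially. 2 * KK n \<le> c * real n" unfolding KK_def using c(1) by real_asymp
    show "\<forall>\<^sub>F n in sequentially. 3 * real m \<le> c * real n" using c(1) by real_asymp
    from order_tendstoD(2)[OF e1, of "\<eta> / 8"] \<eta> show "\<forall>\<^sub>F n in sequentially. 2 * C * (4 * (real (Kp n) / real n) * B + (KK n + 2) / real n) \<le> \<eta> / 8"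
      by (auto elim: eventually_mono)
    from order_tendstoD(2)[OF e2, of "\<eta> / 8"] \<eta> show "\<forall>\<^sub>F n in sequentially. C3 / real n + (real n + 1)\<^sup>2 * PIE n / real n \<le> \<eta> / 8"
      by (auto elim: eventually_mono)
  qed
  from ev kap show ?thesis
  proof (eventually_elim, intro allI impI)
    case (elim n)
    fix H i assume run: "process_run m p H" and H: "real (oldest H + nverts H) \<le> sqrt (real n)" and ti: "process_run.t0 H + i = n"
    interpret process_run m p repl H by (rule run)
    define i0 where "i0 = T n - t0"
    have t0: "t0 \<le> T n" using H elim(1) by (simp add: T_def t0_def) linarith
    have i0: "t0 + i0 = T n" using t0 by (simp add: i0_def)
    define z where "z j = Ea j (\<lambda>G. (Ypot (beta n) G - cn n (t0 + j))\<^sup>2)" for j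
    have n0: "0 < real n" using elim(1) by simp
    have start: "z i0 \<le> (real (T n))\<^sup>2"
    proof -
      have "z i0 \<le> Ea i0 (\<lambda>_. (real (T n))\<^sup>2)" unfolding z_def
      proof (rule Ea_mono)
        fix G assume G: "live i0 G"
        have "nverts G \<le> T n" using live_time[OF G] i0 by simp
        then have "\<bar>Ypot (beta n) G - cn n (t0 + i0)\<bar> \<le> \<bar>real (T n)\<bar>"
          using Ypot_bounds[OF run G, of n] cn_bounds[of "T n" n] elim(1) i0 by (simp add: abs_le_iff)
        then show "(Ypot (beta n) G - cn n (t0 + i0))\<^sup>2 \<le> (real (T n))\<^sup>2" by (simp only: abs_le_square_iff)
      qed
      also have "\<dots> \<le> (real (T n))\<^sup>2" by (rule Ea_const_le) simp
      finally show ?thesis .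
    qed
    define e where "e t = 2 * real n * C * \<eta>' + 2 * real n * C * (osn n t + (KK n + 2) / real n) + C3 + (real n + 1)\<^sup>2 * PIE n" for t
    have stp: "z (Suc j) \<le> z j + e (t0 + j)" if j: "T n \<le> t0 + j" "Suc (t0 + j) \<le> n" for j
    proof -
      have "\<epsilon> * real n \<le> real (T n)" unfolding T_def using real_nat_ceiling_ge by blast
      then have en: "\<epsilon> * real n \<le> real (t0 + j)" using j by linarith
      have "Ea (Suc j) (\<lambda>G. (Ypot (beta n) G - cn n (Suc (t0 + j)))\<^sup>2) \<le> Ea j (\<lambda>G. (Ypot (beta n) G - cn n (t0 + j))\<^sup>2)
         + 2 * real n * C1 B c * Ea j (\<lambda>G. if typical (KK n) G then kappa m G else 0)
         + 2 * real n * C1 B c * (osn n (t0 + j) + (KK n + 2) / real n) + (real m + 2 + 2 * real m * rho B c)\<^sup>2 + (real n + 1)\<^sup>2 * PIE n"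
      proof (rule second_moment_step[OF run])
        have "lo n (T n) \<le> lo n (t0 + j)" using j RR_pos[of n] by (simp add: lo_def divide_right_mono)
        then show "bf s (lo n (t0 + j)) \<le> B" unfolding B_def using elim(1) \<epsilon> by (intro bf_antimono[OF s]) auto
        fix G assume G: "live j G" "typical (KK n) G"
        define u1 u2 where "u1 = (1 - p) * real (t0 + j)" and "u2 = a * real (t0 + j)"
        have "2 * c * real n \<le> (1 - p) * \<epsilon> * real n" "2 * c * real n \<le> a * \<epsilon> * real n"
          using c n0 by (auto intro!: mult_right_mono)
        moreover have "(1 - p) * \<epsilon> * real n \<le> u1" "a * \<epsilon> * real n \<le> u2"
          unfolding u1_def u2_def mult.assoc using en p a by (auto intro!: mult_left_mono)
        moreover have "u1 - KK n \<le> real (oldest G)" "u2 - 2 * KK n \<le> real (act G)"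
          using typical_oldest(1)[OF G] typical_act_ge[OF G] by (simp_all only: u1_def u2_def a_def)
        moreover have "2 * KK n \<le> c * real n" using elim(1) by blast
        ultimately have "c * real n \<le> real (oldest G)" "c * real n \<le> real (act G)" using KK_nonneg[of n] by linarith+
        then show "c * real n \<le> real (oldest G) \<and> c * real n \<le> real (act G) \<and> 3 * m \<le> act G"
          using elim(1) by linarith
      qed (use elim(1) H j c in auto)
      moreover have "2 * real n * C1 B c * Ea j (\<lambda>G. if typical (KK n) G then kappa m G else 0) \<le> 2 * real n * C * \<eta>'"
        unfolding C_def[symmetric] using elim(2) run H en j C0 by (intro mult_left_mono) auto
      ultimately show ?thesis unfolding z_def e_def C_def C3_def by simp
    qed
    have "z (i0 + k) \<le> z i0 + (\<Sum>t\<in>{T n..<T n + k}. e t)" if "T n + k \<le> n" for k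
      using that
    proof (induction k)
      case (Suc k)
      have eqt: "t0 + (i0 + k) = T n + k" using i0 by simp
      have "z (Suc (i0 + k)) \<le> z (i0 + k) + e (t0 + (i0 + k))" by (rule stp) (use eqt Suc.prems in auto)
      then show ?case using Suc eqt by simp
    qed simp
    from this[of "n - T n"] have "z (i0 + (n - T n)) \<le> z i0 + (\<Sum>t\<in>{T n..<n}. e t)" using elim(1) by simp
    moreover have "i0 + (n - T n) = i" using ti i0 elim(1) by linarith
    moreover have "z i = Ea i (\<lambda>G. (Ypot (beta n) G - cn n n)\<^sup>2)" by (simp add: z_def ti)
    ultimately have "Ea i (\<lambda>G. (Ypot (beta n) G - cn n n)\<^sup>2) \<le> (real (T n))\<^sup>2 + (\<Sum>t\<in>{T n..<n}. e t)" using start by simp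
    also have "(\<Sum>t\<in>{T n..<n}. e t) \<le> (\<eta> / 8 + \<eta> / 8 + \<eta> / 8) * (real n)\<^sup>2"
    proof -
      define b where "b = 2 * real n * C * \<eta>' + 2 * real n * C * ((KK n + 2) / real n) + C3 + (real n + 1)\<^sup>2 * PIE n"
      have b0: "0 \<le> b" using C0 \<eta>' KK_nonneg[of n] by (simp add: b_def C3_def PIE_def)
      have "(\<Sum>t\<in>{T n..<n}. e t) = (\<Sum>t\<in>{T n..<n}. 2 * real n * C * osn n t + b)" by (rule sum.cong) (auto simp: e_def b_def algebra_simps)
      also have "\<dots> = 2 * real n * C * (\<Sum>t\<in>{T n..<n}. osn n t) + real (n - T n) * b" by (simp add: sum.distrib sum_distrib_left)
      also have "\<dots> \<le> 2 * real n * C * (4 * real (Kp n) * B) + real n * b"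
      proof (intro add_mono mult_left_mono mult_right_mono sum_osn)
        show "bf s (lo n (T n)) \<le> B" unfolding B_def using elim(1) \<epsilon> by (intro bf_antimono[OF s]) auto
      qed (use elim(1) C0 b0 in auto)
      also have "\<dots> = (2 * C * \<eta>' + 2 * C * (4 * (real (Kp n) / real n) * B + (KK n + 2) / real n) + (C3 / real n + (real n + 1)\<^sup>2 * PIE n / real n)) * (real n)\<^sup>2"
        using n0 by (simp add: b_def field_simps power2_eq_square)
      also have "\<dots> \<le> (\<eta> / 8 + \<eta> / 8 + \<eta> / 8) * (real n)\<^sup>2"
        using elim(1) \<eta>' by (intro mult_right_mono add_mono) auto
      finally show ?thesis .
    qed
    also have "(real (T n))\<^sup>2 \<le> (2 * \<epsilon> * real n)\<^sup>2" using elim(1) by (intro power_mono) auto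
    also have "\<dots> = 4 * \<epsilon>\<^sup>2 * (real n)\<^sup>2" by (simp add: power_mult_distrib)
    also have "\<dots> \<le> \<eta> / 4 * (real n)\<^sup>2" using \<epsilon> by (intro mult_right_mono) auto
    finally have "Ea i (\<lambda>G. (Ypot (beta n) G - cn n n)\<^sup>2) \<le> \<eta> / 4 * (real n)\<^sup>2 + (\<eta> / 8 + \<eta> / 8 + \<eta> / 8) * (real n)\<^sup>2" by simp
    also have "\<dots> = (5 / 8) * (\<eta> * (real n)\<^sup>2)" by (simp add: algebra_simps)
    also have "\<dots> \<le> 1 * (\<eta> * (real n)\<^sup>2)" using \<eta> by (intro mult_right_mono) auto
    finally show "Ea i (\<lambda>G. (Ypot (beta n) G - cn n n)\<^sup>2) \<le> \<eta> * (real n)\<^sup>2" by simp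
  qed
qed

end

section \<open>Trajectories\<close>

lemma sum_PiE_insert:
  assumes "x \<notin> S"
  shows "(\<Sum>s\<in>PiE (insert x S) T. h s) = (\<Sum>g\<in>PiE S T. \<Sum>y\<in>T x. h (g(x := y)))"
proof -
  have "(\<Sum>s\<in>PiE (insert x S) T. h s) = (\<Sum>(y, g)\<in>T x \<times> PiE S T. h (g(x := y)))"
    unfolding PiE_insert_eq by (subst sum.reindex[OF inj_combinator[OF assms]]) (simp add: case_prod_unfold)
  also have "\<dots> = (\<Sum>y\<in>T x. \<Sum>g\<in>PiE S T. h (g(x := y)))" by (rule sum.cartesian_product[symmetric])
  also have "\<dots> = (\<Sum>g\<in>PiE S T. \<Sum>y\<in>T x. h (g(x := y)))" by (rule sum.swap)
  finally show ?thesis .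
qed

lemma sets_process: "sets (process repl m p H) = sets (PiM UNIV (\<lambda>_. count_space UNIV))"
proof -
  interpret IT: Ionescu_Tulcea "transition repl m p H" "\<lambda>_. count_space UNIV" by (rule Ionescu_Tulcea_transition)
  show ?thesis unfolding process_def by (rule IT.PF.sets_lim)
qed

lemma space_process [simp]: "space (process repl m p H) = UNIV"
  using sets_eq_imp_space_eq[OF sets_process] by (simp add: space_PiM)

lemma process_coordinate_sets: "{\<omega>. Q (\<omega> i)} \<in> sets (process repl m p H)"
proof -
  have "(\<lambda>\<omega>. \<omega> i) \<in> measurable (process repl m p H) (count_space UNIV)"
    unfolding measurable_cong_sets[OF sets_process refl] by (rule measurable_component_singleton) simp
  from measurable_sets[OF this, of "Collect Q"] show ?thesis by (simp add: vimage_def)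
qed

context process_run begin

abbreviation PP where "PP \<equiv> process repl m p H"

definition path_weight :: "nat \<Rightarrow> (nat \<Rightarrow> mgraph) \<Rightarrow> real" where
  "path_weight n s = indicator {H} (s 0) * (\<Prod>i<n. pmf (step repl m p (s i)) (s (Suc i)))"

definition paths :: "nat \<Rightarrow> (nat \<Rightarrow> mgraph) set" where "paths n = PiE {..n} (\<lambda>i. set_pmf (L i))"

lemma finite_paths: "finite (paths n)" unfolding paths_def by (rule finite_PiE) auto

text \<open>Finitely many paths carry the whole mass up to step \<open>n\<close>, so cylinder
  probabilities can be summed like a finite Markov chain.\<close>

lemma sum_paths: "(\<Sum>s\<in>paths n. path_weight n s * f (s n)) = ex (L n) f"
proof (induction n arbitrary: f)
  case 0
  have "paths 0 = PiE (insert 0 {}) (\<lambda>i. set_pmf (L i))" by (simp add: paths_def atMost_0)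
  then show ?case by (simp add: sum_PiE_insert path_weight_def)
next
  case (Suc n)
  have "paths (Suc n) = PiE (insert (Suc n) {..n}) (\<lambda>i. set_pmf (L i))" by (simp add: paths_def atMost_Suc)
  then have "(\<Sum>s\<in>paths (Suc n). path_weight (Suc n) s * f (s (Suc n))) =
    (\<Sum>g\<in>paths n. \<Sum>y\<in>set_pmf (L (Suc n)). path_weight (Suc n) (g(Suc n := y)) * f y)"
    by (simp add: sum_PiE_insert paths_def)
  also have "\<dots> = (\<Sum>g\<in>paths n. path_weight n g * ex (step repl m p (g n)) f)"
  proof (rule sum.cong[OF refl])
    fix g assume g: "g \<in> paths n"
    then have gn: "g n \<in> set_pmf (L n)" by (auto simp: paths_def)
    have w: "path_weight (Suc n) (g(Suc n := y)) = path_weight n g * pmf (step repl m p (g n)) y" for y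
    proof -
      have "(\<Prod>i<n. pmf (step repl m p ((g(Suc n := y)) i)) ((g(Suc n := y)) (Suc i))) = (\<Prod>i<n. pmf (step repl m p (g i)) (g (Suc i)))"
        by (rule prod.cong) auto
      then show ?thesis by (simp add: path_weight_def)
    qed
    have "set_pmf (step repl m p (g n)) \<subseteq> set_pmf (L (Suc n))" using gn by auto
    from ex_sum[OF finite_law this] show "(\<Sum>y\<in>set_pmf (L (Suc n)). path_weight (Suc n) (g(Suc n := y)) * f y) = path_weight n g * ex (step repl m p (g n)) f"
      unfolding w by (simp add: sum_distrib_left mult.assoc)
  qed
  also have "\<dots> = ex (L n) (\<lambda>G. ex (step repl m p G) f)" by (rule Suc.IH)
  also have "\<dots> = ex (L (Suc n)) f" unfolding law.simps by (rule ex_bind[symmetric]) (use step_facts(1) law_good in auto)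
  finally show ?case .
qed

text \<open>\<open>B\<close> depends only on the first \<open>n + 1\<close> coordinates, so it
  contains the disjoint cylinders of the paths satisfying it. Only this inequality is shown;
  equality follows by passing to complements.\<close>

lemma process_ge_paths:
  assumes meas: "{\<omega>. B \<omega>} \<in> sets PP" and B: "\<And>\<omega> s. (\<And>i. i \<le> n \<Longrightarrow> \<omega> i = s i) \<Longrightarrow> B s \<Longrightarrow> B \<omega>"
  shows "(\<Sum>s\<in>paths n. path_weight n s * of_bool (B s)) \<le> measure PP {\<omega>. B \<omega>}"
proof -
  interpret prob_space PP by (rule prob_space_process)
  define C where "C s = {\<omega>. \<forall>i\<le>n. \<omega> i = s i}" for s :: "nat \<Rightarrow> mgraph"
  have C: "C s \<in> sets PP" for s
  proof -
    have "C s = (\<Inter>i\<in>{..n}. {\<omega>. \<omega> i = s i})" by (auto simp: C_def)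
    then show ?thesis by (auto intro!: sets.finite_INT process_coordinate_sets)
  qed
  have wC: "measure PP (C s) = path_weight n s" for s
    unfolding measure_def C_def process_cylinder
    by (simp add: path_weight_def prod_ennreal indicator_def prod_nonneg)
  define P where "P = {s \<in> paths n. B s}"
  have fin: "finite P" using finite_paths by (simp add: P_def)
  have "disjoint_family_on C P"
  proof (unfold disjoint_family_on_def, intro ballI impI)
    fix s s' assume s: "s \<in> P" "s' \<in> P" "s \<noteq> s'"
    then have "\<exists>i\<le>n. s i \<noteq> s' i" using PiE_ext[of s "{..n}" "\<lambda>i. set_pmf (L i)" s'] by (auto simp: P_def paths_def)
    then show "C s \<inter> C s' = {}" by (fastforce simp: C_def)
  qed
  from finite_measure_finite_Union[OF fin _ this] have "measure PP (\<Union>s\<in>P. C s) = (\<Sum>s\<in>P. path_weight n s)"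
    using C by (simp add: wC image_subset_iff)
  also have "\<dots> = (\<Sum>s\<in>paths n. path_weight n s * of_bool (B s))"
    unfolding P_def using finite_paths by (intro sum.mono_neutral_cong_left) auto
  finally show ?thesis using finite_measure_mono[OF _ meas, of "\<Union>s\<in>P. C s"] B by (auto simp: C_def P_def)
qed

text \<open>The lower bound by path weights holds for the event and for its complement, and both
  sides add up to 1.\<close>

lemma process_coordinate: "measure PP {\<omega>. Q (\<omega> i)} = ex (L i) (\<lambda>G. of_bool (Q G))"
proof -
  interpret prob_space PP by (rule prob_space_process)
  have ge: "ex (L i) (\<lambda>G. of_bool (R G)) \<le> measure PP {\<omega>. R (\<omega> i)}" for R
    unfolding sum_paths[symmetric] by (rule process_ge_paths[OF process_coordinate_sets]) auto
  have "{\<omega>. \<not> Q (\<omega> i)} = space PP - {\<omega>. Q (\<omega> i)}" by auto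
  then have "measure PP {\<omega>. \<not> Q (\<omega> i)} = 1 - measure PP {\<omega>. Q (\<omega> i)}"
    using prob_compl[OF process_coordinate_sets] by simp
  moreover have "ex (L i) (\<lambda>G. of_bool (\<not> Q G)) = 1 - ex (L i) (\<lambda>G. of_bool (Q G))"
  proof -
    have "ex (L i) (\<lambda>G. of_bool (\<not> Q G) + of_bool (Q G)) = ex (L i) (\<lambda>_. 1)" by (rule ex_cong) auto
    then show ?thesis by (simp add: ex_add)
  qed
  ultimately show ?thesis using ge[of Q] ge[of "\<lambda>G. \<not> Q G"] by linarith
qed

text \<open>The trajectory space contains sequences in which edges reappear, so this is an almost
  sure statement: every path violating it contains a transition of probability 0.\<close>

lemma process_dead_stays: "AE \<omega> in PP. edges (\<omega> i) = {#} \<longrightarrow> edges (\<omega> (Suc i)) = {#}"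
proof -
  interpret prob_space PP by (rule prob_space_process)
  define B where "B \<omega> \<longleftrightarrow> (edges (\<omega> i) = {#} \<longrightarrow> edges (\<omega> (Suc i)) = {#})" for \<omega> :: "nat \<Rightarrow> mgraph"
  have "{\<omega>. B \<omega>} = {\<omega>. edges (\<omega> i) \<noteq> {#}} \<union> {\<omega>. edges (\<omega> (Suc i)) = {#}}" by (auto simp: B_def)
  then have meas: "{\<omega>. B \<omega>} \<in> sets PP" 
    using sets.Un[OF process_coordinate_sets[of "\<lambda>G. edges G \<noteq> {#}" i] process_coordinate_sets[of "\<lambda>G. edges G = {#}" "Suc i"]] by simp
  have "path_weight (Suc i) s * of_bool (B s) = path_weight (Suc i) s * 1" for s
  proof (cases "B s")
    case False
    then have "step repl m p (s i) = return_pmf (s i)" "s (Suc i) \<noteq> s i" by (auto simp: B_def step_def)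
    then have "path_weight (Suc i) s = 0" by (simp add: path_weight_def)
    then show ?thesis by simp
  qed simp
  then have "(\<Sum>s\<in>paths (Suc i). path_weight (Suc i) s * of_bool (B s)) = (\<Sum>s\<in>paths (Suc i). path_weight (Suc i) s * 1)"
    by (rule sum.cong[OF refl])
  also have "\<dots> = 1" unfolding sum_paths[where n = "Suc i" and f = "\<lambda>_. 1"] by simp
  finally have "(\<Sum>s\<in>paths (Suc i). path_weight (Suc i) s * of_bool (B s)) = 1" .
  moreover have "(\<Sum>s\<in>paths (Suc i). path_weight (Suc i) s * of_bool (B s)) \<le> measure PP {\<omega>. B \<omega>}"
    by (rule process_ge_paths[OF meas]) (simp add: B_def)
  ultimately have "measure PP {\<omega>. B \<omega>} = 1" using prob_le_1[of "{\<omega>. B \<omega>}"] by linarith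
  then have "AE \<omega> in PP. \<omega> \<in> {\<omega>. B \<omega>}" using prob_eq_1[OF meas] by simp
  then show ?thesis by (simp add: B_def)
qed

lemma dies_sets: "{\<omega>. dies \<omega>} \<in> sets PP"
proof -
  have "{\<omega>. dies \<omega>} = (\<Union>i. {\<omega>. edges (\<omega> i) = {#}})" by (auto simp: dies_def)
  then show ?thesis using process_coordinate_sets[of "\<lambda>G. edges G = {#}"] by auto
qed

text \<open>Extinction by step \<open>n\<close> is almost surely the event of being edgeless at step
  \<open>n\<close>, for which the survival bound is uniform in \<open>n\<close>; continuity from
  below gives the limit.\<close>

lemma process_dies: "measure PP {\<omega>. dies \<omega>} \<le> (1 - p) / p"
proof -
  interpret prob_space PP by (rule prob_space_process)
  define E where "E n = (\<Union>i\<le>n. {\<omega>::nat \<Rightarrow> mgraph. edges (\<omega> i) = {#}})" for n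
  have Em: "E n \<in> sets PP" for n unfolding E_def using process_coordinate_sets[of "\<lambda>G. edges G = {#}"] by auto
  have "AE \<omega> in PP. \<forall>i. edges (\<omega> i) = {#} \<longrightarrow> edges (\<omega> (Suc i)) = {#}"
    using process_dead_stays by (simp add: AE_all_countable)
  then have "AE \<omega> in PP. \<omega> \<in> E n \<longrightarrow> \<omega> \<in> {\<omega>. edges (\<omega> n) = {#}}" for n
  proof (rule AE_mp, intro AE_I2 impI)
    fix \<omega> assume st: "\<forall>i. edges (\<omega> i) = {#} \<longrightarrow> edges (\<omega> (Suc i)) = {#}" and "\<omega> \<in> E n"
    then obtain i where i: "i \<le> n" "edges (\<omega> i) = {#}" by (auto simp: E_def)
    have "edges (\<omega> (i + k)) = {#}" for k using i st by (induction k) auto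
    from this[of "n - i"] show "\<omega> \<in> {\<omega>. edges (\<omega> n) = {#}}" using i by simp
  qed
  then have "measure PP (E n) \<le> measure PP {\<omega>. edges (\<omega> n) = {#}}" for n
    by (rule finite_measure_mono_AE) (rule process_coordinate_sets)
  then have b: "measure PP (E n) \<le> (1 - p) / p" for n
    by (rule order_trans) (simp add: process_coordinate[of "\<lambda>G. edges G = {#}"] survival)
  have "(\<lambda>n. measure PP (E n)) \<longlonglongrightarrow> measure PP (\<Union>n. E n)"
  proof (rule finite_Lim_measure_incseq)
    show "range E \<subseteq> sets PP" using Em by auto
    show "incseq E" unfolding incseq_def E_def by (intro allI impI UN_mono) auto
  qed
  moreover have "(\<Union>n. E n) = {\<omega>. dies \<omega>}" by (auto simp: E_def dies_def)
  ultimately show ?thesis using b by (auto intro: LIMSEQ_le_const2)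
qed

text \<open>A surviving trajectory has edges at step \<open>i\<close>, so a failure of
  \<open>Q\<close> together with survival is bounded by \<open>Ea\<close>; dividing by the
  probability of survival, bounded below, passes to the conditional law.\<close>

lemma cond_prob_alive_ge:
  "1 - Ea i (\<lambda>G. of_bool (\<not> Q G)) / (1 - (1 - p) / p) \<le> \<P>(\<omega> in PP. Q (\<omega> i) \<bar> \<not> dies \<omega>)"
  "\<P>(\<omega> in PP. Q (\<omega> i) \<bar> \<not> dies \<omega>) \<le> 1"
proof -
  interpret prob_space PP by (rule prob_space_process)
  define N where "N = {\<omega>::nat \<Rightarrow> mgraph. \<not> dies \<omega>}"
  define c where "c = 1 - (1 - p) / p"
  have c0: "0 < c" using p by (simp add: c_def)
  have N: "N \<in> sets PP"
  proof -
    have "N = space PP - {\<omega>. dies \<omega>}" by (auto simp: N_def)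
    then show ?thesis by (simp only: sets.compl_sets[OF dies_sets])
  qed
  have pN: "c \<le> measure PP N"
  proof -
    have "N = space PP - {\<omega>. dies \<omega>}" by (auto simp: N_def)
    then show ?thesis using prob_compl[OF dies_sets] process_dies by (simp add: c_def)
  qed
  define g b where "g = measure PP ({\<omega>. Q (\<omega> i)} \<inter> N)" and "b = measure PP ({\<omega>. \<not> Q (\<omega> i)} \<inter> N)"
  have gb: "g + b = measure PP N"
  proof -
    have "measure PP (({\<omega>. Q (\<omega> i)} \<inter> N) \<union> ({\<omega>. \<not> Q (\<omega> i)} \<inter> N)) = g + b"
      unfolding g_def b_def
      by (rule finite_measure_Union) (auto intro!: sets.Int N process_coordinate_sets process_coordinate_sets[of "\<lambda>G. \<not> Q G"])
    moreover have "({\<omega>. Q (\<omega> i)} \<inter> N) \<union> ({\<omega>. \<not> Q (\<omega> i)} \<inter> N) = N" by auto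
    ultimately show ?thesis by simp
  qed
  have bE: "b \<le> Ea i (\<lambda>G. of_bool (\<not> Q G))"
  proof -
    have "b \<le> measure PP {\<omega>. edges (\<omega> i) \<noteq> {#} \<and> \<not> Q (\<omega> i)}" unfolding b_def
      by (rule finite_measure_mono[OF _ process_coordinate_sets[of "\<lambda>G. edges G \<noteq> {#} \<and> \<not> Q G"]]) (auto simp: N_def dies_def)
    also have "\<dots> = Ea i (\<lambda>G. of_bool (\<not> Q G))" 
      unfolding process_coordinate[of "\<lambda>G. edges G \<noteq> {#} \<and> \<not> Q G"] Ea_def by (rule ex_cong) auto
    finally show ?thesis .
  qed
  have b0: "0 \<le> b" "0 \<le> g" by (simp_all add: b_def g_def)
  have eq: "\<P>(\<omega> in PP. Q (\<omega> i) \<bar> \<not> dies \<omega>) = g / measure PP N"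
    by (simp add: cond_prob_def g_def N_def Int_def)
  have mp: "0 < measure PP N" using pN c0 by linarith
  have "b / measure PP N \<le> Ea i (\<lambda>G. of_bool (\<not> Q G)) / c" using bE b0 c0 pN by (intro frac_le) auto
  moreover have "g / measure PP N = 1 - b / measure PP N" using gb mp by (simp add: field_simps)
  ultimately show "1 - Ea i (\<lambda>G. of_bool (\<not> Q G)) / (1 - (1 - p) / p) \<le> \<P>(\<omega> in PP. Q (\<omega> i) \<bar> \<not> dies \<omega>)"
    unfolding eq c_def by linarith
  show "\<P>(\<omega> in PP. Q (\<omega> i) \<bar> \<not> dies \<omega>) \<le> 1" unfolding eq using gb b0 mp by (simp add: divide_le_eq_1)
qed

end

section \<open>Convergence of the degree counts\<close>

lemma prod_mset_diff_le:
  fixes f g :: "'a \<Rightarrow> real"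
  assumes "\<And>x. x \<in># M \<Longrightarrow> 0 \<le> f x \<and> f x \<le> 1 \<and> 0 \<le> g x \<and> g x \<le> 1"
  shows "\<bar>(\<Prod>x\<in>#M. f x) - (\<Prod>x\<in>#M. g x)\<bar> \<le> (\<Sum>x\<in>#M. \<bar>f x - g x\<bar>)"
  using assms
proof (induction M)
  case (add x M)
  define F G where "F = (\<Prod>x\<in>#M. f x)" and "G = (\<Prod>x\<in>#M. g x)"
  have b: "0 \<le> F" "F \<le> 1" using prod_mset_bounds[of M f] add.prems by (auto simp: F_def)
  have x: "0 \<le> f x" "f x \<le> 1" "0 \<le> g x" "g x \<le> 1" using add.prems by auto
  have IH: "\<bar>F - G\<bar> \<le> (\<Sum>x\<in>#M. \<bar>f x - g x\<bar>)" unfolding F_def G_def using add by auto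
  have "f x * F - g x * G = (f x - g x) * F + g x * (F - G)" by (simp add: algebra_simps)
  then have "\<bar>f x * F - g x * G\<bar> \<le> \<bar>(f x - g x) * F\<bar> + \<bar>g x * (F - G)\<bar>" by linarith
  also have "\<dots> \<le> \<bar>f x - g x\<bar> * 1 + 1 * \<bar>F - G\<bar>" unfolding abs_mult using b x by (intro add_mono mult_mono) auto
  finally show ?case using IH by (simp add: F_def G_def)
qed simp

text \<open>Uniformity over the start graph is essential because \<open>H\<close> varies with
  \<open>n\<close>. The index \<open>i\<close> is the number of steps after which time
  \<open>n\<close> is reached.\<close>

definition negligible :: "nat \<Rightarrow> real \<Rightarrow> bool \<Rightarrow> (nat \<Rightarrow> mgraph \<Rightarrow> bool) \<Rightarrow> bool" where
  "negligible m p repl B \<longleftrightarrow> (\<forall>\<delta>>0. \<forall>\<^sub>F n in sequentially. \<forall>H i. process_run m p H \<longrightarrow>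
     real (oldest H + nverts H) \<le> sqrt (real n) \<longrightarrow> process_run.t0 H + i = n \<longrightarrow>
     process_run.Ea m p repl H i (\<lambda>G. of_bool (B n G)) \<le> \<delta>)"

lemma negligible_cover:
  assumes A: "negligible m p repl A" and B: "negligible m p repl B"
    and cov: "\<forall>\<^sub>F n in sequentially. \<forall>H i G. process_run m p H \<longrightarrow> process_run.t0 H + i = n \<longrightarrow>
      process_run.live m p repl H i G \<longrightarrow> C n G \<longrightarrow> A n G \<or> B n G"
  shows "negligible m p repl C"
  unfolding negligible_def
proof (intro allI impI)
  fix \<delta> :: real assume "0 < \<delta>"
  then have d: "0 < \<delta> / 2" by simp
  show "\<forall>\<^sub>F n in sequentially. \<forall>H i. process_run m p H \<longrightarrow> real (oldest H + nverts H) \<le> sqrt (real n) \<longrightarrow>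
     process_run.t0 H + i = n \<longrightarrow> process_run.Ea m p repl H i (\<lambda>G. of_bool (C n G)) \<le> \<delta>"
    using A[unfolded negligible_def, rule_format, OF d] B[unfolded negligible_def, rule_format, OF d] cov
  proof eventually_elim
    case (elim n)
    show ?case
    proof (intro allI impI)
      fix H i assume run: "process_run m p H" and sq: "real (oldest H + nverts H) \<le> sqrt (real n)" and ti: "process_run.t0 H + i = n"
      interpret process_run m p repl H by (rule run)
      have "Ea i (\<lambda>G. of_bool (C n G)) \<le> Ea i (\<lambda>G. of_bool (A n G) + of_bool (B n G))"
      proof (rule Ea_mono)
        fix G assume "live i G"
        then have "C n G \<longrightarrow> A n G \<or> B n G" using elim(3) run ti by blast
        then show "(of_bool (C n G) :: real) \<le> of_bool (A n G) + of_bool (B n G)" by auto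
      qed
      also have "\<dots> \<le> \<delta> / 2 + \<delta> / 2" unfolding Ea_add using elim(1,2) run sq ti by (intro add_mono) auto
      finally show "Ea i (\<lambda>G. of_bool (C n G)) \<le> \<delta>" by simp
    qed
  qed
qed

lemma negligible_atypical: "negligible m p repl (\<lambda>n G. \<not> process_run.typical p (KK n) G)"
  unfolding negligible_def
proof (intro allI impI)
  fix \<delta> :: real assume d: "0 < \<delta>"
  have "PIE \<longlonglongrightarrow> 0" unfolding PIE_def[abs_def] KK_def by real_asymp
  from order_tendstoD(2)[OF this d] eventually_ge_at_top[of 1]
  show "\<forall>\<^sub>F n in sequentially. \<forall>H i. process_run m p H \<longrightarrow> real (oldest H + nverts H) \<le> sqrt (real n) \<longrightarrow>
     process_run.t0 H + i = n \<longrightarrow> process_run.Ea m p repl H i (\<lambda>G. of_bool (\<not> process_run.typical p (KK n) G)) \<le> \<delta>"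
  proof eventually_elim
    case (elim n)
    show ?case
    proof (intro allI impI)
      fix H i assume run: "process_run m p H" and sq: "real (oldest H + nverts H) \<le> sqrt (real n)" and ti: "process_run.t0 H + i = n"
      show "process_run.Ea m p repl H i (\<lambda>G. of_bool (\<not> process_run.typical p (KK n) G)) \<le> \<delta>"
        using PIE_bound[OF run elim(2) sq, of i repl] ti elim(1) by simp
    qed
  qed
qed

context pa_limit begin

text \<open>Chebyshev's inequality applied to the second-moment bound.\<close>

lemma negligible_Ypot:
  assumes a: "0 < a" shows "negligible m p repl (\<lambda>n G. a * real n < \<bar>Ypot (beta n) G - cn n n\<bar>)"
  unfolding negligible_def
proof (intro allI impI)
  fix \<delta> :: real assume d: "0 < \<delta>"
  have "0 < \<delta> * a\<^sup>2" using d a by simp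
  from Y_small[OF this] eventually_ge_at_top[of 1]
  show "\<forall>\<^sub>F n in sequentially. \<forall>H i. process_run m p H \<longrightarrow> real (oldest H + nverts H) \<le> sqrt (real n) \<longrightarrow>
     process_run.t0 H + i = n \<longrightarrow> process_run.Ea m p repl H i (\<lambda>G. of_bool (a * real n < \<bar>Ypot (beta n) G - cn n n\<bar>)) \<le> \<delta>"
  proof (eventually_elim, intro allI impI)
    fix n H i
    assume Y: "\<forall>H i. process_run m p H \<longrightarrow> real (oldest H + nverts H) \<le> sqrt (real n) \<longrightarrow> process_run.t0 H + i = n \<longrightarrow>
        process_run.Ea m p repl H i (\<lambda>G. (Ypot (beta n) G - cn n n)\<^sup>2) \<le> \<delta> * a\<^sup>2 * (real n)\<^sup>2"
      and n1: "1 \<le> n" and run: "process_run m p H" and sq: "real (oldest H + nverts H) \<le> sqrt (real n)" and ti: "process_run.t0 H + i = n"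
    interpret process_run m p repl H by (rule run)
    have an: "0 < a * real n" using a n1 by simp
    have "Ea i (\<lambda>G. of_bool (a * real n < \<bar>Ypot (beta n) G - cn n n\<bar>)) \<le> Ea i (\<lambda>G. 1 / (a * real n)\<^sup>2 * (Ypot (beta n) G - cn n n)\<^sup>2)"
    proof (rule Ea_mono)
      fix G
      show "of_bool (a * real n < \<bar>Ypot (beta n) G - cn n n\<bar>) \<le> 1 / (a * real n)\<^sup>2 * (Ypot (beta n) G - cn n n)\<^sup>2"
      proof (cases "a * real n < \<bar>Ypot (beta n) G - cn n n\<bar>")
        case True
        then have "(a * real n)\<^sup>2 \<le> \<bar>Ypot (beta n) G - cn n n\<bar>\<^sup>2" using an by (intro power_mono) auto
        then show ?thesis using True a n1 by (simp add: le_divide_eq_1)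
      qed simp
    qed
    also have "\<dots> \<le> 1 / (a * real n)\<^sup>2 * (\<delta> * a\<^sup>2 * (real n)\<^sup>2)"
      unfolding Ea_cmult using Y run sq ti by (intro mult_left_mono) auto
    also have "\<dots> = \<delta>" using a n1 by (simp add: power_mult_distrib)
    finally show "Ea i (\<lambda>G. of_bool (a * real n < \<bar>Ypot (beta n) G - cn n n\<bar>)) \<le> \<delta>" .
  qed
qed

text \<open>At time \<open>n\<close> the oldest vertex is near position 1, so its weight is near
  \<open>s + (1 - s) * W 0 = 1\<close>, while birth times beyond \<open>NN n\<close> have negative
  age and weight \<open>s\<close>. Each factor of the product is then close to \<open>s\<close>. The
  hypothesis on \<open>lo\<close> keeps the age below \<open>Lg\<close>, where \<open>W\<close> is a
  pure exponential.\<close>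

lemma final_comparison:
  assumes run: "process_run m p H" and G: "process_run.live m p repl H i G" "process_run.typical p (KK n) G"
    and n: "process_run.t0 H + i = n" "Kp n < n" and lo: "- ln (lo n n) < Lg"
  shows "\<bar>(\<Sum>v\<in>{1..nverts G}. s ^ degree G v) - Ypot (beta n) G\<bar>
    \<le> 2 * real m * (real n * (exp (lm * - ln (lo n n)) - 1) + (2 * real (Kp n) + KK n + 1))"
proof -
  interpret process_run m p repl H by (rule run)
  note gg = live_good[OF G(1)]
  define \<delta> where "\<delta> = exp (lm * - ln (lo n n)) - 1"
  define i' where "i' = real (oldest G)"
  define bi where "bi = beta n (oldest G)"
  have i1: "1 \<le> i'" using live_pos[OF G(1)] by (simp add: i'_def)
  have ty: "(1 - p) * real n - KK n \<le> i'" "i' \<le> (1 - p) * real n + KK n"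
    using typical_oldest[OF G] n by (auto simp: i'_def)
  have R: "0 < RR n" and N: "0 < NN n" by (rule RR_pos, rule NN_pos)
  have lo0: "0 < lo n n" "lo n n \<le> 1" using n R by (auto simp: lo_def divide_le_eq_1 RR_def)
  have W0: "0 \<le> - ln (lo n n)" using lo0 by simp
  have il: "lo n n \<le> i' / NN n"
  proof -
    have "(1 - p) * (real n - real (Kp n)) \<le> i'" using ty Kp_ge[of n] by (simp add: right_diff_distrib)
    then have "(1 - p) * (real n - real (Kp n)) / NN n \<le> i' / NN n" using N by (intro divide_right_mono) auto
    then show ?thesis using p by (simp add: lo_def NN_def)
  qed
  have iN: "i' \<le> NN n" using ty Kp_ge[of n] KK_nonneg[of n] p by (simp add: NN_def RR_def algebra_simps)
  have be: "bi = bf s (i' / NN n)" using i1 by (simp add: bi_def beta_def i'_def max_def)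
  have "bi \<le> bf s (lo n n)" unfolding be by (rule bf_antimono[OF s lo0(1) il])
  also have "bf s (lo n n) = s + (1 - s) * (1 + \<delta>)" unfolding bf_def \<delta>_def using W_init[OF W0 lo] by simp
  also have "\<dots> \<le> 1 + \<delta>"
  proof -
    have "0 \<le> lm * - ln (lo n n)" using W0 lam by (intro mult_nonneg_nonneg) auto
    then have "0 \<le> \<delta>" unfolding \<delta>_def by simp
    then have "(1 - s) * \<delta> \<le> 1 * \<delta>" using s by (intro mult_right_mono) auto
    then show ?thesis by (simp add: algebra_simps)
  qed
  finally have bi1: "bi \<le> 1 + \<delta>" .
  have "1 \<le> W (- ln (i' / NN n))" using i1 N iN by (intro W_ge_1) (simp add: ln_le_zero_iff)
  then have "s + (1 - s) * 1 \<le> s + (1 - s) * W (- ln (i' / NN n))" using s by (intro add_left_mono mult_left_mono) auto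
  then have bi2: "1 \<le> bi" unfolding be bf_def by simp
  have d0: "0 \<le> \<delta>" using bi1 bi2 by linarith
  define h where "h w = \<bar>s - beta n w / bi\<bar>" for w
  have fac: "0 \<le> beta n w / bi \<and> beta n w / bi \<le> 1" if "oldest G \<le> w" for w
    using beta_pos[of n w] beta_anti[OF that, of n] bi2 by (simp add: bi_def divide_le_eq_1)
  have h: "h w \<le> \<delta> + of_bool (real w \<le> NN n)" if "w \<in> {oldest G..nverts G}" for w
  proof (cases "real w \<le> NN n")
    case True
    then show ?thesis using fac[of w] that s d0 by (simp add: h_def abs_le_iff)
  next
    case False
    then have "beta n w = s" using N W_neg by (simp add: beta_def bf_def max_def)
    then have "h w = s * (bi - 1) / bi" using bi2 s by (simp add: h_def field_simps abs_if)
    also have "\<dots> \<le> 1 * (bi - 1) / 1" using bi2 s by (intro frac_le mult_mono) auto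
    finally show ?thesis using bi1 False by simp
  qed
  \<comment> \<open>The exceptional birth times lie between \<open>oldest\<close> and
    \<open>NN n\<close>, a gap caused by the padding of \<open>RR n\<close> and the deviation of
    \<open>oldest\<close>.\<close>
  have cnt: "real (card {w \<in> {oldest G..nverts G}. real w \<le> NN n}) \<le> 2 * real (Kp n) + KK n + 1"
  proof -
    have "{w \<in> {oldest G..nverts G}. real w \<le> NN n} \<subseteq> {oldest G..nat \<lfloor>NN n\<rfloor>}" by (auto simp: le_nat_floor)
    then have "card {w \<in> {oldest G..nverts G}. real w \<le> NN n} \<le> card {oldest G..nat \<lfloor>NN n\<rfloor>}" by (intro card_mono) auto
    then have "real (card {w \<in> {oldest G..nverts G}. real w \<le> NN n}) \<le> real (Suc (nat \<lfloor>NN n\<rfloor>) - oldest G)" by simp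
    also have "\<dots> \<le> NN n - i' + 1"
    proof -
      have "real (nat \<lfloor>NN n\<rfloor>) \<le> NN n" using N by simp
      then show ?thesis using iN by (cases "oldest G \<le> Suc (nat \<lfloor>NN n\<rfloor>)") (auto simp: i'_def of_nat_diff)
    qed
    also have "\<dots> \<le> 2 * real (Kp n) + KK n + 1"
    proof -
      have "(1 - p) * (2 * real (Kp n)) \<le> 1 * (2 * real (Kp n))" using p by (intro mult_right_mono) auto
      then show ?thesis using ty by (simp add: NN_def RR_def algebra_simps)
    qed
    finally show ?thesis .
  qed
  have an: "real (card {oldest G..nverts G}) \<le> real n"
    using act_le[OF G(1)] n live_pos[OF G(1)] by (simp add: act_def)
  have "(\<Sum>v\<in>{1..nverts G}. s ^ degree G v) - Ypot (beta n) G = (\<Sum>v\<in>{1..nverts G}. (\<Prod>b\<in>#births G v. s) - (\<Prod>b\<in>#births G v. beta n b / bi))"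
    by (simp add: Ypot_def sum_subtractf bi_def size_births)
  also have "\<bar>\<dots>\<bar> \<le> (\<Sum>v\<in>{1..nverts G}. \<Sum>b\<in>#births G v. h b)"
    unfolding h_def
    by (rule order_trans[OF sum_abs], rule sum_mono, rule prod_mset_diff_le) (use fac s births_bounds[OF gg m] in auto)
  also have "\<dots> = 2 * real m * (\<Sum>w\<in>{oldest G..nverts G}. h w)"
    unfolding sum_births[OF gg] by (simp add: sum_distrib_left mult.assoc)
  also have "\<dots> \<le> 2 * real m * (\<Sum>w\<in>{oldest G..nverts G}. \<delta> + of_bool (real w \<le> NN n))"
    by (intro mult_left_mono sum_mono h) auto
  also have "(\<Sum>w\<in>{oldest G..nverts G}. \<delta> + of_bool (real w \<le> NN n)) = real (card {oldest G..nverts G}) * \<delta> + real (card {w \<in> {oldest G..nverts G}. real w \<le> NN n})"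
    by (simp add: sum.distrib of_bool_def sum.If_cases Int_def)
  also have "2 * real m * (real (card {oldest G..nverts G}) * \<delta> + real (card {w \<in> {oldest G..nverts G}. real w \<le> NN n}))
    \<le> 2 * real m * (real n * \<delta> + (2 * real (Kp n) + KK n + 1))"
    using cnt an d0 by (intro mult_left_mono add_mono mult_right_mono) auto
  finally show ?thesis by (simp add: \<delta>_def)
qed

definition II :: real where "II = integral {0..1} (\<lambda>x. FF s (- ln x) ^ m)"

lemma cn_limit: "\<bar>cn n n - p * II * real n\<bar> \<le> 2 * real (Kp n)"
proof -
  have R: "0 < RR n" by (rule RR_pos)
  define r where "r = real n / RR n"
  have r: "0 \<le> r" "r \<le> 1" using R by (auto simp: r_def RR_def divide_le_eq_1)
  define J1 J2 where "J1 = integral {0..r} (\<lambda>x. FF s (- ln x) ^ m)" and "J2 = integral {r..1} (\<lambda>x. FF s (- ln x) ^ m)"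
  have eq: "J1 + J2 = II" unfolding J1_def J2_def II_def
    using Henstock_Kurzweil_Integration.integral_combine[OF r FFm_integrable[OF order_refl order_refl]] .
  have b: "0 \<le> J2" "J2 \<le> 1 - r" "0 \<le> II" "II \<le> 1"
    unfolding J2_def II_def using integral_FFm_bounds[of r 1] integral_FFm_bounds[of 0 1] r by auto
  have Rn: "RR n * (1 - r) = 2 * real (Kp n)" using R by (simp add: r_def right_diff_distrib) (simp add: RR_def)
  have "cn n n - p * II * real n = p * (2 * real (Kp n) * II - RR n * J2)"
    unfolding cn_def r_def[symmetric] J1_def[symmetric] eq[symmetric] by (simp add: RR_def algebra_simps)
  also have "\<bar>\<dots>\<bar> \<le> 1 * (2 * real (Kp n))" unfolding abs_mult
  proof (rule mult_mono)
    have "RR n * J2 \<le> RR n * (1 - r)" "0 \<le> RR n * J2" using b R by (auto intro!: mult_left_mono)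
    moreover have "2 * real (Kp n) * II \<le> 2 * real (Kp n) * 1" by (rule mult_left_mono) (use b in auto)
    moreover have "0 \<le> 2 * real (Kp n) * II" using b by simp
    ultimately show "\<bar>2 * real (Kp n) * II - RR n * J2\<bar> \<le> 2 * real (Kp n)" unfolding Rn by linarith
  qed (use p in auto)
  finally show ?thesis by simp
qed

lemma negligible_generating_function:
  assumes a: "0 < a"
  shows "negligible m p repl (\<lambda>n G. a * real n < \<bar>(\<Sum>v\<in>{1..nverts G}. s ^ degree G v) - p * II * real n\<bar>)"
proof (rule negligible_cover[OF negligible_atypical negligible_Ypot[of "a / 2"]])
  show "0 < a / 2" using a by simp
  have k: "(\<lambda>n. real (Kp n) / real n) \<longlonglongrightarrow> 0" by (rule Kp_ratio)
  have lol: "(\<lambda>n. lo n n) \<longlonglongrightarrow> (1 - 0) / (1 + 2 * 0)"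
  proof (rule Lim_transform_eventually)
    show "(\<lambda>n. (1 - real (Kp n) / real n) / (1 + 2 * (real (Kp n) / real n))) \<longlonglongrightarrow> (1 - 0) / (1 + 2 * 0)"
      by (intro tendsto_intros k) auto
    show "\<forall>\<^sub>F n in sequentially. (1 - real (Kp n) / real n) / (1 + 2 * (real (Kp n) / real n)) = lo n n"
    proof (rule eventually_mono[OF eventually_gt_at_top[of 0]])
      fix n :: nat assume "0 < n"
      then have "1 - real (Kp n) / real n = (real n - real (Kp n)) / real n" "1 + 2 * (real (Kp n) / real n) = RR n / real n"
        by (simp_all add: RR_def diff_divide_distrib add_divide_distrib)
      then show "(1 - real (Kp n) / real n) / (1 + 2 * (real (Kp n) / real n)) = lo n n" using \<open>0 < n\<close> by (simp add: lo_def)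
    qed
  qed
  have l: "(\<lambda>n. - ln (lo n n)) \<longlonglongrightarrow> - ln 1" by (intro tendsto_intros) (use lol in auto)
  have kk: "(\<lambda>n. KK n / real n + 1 / real n) \<longlonglongrightarrow> 0" unfolding KK_def by real_asymp
  have "(\<lambda>n. 2 * real m * ((exp (lm * - ln (lo n n)) - 1) + (2 * (real (Kp n) / real n) + (KK n / real n + 1 / real n))) + 2 * (real (Kp n) / real n))
    \<longlonglongrightarrow> 2 * real m * ((exp (lm * - ln 1) - 1) + (2 * 0 + 0)) + 2 * 0"
    by (intro tendsto_intros k kk l)
  then have err: "\<forall>\<^sub>F n in sequentially. 2 * real m * ((exp (lm * - ln (lo n n)) - 1) + (2 * (real (Kp n) / real n) + (KK n / real n + 1 / real n))) + 2 * (real (Kp n) / real n) < a / 2"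
    by (rule order_tendstoD(2)) (use a in simp)
  have lL: "\<forall>\<^sub>F n in sequentially. - ln (lo n n) < Lg" by (rule order_tendstoD(2)[OF l]) (use L in simp)
  have kn: "\<forall>\<^sub>F n in sequentially. real (Kp n) / real n < 1" by (rule order_tendstoD(2)[OF k]) simp
  show "\<forall>\<^sub>F n in sequentially. \<forall>H i G. process_run m p H \<longrightarrow> process_run.t0 H + i = n \<longrightarrow>
      process_run.live m p repl H i G \<longrightarrow> a * real n < \<bar>(\<Sum>v\<in>{1..nverts G}. s ^ degree G v) - p * II * real n\<bar> \<longrightarrow>
      \<not> process_run.typical p (KK n) G \<or> a / 2 * real n < \<bar>Ypot (beta n) G - cn n n\<bar>"
    using err lL kn eventually_gt_at_top[of "0::nat"]
  proof (eventually_elim, intro allI impI)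
    fix n H i G
    assume err: "2 * real m * ((exp (lm * - ln (lo n n)) - 1) + (2 * (real (Kp n) / real n) + (KK n / real n + 1 / real n))) + 2 * (real (Kp n) / real n) < a / 2"
      and lL: "- ln (lo n n) < Lg" and kn: "real (Kp n) / real n < 1" and n0: "0 < n"
      and run: "process_run m p H" and ti: "process_run.t0 H + i = n" and live: "process_run.live m p repl H i G"
      and big: "a * real n < \<bar>(\<Sum>v\<in>{1..nverts G}. s ^ degree G v) - p * II * real n\<bar>"
    show "\<not> process_run.typical p (KK n) G \<or> a / 2 * real n < \<bar>Ypot (beta n) G - cn n n\<bar>"
    proof (rule ccontr)
      assume good: "\<not> (\<not> process_run.typical p (KK n) G \<or> a / 2 * real n < \<bar>Ypot (beta n) G - cn n n\<bar>)"
      define S where "S = (\<Sum>v\<in>{1..nverts G}. s ^ degree G v)"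
      define E where "E = 2 * real m * (real n * (exp (lm * - ln (lo n n)) - 1) + (2 * real (Kp n) + KK n + 1))"
      have "Kp n < n" using kn n0 by simp
      then have 1: "\<bar>S - Ypot (beta n) G\<bar> \<le> E"
        unfolding S_def E_def using final_comparison[OF run live _ ti _ lL] good by auto
      have 2: "\<bar>Ypot (beta n) G - cn n n\<bar> \<le> a / 2 * real n" using good by auto
      have "E + 2 * real (Kp n) = (2 * real m * ((exp (lm * - ln (lo n n)) - 1) + (2 * (real (Kp n) / real n) + (KK n / real n + 1 / real n))) + 2 * (real (Kp n) / real n)) * real n"
        using n0 by (simp add: E_def distrib_right distrib_left)
      also have "\<dots> \<le> a / 2 * real n" using err by (intro mult_right_mono) auto
      finally have 3: "E + 2 * real (Kp n) \<le> a / 2 * real n" .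
      have "a / 2 * real n + a / 2 * real n = a * real n" by simp
      then show False using big 1 2 3 cn_limit[of n] unfolding S_def[symmetric] by linarith
    qed
  qed
qed

end

section \<open>From generating functions to degree counts, and the final limit\<close>

definition xlim :: "nat \<Rightarrow> real \<Rightarrow> nat \<Rightarrow> real" where
  "xlim m p k = p * delay.xc (p / (4 * p - 2)) (ln (p / (1 - p))) m k"

context pa_limit begin

lemma xlim_eq: "xlim m p k = p * xc m k"
  by (simp add: xlim_def lm_def Lg_def)

text \<open>The generating function of the degree counts and that of the limits are both cut after
  the term \<open>k\<close> and solved for it. The two tails have order \<open>s ^ Suc k\<close>,
  one power better than the term to be isolated.\<close>

lemma degree_truncation:
  assumes "s < 1/2" "nverts G \<le> n"
  shows "s ^ k * \<bar>real (num_degree k G) - xlim m p k * real n\<bar> \<le>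
    \<bar>(\<Sum>v\<in>{1..nverts G}. s ^ degree G v) - p * II * real n\<bar>
    + (\<Sum>j<k. \<bar>real (num_degree j G) - xlim m p j * real n\<bar>) + s ^ Suc k * (1 + 2 ^ Suc k) * real n"
proof -
  define V where "V = {1..nverts G}"
  define X where "X j = real (num_degree j G)" for j
  define y where "y j = X j - xlim m p j * real n" for j
  define r where "r = (\<Sum>v\<in>{v\<in>V. Suc k \<le> degree G v}. s ^ degree G v)"
  define e where "e = II - (\<Sum>j<Suc k. xc m j * s ^ j)"
  have fV: "finite V" by (simp add: V_def)
  have "(\<Sum>v\<in>V. s ^ degree G v) = (\<Sum>v\<in>{v\<in>V. degree G v < Suc k}. s ^ degree G v) + r"
    unfolding r_def using fV by (subst sum.union_disjoint[symmetric]) (auto intro!: sum.cong)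
  also have "(\<Sum>v\<in>{v\<in>V. degree G v < Suc k}. s ^ degree G v) = (\<Sum>j<Suc k. \<Sum>v\<in>{v\<in>{v\<in>V. degree G v < Suc k}. degree G v = j}. s ^ degree G v)"
    by (rule sum.group[symmetric]) (use fV in auto)
  also have "\<dots> = (\<Sum>j<Suc k. X j * s ^ j)"
  proof (rule sum.cong[OF refl])
    fix j assume "j \<in> {..<Suc k}"
    then have "{v\<in>{v\<in>V. degree G v < Suc k}. degree G v = j} = {v\<in>V. degree G v = j}" by auto
    then show "(\<Sum>v\<in>{v\<in>{v\<in>V. degree G v < Suc k}. degree G v = j}. s ^ degree G v) = X j * s ^ j"
      by (simp add: X_def num_degree_def V_def)
  qed
  finally have gf: "(\<Sum>v\<in>V. s ^ degree G v) = (\<Sum>j<Suc k. X j * s ^ j) + r" .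
  have r: "0 \<le> r" "r \<le> s ^ Suc k * real n"
  proof -
    show "0 \<le> r" unfolding r_def using s by (intro sum_nonneg) auto
    have "r \<le> (\<Sum>v\<in>{v\<in>V. Suc k \<le> degree G v}. s ^ Suc k)" unfolding r_def using s by (intro sum_mono power_decreasing) auto
    also have "\<dots> = real (card {v\<in>V. Suc k \<le> degree G v}) * s ^ Suc k" by simp
    also have "\<dots> \<le> real n * s ^ Suc k"
    proof -
      have "card {v\<in>V. Suc k \<le> degree G v} \<le> card V" using fV by (intro card_mono) auto
      then have "card {v\<in>V. Suc k \<le> degree G v} \<le> n" using assms by (simp add: V_def)
      then show ?thesis using s by (intro mult_right_mono) auto
    qed
    finally show "r \<le> s ^ Suc k * real n" by (simp add: mult.commute)
  qed
  have "\<bar>e\<bar> \<le> (2 * s) ^ Suc k" unfolding e_def II_def by (rule xc_truncate) (use s assms in auto)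
  then have "\<bar>p * e * real n\<bar> \<le> 1 * (2 * s) ^ Suc k * real n" unfolding abs_mult using p s by (intro mult_mono) auto
  then have e: "\<bar>p * e * real n\<bar> \<le> s ^ Suc k * 2 ^ Suc k * real n" by (simp only: power_mult_distrib mult_1 mult.commute[of "2 ^ Suc k"])
  have "p * II * real n = (\<Sum>j<Suc k. xlim m p j * real n * s ^ j) + p * e * real n"
    by (simp add: e_def xlim_eq sum_distrib_left sum_distrib_right algebra_simps)
  with gf have "(\<Sum>v\<in>V. s ^ degree G v) - p * II * real n = (\<Sum>j<Suc k. y j * s ^ j) + (r - p * e * real n)"
    by (simp add: y_def sum_subtractf left_diff_distrib)
  then have "y k * s ^ k = ((\<Sum>v\<in>V. s ^ degree G v) - p * II * real n) - (\<Sum>j<k. y j * s ^ j) - (r - p * e * real n)" by simp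
  moreover have "\<bar>\<Sum>j<k. y j * s ^ j\<bar> \<le> (\<Sum>j<k. \<bar>y j\<bar>)"
  proof (rule order_trans[OF sum_abs sum_mono])
    fix j
    have "\<bar>y j\<bar> * s ^ j \<le> \<bar>y j\<bar> * 1" using s by (intro mult_left_mono power_le_one) auto
    then show "\<bar>y j * s ^ j\<bar> \<le> \<bar>y j\<bar>" using s by (simp add: abs_mult)
  qed
  moreover have "\<bar>r - p * e * real n\<bar> \<le> s ^ Suc k * (1 + 2 ^ Suc k) * real n"
  proof -
    have "s ^ Suc k * (1 + 2 ^ Suc k) * real n = s ^ Suc k * real n + s ^ Suc k * 2 ^ Suc k * real n" by (simp add: algebra_simps)
    then show ?thesis using r e by linarith
  qed
  ultimately have "\<bar>y k * s ^ k\<bar> \<le> \<bar>(\<Sum>v\<in>V. s ^ degree G v) - p * II * real n\<bar> + (\<Sum>j<k. \<bar>y j\<bar>) + s ^ Suc k * (1 + 2 ^ Suc k) * real n"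
    by linarith
  then show ?thesis using s by (simp add: y_def X_def V_def abs_mult mult.commute)
qed

end

text \<open>Induction over the degree, with \<open>s\<close> chosen afresh for every
  \<open>k\<close> and every tolerance: \<open>pa_limit\<close> is entered only inside the step, as
  the limit itself must not depend on \<open>s\<close>.\<close>

lemma negligible_degrees:
  assumes mp: "1 \<le> m" "1 / 2 < p" "p < 1" and a: "0 < a"
  shows "negligible m p repl (\<lambda>n G. \<exists>j<k. a * real n < \<bar>real (num_degree j G) - xlim m p j * real n\<bar>)"
  using a
proof (induction k arbitrary: a)
  case 0
  have "process_run.Ea m p repl H i (\<lambda>G. 0) = 0" if "process_run m p H" for H i
    by (simp add: process_run.Ea_def[OF that])
  then show ?case by (auto simp: negligible_def)
next
  case (Suc k)
  \<comment> \<open>Makes the tail at most \<open>a * s ^ k / 4\<close> times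
    \<open>n\<close>.\<close>
  define s where "s = min (1 / 4) (a / (4 * (1 + 2 ^ Suc k)))"
  have q: "(0::real) < 1 + 2 ^ Suc k" by (simp add: add_pos_nonneg)
  have ss: "0 < s" "s < 1 / 2" "s < 1" using Suc.prems q by (auto simp: s_def)
  have sa: "s * (1 + 2 ^ Suc k) \<le> a / 4"
  proof -
    have "s * (1 + 2 ^ Suc k) \<le> a / (4 * (1 + 2 ^ Suc k)) * (1 + 2 ^ Suc k)" using q by (intro mult_right_mono) (auto simp: s_def)
    also have "\<dots> = a / 4"
    proof -
      have "a / (4 * u) * u = a / 4" if "0 < u" for u using that by simp
      from this[OF q] show ?thesis .
    qed
    finally show ?thesis .
  qed
  interpret pa_limit m p repl s by unfold_locales (use mp ss in auto)
  \<comment> \<open>A tolerance for the smaller degrees such that the \<open>k\<close> errors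
    together stay below \<open>a * s ^ k / 4\<close>. With the tail and the generating function this
    leaves three quarters of \<open>a * s ^ k\<close>, a contradiction.\<close>
  define a' where "a' = a * s ^ k / (4 * (real k + 1))"
  have sk: "0 < s ^ k" "s ^ k \<le> 1" using s by (auto intro: power_le_one)
  have a': "0 < a'" "a' \<le> a" "real k * a' \<le> a * s ^ k / 4"
  proof -
    show "0 < a'" using Suc.prems sk by (simp add: a'_def)
    have ask: "a * s ^ k \<le> a * 1" using sk Suc.prems by (intro mult_left_mono) auto
    have "a' \<le> a * s ^ k / 1" unfolding a'_def using Suc.prems sk by (intro divide_left_mono) auto
    then show "a' \<le> a" using ask by simp
    have "u * (x / (4 * u)) = x / 4" if "u \<noteq> 0" for u x :: real using that by simp
    from this[of "real k + 1" "a * s ^ k"] have "(real k + 1) * a' = a * s ^ k / 4" unfolding a'_def by simp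
    then show "real k * a' \<le> a * s ^ k / 4" using \<open>0 < a'\<close> by (simp add: distrib_right)
  qed
  have b: "0 < a * s ^ k / 4" using Suc.prems sk by simp
  show ?case
  proof (rule negligible_cover[OF Suc.IH[OF a'(1)] negligible_generating_function[OF b]], rule eventually_mono[OF eventually_gt_at_top[of 0]], intro allI impI, rule ccontr)
    fix n :: nat and H i G
    assume n: "0 < n" and run: "process_run m p H" and t: "process_run.t0 H + i = n" and live: "process_run.live m p repl H i G"
      and bad: "\<exists>j<Suc k. a * real n < \<bar>real (num_degree j G) - xlim m p j * real n\<bar>"
      and good: "\<not> ((\<exists>j<k. a' * real n < \<bar>real (num_degree j G) - xlim m p j * real n\<bar>) \<or>
        a * s ^ k / 4 * real n < \<bar>(\<Sum>v\<in>{1..nverts G}. s ^ degree G v) - p * II * real n\<bar>)"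
    have nv: "nverts G \<le> n" using process_run.live_time[OF run live] t by simp
    have sm: "\<bar>real (num_degree j G) - xlim m p j * real n\<bar> \<le> a' * real n" if "j < k" for j using good that by auto
    have a'n: "a' * real n \<le> a * real n" using a' by (intro mult_right_mono) auto
    have bk: "a * real n < \<bar>real (num_degree k G) - xlim m p k * real n\<bar>"
    proof -
      obtain j where j: "j < Suc k" "a * real n < \<bar>real (num_degree j G) - xlim m p j * real n\<bar>" using bad by blast
      then show ?thesis using sm[of j] a'n by (cases "j = k") auto
    qed
    have "(\<Sum>j<k. \<bar>real (num_degree j G) - xlim m p j * real n\<bar>) \<le> (\<Sum>j<k. a' * real n)" by (rule sum_mono) (use sm in auto)
    also have "\<dots> = real k * a' * real n" by simp
    also have "\<dots> \<le> a * s ^ k / 4 * real n" using a'(3) by (intro mult_right_mono) auto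
    finally have 1: "(\<Sum>j<k. \<bar>real (num_degree j G) - xlim m p j * real n\<bar>) \<le> a * s ^ k / 4 * real n" .
    have "s ^ k * (s * (1 + 2 ^ Suc k)) * real n \<le> s ^ k * (a / 4) * real n" using sa sk by (intro mult_right_mono mult_left_mono) auto
    then have 2: "s ^ Suc k * (1 + 2 ^ Suc k) * real n \<le> a * s ^ k / 4 * real n" by (simp add: mult_ac)
    have 3: "\<bar>(\<Sum>v\<in>{1..nverts G}. s ^ degree G v) - p * II * real n\<bar> \<le> a * s ^ k / 4 * real n" using good by auto
    have 4: "s ^ k * (a * real n) < s ^ k * \<bar>real (num_degree k G) - xlim m p k * real n\<bar>" using bk sk by (intro mult_strict_left_mono) auto
    define z where "z = a * s ^ k / 4 * real n"
    have z: "s ^ k * (a * real n) = 4 * z" by (simp add: z_def)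
    have "0 < z" using b n by (simp add: z_def)
    then show False using 1 2 3 4 degree_truncation[OF ss(2) nv, of k] unfolding z z_def[symmetric] by linarith
  qed
qed

lemma xlim_pos:
  assumes "1 \<le> m" "1 / 2 < p" "p < 1" shows "0 < xlim m p k"
proof -
  interpret delay "p / (4 * p - 2)" "ln (p / (1 - p))" using assms by unfold_locales auto
  show ?thesis unfolding xlim_def using xc_pos[OF assms(1)] assms by simp
qed

lemma xlim_subcritical:
  assumes "1 \<le> m" "1 / 2 < p" "p < 1" "alpha p < 1"
  shows "\<exists>\<epsilon>. \<epsilon> \<longlonglongrightarrow> 0 \<and> (\<forall>\<^sub>F k in sequentially. xlim m p k = alpha p powr (real k * (1 + \<epsilon> k)))"
proof -
  interpret delay "p / (4 * p - 2)" "ln (p / (1 - p))" using assms by unfold_locales auto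
  have "p / (4 * p - 2) * ln (p / (1 - p)) = alpha p" by (simp add: alpha_def gamma_def)
  then show ?thesis using xc_subcritical[OF _ assms(1), of p] assms by (simp add: xlim_def)
qed

text \<open>The equation for \<open>zeta\<close> is the characteristic equation in disguise:
  \<open>\<beta> = lam * (1 - zeta)\<close> satisfies \<open>exp (- \<beta> * L) = zeta\<close>,
  whence \<open>eta = 1 / \<beta>\<close>. The condition \<open>alpha * zeta < 1\<close> is the one
  required by the asymptotics of \<open>W\<close>.\<close>

lemma xlim_supercritical:
  assumes m: "1 \<le> m" and p: "1 / 2 < p" "p < 1" and al: "1 < alpha p"
  obtains a where "0 < a" "(\<lambda>k. xlim m p k - a * real k powr (- eta p - 1)) \<in> O(\<lambda>k. real k powr (- eta p - 2))"
proof -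
  define lam L where "lam = p / (4 * p - 2)" and "L = ln (p / (1 - p))"
  interpret delay lam L using p by unfold_locales (auto simp: lam_def L_def)
  have alE: "lam * L = alpha p" by (simp add: alpha_def gamma_def lam_def L_def)
  note z = zeta_props[OF al]
  define \<beta> where "\<beta> = lam * (1 - zeta p)"
  have bL: "\<beta> * L = alpha p * (1 - zeta p)" by (simp add: \<beta>_def alE[symmetric])
  have ez: "exp (- \<beta> * L) = zeta p"
  proof -
    have "exp (- \<beta> * L) = 1 / exp (alpha p * (1 - zeta p))" using bL by (simp add: exp_minus inverse_eq_divide)
    also have "\<dots> = zeta p" using z(3) by (simp add: field_simps)
    finally show ?thesis .
  qed
  have b0: "\<beta> > 0" using lam z by (simp add: \<beta>_def)
  have "ln (zeta p) = - \<beta> * L" using ez ln_exp[of "- \<beta> * L"] by simp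
  then have eta: "eta p = 1 / \<beta>" using b0 L by (simp add: eta_def gamma_def L_def[symmetric])
  obtain a where a: "a > 0" "(\<lambda>k. xc m k - a * real k powr (- (1 / \<beta>) - 1)) \<in> O(\<lambda>k. real k powr (- (1 / \<beta>) - 2))"
    by (rule xc_supercritical[of \<beta> m]) (use ez b0 alE z m in \<open>auto simp: \<beta>_def\<close>)
  have "(\<lambda>k. xlim m p k - (p * a) * real k powr (- eta p - 1)) = (\<lambda>k. p * (xc m k - a * real k powr (- (1 / \<beta>) - 1)))"
    by (simp add: fun_eq_iff xlim_def lam_def L_def eta right_diff_distrib mult.assoc)
  moreover have "(\<lambda>k. p * (xc m k - a * real k powr (- (1 / \<beta>) - 1))) \<in> O(\<lambda>k. real k powr (- eta p - 2))"
    using a(2) p unfolding eta by simp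
  ultimately have "(\<lambda>k. xlim m p k - (p * a) * real k powr (- eta p - 1)) \<in> O(\<lambda>k. real k powr (- eta p - 2))" by (simp only:)
  with a(1) p show thesis by (intro that[of "p * a"]) auto
qed

lemma degree_convergence:
  assumes mp: "1 \<le> m" "1 / 2 < p" "p < 1" and H: "\<And>n. H n \<in> graph_class m"
    and small: "(\<lambda>n. real (nverts (H n))) \<in> o(\<lambda>n. real n powr (1 / 2))" and e: "0 < e"
  shows "(\<lambda>n. \<P>(\<omega> in process repl m p (H n).
     \<bar>real (num_degree k (graph_at (H n) \<omega> n)) - xlim m p k * real n\<bar> \<le> e * (xlim m p k * real n) \<bar> \<not> dies \<omega>)) \<longlonglongrightarrow> 1"
proof (rule tendstoI)
  fix d :: real assume d: "0 < d"
  define c where "c = 1 - (1 - p) / p"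
  have c: "0 < c" using mp by (simp add: c_def)
  define bad where "bad n G \<longleftrightarrow> \<not> \<bar>real (num_degree k G) - xlim m p k * real n\<bar> \<le> e * (xlim m p k * real n)" for n :: nat and G
  have a: "0 < e * xlim m p k" using e xlim_pos[OF mp] by simp
  have "negligible m p repl bad"
    by (rule negligible_cover[OF negligible_degrees[OF mp a, of repl "Suc k"] negligible_degrees[OF mp a, of repl "Suc k"]])
      (auto simp: bad_def not_le mult.assoc intro!: always_eventually exI[of _ k])
  from this[unfolded negligible_def, rule_format, of "d * c / 2"] d c
  have neg: "\<forall>\<^sub>F n in sequentially. \<forall>H i. process_run m p H \<longrightarrow> real (oldest H + nverts H) \<le> sqrt (real n) \<longrightarrow>
     process_run.t0 H + i = n \<longrightarrow> process_run.Ea m p repl H i (\<lambda>G. of_bool (bad n G)) \<le> d * c / 2" by simp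
  \<comment> \<open>The constant \<open>1/2\<close> is chosen because
    \<open>t0 = oldest + nverts\<close> is at most twice \<open>nverts\<close>.\<close>
  have sm: "\<forall>\<^sub>F n in sequentially. norm (real (nverts (H n))) \<le> 1 / 2 * norm (real n powr (1 / 2))"
    by (rule landau_o.smallD[OF small]) simp
  show "\<forall>\<^sub>F n in sequentially. dist (\<P>(\<omega> in process repl m p (H n).
     \<bar>real (num_degree k (graph_at (H n) \<omega> n)) - xlim m p k * real n\<bar> \<le> e * (xlim m p k * real n) \<bar> \<not> dies \<omega>)) 1 < d"
    using neg sm eventually_ge_at_top[of 1]
  proof eventually_elim
    case (elim n)
    have old: "oldest (H n) \<le> nverts (H n)" using H[of n] by (simp add: graph_class_def)
    have good: "good_graph m (H n)" by (rule good_graph_class[OF mp(1) H])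
    have "edges (H n) \<noteq> {#}" using edges_empty_iff[OF good mp(1)] old by (simp add: act_def)
    then interpret process_run m p repl "H n" using mp good by unfold_locales
    have sq: "real (oldest (H n) + nverts (H n)) \<le> sqrt (real n)"
      using elim(2) old by (simp add: powr_half_sqrt)
    have "sqrt (real n) \<le> sqrt (real n) * sqrt (real n)" using elim(3) by (intro mult_le_cancel_left1[THEN iffD2]) simp
    then have le: "t0 \<le> n" using sq by (simp add: t0_def)
    define i where "i = n - t0"
    have i: "t0 + i = n" using le by (simp add: i_def)
    have g: "graph_at (H n) \<omega> n = \<omega> i" for \<omega> by (simp add: graph_at_def i_def t0_def)
    have "Ea i (\<lambda>G. of_bool (bad n G)) \<le> d * c / 2" using elim(1) sq i process_run_axioms by blast
    then have "Ea i (\<lambda>G. of_bool (bad n G)) / c \<le> d * c / 2 / c" using c by (intro divide_right_mono) auto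
    then have "Ea i (\<lambda>G. of_bool (bad n G)) / c \<le> d / 2" using c by simp
    with cond_prob_alive_ge[where Q = "\<lambda>G. \<bar>real (num_degree k G) - xlim m p k * real n\<bar> \<le> e * (xlim m p k * real n)" and i = i] d
    show ?case unfolding g bad_def[symmetric] c_def[symmetric] dist_real_def by linarith
  qed
qed

text \<open>Passes from every fixed precision to a precision tending to 0: at \<open>n\<close> the
  finest level \<open>1 / (j + 1)\<close> with \<open>j \<le> n\<close> already within its own
  tolerance is used. Each fixed level is eventually available, so the chosen one tends to infinity,
  without any monotonicity of \<open>P\<close>.\<close>

lemma diagonal_rate:
  fixes P :: "real \<Rightarrow> nat \<Rightarrow> real"
  assumes lim: "\<And>e. 0 < e \<Longrightarrow> P e \<longlonglongrightarrow> 1"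
  obtains d where "d \<longlonglongrightarrow> 0" "(\<lambda>n. P (d n) n) \<longlonglongrightarrow> 1"
proof -
  define g where "g j n \<longleftrightarrow> \<bar>P (1 / real (Suc j)) n - 1\<bar> < 1 / real (Suc j)" for j n
  define S where "S n = {j. j \<le> n \<and> g j n}" for n
  define J where "J n = Max (S n)" for n
  define d where "d n = 1 / real (Suc (J n))" for n
  have fin: "finite (S n)" for n by (rule finite_subset[of _ "{..n}"]) (auto simp: S_def)
  have ev: "\<forall>\<^sub>F n in sequentially. j \<in> S n" for j
  proof -
    have "0 < 1 / real (Suc j)" by simp
    from tendstoD[OF lim[OF this] this] have "\<forall>\<^sub>F n in sequentially. g j n" by (simp add: g_def dist_real_def)
    with eventually_ge_at_top[of j] show ?thesis by eventually_elim (simp add: S_def)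
  qed
  have "filterlim J at_top sequentially" unfolding filterlim_at_top
  proof
    fix j show "\<forall>\<^sub>F n in sequentially. j \<le> J n" using ev[of j] by eventually_elim (simp add: J_def Max_ge fin)
  qed
  from filterlim_compose[OF LIMSEQ_Suc[OF lim_1_over_n] this] have d: "d \<longlonglongrightarrow> 0" by (simp add: d_def[abs_def])
  have "\<forall>\<^sub>F n in sequentially. norm (P (d n) n - 1) \<le> d n" using ev[of 0]
  proof eventually_elim
    case (elim n)
    then have "J n \<in> S n" unfolding J_def using Max_in[OF fin, of n] by auto
    then show ?case by (simp add: S_def g_def d_def)
  qed
  from Lim_null_comparison[OF this d] have "(\<lambda>n. P (d n) n) \<longlonglongrightarrow> 1" by (simp add: LIM_zero_iff)
  with d show thesis by (rule that)
qed

theorem theorem2: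
  fixes m :: nat and p :: real and repl :: bool
  assumes "m \<ge> 1" and "1 / 2 < p" and "p < 1"
  shows "\<exists>x :: nat \<Rightarrow> real.
    (alpha p < 1 \<longrightarrow>
      (\<exists>\<epsilon> :: nat \<Rightarrow> real. \<epsilon> \<longlonglongrightarrow> 0 \<and>
        (\<forall>\<^sub>F k in sequentially. x k = alpha p powr (real k * (1 + \<epsilon> k))))) \<and>
    (alpha p > 1 \<longrightarrow>
      (\<exists>a b :: real. a > 0 \<and> b > 0 \<and>
        (\<lambda>k. x k - a * real k powr (- eta p - 1))
          \<in> O(\<lambda>k. real k powr (- eta p - 2) * ln (real k) powr b))) \<and>
    (\<forall>H :: nat \<Rightarrow> mgraph.
      (\<forall>n. H n \<in> graph_class m) \<and> (\<lambda>n. real (nverts (H n))) \<in> o(\<lambda>n. real n powr (1 / 2)) \<longrightarrow>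
      (\<forall>k. \<exists>\<delta> :: nat \<Rightarrow> real. \<delta> \<longlonglongrightarrow> 0 \<and>
        (\<lambda>n. \<P>(\<omega> in process repl m p (H n).
               \<bar>real (num_degree k (graph_at (H n) \<omega> n)) - x k * real n\<bar> \<le> \<delta> n * (x k * real n)
               \<bar> \<not> dies \<omega>)) \<longlonglongrightarrow> 1))"
proof (rule exI[of _ "xlim m p"], intro conjI impI allI)
  note mp = assms
  show "\<exists>\<epsilon>. \<epsilon> \<longlonglongrightarrow> 0 \<and> (\<forall>\<^sub>F k in sequentially. xlim m p k = alpha p powr (real k * (1 + \<epsilon> k)))" if "alpha p < 1"
    by (rule xlim_subcritical[OF mp that])
  show "\<exists>a b. a > 0 \<and> b > 0 \<and> (\<lambda>k. xlim m p k - a * real k powr (- eta p - 1))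
      \<in> O(\<lambda>k. real k powr (- eta p - 2) * ln (real k) powr b)" if al: "1 < alpha p"
  proof -
    obtain a where a: "0 < a" "(\<lambda>k. xlim m p k - a * real k powr (- eta p - 1)) \<in> O(\<lambda>k. real k powr (- eta p - 2))"
      by (rule xlim_supercritical[OF mp al])
    \<comment> \<open>The error proved above carries no logarithm, so any positive exponent
      \<open>b\<close> works; 1 is taken.\<close>
    have "(\<lambda>k. real k powr (- eta p - 2)) \<in> O(\<lambda>k. real k powr (- eta p - 2) * ln (real k) powr 1)"
    proof (rule bigoI[where c = 1])
      have "\<forall>\<^sub>F k in sequentially. 1 \<le> ln (real k)" by real_asymp
      then show "\<forall>\<^sub>F k in sequentially. norm (real k powr (- eta p - 2)) \<le> 1 * norm (real k powr (- eta p - 2) * ln (real k) powr 1)"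
      proof eventually_elim
        case (elim k)
        have "real k powr (- eta p - 2) * 1 \<le> real k powr (- eta p - 2) * ln (real k)" using elim by (intro mult_left_mono) auto
        then show ?case using elim by (simp add: abs_mult)
      qed
    qed
    from landau_o.big_trans[OF a(2) this] a(1) show ?thesis by (intro exI[of _ a] exI[of _ 1]) simp
  qed
  fix H :: "nat \<Rightarrow> mgraph" and k
  assume "(\<forall>n. H n \<in> graph_class m) \<and> (\<lambda>n. real (nverts (H n))) \<in> o(\<lambda>n. real n powr (1 / 2))"
  then have H: "\<And>n. H n \<in> graph_class m" and small: "(\<lambda>n. real (nverts (H n))) \<in> o(\<lambda>n. real n powr (1 / 2))" by auto
  show "\<exists>\<delta>. \<delta> \<longlonglongrightarrow> 0 \<and> (\<lambda>n. \<P>(\<omega> in process repl m p (H n).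
      \<bar>real (num_degree k (graph_at (H n) \<omega> n)) - xlim m p k * real n\<bar> \<le> \<delta> n * (xlim m p k * real n) \<bar> \<not> dies \<omega>)) \<longlonglongrightarrow> 1"
    by (rule diagonal_rate[OF degree_convergence[OF mp H small, of _ repl k]]) blast+
qed

end
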